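(* The cooperad $\mathcal{OC}^\vee$ is a sub-cooperad of $\mathbf S$, and hence the 2-colored DG operad $\mathcal{OC}_\infty=\mathrm{Cobar}(\mathcal{OC}^\vee)$ governing open-closed homotopy algebras is a sub DG operad of $\mathbf{Ger}^+_\infty=\mathrm{Cobar}(\mathbf S)$.
   Context: $\mathbb K$ is a field of characteristic zero. $\mathbf s$ denotes suspension (degrees raised by $1$). For a (co)operad $\mathcal O$, $\Lambda\mathcal O(m)=\mathbf s^{1-m}\mathcal O(m)\otimes \mathrm{sgn}_m$. $\mathbf{Ger}$ is the operad of Gerstenhaber algebras and $\mathbf{Ger}^\vee=\Lambda^2\mathbf{Ger}^*$ is its Koszul dual cooperad. The degree of a cooperation is the degree of the corresponding vector of the cooperad; the corresponding map has the opposite degree. Signs below are those of suspended structures: on $\mathbf s^{-2}V$, $\mathbf s^{-1}A$ the maps $\Delta_{\mathfrak c},\Delta_{\mathfrak o},\rho$ have degree $0$. An $\mathbf S$-coalgebra is a pair $(V,A)$ where $V$ is a $\mathbf{Ger}^\vee$-coalgebra (cocommutative comultiplication $\Delta_{\mathfrak c}$, cobracket $\delta_{\mathfrak c}$) and $A$ is a $\Lambda\mathbf{coassoc}$-coalgebra (comultiplication $\Delta_{\mathfrak o}$), together with a unary operation $\rho:A\to V$ of degree $-1$ such that: (i) $\delta_{\mathfrak c}\circ\rho=0$; (ii) $\Delta_{\mathfrak c}\circ\rho=(\rho\otimes\rho)\circ\Delta_{\mathfrak o}$; (iii) $(\rho\otimes \mathrm{id})\circ\Delta_{\mathfrak o}=\sigma\circ(\mathrm{id}\otimes\rho)\circ\Delta_{\mathfrak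 o}$, where $\sigma:A\otimes V\to V\otimes A$ is the flip. $\mathbf S$ is the 2-colored cooperad (color $\mathfrak c$ for $V$, $\mathfrak o$ for $A$) governing $\mathbf S$-coalgebras. An $\mathcal{OC}^\vee$-coalgebra is a pair $(V,A)$ where $V$ is a $\Lambda^2\mathbf{cocomm}$-coalgebra (comultiplication $\Delta_{\mathfrak c}$) and $A$ is a $\Lambda\mathbf{coassoc}$-coalgebra (comultiplication $\Delta_{\mathfrak o}$), together with a unary operation $\rho:A\to V$ of degree $-1$ satisfying (ii) and (iii). $\mathcal{OC}^\vee$ is the 2-colored cooperad governing $\mathcal{OC}^\vee$-coalgebras. *)

theory Defs
  imports
    "HOL-Algebra.Module"
    "HOL-Library.Poly_Mapping"
    "HOL-Combinatorics.Permutations"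
begin

text \<open>
  Everything is 2-colored and graded (cohomologically, so differentials raise the degree by 1) over
  a field \<open>'k\<close>. A profile \<open>w x\<close> consists of the list \<open>w\<close> of the colors of the inputs,
  numbered from 0, and the color \<open>x\<close> of the output. Symmetric groups act on the right: for
  \<open>f\<close> of profile \<open>w x\<close>, the \<open>j\<close>-th input of \<open>f \<cdot> \<sigma>\<close> has the color of the \<open>\<sigma> j\<close>-th input of \<open>f\<close>.
  All signs are Koszul signs.
\<close>

datatype color = Closed | Open

definition ksign :: "int \<Rightarrow> 'k::field" where
  "ksign n = (if even n then 1 else - 1)"

definition scalars :: "'k::field ring" where
  "scalars = \<lparr>carrier = UNIV, monoid.mult = (*), one = 1, zero = 0, add = (+)\<rparr>"

text \<open>The input colors of \<open>f \<circ>\<^sub>i g\<close>.\<close>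

definition ins :: "'c list \<Rightarrow> nat \<Rightarrow> 'c list \<Rightarrow> 'c list" where
  "ins w i u = take i w @ u @ drop (Suc i) w"

definition permw :: "(nat \<Rightarrow> nat) \<Rightarrow> 'c list \<Rightarrow> 'c list" where
  "permw \<sigma> w = map (\<lambda>j. w ! \<sigma> j) [0..<length w]"

text \<open>
  The permutation \<open>\<sigma> \<circ>\<^sub>i \<tau>\<close> with \<open>(f \<cdot> \<sigma>) \<circ>\<^sub>i (g \<cdot> \<tau>) = (f \<circ>\<^bsub>\<sigma> i\<^esub> g) \<cdot> (\<sigma> \<circ>\<^sub>i \<tau>)\<close>,
  where \<open>g\<close> has \<open>m\<close> inputs.
\<close>

definition perm_comp :: "nat \<Rightarrow> (nat \<Rightarrow> nat) \<Rightarrow> nat \<Rightarrow> (nat \<Rightarrow> nat) \<Rightarrow> nat \<Rightarrow> nat" where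
  "perm_comp m \<sigma> i \<tau> p =
     (let place = (\<lambda>j. if j < \<sigma> i then j else j + m - 1) in
      if p < i then place (\<sigma> p)
      else if p < i + m then \<sigma> i + \<tau> (p - i)
      else place (\<sigma> (Suc p - m)))"


section \<open>Collections, DG operads and cooperads\<close>

text \<open>
  The graded components \<open>part w x d\<close> of a collection are subspaces of one ambient vector space
  (such as their direct sum). The ring multiplication in the record type of the library is unused.
\<close>

record ('k, 'a) collection = "('k, 'a) module" +
  part :: "color list \<Rightarrow> color \<Rightarrow> int \<Rightarrow> 'a set"
  act :: "(nat \<Rightarrow> nat) \<Rightarrow> 'a \<Rightarrow> 'a"

locale collection = module "scalars :: 'k::field ring" C
  for C :: "('k::field, 'a, 'z) collection_scheme" (structure) +
  assumes part_submodule: "submodule (part C w x d) (scalars :: 'k::field ring) C"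
    and act_closed:
      "\<lbrakk>\<sigma> permutes {..<length w}; a \<in> part C w x d\<rbrakk> \<Longrightarrow> act C \<sigma> a \<in> part C (permw \<sigma> w) x d"
    and act_add:
      "\<lbrakk>\<sigma> permutes {..<length w}; a \<in> part C w x d; b \<in> part C w x d\<rbrakk>
       \<Longrightarrow> act C \<sigma> (a \<oplus> b) = act C \<sigma> a \<oplus> act C \<sigma> b"
    and act_smult:
      "\<lbrakk>\<sigma> permutes {..<length w}; a \<in> part C w x d\<rbrakk> \<Longrightarrow> act C \<sigma> (c \<odot> a) = c \<odot> act C \<sigma> a"
    and act_id: "a \<in> part C w x d \<Longrightarrow> act C id a = a"
    and act_act:
      "\<lbrakk>\<sigma> permutes {..<length w}; \<tau> permutes {..<length w}; a \<in> part C w x d\<rbrakk>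
       \<Longrightarrow> act C \<tau> (act C \<sigma> a) = act C (\<sigma> \<circ> \<tau>) a"

record ('k, 'a) dg_operad = "('k, 'a) collection" +
  unit :: "color \<Rightarrow> 'a"
  pcomp :: "nat \<Rightarrow> 'a \<Rightarrow> 'a \<Rightarrow> 'a"
  diff :: "'a \<Rightarrow> 'a"

locale dg_operad = collection P
  for P :: "('k::field, 'a, 'z) dg_operad_scheme" (structure) +
  assumes unit_closed: "unit P x \<in> part P [x] x 0"
    and pcomp_closed:
      "\<lbrakk>f \<in> part P w x d; i < length w; g \<in> part P u (w ! i) e\<rbrakk>
       \<Longrightarrow> pcomp P i f g \<in> part P (ins w i u) x (d + e)"
    and pcomp_add_left:
      "\<lbrakk>f \<in> part P w x d; f' \<in> part P w x d; i < length w; g \<in> part P u (w ! i) e\<rbrakk>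
       \<Longrightarrow> pcomp P i (f \<oplus> f') g = pcomp P i f g \<oplus> pcomp P i f' g"
    and pcomp_add_right:
      "\<lbrakk>f \<in> part P w x d; i < length w; g \<in> part P u (w ! i) e; g' \<in> part P u (w ! i) e\<rbrakk>
       \<Longrightarrow> pcomp P i f (g \<oplus> g') = pcomp P i f g \<oplus> pcomp P i f g'"
    and pcomp_smult_left:
      "\<lbrakk>f \<in> part P w x d; i < length w; g \<in> part P u (w ! i) e\<rbrakk>
       \<Longrightarrow> pcomp P i (c \<odot> f) g = c \<odot> pcomp P i f g"
    and pcomp_smult_right:
      "\<lbrakk>f \<in> part P w x d; i < length w; g \<in> part P u (w ! i) e\<rbrakk>
       \<Longrightarrow> pcomp P i f (c \<odot> g) = c \<odot> pcomp P i f g"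
    and pcomp_unit_left: "g \<in> part P u x e \<Longrightarrow> pcomp P 0 (unit P x) g = g"
    and pcomp_unit_right:
      "\<lbrakk>f \<in> part P w x d; i < length w\<rbrakk> \<Longrightarrow> pcomp P i f (unit P (w ! i)) = f"
    and pcomp_sequential:
      "\<lbrakk>f \<in> part P w x d; i < length w; g \<in> part P u (w ! i) e; j < length u;
        h \<in> part P v (u ! j) l\<rbrakk>
       \<Longrightarrow> pcomp P (i + j) (pcomp P i f g) h = pcomp P i f (pcomp P j g h)"
    and pcomp_parallel:
      "\<lbrakk>f \<in> part P w x d; i < k; k < length w; g \<in> part P u (w ! i) e; h \<in> part P v (w ! k) l\<rbrakk>
       \<Longrightarrow> pcomp P (k + length u - 1) (pcomp P i f g) h
          = ksign (e * l) \<odot> pcomp P i (pcomp P k f h) g"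
    and pcomp_equivariant:
      "\<lbrakk>\<sigma> permutes {..<length w}; \<tau> permutes {..<length u};
        f \<in> part P w x d; i < length w; g \<in> part P u (w ! \<sigma> i) e\<rbrakk>
       \<Longrightarrow> pcomp P i (act P \<sigma> f) (act P \<tau> g)
          = act P (perm_comp (length u) \<sigma> i \<tau>) (pcomp P (\<sigma> i) f g)"
    and diff_closed: "f \<in> part P w x d \<Longrightarrow> diff P f \<in> part P w x (d + 1)"
    and diff_add:
      "\<lbrakk>f \<in> part P w x d; g \<in> part P w x d\<rbrakk> \<Longrightarrow> diff P (f \<oplus> g) = diff P f \<oplus> diff P g"
    and diff_smult: "f \<in> part P w x d \<Longrightarrow> diff P (c \<odot> f) = c \<odot> diff P f"
    and diff_diff: "f \<in> part P w x d \<Longrightarrow> diff P (diff P f) = \<zero>"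
    and diff_act:
      "\<lbrakk>\<sigma> permutes {..<length w}; f \<in> part P w x d\<rbrakk> \<Longrightarrow> diff P (act P \<sigma> f) = act P \<sigma> (diff P f)"
    and diff_pcomp:
      "\<lbrakk>f \<in> part P w x d; i < length w; g \<in> part P u (w ! i) e\<rbrakk>
       \<Longrightarrow> diff P (pcomp P i f g) = pcomp P i (diff P f) g \<oplus> ksign d \<odot> pcomp P i f (diff P g)"

definition dg_operad_hom ::
  "('a \<Rightarrow> 'b) \<Rightarrow> ('k::field, 'a, 'y) dg_operad_scheme \<Rightarrow> ('k, 'b, 'z) dg_operad_scheme \<Rightarrow> bool" where
  "dg_operad_hom F P Q \<longleftrightarrow>
     (\<forall>w x d. \<forall>f \<in> part P w x d.
        F f \<in> part Q w x d \<and>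
        (\<forall>g \<in> part P w x d. F (f \<oplus>\<^bsub>P\<^esub> g) = F f \<oplus>\<^bsub>Q\<^esub> F g) \<and>
        (\<forall>c. F (c \<odot>\<^bsub>P\<^esub> f) = c \<odot>\<^bsub>Q\<^esub> F f) \<and>
        (\<forall>\<sigma>. \<sigma> permutes {..<length w} \<longrightarrow> F (act P \<sigma> f) = act Q \<sigma> (F f)) \<and>
        (\<forall>i u e. \<forall>g \<in> part P u (w ! i) e.
           i < length w \<longrightarrow> F (pcomp P i f g) = pcomp Q i (F f) (F g)) \<and>
        F (diff P f) = diff Q (F f)) \<and>
     (\<forall>x. F (unit P x) = unit Q x)"

text \<open>\<open>F\<close> exhibits \<open>P\<close> as a sub DG operad of \<open>Q\<close>.\<close>

definition sub_dg_operad_via ::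
  "('a \<Rightarrow> 'b) \<Rightarrow> ('k::field, 'a, 'y) dg_operad_scheme \<Rightarrow> ('k, 'b, 'z) dg_operad_scheme \<Rightarrow> bool" where
  "sub_dg_operad_via F P Q \<longleftrightarrow>
     dg_operad P \<and> dg_operad Q \<and> dg_operad_hom F P Q \<and> (\<forall>w x d. inj_on F (part P w x d))"

text \<open>
  Tensor products: for profiles \<open>ps = [(w\<^sub>1,x\<^sub>1), \<dots>, (w\<^sub>n,x\<^sub>n)]\<close>, elements of
  \<open>C(w\<^sub>1;x\<^sub>1) \<otimes> \<dots> \<otimes> C(w\<^sub>n;x\<^sub>n)\<close> are represented by lists of pure tensors, and a pure tensor by the
  list of its homogeneous factors, tagged with their degrees. Over a field, two such sums
  are equal in the tensor product iff all multilinear forms agree on them.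
\<close>

definition pure_tensor ::
  "('k, 'a, 'z) collection_scheme \<Rightarrow> (color list \<times> color) list \<Rightarrow> (int \<times> 'a) list \<Rightarrow> bool" where
  "pure_tensor C ps l \<longleftrightarrow> list_all2 (\<lambda>(w, x) (d, a). a \<in> part C w x d) ps l"

definition multilinear ::
  "('k::field, 'a, 'z) collection_scheme \<Rightarrow> (color list \<times> color) list \<Rightarrow> ((int \<times> 'a) list \<Rightarrow> 'k) \<Rightarrow> bool" where
  "multilinear C ps B \<longleftrightarrow>
     (\<forall>l d a b c r. pure_tensor C ps (l @ (d, a) # r) \<and> pure_tensor C ps (l @ (d, b) # r) \<longrightarrow>
        B (l @ (d, a \<oplus>\<^bsub>C\<^esub> b) # r) = B (l @ (d, a) # r) + B (l @ (d, b) # r) \<and>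
        B (l @ (d, c \<odot>\<^bsub>C\<^esub> a) # r) = c * B (l @ (d, a) # r))"

definition tensor_eq ::
  "('k::field, 'a, 'z) collection_scheme \<Rightarrow> (color list \<times> color) list
   \<Rightarrow> (int \<times> 'a) list list \<Rightarrow> (int \<times> 'a) list list \<Rightarrow> bool" where
  "tensor_eq C ps s t \<longleftrightarrow>
     (\<forall>B. multilinear C ps B \<longrightarrow> (\<Sum>l\<leftarrow>s. B l) = (\<Sum>l\<leftarrow>t. B l))"

type_synonym 'a tensor2 = "((int \<times> 'a) \<times> (int \<times> 'a)) list"

definition ten2 :: "'a tensor2 \<Rightarrow> (int \<times> 'a) list list" where
  "ten2 s = map (\<lambda>(p, q). [p, q]) s"

definition lsum :: "('a, 'z) ring_scheme \<Rightarrow> 'a list \<Rightarrow> 'a" where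
  "lsum C as = foldr (\<oplus>\<^bsub>C\<^esub>) as \<zero>\<^bsub>C\<^esub>"

text \<open>
  Coaugmented graded cooperads (with zero differential) in terms of partial cocompositions:
  \<open>cocomp w x i u n\<close> is the degree \<open>n\<close> part of the map
  \<open>C(w \<circ>\<^sub>i u; x) \<rightarrow> C(w; x) \<otimes> C(u; w\<^sub>i)\<close> dual to \<open>f \<otimes> g \<mapsto> f \<circ>\<^sub>i g\<close>. The counit is \<open>counit x\<close> on
  \<open>C([x]; x)\<close> and zero on all other components.
\<close>

record ('k, 'a) cooperad = "('k, 'a) collection" +
  counit :: "color \<Rightarrow> 'a \<Rightarrow> 'k"
  coaug :: "color \<Rightarrow> 'a"
  cocomp :: "color list \<Rightarrow> color \<Rightarrow> nat \<Rightarrow> color list \<Rightarrow> int \<Rightarrow> 'a \<Rightarrow> 'a tensor2"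

locale cooperad = collection C
  for C :: "('k::field, 'a, 'z) cooperad_scheme" (structure) +
  assumes counit_add:
      "\<lbrakk>a \<in> part C [x] x d; b \<in> part C [x] x d\<rbrakk> \<Longrightarrow> counit C x (a \<oplus> b) = counit C x a + counit C x b"
    and counit_smult: "a \<in> part C [x] x d \<Longrightarrow> counit C x (t \<odot> a) = t * counit C x a"
    and counit_degree: "\<lbrakk>a \<in> part C [x] x d; d \<noteq> 0\<rbrakk> \<Longrightarrow> counit C x a = 0"
    and coaug_closed: "coaug C x \<in> part C [x] x 0"
    and counit_coaug: "counit C x (coaug C x) = 1"
    and cocomp_coaug:
      "\<lbrakk>i < length w; ins w i u = [x]\<rbrakk>
       \<Longrightarrow> tensor_eq C [(w, x), (u, w ! i)] (ten2 (cocomp C w x i u 0 (coaug C x)))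
            (if w = [x] \<and> u = [x] then [[(0, coaug C x), (0, coaug C x)]] else [])"
    and cocomp_closed:
      "\<lbrakk>i < length w; a \<in> part C (ins w i u) x n;
        ((d, b), (e, c)) \<in> set (cocomp C w x i u n a)\<rbrakk>
       \<Longrightarrow> b \<in> part C w x d \<and> c \<in> part C u (w ! i) e \<and> d + e = n"
    and cocomp_add:
      "\<lbrakk>i < length w; a \<in> part C (ins w i u) x n; b \<in> part C (ins w i u) x n\<rbrakk>
       \<Longrightarrow> tensor_eq C [(w, x), (u, w ! i)] (ten2 (cocomp C w x i u n (a \<oplus> b)))
            (ten2 (cocomp C w x i u n a @ cocomp C w x i u n b))"
    and cocomp_smult:
      "\<lbrakk>i < length w; a \<in> part C (ins w i u) x n\<rbrakk>
       \<Longrightarrow> tensor_eq C [(w, x), (u, w ! i)] (ten2 (cocomp C w x i u n (t \<odot> a)))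
            (ten2 (map (\<lambda>((d, b), q). ((d, t \<odot> b), q)) (cocomp C w x i u n a)))"
    and counit_left:
      "a \<in> part C u x n
       \<Longrightarrow> lsum C (map (\<lambda>((d, b), (e, c)). counit C x b \<odot> c) (cocomp C [x] x 0 u n a)) = a"
    and counit_right:
      "\<lbrakk>i < length w; a \<in> part C w x n\<rbrakk>
       \<Longrightarrow> lsum C (map (\<lambda>((d, b), (e, c)). counit C (w ! i) c \<odot> b)
             (cocomp C w x i [w ! i] n a)) = a"
    and cocomp_sequential:
      "\<lbrakk>i < length w; j < length u; a \<in> part C (ins w i (ins u j v)) x n\<rbrakk>
       \<Longrightarrow> tensor_eq C [(w, x), (u, w ! i), (v, u ! j)]
            [[p', q', r]. (p, r) \<leftarrow> cocomp C (ins w i u) x (i + j) v n a,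
                          (p', q') \<leftarrow> cocomp C w x i u (fst p) (snd p)]
            [[p, q', r']. (p, q) \<leftarrow> cocomp C w x i (ins u j v) n a,
                          (q', r') \<leftarrow> cocomp C u (w ! i) j v (fst q) (snd q)]"
    and cocomp_parallel:
      "\<lbrakk>i < k; k < length w; a \<in> part C (ins (ins w k v) i u) x n\<rbrakk>
       \<Longrightarrow> tensor_eq C [(w, x), (u, w ! i), (v, w ! k)]
            [[p', q', r]. (p, r) \<leftarrow> cocomp C (ins w i u) x (k + length u - 1) v n a,
                          (p', q') \<leftarrow> cocomp C w x i u (fst p) (snd p)]
            [[(fst p', ksign (fst q * fst r') \<odot> snd p'), q, r'].
                          (p, q) \<leftarrow> cocomp C (ins w k v) x i u n a,
                          (p', r') \<leftarrow> cocomp C w x k v (fst p) (snd p)]"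
    and cocomp_equivariant:
      "\<lbrakk>\<sigma> permutes {..<length w}; \<tau> permutes {..<length u}; i < length w;
        a \<in> part C (ins w (\<sigma> i) u) x n\<rbrakk>
       \<Longrightarrow> tensor_eq C [(permw \<sigma> w, x), (permw \<tau> u, w ! \<sigma> i)]
            (ten2 (cocomp C (permw \<sigma> w) x i (permw \<tau> u) n
                     (act C (perm_comp (length u) \<sigma> i \<tau>) a)))
            (ten2 (map (\<lambda>((d, b), (e, c)). ((d, act C \<sigma> b), (e, act C \<tau> c)))
                     (cocomp C w x (\<sigma> i) u n a)))"

definition subcooperad ::
  "('k::field, 'a, 'y) cooperad_scheme \<Rightarrow> ('k, 'a, 'z) cooperad_scheme \<Rightarrow> bool" where
  "subcooperad D C \<longleftrightarrow>
     cooperad D \<and> cooperad C \<and>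
     \<zero>\<^bsub>D\<^esub> = \<zero>\<^bsub>C\<^esub> \<and>
     (\<forall>x. coaug D x = coaug C x \<and> (\<forall>d. \<forall>a \<in> part D [x] x d. counit D x a = counit C x a)) \<and>
     (\<forall>w x d. part D w x d \<subseteq> part C w x d \<and>
        (\<forall>a \<in> part D w x d.
           (\<forall>b \<in> part D w x d. a \<oplus>\<^bsub>D\<^esub> b = a \<oplus>\<^bsub>C\<^esub> b) \<and>
           (\<forall>c. c \<odot>\<^bsub>D\<^esub> a = c \<odot>\<^bsub>C\<^esub> a) \<and>
           (\<forall>\<sigma>. \<sigma> permutes {..<length w} \<longrightarrow> act D \<sigma> a = act C \<sigma> a))) \<and>
     (\<forall>w x i u n. \<forall>a \<in> part D (ins w i u) x n. i < length w \<longrightarrow>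
        tensor_eq C [(w, x), (u, w ! i)]
          (ten2 (cocomp D w x i u n a)) (ten2 (cocomp C w x i u n a)))"


section \<open>Operads presented by generators and relations\<close>

text \<open>
  The free operad on a set of generators (without symmetries) has as basis the planar trees with
  vertices decorated by generators and with bijectively numbered leaves.
\<close>

record 'g signature =
  gens :: "'g set"
  in_cols :: "'g \<Rightarrow> color list"
  out_col :: "'g \<Rightarrow> color"
  gdeg :: "'g \<Rightarrow> int"

datatype 'g tree = Leaf color nat | Node 'g "'g tree list"

primrec root_col :: "'g signature \<Rightarrow> 'g tree \<Rightarrow> color" where
  "root_col \<Sigma> (Leaf c j) = c"
| "root_col \<Sigma> (Node g ts) = out_col \<Sigma> g"

primrec wf_tree :: "'g signature \<Rightarrow> 'g tree \<Rightarrow> bool" where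
  "wf_tree \<Sigma> (Leaf c j) \<longleftrightarrow> True"
| "wf_tree \<Sigma> (Node g ts) \<longleftrightarrow>
     g \<in> gens \<Sigma> \<and> map (root_col \<Sigma>) ts = in_cols \<Sigma> g \<and> list_all id (map (wf_tree \<Sigma>) ts)"

primrec tdeg :: "'g signature \<Rightarrow> 'g tree \<Rightarrow> int" where
  "tdeg \<Sigma> (Leaf c j) = 0"
| "tdeg \<Sigma> (Node g ts) = gdeg \<Sigma> g + sum_list (map (tdeg \<Sigma>) ts)"

primrec leaves :: "'g tree \<Rightarrow> (nat \<times> color) list" where
  "leaves (Leaf c j) = [(j, c)]"
| "leaves (Node g ts) = concat (map leaves ts)"

primrec preorder :: "'g tree \<Rightarrow> ('g + nat) list" where
  "preorder (Leaf c j) = [Inr j]"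
| "preorder (Node g ts) = Inl g # concat (map preorder ts)"

definition trees :: "'g signature \<Rightarrow> color list \<Rightarrow> color \<Rightarrow> int \<Rightarrow> 'g tree set" where
  "trees \<Sigma> w x d =
     {T. wf_tree \<Sigma> T \<and> root_col \<Sigma> T = x \<and> tdeg \<Sigma> T = d \<and>
         distinct (leaves T) \<and> set (leaves T) = {(j, w ! j) | j. j < length w}}"

primrec relabel :: "(nat \<Rightarrow> nat) \<Rightarrow> 'g tree \<Rightarrow> 'g tree" where
  "relabel \<pi> (Leaf c j) = Leaf c (\<pi> j)"
| "relabel \<pi> (Node g ts) = Node g (map (relabel \<pi>) ts)"

primrec plug :: "nat \<Rightarrow> 'g tree \<Rightarrow> nat \<Rightarrow> 'g tree \<Rightarrow> 'g tree" where
  "plug i S m (Leaf c j) = (if j = i then S else Leaf c (if j < i then j else j + m - 1))"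
| "plug i S m (Node g ts) = Node g (map (plug i S m) ts)"

definition graft :: "nat \<Rightarrow> 'g tree \<Rightarrow> 'g tree \<Rightarrow> 'g tree" where
  "graft i T S = plug i (relabel (\<lambda>j. i + j) S) (length (leaves S)) T"

text \<open>
  A tree stands for the composite of its vertices in preorder. Hence in \<open>T \<circ>\<^sub>i S\<close> the vertices of
  \<open>S\<close> have to be moved past the vertices of \<open>T\<close> that come after the leaf \<open>i\<close>.
\<close>

definition deg_after :: "'g signature \<Rightarrow> nat \<Rightarrow> 'g tree \<Rightarrow> int" where
  "deg_after \<Sigma> i T =
     sum_list (map (case_sum (gdeg \<Sigma>) (\<lambda>_. 0)) (dropWhile (\<lambda>s. s \<noteq> Inr i) (preorder T)))"

definition graft_sign :: "'g signature \<Rightarrow> nat \<Rightarrow> 'g tree \<Rightarrow> 'g tree \<Rightarrow> 'k::field" where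
  "graft_sign \<Sigma> i T S = ksign (tdeg \<Sigma> S * deg_after \<Sigma> i T)"

abbreviation (input) mon :: "'t \<Rightarrow> 't \<Rightarrow>\<^sub>0 'k::field" where
  "mon T \<equiv> Poly_Mapping.single T 1"

definition scale :: "'k::field \<Rightarrow> ('t \<Rightarrow>\<^sub>0 'k) \<Rightarrow> 't \<Rightarrow>\<^sub>0 'k" where
  "scale c a = Poly_Mapping.map ((*) c) a"

definition lin_ext :: "('s \<Rightarrow> 't \<Rightarrow>\<^sub>0 'k::field) \<Rightarrow> ('s \<Rightarrow>\<^sub>0 'k) \<Rightarrow> 't \<Rightarrow>\<^sub>0 'k" where
  "lin_ext f a = (\<Sum>T \<in> Poly_Mapping.keys a. scale (Poly_Mapping.lookup a T) (f T))"

text \<open>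
  Partial composition and action on formal linear combinations. Outside of their proper domain
  they are set to zero: the argument may be any representative of a class in a quotient, which need
  not be homogeneous.
\<close>

definition free_comp ::
  "'g signature \<Rightarrow> nat \<Rightarrow> ('g tree \<Rightarrow>\<^sub>0 'k::field) \<Rightarrow> ('g tree \<Rightarrow>\<^sub>0 'k) \<Rightarrow> 'g tree \<Rightarrow>\<^sub>0 'k" where
  "free_comp \<Sigma> i a b =
     lin_ext (\<lambda>T. lin_ext (\<lambda>S.
       if (i, root_col \<Sigma> S) \<in> set (leaves T)
       then Poly_Mapping.single (graft i T S) (graft_sign \<Sigma> i T S) else 0) b) a"

definition free_act :: "(nat \<Rightarrow> nat) \<Rightarrow> ('g tree \<Rightarrow>\<^sub>0 'k::field) \<Rightarrow> 'g tree \<Rightarrow>\<^sub>0 'k" where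
  "free_act \<sigma> =
     lin_ext (\<lambda>T. if \<sigma> permutes {..<length (leaves T)} then mon (relabel (inv_into UNIV \<sigma>) T) else 0)"

text \<open>The homogeneous components of the operadic ideal generated by \<open>R\<close>.\<close>

inductive rel_ideal ::
  "'g signature \<Rightarrow> ('g tree \<Rightarrow>\<^sub>0 'k::field) set
   \<Rightarrow> color list \<Rightarrow> color \<Rightarrow> int \<Rightarrow> ('g tree \<Rightarrow>\<^sub>0 'k) \<Rightarrow> bool"
  for \<Sigma> R where
  gen: "\<lbrakk>r \<in> R; Poly_Mapping.keys r \<subseteq> trees \<Sigma> w x d\<rbrakk> \<Longrightarrow> rel_ideal \<Sigma> R w x d r"
| zero: "rel_ideal \<Sigma> R w x d 0"
| add: "\<lbrakk>rel_ideal \<Sigma> R w x d r; rel_ideal \<Sigma> R w x d s\<rbrakk> \<Longrightarrow> rel_ideal \<Sigma> R w x d (r + s)"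
| scale: "rel_ideal \<Sigma> R w x d r \<Longrightarrow> rel_ideal \<Sigma> R w x d (scale c r)"
| act: "\<lbrakk>rel_ideal \<Sigma> R w x d r; \<sigma> permutes {..<length w}\<rbrakk>
        \<Longrightarrow> rel_ideal \<Sigma> R (permw \<sigma> w) x d (free_act \<sigma> r)"
| comp_left: "\<lbrakk>rel_ideal \<Sigma> R w x d r; i < length w; S \<in> trees \<Sigma> u (w ! i) e\<rbrakk>
        \<Longrightarrow> rel_ideal \<Sigma> R (ins w i u) x (d + e) (free_comp \<Sigma> i r (mon S))"
| comp_right: "\<lbrakk>T \<in> trees \<Sigma> w x d; i < length w; rel_ideal \<Sigma> R u (w ! i) e r\<rbrakk>
        \<Longrightarrow> rel_ideal \<Sigma> R (ins w i u) x (d + e) (free_comp \<Sigma> i (mon T) r)"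

definition total_ideal ::
  "'g signature \<Rightarrow> ('g tree \<Rightarrow>\<^sub>0 'k::field) set \<Rightarrow> ('g tree \<Rightarrow>\<^sub>0 'k) set" where
  "total_ideal \<Sigma> R = {sum_list rs | rs. \<forall>r \<in> set rs. \<exists>w x d. rel_ideal \<Sigma> R w x d r}"

definition coset ::
  "'g signature \<Rightarrow> ('g tree \<Rightarrow>\<^sub>0 'k::field) set \<Rightarrow> ('g tree \<Rightarrow>\<^sub>0 'k) \<Rightarrow> ('g tree \<Rightarrow>\<^sub>0 'k) set" where
  "coset \<Sigma> R a = {b. b - a \<in> total_ideal \<Sigma> R}"

text \<open>The DG operad with generators \<open>\<Sigma>\<close>, relations \<open>R\<close> and the differential induced by \<open>D\<close>.\<close>

definition presented_dg_operad ::
  "'g signature \<Rightarrow> ('g tree \<Rightarrow>\<^sub>0 'k::field) set \<Rightarrow> (('g tree \<Rightarrow>\<^sub>0 'k) \<Rightarrow> 'g tree \<Rightarrow>\<^sub>0 'k)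
   \<Rightarrow> ('k, ('g tree \<Rightarrow>\<^sub>0 'k) set) dg_operad" where
  "presented_dg_operad \<Sigma> R D =
     \<lparr>carrier = {coset \<Sigma> R a | a. Poly_Mapping.keys a \<subseteq> (\<Union>w x d. trees \<Sigma> w x d)},
      monoid.mult = undefined, one = undefined,
      zero = coset \<Sigma> R 0,
      add = (\<lambda>A B. \<Union>a \<in> A. \<Union>b \<in> B. coset \<Sigma> R (a + b)),
      smult = (\<lambda>c A. \<Union>a \<in> A. coset \<Sigma> R (scale c a)),
      part = (\<lambda>w x d. {coset \<Sigma> R a | a. Poly_Mapping.keys a \<subseteq> trees \<Sigma> w x d}),
      act = (\<lambda>\<sigma> A. \<Union>a \<in> A. coset \<Sigma> R (free_act \<sigma> a)),
      unit = (\<lambda>x. coset \<Sigma> R (mon (Leaf x 0))),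
      pcomp = (\<lambda>i A B. \<Union>a \<in> A. \<Union>b \<in> B. coset \<Sigma> R (free_comp \<Sigma> i a b)),
      diff = (\<lambda>A. \<Union>a \<in> A. coset \<Sigma> R (D a))\<rparr>"


section \<open>Cooperads governing a type of coalgebras\<close>

text \<open>
  A type of coalgebras is given by cooperations and relations between their composites. These
  generate an operad \<open>P\<close>, with a generator for every cooperation of the same degree as the
  map, such that the coalgebras on \<open>(V, A)\<close> are the morphisms from \<open>P\<close> to the coendomorphism operad
  of \<open>(V, A)\<close> (in which \<open>f \<circ>\<^sub>i g\<close> is \<open>f\<close> followed by \<open>g\<close> applied to the \<open>i\<close>-th output).
  The governing cooperad is the graded linear dual of \<open>P\<close>. Its elements are the
  functions on the tree basis that vanish on the ideal of relations, extended by zero to all trees;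
  \<open>part\<close> negates degrees. The cocomposition is determined by
  \<open>\<langle>\<Delta> \<phi>, T \<otimes> S\<rangle> = \<phi>(T \<circ>\<^sub>i S)\<close>, where \<open>\<langle>a \<otimes> b, T \<otimes> S\<rangle> = (-1)^(|b| |T|) a(T) b(S)\<close>.
  A decomposition as a sum of pure tensors exists if \<open>P\<close> is finite dimensional in
  each profile. The coaugmentation is dual to the projection of \<open>P\<close> to the units.
\<close>

definition pairing :: "('t \<Rightarrow> 'k::field) \<Rightarrow> ('t \<Rightarrow>\<^sub>0 'k) \<Rightarrow> 'k" where
  "pairing \<phi> a = (\<Sum>T \<in> Poly_Mapping.keys a. Poly_Mapping.lookup a T * \<phi> T)"

definition dual_part ::
  "'g signature \<Rightarrow> ('g tree \<Rightarrow>\<^sub>0 'k::field) set \<Rightarrow> color list \<Rightarrow> color \<Rightarrow> int \<Rightarrow> ('g tree \<Rightarrow> 'k) set" where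
  "dual_part \<Sigma> R w x d =
     {\<phi>. (\<forall>T. T \<notin> trees \<Sigma> w x (- d) \<longrightarrow> \<phi> T = 0) \<and>
         (\<forall>r. rel_ideal \<Sigma> R w x (- d) r \<longrightarrow> pairing \<phi> r = 0)}"

definition is_cocomp ::
  "'g signature \<Rightarrow> ('g tree \<Rightarrow>\<^sub>0 'k::field) set \<Rightarrow> color list \<Rightarrow> color \<Rightarrow> nat \<Rightarrow> color list \<Rightarrow> int
   \<Rightarrow> ('g tree \<Rightarrow> 'k) \<Rightarrow> ('g tree \<Rightarrow> 'k) tensor2 \<Rightarrow> bool" where
  "is_cocomp \<Sigma> R w x i u n \<phi> s \<longleftrightarrow>
     (\<forall>((d, a), (e, b)) \<in> set s.
        a \<in> dual_part \<Sigma> R w x d \<and> b \<in> dual_part \<Sigma> R u (w ! i) e \<and> d + e = n) \<and>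
     (\<forall>d e. \<forall>T \<in> trees \<Sigma> w x d. \<forall>S \<in> trees \<Sigma> u (w ! i) e.
        (\<Sum>((_, a), (e', b))\<leftarrow>s. ksign (e' * d) * a T * b S)
        = graft_sign \<Sigma> i T S * \<phi> (graft i T S))"

definition governing_cooperad ::
  "'g signature \<Rightarrow> ('g tree \<Rightarrow>\<^sub>0 'k::field) set \<Rightarrow> ('k, 'g tree \<Rightarrow> 'k) cooperad" where
  "governing_cooperad \<Sigma> R =
     \<lparr>carrier = UNIV, monoid.mult = undefined, one = undefined,
      zero = (\<lambda>T. 0),
      add = (\<lambda>\<phi> \<psi> T. \<phi> T + \<psi> T),
      smult = (\<lambda>c \<phi> T. c * \<phi> T),
      part = dual_part \<Sigma> R,
      act = (\<lambda>\<sigma> \<phi> T. \<phi> (relabel \<sigma> T)),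
      counit = (\<lambda>x \<phi>. \<phi> (Leaf x 0)),
      coaug = (\<lambda>x T. if T = Leaf x 0 then 1 else 0),
      cocomp = (\<lambda>w x i u n \<phi>. SOME s. is_cocomp \<Sigma> R w x i u n \<phi> s)\<rparr>"

datatype cooperation = Delta_c | delta_c | Delta_o | rho

text \<open>
  Degrees are those of the maps on the unsuspended \<open>V\<close> and \<open>A\<close>: with \<open>\<Delta>'\<close>, \<open>\<delta>'\<close>, \<open>\<rho>'\<close> denoting the
  maps on \<open>s\<^sup>-\<^sup>2V\<close> and \<open>s\<^sup>-\<^sup>1A\<close>, of degrees 0, -1, 0, one has
  \<open>\<Delta>\<^sub>c = (s\<^sup>2 \<otimes> s\<^sup>2) \<Delta>'\<^sub>c s\<^sup>-\<^sup>2\<close>, \<open>\<delta>\<^sub>c = (s\<^sup>2 \<otimes> s\<^sup>2) \<delta>'\<^sub>c s\<^sup>-\<^sup>2\<close>, \<open>\<Delta>\<^sub>o = (s \<otimes> s) \<Delta>'\<^sub>o s\<^sup>-\<^sup>1\<close>, \<open>\<rho> = s\<^sup>2 \<rho>' s\<^sup>-\<^sup>1\<close>.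
  The corresponding vectors of the cooperad have the opposite degrees -2, -1, -1, -1.
\<close>

definition S_signature :: "cooperation signature" where
  "S_signature =
     \<lparr>gens = UNIV,
      in_cols = (\<lambda>g. case g of Delta_c \<Rightarrow> [Closed, Closed] | delta_c \<Rightarrow> [Closed, Closed]
                  | Delta_o \<Rightarrow> [Open, Open] | rho \<Rightarrow> [Closed]),
      out_col = (\<lambda>g. case g of Delta_c \<Rightarrow> Closed | delta_c \<Rightarrow> Closed | Delta_o \<Rightarrow> Open | rho \<Rightarrow> Open),
      gdeg = (\<lambda>g. case g of Delta_c \<Rightarrow> 2 | delta_c \<Rightarrow> 1 | Delta_o \<Rightarrow> 1 | rho \<Rightarrow> 1)\<rparr>"

definition OC_signature :: "cooperation signature" where
  "OC_signature = S_signature\<lparr>gens := {Delta_c, Delta_o, rho}\<rparr>"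

text \<open>
  In terms of the maps on \<open>s\<^sup>-\<^sup>2V\<close> and \<open>s\<^sup>-\<^sup>1A\<close> the following relations read: \<open>\<Delta>'\<^sub>c\<close> is cocommutative and
  coassociative, \<open>\<Delta>'\<^sub>o\<close> is coassociative, \<open>\<Delta>'\<^sub>c \<rho>' = (\<rho>' \<otimes> \<rho>') \<Delta>'\<^sub>o\<close> and
  \<open>(\<rho>' \<otimes> id) \<Delta>'\<^sub>o = \<sigma> (id \<otimes> \<rho>') \<Delta>'\<^sub>o\<close>. The signs come from \<open>(f \<otimes> g)(s \<otimes> s) = (-1)^|g| fs \<otimes> gs\<close>. In the
  fourth relation the second tree is \<open>(id \<otimes> \<rho>)(\<rho> \<otimes> id) \<Delta>\<^sub>o = - (\<rho> \<otimes> \<rho>) \<Delta>\<^sub>o\<close>, which equals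
  \<open>(s\<^sup>2 \<otimes> s\<^sup>2)(\<rho>' \<otimes> \<rho>') \<Delta>'\<^sub>o s\<^sup>-\<^sup>1\<close>.
\<close>

definition OC_relations :: "(cooperation tree \<Rightarrow>\<^sub>0 'k::field) set" where
  "OC_relations =
     (let c = Leaf Closed; a = Leaf Open in
     {mon (Node Delta_c [c 0, c 1]) - mon (Node Delta_c [c 1, c 0]),
      mon (Node Delta_c [Node Delta_c [c 0, c 1], c 2])
        - mon (Node Delta_c [c 0, Node Delta_c [c 1, c 2]]),
      mon (Node Delta_o [Node Delta_o [a 0, a 1], a 2])
        + mon (Node Delta_o [a 0, Node Delta_o [a 1, a 2]]),
      mon (Node rho [Node Delta_c [c 0, c 1]])
        - mon (Node Delta_o [Node rho [c 0], Node rho [c 1]]),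
      mon (Node Delta_o [Node rho [c 0], a 1])
        + mon (Node Delta_o [a 1, Node rho [c 0]])})"

text \<open>
  The additional relations of S-coalgebras: \<open>\<delta>\<^sub>c\<close> is symmetric and satisfies the co-Jacobi and the
  co-Leibniz identity, which makes \<open>V\<close> a coalgebra over \<open>\<Lambda>\<^sup>2Ger\<^sup>*\<close> (in \<open>Ger\<close> the bracket has degree -1
  and is symmetric as an element of the operad), and \<open>\<delta>\<^sub>c \<rho> = 0\<close>.
\<close>

definition S_relations :: "(cooperation tree \<Rightarrow>\<^sub>0 'k::field) set" where
  "S_relations = OC_relations \<union>
     (let c = Leaf Closed in
     {mon (Node delta_c [c 0, c 1]) - mon (Node delta_c [c 1, c 0]),
      mon (Node delta_c [Node delta_c [c 0, c 1], c 2])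
        + mon (Node delta_c [Node delta_c [c 1, c 2], c 0])
        + mon (Node delta_c [Node delta_c [c 2, c 0], c 1]),
      mon (Node delta_c [Node Delta_c [c 0, c 1], c 2])
        - mon (Node Delta_c [c 0, Node delta_c [c 1, c 2]])
        - mon (Node Delta_c [Node delta_c [c 0, c 2], c 1]),
      mon (Node rho [Node delta_c [c 0, c 1]])})"

definition S_cooperad :: "('k::field, cooperation tree \<Rightarrow> 'k) cooperad" where
  "S_cooperad = governing_cooperad S_signature S_relations"

definition OC_cooperad :: "('k::field, cooperation tree \<Rightarrow> 'k) cooperad" where
  "OC_cooperad = governing_cooperad OC_signature OC_relations"


section \<open>The cobar construction\<close>

text \<open>
  The cobar construction of \<open>C\<close> is the free operad on the suspension of the kernel of the counit:
  it has a generator \<open>(w, x, d, a)\<close> of degree \<open>d + 1\<close> for every \<open>a\<close> of degree \<open>d\<close>, subject to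
  linearity and equivariance in \<open>a\<close>.
\<close>

type_synonym 'a cobar_gen = "color list \<times> color \<times> int \<times> 'a"

definition cobar_signature ::
  "('k::field, 'a, 'z) cooperad_scheme \<Rightarrow> 'a cobar_gen signature" where
  "cobar_signature C =
     \<lparr>gens = {(w, x, d, a). a \<in> part C w x d \<and> (w = [x] \<longrightarrow> counit C x a = 0)},
      in_cols = (\<lambda>(w, x, d, a). w),
      out_col = (\<lambda>(w, x, d, a). x),
      gdeg = (\<lambda>(w, x, d, a). d + 1)\<rparr>"

definition corolla :: "'a cobar_gen \<Rightarrow> 'a cobar_gen tree" where
  "corolla g = Node g (map (\<lambda>j. Leaf (fst g ! j) j) [0..<length (fst g)])"

definition cobar_relations ::
  "('k::field, 'a, 'z) cooperad_scheme \<Rightarrow> ('a cobar_gen tree \<Rightarrow>\<^sub>0 'k) set" where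
  "cobar_relations C =
     {mon (corolla (w, x, d, a \<oplus>\<^bsub>C\<^esub> b)) - mon (corolla (w, x, d, a)) - mon (corolla (w, x, d, b))
        | w x d a b. (w, x, d, a) \<in> gens (cobar_signature C) \<and> (w, x, d, b) \<in> gens (cobar_signature C)}
   \<union> {mon (corolla (w, x, d, c \<odot>\<^bsub>C\<^esub> a)) - scale c (mon (corolla (w, x, d, a)))
        | w x d c a. (w, x, d, a) \<in> gens (cobar_signature C)}
   \<union> {mon (corolla (permw \<sigma> w, x, d, act C \<sigma> a)) - free_act \<sigma> (mon (corolla (w, x, d, a)))
        | w x d \<sigma> a. (w, x, d, a) \<in> gens (cobar_signature C) \<and> \<sigma> permutes {..<length w}}"

text \<open>The projection to the kernel of the counit along the coaugmentation.\<close>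

definition reduce :: "('k::field, 'a, 'z) cooperad_scheme \<Rightarrow> color list \<Rightarrow> color \<Rightarrow> 'a \<Rightarrow> 'a" where
  "reduce C w x a = (if w = [x] then a \<ominus>\<^bsub>C\<^esub> (counit C x a \<odot>\<^bsub>C\<^esub> coaug C x) else a)"

text \<open>
  For \<open>J \<subseteq> {0..<n}\<close> the permutation \<open>unshuffle n J\<close> lists first the elements of \<open>J\<close>, then the
  others, in increasing order.
\<close>

definition unshuffle :: "nat \<Rightarrow> nat set \<Rightarrow> nat \<Rightarrow> nat" where
  "unshuffle n J j = (if j < n then (nths [0..<n] J @ nths [0..<n] (- J)) ! j else j)"

definition unshuffle_sign :: "int list \<Rightarrow> nat set \<Rightarrow> 'k::field" where
  "unshuffle_sign ds J =
     ksign (\<Sum>(i, j) | i < j \<and> j < length ds \<and> i \<notin> J \<and> j \<in> J. ds ! i * ds ! j)"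

text \<open>
  The cobar differential is \<open>D(s a) = - \<Sum> (-1)^|a'| s a' \<circ> s a''\<close>, where the sum extends over all
  trees with two vertices and \<open>a' \<otimes> a''\<close> is the corresponding cocomposition of \<open>a\<close>. Such a tree is
  given by the color \<open>y\<close> of its inner edge and by the set \<open>J\<close> of inputs at the upper vertex.
  On a tree, \<open>D\<close> is the sum of the contributions of all vertices; \<open>cobar_vertex\<close> replaces the
  lowest vertex \<open>g\<close> of the tree with branches \<open>ts\<close>.
\<close>

definition cobar_vertex ::
  "('k::field, 'a, 'z) cooperad_scheme \<Rightarrow> 'a cobar_gen \<Rightarrow> 'a cobar_gen tree list
   \<Rightarrow> 'a cobar_gen tree \<Rightarrow>\<^sub>0 'k" where
  "cobar_vertex C g ts = (case g of (w, x, n, a) \<Rightarrow>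
     - (\<Sum>y \<in> {Closed, Open}. \<Sum>J \<in> Pow {..<length w}.
          (let u = nths w J; v = y # nths w (- J) in
           \<Sum>((d, b), (e, c))\<leftarrow>cocomp C v x 0 u n (act C (unshuffle (length w) J) a).
             Poly_Mapping.single
               (Node (v, x, d, reduce C v x b)
                  (Node (u, y, e, reduce C u y c) (nths ts J) # nths ts (- J)))
               (ksign d * unshuffle_sign (map (tdeg (cobar_signature C)) ts) J))))"

primrec cobar_tree_diff ::
  "('k::field, 'a, 'z) cooperad_scheme \<Rightarrow> 'a cobar_gen tree \<Rightarrow> 'a cobar_gen tree \<Rightarrow>\<^sub>0 'k" where
  "cobar_tree_diff C (Leaf c j) = 0"
| "cobar_tree_diff C (Node g ts) =
     cobar_vertex C g ts
     + (\<Sum>j < length ts.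
          scale (ksign (gdeg (cobar_signature C) g
                        + sum_list (map (tdeg (cobar_signature C)) (take j ts))))
            (lin_ext (\<lambda>t. mon (Node g (ts[j := t]))) (map (cobar_tree_diff C) ts ! j)))"

definition cobar ::
  "('k::field, 'a, 'z) cooperad_scheme \<Rightarrow> ('k, ('a cobar_gen tree \<Rightarrow>\<^sub>0 'k) set) dg_operad" where
  "cobar C =
     presented_dg_operad (cobar_signature C) (cobar_relations C) (lin_ext (cobar_tree_diff C))"

text \<open>The morphism \<open>Cobar(D) \<rightarrow> Cobar(C)\<close> induced by a morphism \<open>f\<close> from \<open>D\<close> to \<open>C\<close>.\<close>

definition cobar_map ::
  "('a \<Rightarrow> 'b) \<Rightarrow> ('k::field, 'b, 'z) cooperad_scheme
   \<Rightarrow> ('a cobar_gen tree \<Rightarrow>\<^sub>0 'k) set \<Rightarrow> ('b cobar_gen tree \<Rightarrow>\<^sub>0 'k) set" where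
  "cobar_map f C A =
     (\<Union>a \<in> A. coset (cobar_signature C) (cobar_relations C)
        (lin_ext (\<lambda>T. mon (map_tree (\<lambda>(w, x, d, b). (w, x, d, f b)) T)) a))"

definition OC_infinity ::
  "('k::field, ((cooperation tree \<Rightarrow> 'k) cobar_gen tree \<Rightarrow>\<^sub>0 'k) set) dg_operad" where
  "OC_infinity = cobar OC_cooperad"

definition Ger_plus_infinity ::
  "('k::field, ((cooperation tree \<Rightarrow> 'k) cobar_gen tree \<Rightarrow>\<^sub>0 'k) set) dg_operad" where
  "Ger_plus_infinity = cobar S_cooperad"

end

theory Submission
  imports "HOL.Vector_Spaces" Defs
begin

text \<open>
  Every relation of S-coalgebras involves \<open>\<delta>\<^sub>c\<close> either in all of its terms or in none, and those of the
  second kind are the relations of OC-coalgebras. Hence the elements of the dual cooperad of \<open>OC\<close>, extended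
  by zero, are the elements of \<open>S\<close> that are supported on trees without \<open>\<delta>\<^sub>c\<close>, and restricting
  functions to such trees is a linear, equivariant retraction. It sends the generators and relations of
  \<open>Cobar(S)\<close> to those of \<open>Cobar(OC)\<close>, so the latter embeds although the retraction need not respect
  the differentials.

  That the cobar differential squares to zero is checked on generators, where \<open>D\<^sup>2\<close> is a sum over trees
  with three vertices. When these lie on a path, the two ways to obtain the tree cancel by the sequential
  axiom. The sum \<open>X\<close> of the other terms satisfies \<open>X = - X\<close> by the parallel axiom.
\<close>

section \<open>Linear combinations of trees\<close>

text \<open>A cocomposition is a list of pure tensors picked by choice, so it is determined only up
  to equality of tensors. Hence additivity and equivariance of the differential D, and D^2 = 0, hold
  only modulo the relations of the cobar construction, whereas the Leibniz rule and the
  compatibility with relabeling hold exactly on trees. Statements about D are therefore reduced to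
  corollas, where they become congruences between sums over cocompositions. Equality of tensors is
  tested by forms with values in the field, but these sums live in a quotient of the free operad;
  linear functionals that vanish on the ideal bridge this gap. D moves the inputs of the upper
  vertex to the front, so a second application produces blocks in other positions and composites of
  unshuffles. For this reason the two-vertex terms are set up for an arbitrary permutation and an
  arbitrary block, and are shown to depend only on the set of inputs in the block. Passing from X =
  - X to X = 0 divides by 2, which is where the characteristic enters.\<close>

lemma ksign_simps [simp]:
  "ksign 0 = 1" "ksign 1 = - 1" "ksign n * ksign n = (1::'k::field)" "ksign (- n) = ksign n"
  "ksign n * (ksign n * c) = (c::'k)"
  by (simp_all add: ksign_def)

lemma ksign_add: "ksign (m + n) = ksign m * (ksign n :: 'k::field)"
  by (auto simp: ksign_def)

lemma ksign_eqI: "(even m \<longleftrightarrow> even n) \<Longrightarrow> ksign m = ksign n"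
  by (simp add: ksign_def)

lemma lookup_scale [simp]: "Poly_Mapping.lookup (scale c a) T = c * Poly_Mapping.lookup a T"
  unfolding scale_def by (simp add: Poly_Mapping.map.rep_eq when_def)

interpretation pm: vector_space "scale :: 'k::field \<Rightarrow> ('t \<Rightarrow>\<^sub>0 'k) \<Rightarrow> ('t \<Rightarrow>\<^sub>0 'k)"
  by unfold_locales (auto intro!: poly_mapping_eqI simp: lookup_add algebra_simps)

lemma scale_single [simp]: "scale c (Poly_Mapping.single T d) = Poly_Mapping.single T (c * d)"
  by (auto intro!: poly_mapping_eqI simp: lookup_single when_def)

lemma keys_scale: "Poly_Mapping.keys (scale c a) \<subseteq> Poly_Mapping.keys a"
  by (auto simp: in_keys_iff)

text \<open>Cancellation can make the support of a sum smaller than the union of the supports.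
  Summing over a common finite superset turns linearity of \<open>lin_ext\<close> into a termwise
  identity.\<close>

lemma lin_ext_superset:
  assumes "finite S" "Poly_Mapping.keys a \<subseteq> S"
  shows "lin_ext f a = (\<Sum>T\<in>S. scale (Poly_Mapping.lookup a T) (f T))"
  unfolding lin_ext_def
  by (rule sum.mono_neutral_left) (use assms in \<open>auto simp: in_keys_iff\<close>)

lemma lin_ext_add: "lin_ext f (a + b) = lin_ext f a + lin_ext f b"
proof -
  let ?S = "Poly_Mapping.keys a \<union> Poly_Mapping.keys b"
  have "lin_ext f c = (\<Sum>T\<in>?S. scale (Poly_Mapping.lookup c T) (f T))" if "c \<in> {a, b, a + b}" for c
    by (rule lin_ext_superset) (use that keys_add[of a b] in auto)
  then show ?thesis
    by (simp add: lookup_add pm.scale_left_distrib sum.distrib)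
qed

lemma lin_ext_scale: "lin_ext f (scale c a) = scale c (lin_ext f a)"
  by (subst lin_ext_superset[OF _ keys_scale])
     (auto simp: lin_ext_def pm.scale_sum_right)

lemma linear_lin_ext: "module_hom scale scale (lin_ext f)"
  by unfold_locales (auto simp: lin_ext_add lin_ext_scale pm.scale_right_distrib pm.scale_left_distrib)

lemmas lin_ext_sum = module_hom.sum[OF linear_lin_ext]
lemmas lin_ext_diff = module_hom.diff[OF linear_lin_ext]
lemmas lin_ext_neg = module_hom.neg[OF linear_lin_ext]
lemmas lin_ext_zero [simp] = module_hom.zero[OF linear_lin_ext]
lemmas lin_ext_linear = lin_ext_add lin_ext_scale lin_ext_sum lin_ext_diff lin_ext_neg

lemma lin_ext_single [simp]: "lin_ext f (Poly_Mapping.single T c) = scale c (f T)"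
  by (cases "c = 0") (auto simp: lin_ext_def)

lemma lin_ext_cong: "(\<And>T. T \<in> Poly_Mapping.keys a \<Longrightarrow> f T = g T) \<Longrightarrow> lin_ext f a = lin_ext g a"
  by (simp add: lin_ext_def)

lemma lin_ext_lin_ext: "lin_ext f (lin_ext g a) = lin_ext (\<lambda>T. lin_ext f (g T)) a"
  unfolding lin_ext_def[of g] lin_ext_def[of "\<lambda>T. lin_ext f (g T)"]
  by (simp add: lin_ext_sum lin_ext_scale)

lemma lin_ext_mon [simp]: "lin_ext mon a = a"
proof (rule poly_mapping_eqI)
  fix T
  have "Poly_Mapping.lookup (lin_ext mon a) T
    = (\<Sum>S\<in>Poly_Mapping.keys a. if S = T then Poly_Mapping.lookup a S else 0)"
    unfolding lin_ext_def by (simp add: lookup_sum lookup_single when_def mult.commute if_distrib cong: if_cong)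
  then show "Poly_Mapping.lookup (lin_ext mon a) T = Poly_Mapping.lookup a T"
    by (simp add: in_keys_iff)
qed

lemma lin_ext_fun_add: "lin_ext (\<lambda>T. f T + g T) a = lin_ext f a + lin_ext g a"
  by (simp add: lin_ext_def pm.scale_right_distrib sum.distrib)

lemma lin_ext_fun_scale: "lin_ext (\<lambda>T. scale c (f T)) a = scale c (lin_ext f a)"
  by (simp add: lin_ext_def pm.scale_sum_right mult.commute)

lemma lin_ext_fun_zero [simp]: "lin_ext (\<lambda>T. 0) a = 0"
  by (simp add: lin_ext_def)

lemma keys_lin_ext:
  "T \<in> Poly_Mapping.keys (lin_ext f a) \<Longrightarrow> \<exists>S \<in> Poly_Mapping.keys a. T \<in> Poly_Mapping.keys (f S)"
proof (rule ccontr)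
  assume T: "T \<in> Poly_Mapping.keys (lin_ext f a)" and "\<not> ?thesis"
  then have "Poly_Mapping.lookup (lin_ext f a) T = 0"
    unfolding lin_ext_def by (auto simp: lookup_sum in_keys_iff intro!: sum.neutral)
  with T show False by (simp add: in_keys_iff)
qed

lemma keys_sum: "T \<in> Poly_Mapping.keys (sum f A) \<Longrightarrow> \<exists>x\<in>A. T \<in> Poly_Mapping.keys (f x)"
  by (metis (mono_tags, lifting) in_keys_iff lookup_sum sum.neutral)

lemma keys_sum_list:
  "T \<in> Poly_Mapping.keys (sum_list (map f xs)) \<Longrightarrow> \<exists>x\<in>set xs. T \<in> Poly_Mapping.keys (f x)"
  by (induction xs) (use keys_add in \<open>fastforce+\<close>)

lemma keys_uminus: "Poly_Mapping.keys (- a) = Poly_Mapping.keys (a :: 't \<Rightarrow>\<^sub>0 'k::field)"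
  by (auto simp: in_keys_iff)

lemma keys_diff_subset: "Poly_Mapping.keys (a - b) \<subseteq> Poly_Mapping.keys a \<union> Poly_Mapping.keys (b :: 't \<Rightarrow>\<^sub>0 'k::field)"
  by (auto simp: in_keys_iff lookup_minus)

lemma sum_list_linear:
  assumes "module_hom scale scale f"
  shows "f (sum_list (map g xs)) = (\<Sum>x\<leftarrow>xs. f (g x))"
  by (induction xs) (auto simp: module_hom.zero[OF assms] module_hom.add[OF assms])

lemma sum_mon_expand: "a = (\<Sum>T\<in>Poly_Mapping.keys a. scale (Poly_Mapping.lookup a T) (mon T))"
  using lin_ext_mon[of a] unfolding lin_ext_def by simp

section \<open>Pairing of functions with linear combinations\<close>

lemma pairing_superset:
  assumes "finite S" "Poly_Mapping.keys a \<subseteq> S"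
  shows "pairing \<phi> a = (\<Sum>T\<in>S. Poly_Mapping.lookup a T * \<phi> T)"
  unfolding pairing_def
  by (rule sum.mono_neutral_left) (use assms in \<open>auto simp: in_keys_iff\<close>)

lemma pairing_add: "pairing \<phi> (a + b) = pairing \<phi> a + pairing \<phi> b"
proof -
  let ?S = "Poly_Mapping.keys a \<union> Poly_Mapping.keys b"
  have "pairing \<phi> c = (\<Sum>T\<in>?S. Poly_Mapping.lookup c T * \<phi> T)" if "c \<in> {a, b, a + b}" for c
    by (rule pairing_superset) (use that keys_add[of a b] in auto)
  then show ?thesis
    by (simp add: lookup_add algebra_simps sum.distrib)
qed

lemma pairing_scale: "pairing \<phi> (scale c a) = c * pairing \<phi> a"
  by (subst pairing_superset[OF _ keys_scale]) (auto simp: pairing_def sum_distrib_left mult.assoc)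

lemma pairing_zero [simp]: "pairing \<phi> 0 = 0"
  by (simp add: pairing_def)

lemma pairing_sum: "pairing \<phi> (sum f A) = (\<Sum>x\<in>A. pairing \<phi> (f x))"
  by (induction A rule: infinite_finite_induct) (auto simp: pairing_add)

lemma pairing_single [simp]: "pairing \<phi> (Poly_Mapping.single T c) = c * \<phi> T"
  by (cases "c = 0") (auto simp: pairing_def)

text \<open>The transpose of a linear extension. It converts vanishing of \<open>\<phi>\<close> on
  the composites of an ideal element with a tree into vanishing of another function on the ideal
  element itself.\<close>

lemma pairing_lin_ext: "pairing \<phi> (lin_ext f a) = pairing (\<lambda>T. pairing \<phi> (f T)) a"
  unfolding lin_ext_def by (simp add: pairing_sum pairing_scale pairing_def[of _ a])

lemma pairing_cong: "(\<And>T. T \<in> Poly_Mapping.keys a \<Longrightarrow> \<phi> T = \<psi> T) \<Longrightarrow> pairing \<phi> a = pairing \<psi> a"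
  by (simp add: pairing_def)

lemma pairing_fun_add: "pairing (\<lambda>T. \<phi> T + \<psi> T) a = pairing \<phi> a + pairing \<psi> a"
  by (simp add: pairing_def algebra_simps sum.distrib)

lemma pairing_fun_scale: "pairing (\<lambda>T. c * \<phi> T) a = c * pairing \<phi> a"
  by (simp add: pairing_def sum_distrib_left mult.left_commute)

lemma pairing_fun_zero [simp]: "pairing (\<lambda>T. 0) a = 0"
  by (simp add: pairing_def)


section \<open>Trees\<close>

definition is_leaf :: "'g tree \<Rightarrow> bool" where
  "is_leaf T \<longleftrightarrow> (\<exists>c j. T = Leaf c j)"

lemma is_leaf_simps [simp]: "is_leaf (Leaf c j)" "\<not> is_leaf (Node g ts)"
  by (auto simp: is_leaf_def)

definition labels :: "'g tree \<Rightarrow> nat list" where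
  "labels T = map fst (leaves T)"

lemma labels_simps [simp]:
  "labels (Leaf c j) = [j]" "labels (Node g ts) = concat (map labels ts)"
  by (simp_all add: labels_def map_concat comp_def) (rule arg_cong[where f = concat], simp add: labels_def)

lemma length_labels: "length (labels T) = length (leaves T)"
  by (simp add: labels_def)

text \<open>Being additive under concatenation, the degree of a segment of a preorder word lets the
  signs given by \<open>deg_after\<close> be read off from a splitting of the word at a
  leaf.\<close>

definition pdeg :: "'g signature \<Rightarrow> ('g + nat) list \<Rightarrow> int" where
  "pdeg \<Sigma> l = sum_list (map (case_sum (gdeg \<Sigma>) (\<lambda>_. 0)) l)"

lemma pdeg_simps [simp]:
  "pdeg \<Sigma> [] = 0" "pdeg \<Sigma> (Inl g # l) = gdeg \<Sigma> g + pdeg \<Sigma> l" "pdeg \<Sigma> (Inr j # l) = pdeg \<Sigma> l"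
  "pdeg \<Sigma> (l @ l') = pdeg \<Sigma> l + pdeg \<Sigma> l'"
  by (auto simp: pdeg_def)

lemma pdeg_concat: "pdeg \<Sigma> (concat ls) = sum_list (map (pdeg \<Sigma>) ls)"
  by (induction ls) auto

lemma pdeg_preorder [simp]: "pdeg \<Sigma> (preorder T) = tdeg \<Sigma> T"
  by (induction T) (auto simp: pdeg_concat comp_def cong: map_cong)

lemma deg_after_pdeg: "deg_after \<Sigma> i T = pdeg \<Sigma> (dropWhile (\<lambda>s. s \<noteq> Inr i) (preorder T))"
  by (simp add: deg_after_def pdeg_def)

lemma deg_after_split:
  assumes "preorder T = l1 @ Inr i # l2" "Inr i \<notin> set l1"
  shows "deg_after \<Sigma> i T = pdeg \<Sigma> l2"
proof -
  have "dropWhile (\<lambda>s. s \<noteq> Inr i) (preorder T) = Inr i # l2"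
    unfolding assms(1) using assms(2) by (subst dropWhile_append2) auto
  then show ?thesis by (simp add: deg_after_pdeg)
qed

lemma set_labels_preorder: "j \<in> set (labels T) \<longleftrightarrow> Inr j \<in> set (preorder T)"
  by (induction T) auto

lemma labels_preorder: "labels T = concat (map (case_sum (\<lambda>_. []) (\<lambda>j. [j])) (preorder T))"
proof (induction T)
  case (Node g ts)
  then show ?case by (simp add: map_concat comp_def cong: map_cong) (induction ts; auto)
qed auto

lemma preorder_split:
  assumes "distinct (labels T)" "i \<in> set (labels T)"
  obtains l1 l2 where "preorder T = l1 @ Inr i # l2" "Inr i \<notin> set l1" "Inr i \<notin> set l2"
proof -
  obtain l1 l2 where s: "preorder T = l1 @ Inr i # l2"
    using assms(2) by (auto simp: set_labels_preorder dest: split_list)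
  have "i \<notin> set (concat (map (case_sum (\<lambda>_. []) (\<lambda>j. [j])) l))" if "l \<in> {l1, l2}" for l
    using assms(1) s that unfolding labels_preorder by auto
  then have "Inr i \<notin> set l" if "l \<in> {l1, l2}" for l
    using that by force
  then show ?thesis using s that by auto
qed

lemma leaves_split:
  assumes "distinct (labels T)" "(i, c) \<in> set (leaves T)"
  obtains l1 l2 where "leaves T = l1 @ (i, c) # l2" "i \<notin> fst ` set l1" "i \<notin> fst ` set l2"
proof -
  obtain l1 l2 where s: "leaves T = l1 @ (i, c) # l2"
    using assms(2) by (auto dest: split_list)
  then show ?thesis using assms(1) that by (auto simp: labels_def)
qed

lemma root_col_relabel [simp]: "root_col \<Sigma> (relabel \<pi> T) = root_col \<Sigma> T"
  by (cases T) auto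

lemma wf_tree_relabel [simp]: "wf_tree \<Sigma> (relabel \<pi> T) = wf_tree \<Sigma> T"
  by (induction T) (auto simp: comp_def list_all_iff cong: map_cong)

lemma tdeg_relabel [simp]: "tdeg \<Sigma> (relabel \<pi> T) = tdeg \<Sigma> T"
  by (induction T) (auto simp: comp_def cong: map_cong)

lemma leaves_relabel: "leaves (relabel \<pi> T) = map (\<lambda>(j, c). (\<pi> j, c)) (leaves T)"
  by (induction T) (auto simp: comp_def map_concat cong: map_cong)

lemma labels_relabel: "labels (relabel \<pi> T) = map \<pi> (labels T)"
  by (auto simp: labels_def leaves_relabel)

lemma length_leaves_relabel [simp]: "length (leaves (relabel \<pi> T)) = length (leaves T)"
  by (simp add: leaves_relabel)

lemma preorder_relabel: "preorder (relabel \<pi> T) = map (map_sum id \<pi>) (preorder T)"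
  by (induction T) (auto simp: comp_def map_concat cong: map_cong)

lemma relabel_relabel: "relabel \<pi> (relabel \<rho> T) = relabel (\<pi> \<circ> \<rho>) T"
  by (induction T) auto

lemma relabel_cong: "(\<And>j. j \<in> set (labels T) \<Longrightarrow> \<pi> j = \<rho> j) \<Longrightarrow> relabel \<pi> T = relabel \<rho> T"
  by (induction T) auto

lemma relabel_id [simp]: "relabel id T = T" "relabel (\<lambda>j. j) T = T"
  by (induction T) (auto simp: map_idI)

text \<open>\<open>dropWhile\<close> has to stop at the same symbol before and after relabeling.
  Including \<open>i\<close> in the injectivity hypothesis covers the case that \<open>i\<close> is
  not a label of \<open>T\<close>.\<close>

lemma deg_after_relabel:
  assumes "inj_on \<pi> (insert i (set (labels T)))"
  shows "deg_after \<Sigma> (\<pi> i) (relabel \<pi> T) = deg_after \<Sigma> i T"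
proof -
  have "dropWhile (\<lambda>s. s \<noteq> Inr (\<pi> i)) (map (map_sum id \<pi>) l)
      = map (map_sum id \<pi>) (dropWhile (\<lambda>s. s \<noteq> Inr i) l)"
    if "\<And>j. Inr j \<in> set l \<Longrightarrow> j \<in> set (labels T)" for l :: "('a + nat) list"
    using that
  proof (induction l)
    case (Cons s l)
    have "map_sum id \<pi> s = Inr (\<pi> i) \<longleftrightarrow> s = Inr i"
      using assms Cons.prems by (cases s) (auto simp: inj_on_def)
    then show ?case using Cons by (auto simp del: id_def simp flip: id_def)
  qed auto
  moreover have "pdeg \<Sigma> (map (map_sum id \<pi>) l) = pdeg \<Sigma> l" for l
    by (auto simp: pdeg_def comp_def intro!: arg_cong[where f = sum_list] split: sum.splits)
  ultimately show ?thesis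
    by (simp add: deg_after_pdeg preorder_relabel set_labels_preorder)
qed

section \<open>Plugging a tree into a leaf: effect on leaves and preorder words\<close>

definition shift :: "nat \<Rightarrow> nat \<Rightarrow> nat \<Rightarrow> nat" where
  "shift i m j = (if j < i then j else j + m - 1)"

lemma concat_concat_map: "concat (concat xss) = concat (map concat xss)"
  by (induction xss) auto

lemma leaves_plug:
  "leaves (plug i S m T)
    = concat (map (\<lambda>(j, c). if j = i then leaves S else [(shift i m j, c)]) (leaves T))"
  by (induction T) (auto simp: shift_def map_concat comp_def concat_concat_map cong: map_cong)

lemma preorder_plug:
  "preorder (plug i S m T)
    = concat (map (case_sum (\<lambda>g. [Inl g]) (\<lambda>j. if j = i then preorder S else [Inr (shift i m j)])) (preorder T))"
  by (induction T) (auto simp: shift_def map_concat comp_def concat_concat_map cong: map_cong)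

lemma plug_notin: "i \<notin> set (labels T) \<Longrightarrow> plug i S m T = relabel (shift i m) T"
  by (induction T) (auto simp: shift_def)

lemma root_col_plug:
  assumes "\<And>c. (i, c) \<in> set (leaves T) \<Longrightarrow> c = root_col \<Sigma> S"
  shows "root_col \<Sigma> (plug i S m T) = root_col \<Sigma> T"
  using assms by (cases T) auto

lemma wf_tree_plug:
  assumes "\<And>c. (i, c) \<in> set (leaves T) \<Longrightarrow> c = root_col \<Sigma> S" "wf_tree \<Sigma> S" "wf_tree \<Sigma> T"
  shows "wf_tree \<Sigma> (plug i S m T)"
  using assms
proof (induction T)
  case (Node g ts)
  have "root_col \<Sigma> (plug i S m t) = root_col \<Sigma> t" if "t \<in> set ts" for t
    by (rule root_col_plug) (use Node.prems that in auto)
  then have "map (root_col \<Sigma>) (map (plug i S m) ts) = map (root_col \<Sigma>) ts"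
    by simp
  then show ?case using Node by (auto simp: list_all_iff simp del: map_map)
qed auto

lemma concat_map_notin:
  "(\<And>x. x \<in> set l \<Longrightarrow> f x = [g x]) \<Longrightarrow> concat (map f l) = map g l"
  by (induction l) auto

lemma leaves_plug_split:
  assumes "leaves T = l1 @ (i, c) # l2" "i \<notin> fst ` set l1" "i \<notin> fst ` set l2"
  shows "leaves (plug i S m T) = map (\<lambda>(j, c). (shift i m j, c)) l1 @ leaves S
           @ map (\<lambda>(j, c). (shift i m j, c)) l2"
proof -
  let ?f = "\<lambda>(j, c). if j = i then leaves S else [(shift i m j, c)]"
  have "concat (map ?f l) = map (\<lambda>(j, c). (shift i m j, c)) l" if "i \<notin> fst ` set l" for l
    by (rule concat_map_notin) (use that in \<open>force\<close>)
  then show ?thesis using assms by (simp add: leaves_plug)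
qed

abbreviation shiftp :: "nat \<Rightarrow> nat \<Rightarrow> 'g + nat \<Rightarrow> 'g + nat" where
  "shiftp i m \<equiv> map_sum id (shift i m)"

lemma preorder_plug_split:
  assumes "preorder T = l1 @ Inr i # l2" "Inr i \<notin> set l1" "Inr i \<notin> set l2"
  shows "preorder (plug i S m T) = map (shiftp i m) l1 @ preorder S @ map (shiftp i m) l2"
proof -
  let ?f = "case_sum (\<lambda>g. [Inl g]) (\<lambda>j. if j = i then preorder S else [Inr (shift i m j)])"
  have "concat (map ?f l) = map (shiftp i m) l" if "Inr i \<notin> set l" for l
    by (rule concat_map_notin) (use that in \<open>auto split: sum.splits\<close>)
  then show ?thesis using assms by (simp add: preorder_plug)
qed

lemma pdeg_map_sum [simp]: "pdeg \<Sigma> (map (map_sum id f) l) = pdeg \<Sigma> l"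
proof (induction l)
  case (Cons s l)
  then show ?case by (cases s) auto
qed auto

lemma tdeg_plug:
  assumes "distinct (labels T)" "i \<in> set (labels T)"
  shows "tdeg \<Sigma> (plug i S m T) = tdeg \<Sigma> T + tdeg \<Sigma> S"
proof -
  obtain l1 l2 where s: "preorder T = l1 @ Inr i # l2" "Inr i \<notin> set l1" "Inr i \<notin> set l2"
    using preorder_split[OF assms] .
  have "pdeg \<Sigma> (preorder (plug i S m T)) = pdeg \<Sigma> (preorder T) + pdeg \<Sigma> (preorder S)"
    by (simp only: preorder_plug_split[OF s]) (simp add: s)
  then show ?thesis by simp
qed

section \<open>Profiles under relabeling and grafting\<close>

lemma length_ins: "i < length w \<Longrightarrow> length (ins w i u) = length w + length u - 1"
  by (auto simp: ins_def)

lemma nth_ins: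
  assumes "i < length w" "j < length w + length u - 1"
  shows "ins w i u ! j = (if j < i then w ! j else if j < i + length u then u ! (j - i)
                          else w ! (j + 1 - length u))"
proof -
  have "Suc (i + (j - (i + length u))) = Suc j - length u" if "\<not> j < i + length u"
    using that by simp
  then show ?thesis
    using assms by (auto simp: ins_def nth_append min_def)
qed

lemma treesD:
  assumes "T \<in> trees \<Sigma> w x d"
  shows "wf_tree \<Sigma> T" "root_col \<Sigma> T = x" "tdeg \<Sigma> T = d" "length (leaves T) = length w"
    "distinct (labels T)" "set (labels T) = {..<length w}"
    "(i, c) \<in> set (leaves T) \<longleftrightarrow> i < length w \<and> c = w ! i"
proof -
  have d: "distinct (leaves T)" and s: "set (leaves T) = {(j, w ! j) | j. j < length w}"
    using assms by (auto simp: trees_def)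
  show "wf_tree \<Sigma> T" "root_col \<Sigma> T = x" "tdeg \<Sigma> T = d"
    using assms by (auto simp: trees_def)
  show "(i, c) \<in> set (leaves T) \<longleftrightarrow> i < length w \<and> c = w ! i"
    by (auto simp: s)
  show l: "set (labels T) = {..<length w}"
    by (force simp: labels_def s)
  have "{(j, w ! j) | j. j < length w} = (\<lambda>j. (j, w ! j)) ` {..<length w}"
    by auto
  moreover have "card ((\<lambda>j. (j, w ! j)) ` {..<length w}) = length w"
    by (subst card_image) (auto simp: inj_on_def)
  ultimately show n: "length (leaves T) = length w"
    using distinct_card[OF d] s by simp
  \<comment> \<open>There are as many leaves as input positions and every position occurs as a
    label, so no label can repeat.\<close>
  show "distinct (labels T)"
    by (rule card_distinct) (simp only: l, simp add: labels_def n)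
qed

text \<open>Distinctness of the leaves is traded for their number, which is easier to compute for
  relabeled and grafted trees: a list as long as its set is large has no repetitions.\<close>

lemma treesI:
  assumes "wf_tree \<Sigma> T" "root_col \<Sigma> T = x" "tdeg \<Sigma> T = d" "length (leaves T) = length w"
    "set (leaves T) = {(j, w ! j) | j. j < length w}"
  shows "T \<in> trees \<Sigma> w x d"
proof -
  have "{(j, w ! j) | j. j < length w} = (\<lambda>j. (j, w ! j)) ` {..<length w}"
    by auto
  then have "card (set (leaves T)) = length (leaves T)"
    unfolding assms(4,5) by (simp, subst card_image) (auto simp: inj_on_def)
  then show ?thesis
    using assms card_distinct[of "leaves T"] by (auto simp: trees_def)
qed

text \<open>The leaves carry their colors, so a tree determines its profile. In particular a nonzero
  value of a dual element on a tree fixes the degree, which is used to simplify signs.\<close>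

lemma trees_unique:
  assumes "T \<in> trees \<Sigma> w x d" "T \<in> trees \<Sigma> w' x' d'"
  shows "w = w'" "x = x'" "d = d'"
proof -
  show "x = x'" "d = d'" using assms by (auto simp: trees_def)
  have "length w = length w'" using treesD(4)[OF assms(1)] treesD(4)[OF assms(2)] by simp
  then show "w = w'"
    using treesD(7)[OF assms(1)] treesD(7)[OF assms(2)] by (metis nth_equalityI)
qed

lemma Leaf_trees: "Leaf x 0 \<in> trees \<Sigma> [x] x 0"
  by (auto intro!: treesI)

abbreviation pinv :: "(nat \<Rightarrow> nat) \<Rightarrow> nat \<Rightarrow> nat" where
  "pinv \<equiv> inv_into UNIV"

lemma length_permw [simp]: "length (permw \<sigma> w) = length w"
  by (simp add: permw_def)

lemma nth_permw [simp]: "j < length w \<Longrightarrow> permw \<sigma> w ! j = w ! \<sigma> j"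
  by (simp add: permw_def)

lemma permutes_less: "\<sigma> permutes {..<n} \<Longrightarrow> \<sigma> i < n \<longleftrightarrow> i < (n::nat)"
  by (metis lessThan_iff permutes_in_image)

lemma permw_permw:
  assumes "\<tau> permutes {..<length w}"
  shows "permw \<tau> (permw \<sigma> w) = permw (\<sigma> \<circ> \<tau>) w"
  by (rule nth_equalityI) (use permutes_less[OF assms] in auto)

lemma permw_id [simp]: "permw id w = w" "permw (\<lambda>x. x) w = w"
  by (auto intro: nth_equalityI)

text \<open>Leaf \<open>j\<close> has color \<open>w ! \<sigma> j\<close> before and number
  \<open>\<sigma> j\<close> after relabeling. So relabeling by \<open>\<sigma>\<close> undoes the
  right action of \<open>\<sigma>\<close>, and the action itself relabels by the inverse.\<close>

lemma relabel_trees: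
  assumes "T \<in> trees \<Sigma> (permw \<sigma> w) x d" "\<sigma> permutes {..<length w}"
  shows "relabel \<sigma> T \<in> trees \<Sigma> w x d"
proof (rule treesI)
  show "set (leaves (relabel \<sigma> T)) = {(j, w ! j) |j. j < length w}"
  proof (intro equalityI subsetI)
    fix p assume "p \<in> {(j, w ! j) |j. j < length w}"
    then obtain j where j: "p = (j, w ! j)" "j < length w" by auto
    define k where "k = pinv \<sigma> j"
    have k: "\<sigma> k = j" "k < length w"
      using assms(2) j permutes_less[OF permutes_inv[OF assms(2)]] by (auto simp: k_def permutes_inverses)
    then have "(k, w ! j) \<in> set (leaves T)"
      using treesD(7)[OF assms(1)] by auto
    then show "p \<in> set (leaves (relabel \<sigma> T))"
      using j k by (force simp: leaves_relabel)
  qed (use treesD(7)[OF assms(1)] permutes_less[OF assms(2)] in \<open>auto simp: leaves_relabel\<close>)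
qed (use treesD[OF assms(1)] in auto)

lemma relabel_trees':
  assumes "T \<in> trees \<Sigma> w x d" "\<sigma> permutes {..<length w}"
  shows "relabel (pinv \<sigma>) T \<in> trees \<Sigma> (permw \<sigma> w) x d"
proof (rule relabel_trees)
  have i: "pinv \<sigma> permutes {..<length w}" by (rule permutes_inv[OF assms(2)])
  then show "pinv \<sigma> permutes {..<length (permw \<sigma> w)}" by simp
  have "permw (pinv \<sigma>) (permw \<sigma> w) = w"
    by (subst permw_permw[OF i]) (simp add: permutes_inv_o[OF assms(2)])
  then show "T \<in> trees \<Sigma> (permw (pinv \<sigma>) (permw \<sigma> w)) x d" using assms by simp
qed

lemma leaves_graft_split:
  assumes "leaves T = l1 @ (i, c) # l2" "i \<notin> fst ` set l1" "i \<notin> fst ` set l2"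
  shows "leaves (graft i T S) = map (\<lambda>(j, c). (shift i (length (leaves S)) j, c)) l1
           @ map (\<lambda>(j, c). (i + j, c)) (leaves S)
           @ map (\<lambda>(j, c). (shift i (length (leaves S)) j, c)) l2"
  unfolding graft_def by (simp add: leaves_plug_split[OF assms] leaves_relabel)

lemma length_leaves_graft:
  assumes "distinct (labels T)" "i \<in> set (labels T)"
  shows "length (leaves (graft i T S)) = length (leaves T) + length (leaves S) - 1"
proof -
  obtain c where "(i, c) \<in> set (leaves T)" using assms(2) by (auto simp: labels_def)
  from leaves_split[OF assms(1) this] obtain l1 l2
    where l: "leaves T = l1 @ (i, c) # l2" "i \<notin> fst ` set l1" "i \<notin> fst ` set l2" .
  show ?thesis unfolding leaves_graft_split[OF l] unfolding l(1) by simp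
qed

lemma graft_trees:
  assumes T: "T \<in> trees \<Sigma> w x d" and i: "i < length w" and S: "S \<in> trees \<Sigma> u (w ! i) e"
  shows "graft i T S \<in> trees \<Sigma> (ins w i u) x (d + e)"
proof (rule treesI)
  note T' = treesD[OF T] and S' = treesD[OF S]
  have c: "c = root_col \<Sigma> (relabel (\<lambda>j. i + j) S)" if "(i, c) \<in> set (leaves T)" for c
    using that T'(7) S'(2) by auto
  show "wf_tree \<Sigma> (graft i T S)" "root_col \<Sigma> (graft i T S) = x"
    unfolding graft_def using T' S'
    by (auto intro!: wf_tree_plug[OF c]) (subst root_col_plug[OF c]; simp)+
  have iT: "i \<in> set (labels T)" using T'(6) i by auto
  show "tdeg \<Sigma> (graft i T S) = d + e"
    unfolding graft_def using tdeg_plug[OF T'(5) iT] T' S' by simp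
  show len: "length (leaves (graft i T S)) = length (ins w i u)"
    using length_leaves_graft[OF T'(5) iT] T' S' i by (simp add: length_ins)
  obtain l1 l2 where l: "leaves T = l1 @ (i, w ! i) # l2" "i \<notin> fst ` set l1" "i \<notin> fst ` set l2"
    using leaves_split[OF T'(5)] T'(7) i by metis
  \<comment> \<open>Without the unique leaf \<open>i\<close>, exactly the other inputs of
    \<open>T\<close> remain; \<open>shift\<close> renumbers them around the block of inputs of
    \<open>S\<close>.\<close>
  have l12: "(j, c) \<in> set l1 \<union> set l2 \<longleftrightarrow> j < length w \<and> c = w ! j \<and> j \<noteq> i" for j c
  proof -
    have "(j, c) \<in> set (leaves T) \<longleftrightarrow> (j, c) = (i, w ! i) \<or> (j, c) \<in> set l1 \<union> set l2"
      unfolding l(1) by auto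
    then show ?thesis using T'(7)[of j c] l(2,3) by force
  qed
  have *: "set (leaves (graft i T S)) = (\<lambda>(j, c). (shift i (length u) j, c)) ` (set l1 \<union> set l2)
      \<union> (\<lambda>(j, c). (i + j, c)) ` set (leaves S)"
    unfolding leaves_graft_split[OF l] using S' by auto
  show "set (leaves (graft i T S)) = {(j, ins w i u ! j) |j. j < length (ins w i u)}"
  proof (intro equalityI subsetI)
    fix p assume "p \<in> set (leaves (graft i T S))"
    then consider j c where "(j, c) \<in> set l1 \<union> set l2" "p = (shift i (length u) j, c)"
      | j c where "(j, c) \<in> set (leaves S)" "p = (i + j, c)"
      unfolding * by auto
    then show "p \<in> {(j, ins w i u ! j) |j. j < length (ins w i u)}"
    proof cases
      case 1
      then show ?thesis using l12 i by (auto simp: shift_def length_ins nth_ins)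
    next
      case 2
      then show ?thesis using S'(7) i by (auto simp: length_ins nth_ins)
    qed
  next
    fix p assume "p \<in> {(j, ins w i u ! j) |j. j < length (ins w i u)}"
    then obtain j where j: "p = (j, ins w i u ! j)" "j < length w + length u - 1"
      using i by (auto simp: length_ins)
    consider "j < i" | "i \<le> j" "j < i + length u" | "i + length u \<le> j" by linarith
    then show "p \<in> set (leaves (graft i T S))"
    proof cases
      case 1
      then have "(j, w ! j) \<in> set l1 \<union> set l2" using l12 i by auto
      then show ?thesis unfolding * using 1 j i by (force simp: shift_def nth_ins)
    next
      case 2
      then have "(j - i, u ! (j - i)) \<in> set (leaves S)" using S'(7) by auto
      then show ?thesis unfolding * using 2 j i by (force simp: nth_ins)
    next
      case 3
      \<comment> \<open>The input of \<open>T\<close> that \<open>shift\<close> sends to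
        \<open>j\<close>, for \<open>j\<close> beyond the block of inputs of
        \<open>S\<close>.\<close>
      define k where "k = j + 1 - length u"
      have k: "k > i" "k < length w" "j = k + length u - 1" using 3 j by (auto simp: k_def)
      then have "(k, w ! k) \<in> set l1 \<union> set l2" using l12 by auto
      moreover have "p = (shift i (length u) k, w ! k)"
        using j(1) 3 k i by (auto simp: shift_def nth_ins)
      ultimately show ?thesis unfolding * by force
    qed
  qed
qed

section \<open>Grafting\<close>

lemma graft_Leaf_left [simp]: "graft 0 (Leaf x 0) S = S"
  by (simp add: graft_def)

lemma plug_Leaf_self:
  "(\<And>c'. (i, c') \<in> set (leaves T) \<Longrightarrow> c' = c) \<Longrightarrow> plug i (Leaf c i) 1 T = T"
  by (induction T) (auto intro!: map_idI)

lemma graft_Leaf_right: "T \<in> trees \<Sigma> w x d \<Longrightarrow> graft i T (Leaf (w ! i) 0) = T"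
  unfolding graft_def using plug_Leaf_self[of i T "w ! i"] by (simp add: treesD(7))

text \<open>Renumbering commutes with plugging as soon as \<open>f\<close> (before) and
  \<open>h\<close> (after) are intertwined by the two shifts. The sequential law and the
  equivariance of grafting are both instances.\<close>

lemma plug_relabel:
  assumes "\<And>l. l \<in> set (labels S) \<Longrightarrow> (f l = j' \<longleftrightarrow> l = j) \<and> (l \<noteq> j \<longrightarrow> shift j' m (f l) = h (shift j m l))"
  shows "plug j' (relabel h U) m (relabel f S) = relabel h (plug j U m S)"
  using assms by (induction S) (auto simp flip: shift_def)

text \<open>By induction on \<open>T\<close> everything happens at the leaf \<open>i\<close>, where
  the claim is that plugging into \<open>S\<close> commutes with translating all labels by
  \<open>i\<close>.\<close>

lemma graft_sequential:
  assumes "distinct (labels S)" "set (labels S) = {..<length (leaves S)}" "j < length (leaves S)"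
  shows "graft (i + j) (graft i T S) U = graft i T (graft j S U)"
proof -
  let ?m = "length (leaves S)" and ?k = "length (leaves U)"
  have len: "length (leaves (graft j S U)) = ?m + ?k - 1"
    by (rule length_leaves_graft) (use assms in auto)
  have U: "relabel ((+) (i + j)) U = relabel ((+) i) (relabel ((+) j) U)"
    unfolding relabel_relabel by (rule relabel_cong) simp
  show ?thesis
    unfolding graft_def[of i T "graft j S U"] len
    unfolding graft_def
  proof (induction T)
    case (Leaf c l)
    have "plug (i + j) (relabel ((+) (i + j)) U) ?k (relabel ((+) i) S)
        = relabel ((+) i) (plug j (relabel ((+) j) U) ?k S)"
      unfolding U
    proof (rule plug_relabel)
      fix l assume "l \<in> set (labels S)"
      then have "l < ?m" using assms(2) by simp
      then show "(i + l = i + j \<longleftrightarrow> l = j) \<and> (l \<noteq> j \<longrightarrow> shift (i + j) ?k (i + l) = i + shift j ?k l)"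
        by (auto simp: shift_def)
    qed
    then show ?case using assms(3) by (auto simp: shift_def)
  qed auto
qed

lemma graft_parallel:
  assumes "i < k" "set (labels S) = {..<length (leaves S)}"
  shows "graft (k + length (leaves S) - 1) (graft i T S) U = graft i (graft k T U) S"
  unfolding graft_def
proof (induction T)
  case (Leaf c l)
  let ?m = "length (leaves S)" and ?n = "length (leaves U)"
  have lt: "l < ?m" if "l \<in> set (labels S)" for l
    using that assms(2) by simp
  \<comment> \<open>The inserted leaves of \<open>S\<close> have numbers below
    \<open>i + ?m\<close>, and \<open>i + ?m\<close> is at most \<open>k + ?m - 1\<close>; so
    plugging at the latter number leaves them alone.\<close>
  have "plug (k + ?m - 1) V ?n (relabel ((+) i) S) = relabel ((+) i) S" for V
  proof -
    have "plug (k + ?m - 1) V ?n (relabel ((+) i) S) = relabel (shift (k + ?m - 1) ?n) (relabel ((+) i) S)"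
      by (rule plug_notin) (use lt assms(1) in \<open>fastforce simp: labels_relabel\<close>)
    also have "\<dots> = relabel ((+) i) S"
      unfolding relabel_relabel by (rule relabel_cong) (use lt assms(1) in \<open>fastforce simp: shift_def\<close>)
    finally show ?thesis .
  qed
  \<comment> \<open>The inserted leaves of \<open>U\<close> start at \<open>k\<close>, beyond
    \<open>i\<close>, so plugging at \<open>i\<close> only translates them.\<close>
  moreover have "plug i V ?m (relabel ((+) k) U) = relabel ((+) (k + ?m - 1)) U" for V
  proof -
    have "plug i V ?m (relabel ((+) k) U) = relabel (shift i ?m) (relabel ((+) k) U)"
      by (rule plug_notin) (use assms(1) in \<open>auto simp: labels_relabel\<close>)
    also have "\<dots> = relabel ((+) (k + ?m - 1)) U"
      unfolding relabel_relabel by (rule relabel_cong) (use assms(1) in \<open>simp add: shift_def\<close>)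
    finally show ?thesis .
  qed
  moreover define V where "V = relabel ((+) (k + ?m - 1)) U"
  ultimately have *: "plug (k + ?m - 1) W ?n (relabel ((+) i) S) = relabel ((+) i) S"
    "plug i (relabel ((+) i) S) ?m (relabel ((+) k) U) = V" for W
    by blast+
  show ?case unfolding V_def[symmetric] using assms(1) * by auto
qed auto

section \<open>Block permutations and the equivariance of grafting\<close>

lemma perm_comp_comp:
  assumes "\<sigma> permutes {..<n}" "\<tau> permutes {..<m}"
  shows "perm_comp m \<sigma>' (\<sigma> i) \<tau>' \<circ> perm_comp m \<sigma> i \<tau> = perm_comp m (\<sigma>' \<circ> \<sigma>) i (\<tau>' \<circ> \<tau>)"
proof
  fix p
  have inj: "\<sigma> a = \<sigma> b \<longleftrightarrow> a = b" for a b using permutes_inj[OF assms(1)] by (auto simp: inj_def)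
  have t: "\<tau> a < m" if "a < m" for a using that permutes_less[OF assms(2)] by auto
  consider "p < i" | "i \<le> p" "p < i + m" | "i + m \<le> p" by linarith
  then show "(perm_comp m \<sigma>' (\<sigma> i) \<tau>' \<circ> perm_comp m \<sigma> i \<tau>) p = perm_comp m (\<sigma>' \<circ> \<sigma>) i (\<tau>' \<circ> \<tau>) p"
  proof cases
    case 1
    then have "\<sigma> p \<noteq> \<sigma> i" using inj by auto
    with 1 show ?thesis by (auto simp: perm_comp_def Let_def)
  next
    case 2
    have "\<tau> (p - i) < m" using 2 by (intro t) auto
    with 2 show ?thesis by (auto simp: perm_comp_def Let_def)
  next
    case 3
    then have "\<sigma> (Suc p - m) \<noteq> \<sigma> i" using inj by auto
    with 3 show ?thesis by (auto simp: perm_comp_def Let_def)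
  qed
qed

lemma perm_comp_id [simp]: "perm_comp m id i id = id"
  by (auto simp: perm_comp_def Let_def fun_eq_iff)

text \<open>The block sits at \<open>i\<close> before and at \<open>\<sigma> i\<close> after the
  permutation, so the inverse is expanded at \<open>\<sigma> i\<close>. Both equations are instances
  of \<open>perm_comp_comp\<close>.\<close>

lemma perm_comp_inverse:
  assumes "\<sigma> permutes {..<n}" "\<tau> permutes {..<m}"
  shows "perm_comp m (pinv \<sigma>) (\<sigma> i) (pinv \<tau>) \<circ> perm_comp m \<sigma> i \<tau> = id"
    "perm_comp m \<sigma> i \<tau> \<circ> perm_comp m (pinv \<sigma>) (\<sigma> i) (pinv \<tau>) = id"
proof -
  show "perm_comp m (pinv \<sigma>) (\<sigma> i) (pinv \<tau>) \<circ> perm_comp m \<sigma> i \<tau> = id"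
    using assms by (simp add: perm_comp_comp permutes_inv_o)
  have "pinv \<sigma> (\<sigma> i) = i" using assms by (simp add: permutes_inverses)
  with perm_comp_comp[OF permutes_inv[OF assms(1)] permutes_inv[OF assms(2)], of \<sigma> "\<sigma> i" \<tau>]
  show "perm_comp m \<sigma> i \<tau> \<circ> perm_comp m (pinv \<sigma>) (\<sigma> i) (pinv \<tau>) = id"
    using assms by (simp add: permutes_inv_o)
qed

lemma pinv_perm_comp:
  assumes "\<sigma> permutes {..<n}" "\<tau> permutes {..<m}"
  shows "pinv (perm_comp m \<sigma> i \<tau>) = perm_comp m (pinv \<sigma>) (\<sigma> i) (pinv \<tau>)"
  by (rule inv_unique_comp[OF perm_comp_inverse(2)[OF assms] perm_comp_inverse(1)[OF assms]])

lemma perm_comp_permutes: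
  assumes "\<sigma> permutes {..<n}" "\<tau> permutes {..<m}" "i < n"
  shows "perm_comp m \<sigma> i \<tau> permutes {..<n + m - 1}"
proof -
  have "bij (perm_comp m \<sigma> i \<tau>)"
    using perm_comp_inverse[OF assms(1,2)] by (intro o_bij)
  moreover have "perm_comp m \<sigma> i \<tau> p = p" if "p \<notin> {..<n + m - 1}" for p
  proof -
    have p: "n + m - 1 \<le> p" "i + m \<le> p" using assms that by auto
    then have "\<sigma> (Suc p - m) = Suc p - m" "\<sigma> i < n"
      using assms permutes_not_in[OF assms(1)] permutes_less[OF assms(1)] by auto
    then show ?thesis
      using p by (auto simp: perm_comp_def Let_def)
  qed
  ultimately show ?thesis
    by (auto simp: permutes_def bij_iff)
qed

lemma permw_perm_comp:
  assumes "\<sigma> permutes {..<length w}" "\<tau> permutes {..<length u}" "i < length w"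
  shows "permw (perm_comp (length u) \<sigma> i \<tau>) (ins w (\<sigma> i) u) = ins (permw \<sigma> w) i (permw \<tau> u)"
proof (rule nth_equalityI)
  have si: "\<sigma> i < length w" using assms permutes_less by blast
  have inj: "\<sigma> a = \<sigma> b \<longleftrightarrow> a = b" for a b using permutes_inj[OF assms(1)] by (auto simp: inj_def)
  let ?m = "length u"
  show "length (permw (perm_comp ?m \<sigma> i \<tau>) (ins w (\<sigma> i) u)) = length (ins (permw \<sigma> w) i (permw \<tau> u))"
    using si assms by (simp add: length_ins)
  fix p assume "p < length (permw (perm_comp ?m \<sigma> i \<tau>) (ins w (\<sigma> i) u))"
  then have p: "p < length w + ?m - 1" using si by (simp add: length_ins)
  have q: "perm_comp ?m \<sigma> i \<tau> p < length w + ?m - 1"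
    using p permutes_less[OF perm_comp_permutes[OF assms]] by simp
  consider "p < i" | "i \<le> p" "p < i + ?m" | "i + ?m \<le> p" by linarith
  then have "ins w (\<sigma> i) u ! perm_comp ?m \<sigma> i \<tau> p = ins (permw \<sigma> w) i (permw \<tau> u) ! p"
  proof cases
    case 1
    then have "\<sigma> p \<noteq> \<sigma> i" using inj by auto
    with 1 show ?thesis using p q si assms by (simp add: nth_ins) (auto simp: perm_comp_def Let_def)
  next
    case 2
    then have "\<tau> (p - i) < ?m" using permutes_less[OF assms(2)] by auto
    with 2 show ?thesis using p q si assms by (simp add: nth_ins) (auto simp: perm_comp_def Let_def)
  next
    case 3
    then have "\<sigma> (Suc p - ?m) \<noteq> \<sigma> i" using inj by auto
    with 3 show ?thesis using p q si assms by (simp add: nth_ins) (auto simp: perm_comp_def Let_def)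
  qed
  then show "permw (perm_comp ?m \<sigma> i \<tau>) (ins w (\<sigma> i) u) ! p = ins (permw \<sigma> w) i (permw \<tau> u) ! p"
    using p si by (simp add: length_ins)
qed

text \<open>Relabeling is inverse to the right action. Therefore the slot \<open>i\<close> moves to
  \<open>\<sigma> i\<close> here, in contrast to the equivariance axiom of operads.\<close>

lemma graft_relabel:
  assumes "\<sigma> permutes {..<n}" "\<tau> permutes {..<length (leaves S)}" "set (labels S) = {..<length (leaves S)}"
  shows "graft (\<sigma> i) (relabel \<sigma> T) (relabel \<tau> S) = relabel (perm_comp (length (leaves S)) \<sigma> i \<tau>) (graft i T S)"
proof -
  let ?m = "length (leaves S)" and ?h = "perm_comp (length (leaves S)) \<sigma> i \<tau>"
  have inj: "\<sigma> a = \<sigma> b \<longleftrightarrow> a = b" for a b using permutes_inj[OF assms(1)] by (auto simp: inj_def)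
  have "relabel ((+) (\<sigma> i)) (relabel \<tau> S) = relabel ?h (relabel ((+) i) S)"
    unfolding relabel_relabel by (rule relabel_cong) (use assms in \<open>auto simp: perm_comp_def Let_def\<close>)
  moreover have "plug (\<sigma> i) (relabel ?h (relabel ((+) i) S)) ?m (relabel \<sigma> T)
      = relabel ?h (plug i (relabel ((+) i) S) ?m T)"
  proof (rule plug_relabel)
    fix l
    show "(\<sigma> l = \<sigma> i \<longleftrightarrow> l = i) \<and> (l \<noteq> i \<longrightarrow> shift (\<sigma> i) ?m (\<sigma> l) = ?h (shift i ?m l))"
      using inj by (cases "l < i") (auto simp: shift_def perm_comp_def Let_def)
  qed
  ultimately show ?thesis by (simp add: graft_def)
qed

section \<open>Koszul signs of iterated grafting\<close>

lemma shift_inj: "j \<noteq> i \<Longrightarrow> k \<noteq> i \<Longrightarrow> shift i m j = shift i m k \<longleftrightarrow> j = k"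
  by (auto simp: shift_def)

lemma Inr_map_sum_image: "Inr x \<in> map_sum g f ` A \<longleftrightarrow> (\<exists>y. Inr y \<in> A \<and> x = f y)"
proof -
  have "Inr x = map_sum g f s \<longleftrightarrow> (\<exists>y. s = Inr y \<and> x = f y)" for s by (cases s) auto
  then show ?thesis by (auto simp: image_iff)
qed

text \<open>The leaf \<open>i\<close> is excluded because its shift collides with that of
  \<open>i - 1\<close> if the inserted tree has no leaves.\<close>

lemma Inr_shiftp:
  assumes "Inr k \<notin> set l" "Inr i \<notin> set l" "k \<noteq> i"
  shows "Inr (shift i m k) \<notin> shiftp i m ` set l"
proof
  assume "Inr (shift i m k) \<in> shiftp i m ` set l"
  then obtain j where "Inr j \<in> set l" "shift i m k = shift i m j" by (auto simp: Inr_map_sum_image)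
  then show False using assms shift_inj[of k i j m] by metis
qed

text \<open>In the preorder word of the graft, the rest of \<open>S\<close> is followed by the rest
  of \<open>T\<close>. This additivity is what makes the signs of the sequential law agree.\<close>

lemma deg_after_graft_inside:
  assumes T: "distinct (labels T)" "i \<in> set (labels T)"
    and S: "distinct (labels S)" "set (labels S) = {..<length (leaves S)}" "j < length (leaves S)"
  shows "deg_after \<Sigma> (i + j) (graft i T S) = deg_after \<Sigma> j S + deg_after \<Sigma> i T"
proof -
  let ?m = "length (leaves S)"
  obtain l1 l2 where l: "preorder T = l1 @ Inr i # l2" "Inr i \<notin> set l1" "Inr i \<notin> set l2"
    using preorder_split[OF T] .
  obtain k1 k2 where k: "preorder S = k1 @ Inr j # k2" "Inr j \<notin> set k1" "Inr j \<notin> set k2"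
    using preorder_split[OF S(1), of j] S by auto
  have "preorder (graft i T S) = (map (shiftp i ?m) l1 @ map (map_sum id ((+) i)) k1) @ Inr (i + j)
     # (map (map_sum id ((+) i)) k2 @ map (shiftp i ?m) l2)"
    unfolding graft_def preorder_plug_split[OF l] preorder_relabel k(1) by simp
  moreover have "Inr (i + j) \<notin> shiftp i ?m ` set l1"
  proof
    assume "Inr (i + j) \<in> shiftp i ?m ` set l1"
    then obtain k where "Inr k \<in> set l1" "i + j = shift i ?m k" by (auto simp: Inr_map_sum_image)
    then show False using l(2) S(3) by (cases "k = i") (auto simp: shift_def split: if_splits)
  qed
  moreover have "Inr (i + j) \<notin> map_sum id ((+) i) ` set k1"
  proof
    assume "Inr (i + j) \<in> map_sum id ((+) i) ` set k1"
    then show False using k(2) by (auto simp: Inr_map_sum_image)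
  qed
  ultimately have "deg_after \<Sigma> (i + j) (graft i T S)
      = pdeg \<Sigma> (map (map_sum id ((+) i)) k2 @ map (shiftp i ?m) l2)"
    by (intro deg_after_split) auto
  then show ?thesis
    using deg_after_split[OF l(1,2)] deg_after_split[OF k(1,2)] by simp
qed

text \<open>The vertices of \<open>S\<close> come after the leaf \<open>k\<close> exactly if
  \<open>k\<close> precedes \<open>i\<close> in planar order. Planar order is unrelated to the
  numbering of the leaves, so both cases occur.\<close>

lemma deg_after_graft_outside:
  assumes T: "distinct (labels T)" "i \<in> set (labels T)" "k \<in> set (labels T)" "i \<noteq> k"
    and l: "preorder T = l1 @ Inr i # l2" and S: "set (labels S) = {..<length (leaves S)}"
  shows "deg_after \<Sigma> (shift i (length (leaves S)) k) (graft i T S)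
    = deg_after \<Sigma> k T + (if Inr k \<in> set l1 then tdeg \<Sigma> S else 0)"
    and "Inr k \<in> set l1 \<longleftrightarrow> Inr k \<notin> set l2" and "Inr i \<notin> set l1" "Inr i \<notin> set l2"
proof -
  let ?m = "length (leaves S)"
  have d: "distinct (concat (map (case_sum (\<lambda>_. []) (\<lambda>j. [j])) (preorder T)))"
    using T(1) by (simp add: labels_preorder)
  have in_iff: "Inr j \<in> set l \<longleftrightarrow> j \<in> set (concat (map (case_sum (\<lambda>_. []) (\<lambda>j. [j])) l))" for j l
    by (auto split: sum.splits) 
  show l': "Inr i \<notin> set l1" "Inr i \<notin> set l2"
    using d unfolding in_iff l by auto
  show kk: "Inr k \<in> set l1 \<longleftrightarrow> Inr k \<notin> set l2"
    using d T(3,4) unfolding set_labels_preorder in_iff l by auto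
  have p: "preorder (graft i T S) = map (shiftp i ?m) l1 @ map (map_sum id ((+) i)) (preorder S)
      @ map (shiftp i ?m) l2"
    unfolding graft_def preorder_plug_split[OF l l'] preorder_relabel ..
  show "deg_after \<Sigma> (shift i ?m k) (graft i T S)
    = deg_after \<Sigma> k T + (if Inr k \<in> set l1 then tdeg \<Sigma> S else 0)"
  proof (cases "Inr k \<in> set l1")
    case True
    then obtain a b where a: "l1 = a @ Inr k # b" "Inr k \<notin> set a"
      by (auto dest: split_list_first)
    have "deg_after \<Sigma> (shift i ?m k) (graft i T S)
       = pdeg \<Sigma> (map (shiftp i ?m) b @ map (map_sum id ((+) i)) (preorder S) @ map (shiftp i ?m) l2)"
      by (rule deg_after_split[where ?l1.0 = "map (shiftp i ?m) a"])
         (use a l' T(4) Inr_shiftp[of k a i ?m] in \<open>auto simp: p\<close>)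
    moreover have "deg_after \<Sigma> k T = pdeg \<Sigma> (b @ Inr i # l2)"
      by (rule deg_after_split[where ?l1.0 = a]) (use a l in auto)
    ultimately show ?thesis using True by simp
  next
    case False
    then obtain a b where a: "l2 = a @ Inr k # b" "Inr k \<notin> set a"
      using kk by (auto dest: split_list_first)
    have S: "Inr (shift i ?m k) \<notin> map_sum id ((+) i) ` set (preorder S)"
    proof
      assume "Inr (shift i ?m k) \<in> map_sum id ((+) i) ` set (preorder S)"
      then obtain j where j: "Inr j \<in> set (preorder S)" "shift i ?m k = i + j"
        by (auto simp: Inr_map_sum_image)
      then have "j < ?m" using S unfolding set_labels_preorder[symmetric] by blast
      then show False using j T(4) by (auto simp: shift_def split: if_splits)
    qed
    have "deg_after \<Sigma> (shift i ?m k) (graft i T S) = pdeg \<Sigma> (map (shiftp i ?m) b)"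
      by (rule deg_after_split[where ?l1.0 = "map (shiftp i ?m) l1 @ map (map_sum id ((+) i)) (preorder S)
              @ map (shiftp i ?m) a"])
         (use a l' S T(4) Inr_shiftp[of k a i ?m] Inr_shiftp[of k l1 i ?m] False in \<open>auto simp: p\<close>)
    moreover have "deg_after \<Sigma> k T = pdeg \<Sigma> b"
      by (rule deg_after_split[where ?l1.0 = "l1 @ Inr i # a"]) (use a l T(4) False in auto)
    ultimately show ?thesis using False by simp
  qed
qed

text \<open>Exactly one of the leaves \<open>i\<close> and \<open>k\<close> precedes the other in
  planar order. By \<open>deg_after_graft_outside\<close> the extra factor
  \<open>ksign (e * l)\<close> therefore arises on exactly one of the two sides, and the Koszul sign
  on the right compensates for it.\<close>

lemma parallel_sign:
  assumes T: "distinct (labels T)" "i \<in> set (labels T)" "k \<in> set (labels T)" "i \<noteq> k"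
    and S: "set (labels S) = {..<length (leaves S)}" and U: "set (labels U) = {..<length (leaves U)}"
    and "tdeg \<Sigma> S = e" "tdeg \<Sigma> U = l"
  shows "ksign (e * deg_after \<Sigma> i T) * ksign (l * deg_after \<Sigma> (shift i (length (leaves S)) k) (graft i T S))
    = ksign (e * l) * (ksign (l * deg_after \<Sigma> k T)
        * ksign (e * deg_after \<Sigma> (shift k (length (leaves U)) i) (graft k T U)) :: 'k::field)"
proof -
  obtain l1 l2 where l: "preorder T = l1 @ Inr i # l2"
    using preorder_split[OF T(1,2)] by metis
  obtain k1 k2 where k: "preorder T = k1 @ Inr k # k2"
    using preorder_split[OF T(1,3)] by metis
  note A = deg_after_graft_outside[OF T l S] and B = deg_after_graft_outside[OF T(1,3,2) T(4)[symmetric] k U]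
  have "Inr k \<in> set l1 \<longleftrightarrow> Inr i \<notin> set k1"
  proof
    assume "Inr k \<in> set l1"
    then obtain a b where "l1 = a @ Inr k # b" by (auto dest: split_list)
    with l have "preorder T = a @ Inr k # (b @ Inr i # l2)" by simp
    with k B(3,4) have "k2 = b @ Inr i # l2"
      by (metis append_Cons_eq_iff)
    then have "Inr i \<in> set k2" by simp
    with B(2) show "Inr i \<notin> set k1" by simp
  next
    assume "Inr i \<notin> set k1"
    with B(2) have "Inr i \<in> set k2" by simp
    then obtain a b where "k2 = a @ Inr i # b" by (auto dest: split_list)
    with k have "preorder T = (k1 @ Inr k # a) @ Inr i # b" by simp
    with l A(3,4) have "l1 = k1 @ Inr k # a"
      by (metis append_Cons_eq_iff)
    then show "Inr k \<in> set l1" by simp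
  qed
  then show ?thesis
    unfolding A(1) B(1) assms(7,8)
    by (auto simp: ksign_def)
qed

section \<open>The free operad\<close>

definition homog :: "'g signature \<Rightarrow> color list \<Rightarrow> color \<Rightarrow> int \<Rightarrow> ('g tree \<Rightarrow>\<^sub>0 'k::field) set" where
  "homog \<Sigma> w x d = {a. Poly_Mapping.keys a \<subseteq> trees \<Sigma> w x d}"

lemma homog_mon [simp]: "T \<in> trees \<Sigma> w x d \<Longrightarrow> Poly_Mapping.single T c \<in> homog \<Sigma> w x d"
  by (auto simp: homog_def)

lemma homog_zero [simp]: "0 \<in> homog \<Sigma> w x d"
  by (auto simp: homog_def)

lemma homog_add [intro]: "a \<in> homog \<Sigma> w x d \<Longrightarrow> b \<in> homog \<Sigma> w x d \<Longrightarrow> a + b \<in> homog \<Sigma> w x d"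
  using keys_add[of a b] by (auto simp: homog_def)

lemma homog_scale [intro]: "a \<in> homog \<Sigma> w x d \<Longrightarrow> scale c a \<in> homog \<Sigma> w x d"
  using keys_scale[of c a] by (auto simp: homog_def)

lemma homog_uminus [intro]: "a \<in> homog \<Sigma> w x d \<Longrightarrow> - a \<in> homog \<Sigma> w x d"
  by (simp add: homog_def keys_uminus)

lemma homog_diff [intro]: "a \<in> homog \<Sigma> w x d \<Longrightarrow> b \<in> homog \<Sigma> w x d \<Longrightarrow> a - b \<in> homog \<Sigma> w x d"
  using keys_diff_subset[of a b] by (auto simp: homog_def)

lemma homog_sum: "(\<And>x. x \<in> A \<Longrightarrow> f x \<in> homog \<Sigma> w y d) \<Longrightarrow> sum f A \<in> homog \<Sigma> w y d"
  by (induction A rule: infinite_finite_induct) auto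

lemma homog_sum_list: "(\<And>x. x \<in> set xs \<Longrightarrow> f x \<in> homog \<Sigma> w y d) \<Longrightarrow> (\<Sum>x\<leftarrow>xs. f x) \<in> homog \<Sigma> w y d"
  by (induction xs) auto

lemma homog_lin_ext: "(\<And>T. T \<in> Poly_Mapping.keys a \<Longrightarrow> f T \<in> homog \<Sigma> w x d) \<Longrightarrow> lin_ext f a \<in> homog \<Sigma> w x d"
  unfolding lin_ext_def by (auto intro: homog_sum)

lemma span_induct_mon [consumes 1, case_names mon zero add scale]:
  assumes "Poly_Mapping.keys a \<subseteq> X"
    and mon: "\<And>T. T \<in> X \<Longrightarrow> P (mon T)" and zero: "P 0"
    and add: "\<And>a b. Poly_Mapping.keys a \<subseteq> X \<Longrightarrow> Poly_Mapping.keys b \<subseteq> X \<Longrightarrow> P a \<Longrightarrow> P b \<Longrightarrow> P (a + b)"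
    and scale: "\<And>c a. Poly_Mapping.keys a \<subseteq> X \<Longrightarrow> P a \<Longrightarrow> P (scale c a)"
  shows "P a"
proof -
  have "P (\<Sum>T\<in>F. scale (Poly_Mapping.lookup a T) (mon T)) \<and>
      Poly_Mapping.keys (\<Sum>T\<in>F. scale (Poly_Mapping.lookup a T) (mon T)) \<subseteq> X" if "finite F" "F \<subseteq> X" for F
    using that
  proof (induction F)
    case (insert T F)
    have k: "Poly_Mapping.keys (Poly_Mapping.single T c) \<subseteq> X" for c using insert.prems by auto
    have "P (scale (Poly_Mapping.lookup a T) (mon T))"
      using insert.prems by (intro scale mon k) auto
    moreover have "Poly_Mapping.keys (Poly_Mapping.single T c + b) \<subseteq> X" if "Poly_Mapping.keys b \<subseteq> X" for b c
      using keys_add[of "Poly_Mapping.single T c" b] k[of c] that by blast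
    ultimately show ?case
      using insert k[of "Poly_Mapping.lookup a T"]
      by (simp del: keys_single) (blast intro: add)
  qed (auto intro: zero)
  from this[OF finite_keys assms(1)] show ?thesis
    using sum_mon_expand[of a] by simp
qed

lemma homog_induct [consumes 1, case_names mon zero add scale]:
  assumes "a \<in> homog \<Sigma> w x d"
    and "\<And>T. T \<in> trees \<Sigma> w x d \<Longrightarrow> P (mon T)" and "P 0"
    and "\<And>a b. a \<in> homog \<Sigma> w x d \<Longrightarrow> b \<in> homog \<Sigma> w x d \<Longrightarrow> P a \<Longrightarrow> P b \<Longrightarrow> P (a + b)"
    and "\<And>c a. a \<in> homog \<Sigma> w x d \<Longrightarrow> P a \<Longrightarrow> P (scale c a)"
  shows "P a"
  using assms unfolding homog_def by (intro span_induct_mon[of a "trees \<Sigma> w x d" P]) auto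

lemma free_comp_add_left: "free_comp \<Sigma> i (a + a') b = free_comp \<Sigma> i a b + free_comp \<Sigma> i a' b"
  and free_comp_scale_left: "free_comp \<Sigma> i (scale c a) b = scale c (free_comp \<Sigma> i a b)"
  and free_comp_add_right: "free_comp \<Sigma> i a (b + b') = free_comp \<Sigma> i a b + free_comp \<Sigma> i a b'"
  and free_comp_scale_right: "free_comp \<Sigma> i a (scale c b) = scale c (free_comp \<Sigma> i a b)"
  by (simp_all add: free_comp_def lin_ext_add lin_ext_scale lin_ext_fun_add lin_ext_fun_scale)

lemma linear_free_comp_left: "module_hom scale scale (\<lambda>a. free_comp \<Sigma> i a b)"
  and linear_free_comp_right: "module_hom scale scale (\<lambda>b. free_comp \<Sigma> i a b)"
  by (unfold_locales; auto simp: free_comp_add_left free_comp_scale_left free_comp_add_right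
      free_comp_scale_right pm.scale_right_distrib pm.scale_left_distrib)+

lemmas free_comp_zero_left [simp] = module_hom.zero[OF linear_free_comp_left]
lemmas free_comp_zero_right [simp] = module_hom.zero[OF linear_free_comp_right]
lemmas free_comp_bilinear = free_comp_add_left free_comp_scale_left free_comp_add_right free_comp_scale_right
  module_hom.neg[OF linear_free_comp_left] module_hom.neg[OF linear_free_comp_right]
  module_hom.diff[OF linear_free_comp_left] module_hom.diff[OF linear_free_comp_right]
  module_hom.sum[OF linear_free_comp_left] module_hom.sum[OF linear_free_comp_right]

lemma free_comp_mon:
  assumes "T \<in> trees \<Sigma> w x d" "i < length w" "S \<in> trees \<Sigma> u (w ! i) e"
  shows "free_comp \<Sigma> i (mon T) (mon S) = Poly_Mapping.single (graft i T S) (graft_sign \<Sigma> i T S)"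
  using assms treesD(7)[OF assms(1)] treesD(2)[OF assms(3)] by (simp add: free_comp_def)

lemma free_comp_mon_scale:
  assumes "T \<in> trees \<Sigma> w x d" "i < length w" "S \<in> trees \<Sigma> u (w ! i) e"
  shows "free_comp \<Sigma> i (mon T) (mon S) = scale (graft_sign \<Sigma> i T S) (mon (graft i T S))"
  using free_comp_mon[OF assms] by simp

lemma free_comp_mon_zero:
  assumes "T \<in> trees \<Sigma> w x d" "S \<in> trees \<Sigma> u y e" "\<not> (i < length w \<and> y = w ! i)"
  shows "free_comp \<Sigma> i (mon T) (mon S) = 0"
  using assms treesD(7)[OF assms(1)] treesD(2)[OF assms(2)] by (auto simp add: free_comp_def)

lemma free_comp_homog:
  assumes "a \<in> homog \<Sigma> w x d" "i < length w" "b \<in> homog \<Sigma> u (w ! i) e"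
  shows "free_comp \<Sigma> i a b \<in> homog \<Sigma> (ins w i u) x (d + e)"
  using assms(1)
proof (induction a rule: homog_induct)
  case (mon T)
  from assms(3) show ?case
    by (induction b rule: homog_induct)
       (auto simp: free_comp_bilinear free_comp_mon[OF mon assms(2)] graft_trees[OF mon assms(2)])
qed (auto simp: free_comp_bilinear)

text \<open>Makes sense for every renumbering and involves no inverse. On homogeneous elements of
  the right arity, \<open>free_act \<sigma>\<close> is \<open>rel (pinv \<sigma>)\<close>, so
  statements on the action are proved for \<open>rel\<close> and then transferred.\<close>

definition rel :: "(nat \<Rightarrow> nat) \<Rightarrow> ('g tree \<Rightarrow>\<^sub>0 'k::field) \<Rightarrow> 'g tree \<Rightarrow>\<^sub>0 'k" where
  "rel \<pi> = lin_ext (\<lambda>T. mon (relabel \<pi> T))"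

lemma linear_rel: "module_hom scale scale (rel \<pi>)"
  unfolding rel_def by (rule linear_lin_ext)

lemmas rel_linear = module_hom.add[OF linear_rel] module_hom.scale[OF linear_rel]
  module_hom.neg[OF linear_rel] module_hom.diff[OF linear_rel] module_hom.sum[OF linear_rel]
  sum_list_linear[OF linear_rel]

lemma rel_zero [simp]: "rel \<pi> 0 = 0"
  by (rule module_hom.zero[OF linear_rel])

lemma rel_mon [simp]: "rel \<pi> (Poly_Mapping.single T c) = Poly_Mapping.single (relabel \<pi> T) c"
  by (simp add: rel_def)

lemma rel_rel: "rel \<pi> (rel \<rho> a) = rel (\<pi> \<circ> \<rho>) a"
  unfolding rel_def by (simp add: lin_ext_lin_ext relabel_relabel)

lemma rel_id [simp]: "rel id a = a" "rel (\<lambda>j. j) a = a"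
  by (simp_all add: rel_def del: id_apply)

lemma rel_homog:
  assumes "a \<in> homog \<Sigma> (permw \<sigma> w) x d" "\<sigma> permutes {..<length w}"
  shows "rel \<sigma> a \<in> homog \<Sigma> w x d"
  using assms(1) unfolding rel_def homog_def
  by (auto dest!: keys_lin_ext intro!: relabel_trees[OF _ assms(2)])

lemma free_act_rel:
  assumes "a \<in> homog \<Sigma> w x d" "\<sigma> permutes {..<length w}"
  shows "free_act \<sigma> a = rel (pinv \<sigma>) a"
  unfolding free_act_def rel_def
  by (rule lin_ext_cong) (use assms in \<open>auto simp: homog_def treesD(4)\<close>)

lemma free_act_homog:
  assumes "a \<in> homog \<Sigma> w x d" "\<sigma> permutes {..<length w}"
  shows "free_act \<sigma> a \<in> homog \<Sigma> (permw \<sigma> w) x d"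
  using assms(1) unfolding free_act_rel[OF assms] unfolding rel_def homog_def
  by (auto dest!: keys_lin_ext intro!: relabel_trees'[OF _ assms(2)])

lemma linear_free_act: "module_hom scale scale (free_act \<sigma>)"
  unfolding free_act_def by (rule linear_lin_ext)

lemma free_comp_unit_left:
  assumes "b \<in> homog \<Sigma> u x e"
  shows "free_comp \<Sigma> 0 (mon (Leaf x 0)) b = b"
  using assms
proof (induction b rule: homog_induct)
  case (mon S)
  then show ?case
    using free_comp_mon[OF Leaf_trees, where i = 0 and S = S and \<Sigma> = \<Sigma> and u = u and x = x and e = e]
    by (simp add: graft_sign_def deg_after_def)
qed (auto simp: free_comp_bilinear)

lemma free_comp_unit_right:
  assumes "a \<in> homog \<Sigma> w x d" "i < length w"
  shows "free_comp \<Sigma> i a (mon (Leaf (w ! i) 0)) = a"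
  using assms(1)
proof (induction a rule: homog_induct)
  case (mon T)
  then show ?case
    using free_comp_mon[OF mon assms(2) Leaf_trees]
    by (simp add: graft_sign_def graft_Leaf_right[OF mon])
qed (auto simp: free_comp_bilinear)

lemma free_comp_sequential:
  assumes "a \<in> homog \<Sigma> w x d" "i < length w" "b \<in> homog \<Sigma> u (w ! i) e" "j < length u"
    "c \<in> homog \<Sigma> v (u ! j) l"
  shows "free_comp \<Sigma> (i + j) (free_comp \<Sigma> i a b) c = free_comp \<Sigma> i a (free_comp \<Sigma> j b c)"
  using assms(1)
proof (induction a rule: homog_induct)
  case T: (mon T)
  from assms(3) show ?case
  proof (induction b rule: homog_induct)
    case S: (mon S)
    note T' = treesD[OF T] and S' = treesD[OF S]
    from assms(5) show ?case
    proof (induction c rule: homog_induct)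
      case U: (mon U)
      have ij: "i + j < length (ins w i u)" "ins w i u ! (i + j) = u ! j"
        using assms by (auto simp: length_ins nth_ins)
      have 1: "free_comp \<Sigma> (i + j) (mon (graft i T S)) (mon U)
          = scale (graft_sign \<Sigma> (i + j) (graft i T S) U) (mon (graft (i + j) (graft i T S) U))"
        by (rule free_comp_mon_scale[OF graft_trees[OF T assms(2) S]]) (use ij U in auto)
      have 2: "free_comp \<Sigma> i (mon T) (mon (graft j S U))
          = scale (graft_sign \<Sigma> i T (graft j S U)) (mon (graft i T (graft j S U)))"
        by (rule free_comp_mon_scale[OF T assms(2) graft_trees[OF S assms(4) U]])
      have g: "graft (i + j) (graft i T S) U = graft i T (graft j S U)"
        by (rule graft_sequential) (use S' assms in auto)
      have d: "deg_after \<Sigma> (i + j) (graft i T S) = deg_after \<Sigma> j S + deg_after \<Sigma> i T"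
        by (rule deg_after_graft_inside) (use S' T' assms in auto)
      have t: "tdeg \<Sigma> (graft j S U) = e + l"
        by (rule treesD(3)[OF graft_trees[OF S assms(4) U]])
      \<comment> \<open>Both exponents are congruent to \<open>e * a + l * a + l * b\<close> with
        \<open>a = deg_after \<Sigma> i T\<close> and
        \<open>b = deg_after \<Sigma> j S\<close>.\<close>
      have sgn: "graft_sign \<Sigma> i T S * graft_sign \<Sigma> (i + j) (graft i T S) U
          = (graft_sign \<Sigma> j S U * graft_sign \<Sigma> i T (graft j S U) :: 'b)"
        unfolding graft_sign_def d t treesD(3)[OF S] treesD(3)[OF U]
        by (auto simp: ksign_def)
      show ?case
        by (simp only: free_comp_mon_scale[OF T assms(2) S] free_comp_mon_scale[OF S assms(4) U]
            free_comp_scale_left free_comp_scale_right 1 2 g pm.scale_scale sgn)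
    qed (auto simp: free_comp_bilinear)
  qed (auto simp: free_comp_bilinear)
qed (auto simp: free_comp_bilinear)

lemma free_comp_parallel:
  assumes "a \<in> homog \<Sigma> w x d" "i < k" "k < length w" "b \<in> homog \<Sigma> u (w ! i) e" "c \<in> homog \<Sigma> v (w ! k) l"
  shows "free_comp \<Sigma> (k + length u - 1) (free_comp \<Sigma> i a b) c
    = scale (ksign (e * l)) (free_comp \<Sigma> i (free_comp \<Sigma> k a c) b)"
  using assms(1)
proof (induction a rule: homog_induct)
  case T: (mon T)
  from assms(4) show ?case
  proof (induction b rule: homog_induct)
    case S: (mon S)
    note T' = treesD[OF T] and S' = treesD[OF S]
    from assms(5) show ?case
    proof (induction c rule: homog_induct)
      case U: (mon U)
      have i: "i < length w" using assms by simp
      have ki: "k + length u - 1 < length (ins w i u)" "ins w i u ! (k + length u - 1) = w ! k"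
        "i < length (ins w k v)" "ins w k v ! i = w ! i"
        using assms(2,3) by (auto simp: length_ins nth_ins)
      have 1: "free_comp \<Sigma> (k + length u - 1) (mon (graft i T S)) (mon U)
          = scale (graft_sign \<Sigma> (k + length u - 1) (graft i T S) U)
              (mon (graft (k + length u - 1) (graft i T S) U))"
        by (rule free_comp_mon_scale[OF graft_trees[OF T i S]]) (use ki U in auto)
      have 2: "free_comp \<Sigma> i (mon (graft k T U)) (mon S)
          = scale (graft_sign \<Sigma> i (graft k T U) S) (mon (graft i (graft k T U) S))"
        by (rule free_comp_mon_scale[OF graft_trees[OF T assms(3) U]]) (use ki S in auto)
      have g: "graft (k + length u - 1) (graft i T S) U = graft i (graft k T U) S"
        using graft_parallel[OF assms(2), of S T U] S' by simp
      have sh: "k + length u - 1 = shift i (length (leaves S)) k" "i = shift k (length (leaves U)) i"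
        using assms(2) S' by (auto simp: shift_def)
      have ST: "distinct (labels T)" "i \<in> set (labels T)" "k \<in> set (labels T)" "i \<noteq> k"
        "set (labels S) = {..<length (leaves S)}" "set (labels U) = {..<length (leaves U)}"
        "tdeg \<Sigma> S = e" "tdeg \<Sigma> U = l"
        using T' S' treesD[OF U] assms(2,3) i by simp_all
      have sgn: "graft_sign \<Sigma> i T S * graft_sign \<Sigma> (k + length u - 1) (graft i T S) U
          = (ksign (e * l) * (graft_sign \<Sigma> k T U * graft_sign \<Sigma> i (graft k T U) S) :: 'b)"
        unfolding graft_sign_def treesD(3)[OF S] treesD(3)[OF U] sh(1)
        using parallel_sign[where T = T and S = S and U = U and i = i and k = k and \<Sigma> = \<Sigma> and e = e and l = l] ST
        by (metis sh(2))
      show ?case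
        by (simp only: free_comp_mon_scale[OF T i S] free_comp_mon_scale[OF T assms(3) U]
            free_comp_scale_left free_comp_scale_right 1 2 g pm.scale_scale sgn)
    qed (auto simp: free_comp_bilinear pm.scale_right_distrib mult.commute)
  qed (auto simp: free_comp_bilinear pm.scale_right_distrib mult.commute)
qed (auto simp: free_comp_bilinear pm.scale_right_distrib mult.commute)

lemma deg_after_relabel_permutes:
  "\<sigma> permutes A \<Longrightarrow> deg_after \<Sigma> (\<sigma> i) (relabel \<sigma> T) = deg_after \<Sigma> i T"
  by (rule deg_after_relabel) (metis inj_on_subset permutes_inj subset_UNIV)

lemma free_comp_rel:
  assumes "\<sigma> permutes {..<length w}" "\<tau> permutes {..<length u}"
    "a \<in> homog \<Sigma> w x d" "i < length w" "b \<in> homog \<Sigma> u (w ! i) e"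
  shows "free_comp \<Sigma> (\<sigma> i) (rel \<sigma> a) (rel \<tau> b) = rel (perm_comp (length u) \<sigma> i \<tau>) (free_comp \<Sigma> i a b)"
  using assms(3)
proof (induction a rule: homog_induct)
  case T: (mon T)
  from assms(5) show ?case
  proof (induction b rule: homog_induct)
    case S: (mon S)
    note T' = treesD[OF T] and S' = treesD[OF S]
    have m: "(\<sigma> i, root_col \<Sigma> S) \<in> set (leaves (relabel \<sigma> T))"
      using T' S' assms(4) by (force simp: leaves_relabel)
    have "graft (\<sigma> i) (relabel \<sigma> T) (relabel \<tau> S) = relabel (perm_comp (length u) \<sigma> i \<tau>) (graft i T S)"
      using graft_relabel[OF assms(1), of \<tau> S i T] S' assms(2) by simp
    moreover have "graft_sign \<Sigma> (\<sigma> i) (relabel \<sigma> T) (relabel \<tau> S) = (graft_sign \<Sigma> i T S :: 'b)"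
      by (simp add: graft_sign_def deg_after_relabel_permutes[OF assms(1)])
    moreover have "free_comp \<Sigma> i (mon T) (mon S) = Poly_Mapping.single (graft i T S) (graft_sign \<Sigma> i T S :: 'b)"
      by (rule free_comp_mon[OF T assms(4) S])
    ultimately show ?case using m by (simp add: free_comp_def)
  qed (auto simp: free_comp_bilinear rel_linear)
qed (auto simp: free_comp_bilinear rel_linear)

section \<open>Ideals and presented operads\<close>

text \<open>Representatives of classes need not be homogeneous, so the ideal is studied inside the
  span of the trees of all profiles and degrees.\<close>

definition spanned :: "'g signature \<Rightarrow> ('g tree \<Rightarrow>\<^sub>0 'k::field) set" where
  "spanned \<Sigma> = {a. Poly_Mapping.keys a \<subseteq> (\<Union>w x d. trees \<Sigma> w x d)}"

lemma homog_spanned: "a \<in> homog \<Sigma> w x d \<Longrightarrow> a \<in> spanned \<Sigma>"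
  unfolding homog_def spanned_def by blast

lemma spanned_zero [simp]: "0 \<in> spanned \<Sigma>"
  by (simp add: spanned_def)

lemma spanned_add: "a \<in> spanned \<Sigma> \<Longrightarrow> b \<in> spanned \<Sigma> \<Longrightarrow> a + b \<in> spanned \<Sigma>"
  using keys_add[of a b] unfolding spanned_def by blast

lemma spanned_scale: "a \<in> spanned \<Sigma> \<Longrightarrow> scale c a \<in> spanned \<Sigma>"
  using keys_scale[of c a] unfolding spanned_def by blast

lemma spanned_uminus: "a \<in> spanned \<Sigma> \<Longrightarrow> - a \<in> spanned \<Sigma>"
  by (simp add: spanned_def keys_uminus)

lemma spanned_induct [consumes 1, case_names mon zero add scale]:
  assumes "a \<in> spanned \<Sigma>"
    and "\<And>T w x d. T \<in> trees \<Sigma> w x d \<Longrightarrow> P (mon T)" and "P 0"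
    and "\<And>a b. a \<in> spanned \<Sigma> \<Longrightarrow> b \<in> spanned \<Sigma> \<Longrightarrow> P a \<Longrightarrow> P b \<Longrightarrow> P (a + b)"
    and "\<And>c a. a \<in> spanned \<Sigma> \<Longrightarrow> P a \<Longrightarrow> P (scale c a)"
  shows "P a"
  using assms unfolding spanned_def by (intro span_induct_mon[of a "\<Union>w x d. trees \<Sigma> w x d" P]) auto

lemma rel_ideal_homog: "rel_ideal \<Sigma> R w x d r \<Longrightarrow> r \<in> homog \<Sigma> w x d"
proof (induction rule: rel_ideal.induct)
  case (comp_left w x d r i S u e)
  then show ?case by (intro free_comp_homog homog_mon)
next
  case (comp_right T w x d i u e r)
  then show ?case by (intro free_comp_homog homog_mon)
qed (auto intro: free_act_homog, simp add: homog_def)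

lemma total_ideal_add: "a \<in> total_ideal \<Sigma> R \<Longrightarrow> b \<in> total_ideal \<Sigma> R \<Longrightarrow> a + b \<in> total_ideal \<Sigma> R"
proof -
  assume "a \<in> total_ideal \<Sigma> R" "b \<in> total_ideal \<Sigma> R"
  then obtain rs ss where "a = sum_list rs" "\<forall>r \<in> set rs. \<exists>w x d. rel_ideal \<Sigma> R w x d r"
    "b = sum_list ss" "\<forall>r \<in> set ss. \<exists>w x d. rel_ideal \<Sigma> R w x d r"
    unfolding total_ideal_def by blast
  then show ?thesis
    unfolding total_ideal_def by (intro CollectI exI[of _ "rs @ ss"]) auto
qed

lemma rel_ideal_total: "rel_ideal \<Sigma> R w x d r \<Longrightarrow> r \<in> total_ideal \<Sigma> R"
  unfolding total_ideal_def by (intro CollectI exI[of _ "[r]"]) auto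

lemma total_ideal_zero [simp]: "0 \<in> total_ideal \<Sigma> R"
  unfolding total_ideal_def by (intro CollectI exI[of _ "[]"]) auto

lemma total_ideal_induct [consumes 1, case_names zero add]:
  assumes "r \<in> total_ideal \<Sigma> R" "P 0"
    and "\<And>r s w x d. rel_ideal \<Sigma> R w x d r \<Longrightarrow> s \<in> total_ideal \<Sigma> R \<Longrightarrow> P s \<Longrightarrow> P (r + s)"
  shows "P r"
proof -
  obtain rs where r: "r = sum_list rs" "\<forall>r \<in> set rs. \<exists>w x d. rel_ideal \<Sigma> R w x d r"
    using assms(1) unfolding total_ideal_def by auto
  have "sum_list rs \<in> total_ideal \<Sigma> R \<and> P (sum_list rs)"
    using r(2)
  proof (induction rs)
    case (Cons r rs)
    then show ?case
      by (auto intro!: total_ideal_add intro: rel_ideal_total assms(3))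
  qed (simp add: assms(2))
  with r show ?thesis by simp
qed

lemma total_ideal_scale: "a \<in> total_ideal \<Sigma> R \<Longrightarrow> scale c a \<in> total_ideal \<Sigma> R"
  by (induction rule: total_ideal_induct)
     (auto simp: pm.scale_right_distrib intro!: total_ideal_add intro: rel_ideal_total rel_ideal.scale)

lemma total_ideal_uminus: "a \<in> total_ideal \<Sigma> R \<Longrightarrow> - a \<in> total_ideal \<Sigma> R"
  using total_ideal_scale[of a \<Sigma> R "- 1"] by simp

lemma total_ideal_spanned: "a \<in> total_ideal \<Sigma> R \<Longrightarrow> a \<in> spanned \<Sigma>"
  by (induction rule: total_ideal_induct) (auto intro: spanned_add homog_spanned rel_ideal_homog)

text \<open>The total ideal consists of sums of elements of its homogeneous components, and a linear
  map need only be tested on these.\<close>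

lemma total_ideal_linear:
  assumes "module_hom scale scale f" "a \<in> total_ideal \<Sigma> R"
    and "\<And>w x d r. rel_ideal \<Sigma> R w x d r \<Longrightarrow> f r \<in> total_ideal \<Sigma>' R'"
  shows "f a \<in> total_ideal \<Sigma>' R'"
  using assms(2)
  by (induction rule: total_ideal_induct)
     (auto simp: module_hom.zero[OF assms(1)] module_hom.add[OF assms(1)] intro!: total_ideal_add assms(3))

text \<open>A representative of a class may contain trees that cannot be composed with a given
  component of \<open>r\<close>. Such composites vanish by \<open>free_comp_mon_zero\<close>; the
  others lie in the ideal by its closure rule.\<close>

lemma total_ideal_comp_left:
  assumes "r \<in> total_ideal \<Sigma> R" "b \<in> spanned \<Sigma>"
  shows "free_comp \<Sigma> i r b \<in> total_ideal \<Sigma> R"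
  using assms(2)
proof (induction b rule: spanned_induct)
  case (mon S u y e)
  show ?case
  proof (rule total_ideal_linear[OF linear_free_comp_left assms(1)])
    fix w x d r assume r: "rel_ideal \<Sigma> R w x d r"
    show "free_comp \<Sigma> i r (mon S) \<in> total_ideal \<Sigma> R"
    proof (cases "i < length w \<and> y = w ! i")
      case True
      then show ?thesis using mon r by (auto intro!: rel_ideal_total rel_ideal.comp_left)
    next
      case False
      from rel_ideal_homog[OF r] have "free_comp \<Sigma> i r (mon S) = 0"
        by (induction r rule: homog_induct) (auto simp: free_comp_bilinear free_comp_mon_zero[OF _ mon False])
      then show ?thesis by simp
    qed
  qed
qed (auto simp: free_comp_bilinear intro: total_ideal_add total_ideal_scale)

lemma total_ideal_comp_right:
  assumes "r \<in> total_ideal \<Sigma> R" "a \<in> spanned \<Sigma>"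
  shows "free_comp \<Sigma> i a r \<in> total_ideal \<Sigma> R"
  using assms(2)
proof (induction a rule: spanned_induct)
  case (mon T w x d)
  show ?case
  proof (rule total_ideal_linear[OF linear_free_comp_right assms(1)])
    fix u y e r assume r: "rel_ideal \<Sigma> R u y e r"
    show "free_comp \<Sigma> i (mon T) r \<in> total_ideal \<Sigma> R"
    proof (cases "i < length w \<and> y = w ! i")
      case True
      then show ?thesis using mon r by (auto intro!: rel_ideal_total rel_ideal.comp_right)
    next
      case False
      from rel_ideal_homog[OF r] have "free_comp \<Sigma> i (mon T) r = 0"
        by (induction r rule: homog_induct) (auto simp: free_comp_bilinear free_comp_mon_zero[OF mon _ False])
      then show ?thesis by simp
    qed
  qed
qed (auto simp: free_comp_bilinear intro: total_ideal_add total_ideal_scale)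

text \<open>Components whose arity does not fit \<open>\<sigma>\<close> are annihilated by
  \<open>free_act \<sigma>\<close>; the others stay in the ideal by its closure rule.\<close>

lemma total_ideal_act:
  assumes "r \<in> total_ideal \<Sigma> R"
  shows "free_act \<sigma> r \<in> total_ideal \<Sigma> R"
proof (rule total_ideal_linear[OF linear_free_act assms])
  fix w x d r assume r: "rel_ideal \<Sigma> R w x d r"
  show "free_act \<sigma> r \<in> total_ideal \<Sigma> R"
  proof (cases "\<sigma> permutes {..<length w}")
    case True
    then show ?thesis using r by (auto intro!: rel_ideal_total rel_ideal.act)
  next
    case False
    from rel_ideal_homog[OF r] have "free_act \<sigma> r = 0"
      by (induction r rule: homog_induct)
         (auto simp: module_hom.add[OF linear_free_act] module_hom.scale[OF linear_free_act]
           module_hom.zero[OF linear_free_act], simp add: free_act_def treesD(4) False)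
    then show ?thesis by simp
  qed
qed

section \<open>Congruence modulo the ideal, and cosets\<close>

definition cong_mod :: "'g signature \<Rightarrow> ('g tree \<Rightarrow>\<^sub>0 'k::field) set \<Rightarrow> ('g tree \<Rightarrow>\<^sub>0 'k) \<Rightarrow> ('g tree \<Rightarrow>\<^sub>0 'k) \<Rightarrow> bool" where
  "cong_mod \<Sigma> R a b \<longleftrightarrow> a - b \<in> total_ideal \<Sigma> R"

lemma cong_refl [simp, intro]: "cong_mod \<Sigma> R a a"
  by (simp add: cong_mod_def)

lemma cong_sym: "cong_mod \<Sigma> R a b \<Longrightarrow> cong_mod \<Sigma> R b a"
  unfolding cong_mod_def using total_ideal_uminus[of "a - b"] by simp

lemma cong_trans [trans]: "cong_mod \<Sigma> R a b \<Longrightarrow> cong_mod \<Sigma> R b c \<Longrightarrow> cong_mod \<Sigma> R a c"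
  unfolding cong_mod_def using total_ideal_add[of "a - b" \<Sigma> R "b - c"] by simp

lemma cong_eq_trans [trans]: "cong_mod \<Sigma> R a b \<Longrightarrow> b = c \<Longrightarrow> cong_mod \<Sigma> R a c"
  "a = b \<Longrightarrow> cong_mod \<Sigma> R b c \<Longrightarrow> cong_mod \<Sigma> R a c"
  by simp_all

lemma cong_add: "cong_mod \<Sigma> R a b \<Longrightarrow> cong_mod \<Sigma> R a' b' \<Longrightarrow> cong_mod \<Sigma> R (a + a') (b + b')"
  unfolding cong_mod_def using total_ideal_add[of "a - b" \<Sigma> R "a' - b'"] by (simp add: algebra_simps)

lemma cong_scale: "cong_mod \<Sigma> R a b \<Longrightarrow> cong_mod \<Sigma> R (scale c a) (scale c b)"
  unfolding cong_mod_def using total_ideal_scale[of "a - b" \<Sigma> R c] by (simp add: pm.scale_right_diff_distrib)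

lemma cong_uminus: "cong_mod \<Sigma> R a b \<Longrightarrow> cong_mod \<Sigma> R (- a) (- b)"
  unfolding cong_mod_def using total_ideal_uminus[of "a - b" \<Sigma> R] by simp

lemma cong_sum: "(\<And>x. x \<in> A \<Longrightarrow> cong_mod \<Sigma> R (f x) (g x)) \<Longrightarrow> cong_mod \<Sigma> R (sum f A) (sum g A)"
  by (induction A rule: infinite_finite_induct) (auto intro: cong_add)

lemma cong_sum_list: "(\<And>x. x \<in> set xs \<Longrightarrow> cong_mod \<Sigma> R (f x) (g x)) \<Longrightarrow> cong_mod \<Sigma> R (\<Sum>x\<leftarrow>xs. f x) (\<Sum>x\<leftarrow>xs. g x)"
  by (induction xs) (auto intro: cong_add)

lemma cong_zero_iff: "cong_mod \<Sigma> R a 0 \<longleftrightarrow> a \<in> total_ideal \<Sigma> R"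
  by (simp add: cong_mod_def)

lemma cong_comp_left: "cong_mod \<Sigma> R a a' \<Longrightarrow> b \<in> spanned \<Sigma> \<Longrightarrow> cong_mod \<Sigma> R (free_comp \<Sigma> i a b) (free_comp \<Sigma> i a' b)"
  unfolding cong_mod_def using total_ideal_comp_left[of "a - a'" \<Sigma> R b i] by (simp add: free_comp_bilinear)

lemma cong_comp_right: "cong_mod \<Sigma> R b b' \<Longrightarrow> a \<in> spanned \<Sigma> \<Longrightarrow> cong_mod \<Sigma> R (free_comp \<Sigma> i a b) (free_comp \<Sigma> i a b')"
  unfolding cong_mod_def using total_ideal_comp_right[of "b - b'" \<Sigma> R a i] by (simp add: free_comp_bilinear)

lemma cong_act: "cong_mod \<Sigma> R a b \<Longrightarrow> cong_mod \<Sigma> R (free_act \<sigma> a) (free_act \<sigma> b)"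
  unfolding cong_mod_def using total_ideal_act[of "a - b" \<Sigma> R \<sigma>] by (simp add: module_hom.diff[OF linear_free_act])

text \<open>The ideal is closed under \<open>free_act\<close>, with which \<open>rel\<close> agrees,
  up to inversion, on homogeneous elements of the right arity; hence the two homogeneity
  hypotheses.\<close>

lemma cong_rel:
  assumes "cong_mod \<Sigma> R a b" "\<sigma> permutes {..<length w}" "a \<in> homog \<Sigma> w x d" "b \<in> homog \<Sigma> w x d"
  shows "cong_mod \<Sigma> R (rel \<sigma> a) (rel \<sigma> b)"
proof -
  have "pinv \<sigma> permutes {..<length w}" "pinv (pinv \<sigma>) = \<sigma>"
    using assms(2) by (auto intro: permutes_inv permutes_inv_inv)
  then have "free_act (pinv \<sigma>) a = rel \<sigma> a" "free_act (pinv \<sigma>) b = rel \<sigma> b"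
    using free_act_rel assms(3,4) by metis+
  then show ?thesis using cong_act[OF assms(1), of "pinv \<sigma>"] by simp
qed

lemma coset_eq_iff: "coset \<Sigma> R a = coset \<Sigma> R b \<longleftrightarrow> cong_mod \<Sigma> R a b"
proof
  assume "coset \<Sigma> R a = coset \<Sigma> R b"
  moreover have "a \<in> coset \<Sigma> R a" by (simp add: coset_def)
  ultimately show "cong_mod \<Sigma> R a b" by (simp add: coset_def cong_mod_def)
next
  assume "cong_mod \<Sigma> R a b"
  then show "coset \<Sigma> R a = coset \<Sigma> R b"
    unfolding coset_def by (fold cong_mod_def) (blast intro: cong_trans cong_sym)
qed

lemma mem_coset: "b \<in> coset \<Sigma> R a \<longleftrightarrow> cong_mod \<Sigma> R b a"
  by (simp add: coset_def cong_mod_def)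

text \<open>The operations of a presented operad are unions over all representatives. A coset is
  nonempty, so the union collapses once the result is independent of the representative.\<close>

lemma UN_coset:
  assumes "\<And>a'. cong_mod \<Sigma> R a' a \<Longrightarrow> F a' = B"
  shows "(\<Union>a'\<in>coset \<Sigma> R a. F a') = B"
proof -
  have "a \<in> coset \<Sigma> R a" by (simp add: mem_coset)
  with assms show ?thesis by (fastforce simp: mem_coset)
qed

text \<open>The ideal is contained in the span of the trees. So all representatives of such a class
  are spanned, and the two congruences for composition can be chained in
  \<open>presented_pcomp\<close>.\<close>

lemma spanned_cong: "cong_mod \<Sigma> R a b \<Longrightarrow> b \<in> spanned \<Sigma> \<Longrightarrow> a \<in> spanned \<Sigma>"
  using spanned_add[of "a - b" \<Sigma> b] total_ideal_spanned[of "a - b" \<Sigma> R] by (simp add: cong_mod_def)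

section \<open>The operations of a presented operad on cosets\<close>

lemma presented_simps:
  "carrier (presented_dg_operad \<Sigma> R D) = coset \<Sigma> R ` spanned \<Sigma>"
  "part (presented_dg_operad \<Sigma> R D) w x d = coset \<Sigma> R ` homog \<Sigma> w x d"
  "\<zero>\<^bsub>presented_dg_operad \<Sigma> R D\<^esub> = coset \<Sigma> R 0"
  "unit (presented_dg_operad \<Sigma> R D) y = coset \<Sigma> R (mon (Leaf y 0))"
  by (auto simp: presented_dg_operad_def spanned_def homog_def)

lemma presented_add:
  "coset \<Sigma> R a \<oplus>\<^bsub>presented_dg_operad \<Sigma> R D\<^esub> coset \<Sigma> R b = coset \<Sigma> R (a + b)"
  unfolding presented_dg_operad_def
  by (simp, intro UN_coset) (auto simp: coset_eq_iff intro: cong_add)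

lemma presented_smult:
  "c \<odot>\<^bsub>presented_dg_operad \<Sigma> R D\<^esub> coset \<Sigma> R a = coset \<Sigma> R (scale c a)"
  unfolding presented_dg_operad_def
  by (simp, intro UN_coset) (auto simp: coset_eq_iff intro: cong_scale)

lemma presented_act:
  "act (presented_dg_operad \<Sigma> R D) \<sigma> (coset \<Sigma> R a) = coset \<Sigma> R (free_act \<sigma> a)"
  unfolding presented_dg_operad_def
  by (simp, intro UN_coset) (auto simp: coset_eq_iff intro: cong_act)

lemma presented_pcomp:
  assumes "a \<in> spanned \<Sigma>" "b \<in> spanned \<Sigma>"
  shows "pcomp (presented_dg_operad \<Sigma> R D) i (coset \<Sigma> R a) (coset \<Sigma> R b) = coset \<Sigma> R (free_comp \<Sigma> i a b)"
  unfolding presented_dg_operad_def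
  by (simp, intro UN_coset)
     (auto simp: coset_eq_iff intro: cong_trans[OF cong_comp_left cong_comp_right] spanned_cong assms)

lemma presented_diff:
  assumes "module_hom scale scale D" "\<And>r. r \<in> total_ideal \<Sigma> R \<Longrightarrow> D r \<in> total_ideal \<Sigma> R"
  shows "diff (presented_dg_operad \<Sigma> R D) (coset \<Sigma> R a) = coset \<Sigma> R (D a)"
  unfolding presented_dg_operad_def
  by (simp, intro UN_coset)
     (auto simp: coset_eq_iff cong_mod_def assms(2) simp flip: module_hom.diff[OF assms(1)])

lemmas presented = presented_simps presented_add presented_smult presented_act

lemma cring_scalars: "cring (scalars :: 'k::field ring)"
  by (rule cringI)
     (auto intro!: abelian_groupI comm_monoidI simp: scalars_def algebra_simps intro: exI[of _ "- _"],
      metis add.left_inverse add.commute)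

lemma collection_presented:
  fixes R :: "('g tree \<Rightarrow>\<^sub>0 'k::field) set"
  shows "collection (presented_dg_operad \<Sigma> R D)"
proof -
  let ?P = "presented_dg_operad \<Sigma> R D"
  have ag: "abelian_group ?P"
  proof (rule abelian_groupI)
    fix A assume "A \<in> carrier ?P"
    then obtain a where a: "A = coset \<Sigma> R a" "a \<in> spanned \<Sigma>" by (auto simp: presented)
    show "\<exists>B\<in>carrier ?P. B \<oplus>\<^bsub>?P\<^esub> A = \<zero>\<^bsub>?P\<^esub>"
      by (rule bexI[of _ "coset \<Sigma> R (scale (- 1) a)"]) (use a in \<open>auto simp: presented intro: spanned_uminus\<close>)
  qed (auto simp: presented spanned_add add_ac)
  interpret M: Module.module "scalars :: 'k ring" ?P
    by (rule Module.moduleI[OF cring_scalars ag])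
       (auto simp: presented scalars_def spanned_scale pm.scale_left_distrib pm.scale_right_distrib)
  have inv: "\<ominus>\<^bsub>?P\<^esub> coset \<Sigma> R a = coset \<Sigma> R (scale (- 1) a)" if "a \<in> spanned \<Sigma>" for a
    by (rule M.minus_equality) (use that in \<open>auto simp: presented intro: spanned_uminus\<close>)
  show ?thesis
  proof (rule collection.intro[OF M.module_axioms], rule collection_axioms.intro, goal_cases)
    case (1 w x d)
    show ?case
    proof (rule M.submoduleI)
      fix A assume "A \<in> part ?P w x d"
      then obtain a where "A = coset \<Sigma> R a" "a \<in> homog \<Sigma> w x d" by (auto simp: presented)
      then show "\<ominus>\<^bsub>?P\<^esub> A \<in> part ?P w x d"
        using inv homog_spanned by (force simp: presented)
    qed (auto simp: presented intro: homog_spanned)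
  next
    case (2 \<sigma> w a x d)
    then show ?case by (auto simp: presented intro: free_act_homog)
  next
    case (3 \<sigma> w a x d b)
    then show ?case by (auto simp: presented module_hom.add[OF linear_free_act])
  next
    case (4 \<sigma> w a x d c)
    then show ?case by (auto simp: presented module_hom.scale[OF linear_free_act])
  next
    case (5 a w x d)
    then obtain a' where a': "a = coset \<Sigma> R a'" "a' \<in> homog \<Sigma> w x d" by (auto simp: presented)
    then show ?case
      using free_act_rel[OF a'(2), of id] by (simp add: presented permutes_id)
  next
    case (6 \<sigma> w \<tau> a x d)
    then obtain a' where a': "a = coset \<Sigma> R a'" "a' \<in> homog \<Sigma> w x d" by (auto simp: presented)
    have "free_act \<tau> (free_act \<sigma> a') = rel (pinv \<tau>) (rel (pinv \<sigma>) a')"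
      using free_act_rel[OF a'(2) 6(1)] free_act_rel[OF free_act_homog[OF a'(2) 6(1)]] 6(2) by simp
    also have "\<dots> = free_act (\<sigma> \<circ> \<tau>) a'"
      using free_act_rel[OF a'(2) permutes_compose[OF 6(2,1)]] permutes_inj[OF 6(1)] permutes_bij[OF 6(1)] permutes_bij[OF 6(2)]
      by (simp add: rel_rel o_inv_distrib)
    finally show ?case by (simp add: a' presented)
  qed
qed

text \<open>The square of the differential has to vanish modulo the relations, while the Leibniz
  rule and equivariance are demanded before passing to the quotient; this is the form in which the
  cobar differential satisfies them.\<close>

lemma dg_operad_presented:
  fixes R :: "('g tree \<Rightarrow>\<^sub>0 'k::field) set"
  assumes D: "module_hom scale scale D"
    and ideal: "\<And>r. r \<in> total_ideal \<Sigma> R \<Longrightarrow> D r \<in> total_ideal \<Sigma> R"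
    and closed: "\<And>w x d a. a \<in> homog \<Sigma> w x d \<Longrightarrow> D a \<in> homog \<Sigma> w x (d + 1)"
    and sq: "\<And>w x d a. a \<in> homog \<Sigma> w x d \<Longrightarrow> D (D a) \<in> total_ideal \<Sigma> R"
    and Dact: "\<And>w x d \<sigma> a. a \<in> homog \<Sigma> w x d \<Longrightarrow> \<sigma> permutes {..<length w} \<Longrightarrow> D (rel \<sigma> a) = rel \<sigma> (D a)"
    and Dcomp: "\<And>w x d i u e a b. a \<in> homog \<Sigma> w x d \<Longrightarrow> i < length w \<Longrightarrow> b \<in> homog \<Sigma> u (w ! i) e
        \<Longrightarrow> D (free_comp \<Sigma> i a b) = free_comp \<Sigma> i (D a) b + scale (ksign d) (free_comp \<Sigma> i a (D b))"
  shows "dg_operad (presented_dg_operad \<Sigma> R D)"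
proof -
  let ?P = "presented_dg_operad \<Sigma> R D"
  interpret collection ?P by (rule collection_presented)
  note pd = presented_diff[OF D ideal]
  note comp = presented_pcomp[OF homog_spanned homog_spanned]
  show ?thesis
  proof (unfold_locales, goal_cases)
    case (1 x)
    then show ?case by (auto simp: presented Leaf_trees)
  next
    case (2 f w x d i g u e)
    then show ?case by (auto simp: presented comp intro: free_comp_homog)
  next
    case (3 f w x d f' i g u e)
    then show ?case by (auto simp: presented comp[OF homog_add] comp free_comp_bilinear)
  next
    case (4 f w x d i g u e g')
    then show ?case by (auto simp: presented comp[OF _ homog_add] comp free_comp_bilinear)
  next
    case (5 f w x d i g u e c)
    then show ?case by (auto simp: presented comp[OF homog_scale] comp free_comp_bilinear)
  next
    case (6 f w x d i g u e c)
    then show ?case by (auto simp: presented comp[OF _ homog_scale] comp free_comp_bilinear)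
  next
    case (7 g u x e)
    then show ?case by (auto simp: presented comp[OF homog_mon[OF Leaf_trees]] free_comp_unit_left)
  next
    case (8 f w x d i)
    then show ?case by (auto simp: presented comp[OF _ homog_mon[OF Leaf_trees]] free_comp_unit_right)
  next
    case (9 f w x d i g u e j h v l)
    then obtain a b c where abc: "f = coset \<Sigma> R a" "a \<in> homog \<Sigma> w x d" "g = coset \<Sigma> R b"
      "b \<in> homog \<Sigma> u (w ! i) e" "h = coset \<Sigma> R c" "c \<in> homog \<Sigma> v (u ! j) l" by (auto simp: presented)
    note n = comp[OF free_comp_homog[OF abc(2) 9(2) abc(4)]] comp[OF _ free_comp_homog[OF abc(4) 9(4) abc(6)]]
    show ?case
      using abc 9 free_comp_sequential[OF abc(2) 9(2) abc(4) 9(4) abc(6)]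
      by (simp add: n[OF abc(6)] n(2)[OF abc(2)] comp[OF abc(2,4)] comp[OF abc(4,6)])
  next
    case (10 f w x d i k g u e h v l)
    then obtain a b c where abc: "f = coset \<Sigma> R a" "a \<in> homog \<Sigma> w x d" "g = coset \<Sigma> R b"
      "b \<in> homog \<Sigma> u (w ! i) e" "h = coset \<Sigma> R c" "c \<in> homog \<Sigma> v (w ! k) l" by (auto simp: presented)
    have i: "i < length w" using 10 by simp
    show ?case
      using abc 10 free_comp_parallel[OF abc(2) 10(2,3) abc(4,6)]
      by (simp add: comp[OF free_comp_homog[OF abc(2) i abc(4)] abc(6)]
          comp[OF free_comp_homog[OF abc(2) 10(3) abc(6)] abc(4)] comp[OF abc(2,4)] comp[OF abc(2,6)] presented)
  next
    case (11 \<sigma> w \<tau> u f x d i g e)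
    then obtain a b where ab: "f = coset \<Sigma> R a" "a \<in> homog \<Sigma> w x d" "g = coset \<Sigma> R b"
      "b \<in> homog \<Sigma> u (w ! \<sigma> i) e" by (auto simp: presented)
    have i: "\<sigma> i < length w" using 11 by (simp add: permutes_less)
    have inv: "pinv \<sigma> permutes {..<length w}" "pinv \<tau> permutes {..<length u}" "pinv \<sigma> (\<sigma> i) = i"
      using 11 by (auto intro: permutes_inv simp: permutes_inverses)
    have "perm_comp (length u) \<sigma> i \<tau> permutes {..<length (ins w (\<sigma> i) u)}"
      using perm_comp_permutes[OF 11(1,2,4)] by (simp add: length_ins[OF i])
    then have "free_act (perm_comp (length u) \<sigma> i \<tau>) (free_comp \<Sigma> (\<sigma> i) a b)
        = rel (pinv (perm_comp (length u) \<sigma> i \<tau>)) (free_comp \<Sigma> (\<sigma> i) a b)"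
      using free_act_rel[OF free_comp_homog[OF ab(2) i ab(4)]] by blast
    also have "\<dots> = free_comp \<Sigma> i (free_act \<sigma> a) (free_act \<tau> b)"
      using free_comp_rel[OF inv(1,2) ab(2) i ab(4)] 11 ab
      by (simp add: free_act_rel[OF ab(2)] free_act_rel[OF ab(4)] inv(3) pinv_perm_comp)
    finally show ?case
      using ab 11 by (simp add: presented comp[OF free_act_homog free_act_homog] comp[OF ab(2,4)])
  next
    case (12 f w x d)
    then show ?case by (auto simp: presented pd intro: closed)
  next
    case (13 f w x d g)
    then show ?case by (auto simp: presented pd module_hom.add[OF D])
  next
    case (14 f w x d c)
    then show ?case by (auto simp: presented pd module_hom.scale[OF D])
  next
    case (15 f w x d)
    then obtain a where a: "f = coset \<Sigma> R a" "a \<in> homog \<Sigma> w x d" by (auto simp: presented)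
    then show ?case using sq[OF a(2)] by (simp add: presented pd coset_eq_iff cong_zero_iff)
  next
    case (16 \<sigma> w f x d)
    then obtain a where a: "f = coset \<Sigma> R a" "a \<in> homog \<Sigma> w x d" by (auto simp: presented)
    have "D (free_act \<sigma> a) = free_act \<sigma> (D a)"
      using 16(1) free_act_rel[OF a(2)] free_act_rel[OF closed[OF a(2)]] Dact[OF a(2) permutes_inv[OF 16(1)]] by simp
    then show ?case using a by (simp add: presented pd)
  next
    case (17 f w x d i g u e)
    then obtain a b where ab: "f = coset \<Sigma> R a" "a \<in> homog \<Sigma> w x d" "g = coset \<Sigma> R b"
      "b \<in> homog \<Sigma> u (w ! i) e" by (auto simp: presented)
    show ?case
      using ab Dcomp[OF ab(2) 17(2) ab(4)]
      by (simp add: presented pd comp[OF ab(2,4)] comp[OF closed[OF ab(2)] ab(4)] comp[OF ab(2) closed[OF ab(4)]])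
  qed
qed

section \<open>Governing cooperads\<close>

lemma sum_list_sum_swap: "(\<Sum>x\<leftarrow>xs. \<Sum>p\<in>A. f x p) = (\<Sum>p\<in>A. \<Sum>x\<leftarrow>xs. f x p)"
  by (induction xs) (auto simp: sum.distrib)

text \<open>Gaussian elimination, one point at a time. The result is a family in \<open>V\<close>
  that reproduces every \<open>f\<close> in \<open>V\<close> from its values; \<open>V\<close> being
  a proper subspace, the indicator functions of points would not do.\<close>

lemma function_space_basis:
  fixes V :: "('t \<Rightarrow> 'k::field) set"
  assumes "finite X" and add: "\<And>f g. f \<in> V \<Longrightarrow> g \<in> V \<Longrightarrow> (\<lambda>T. f T + g T) \<in> V"
    and scale: "\<And>c f. f \<in> V \<Longrightarrow> (\<lambda>T. c * f T) \<in> V" and zero: "(\<lambda>T. 0) \<in> V"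
    and supp: "\<And>f T. f \<in> V \<Longrightarrow> T \<notin> X \<Longrightarrow> f T = 0"
  shows "\<exists>E. (\<forall>p\<in>X. E p \<in> V) \<and> (\<forall>f\<in>V. \<forall>T. f T = (\<Sum>p\<in>X. f p * E p T))"
  using assms
proof (induction X arbitrary: V rule: finite_induct)
  case empty
  then show ?case by auto
next
  case (insert x X)
  note addV = insert.prems(1) and scaleV = insert.prems(2)
  define V' where "V' = {f \<in> V. f x = 0}"
  have "\<exists>E. (\<forall>p\<in>X. E p \<in> V') \<and> (\<forall>f\<in>V'. \<forall>T. f T = (\<Sum>p\<in>X. f p * E p T))"
  proof (rule insert.IH)
    fix f T assume "f \<in> V'" "T \<notin> X"
    then show "f T = 0" using insert.prems(4)[of f T] by (cases "T = x") (auto simp: V'_def)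
  qed (auto simp: V'_def insert.prems)
  then obtain E where E: "\<And>p. p \<in> X \<Longrightarrow> E p \<in> V'" "\<And>f T. f \<in> V' \<Longrightarrow> f T = (\<Sum>p\<in>X. f p * E p T)"
    by blast
  show ?case
  proof (cases "V' = V")
    case True
    let ?E = "E(x := \<lambda>T. 0)"
    have "(\<Sum>p\<in>insert x X. f p * ?E p T) = (\<Sum>p\<in>X. f p * E p T)" for f T
      using insert.hyps by (auto intro!: sum.cong)
    then show ?thesis
      using E True insert.prems(3) by (intro exI[of _ ?E]) (auto simp del: sum.insert)
  next
    case False
    then obtain f0 where f0: "f0 \<in> V" "f0 x \<noteq> 0" by (auto simp: V'_def)
    define g where "g = (\<lambda>T. inverse (f0 x) * f0 T)"
    have g: "g \<in> V" "g x = 1" using f0 insert.prems(2) by (auto simp: g_def)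
    have sums: "(\<lambda>T. \<Sum>p\<in>F. c p * E p T) \<in> V" if "finite F" "F \<subseteq> X" for F c
      using that
    proof (induction F)
      case (insert q F)
      have "(\<lambda>T. c q * E q T + (\<Sum>p\<in>F. c p * E p T)) \<in> V"
        using insert E(1)[of q] by (intro addV scaleV) (auto simp: V'_def)
      then show ?case using insert.hyps by simp
    qed (simp add: insert.prems(3))
    \<comment> \<open>Write \<open>f\<close> as \<open>f x * g + h\<close> with \<open>h\<close> in
      \<open>V'\<close> and expand \<open>h\<close> by the induction hypothesis. Collecting the
      multiples of \<open>f x\<close> gives \<open>g\<close> minus its own expansion along
      \<open>E\<close>.\<close>
    define e where "e = (\<lambda>T. g T + (- 1) * (\<Sum>p\<in>X. g p * E p T))"
    have e: "e \<in> V"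
      unfolding e_def by (rule insert.prems(1)[OF g(1) insert.prems(2)[OF sums]]) (use insert.hyps in auto)
    let ?E = "E(x := e)"
    have "f T = (\<Sum>p\<in>insert x X. f p * ?E p T)" if "f \<in> V" for f T
    proof -
      let ?h = "\<lambda>T. f T + (- f x) * g T"
      have "?h \<in> V'"
        using insert.prems(1)[OF that insert.prems(2)[OF g(1), of "- f x"]] g(2) by (simp add: V'_def)
      from E(2)[OF this, of T]
      have "f T = f x * g T + (\<Sum>p\<in>X. f p * E p T) - f x * (\<Sum>p\<in>X. g p * E p T)"
        by (simp add: algebra_simps sum_subtractf sum_distrib_left)
      moreover have "(\<Sum>p\<in>X. f p * ?E p T) = (\<Sum>p\<in>X. f p * E p T)"
        using insert.hyps by (auto intro!: sum.cong)
      then have "(\<Sum>p\<in>insert x X. f p * ?E p T) = f x * e T + (\<Sum>p\<in>X. f p * E p T)"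
        using insert.hyps by simp
      moreover have "f x * e T = f x * g T - f x * (\<Sum>p\<in>X. g p * E p T)"
        by (simp add: e_def right_diff_distrib)
      ultimately show ?thesis by (simp only: diff_add_eq)
    qed
    moreover have "?E p \<in> V" if "p \<in> insert x X" for p
      using E(1)[of p] e that by (auto simp: V'_def)
    ultimately show ?thesis by blast
  qed
qed

section \<open>The collection of functions vanishing on the relations\<close>

lemma governing_simps [simp]:
  "carrier (governing_cooperad \<Sigma> R) = UNIV"
  "\<zero>\<^bsub>governing_cooperad \<Sigma> R\<^esub> = (\<lambda>T. 0)"
  "\<phi> \<oplus>\<^bsub>governing_cooperad \<Sigma> R\<^esub> \<psi> = (\<lambda>T. \<phi> T + \<psi> T)"
  "c \<odot>\<^bsub>governing_cooperad \<Sigma> R\<^esub> \<phi> = (\<lambda>T. c * \<phi> T)"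
  "part (governing_cooperad \<Sigma> R) = dual_part \<Sigma> R"
  "act (governing_cooperad \<Sigma> R) \<sigma> \<phi> = (\<lambda>T. \<phi> (relabel \<sigma> T))"
  "counit (governing_cooperad \<Sigma> R) x \<phi> = \<phi> (Leaf x 0)"
  "coaug (governing_cooperad \<Sigma> R) x = (\<lambda>T. if T = Leaf x 0 then 1 else 0)"
  by (auto simp: governing_cooperad_def)

lemma dual_part_add: "\<phi> \<in> dual_part \<Sigma> R w x d \<Longrightarrow> \<psi> \<in> dual_part \<Sigma> R w x d \<Longrightarrow> (\<lambda>T. \<phi> T + \<psi> T) \<in> dual_part \<Sigma> R w x d"
  and dual_part_scale: "\<phi> \<in> dual_part \<Sigma> R w x d \<Longrightarrow> (\<lambda>T. c * \<phi> T) \<in> dual_part \<Sigma> R w x d"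
  and dual_part_zero: "(\<lambda>T. 0) \<in> dual_part \<Sigma> R w x d"
  by (auto simp: dual_part_def pairing_fun_add pairing_fun_scale)

lemma dual_part_supp: "\<phi> \<in> dual_part \<Sigma> R w x d \<Longrightarrow> T \<notin> trees \<Sigma> w x (- d) \<Longrightarrow> \<phi> T = 0"
  by (auto simp: dual_part_def)

lemma dual_part_degree:
  "\<phi> \<in> dual_part \<Sigma> R w x d \<Longrightarrow> T \<in> trees \<Sigma> w' x' e \<Longrightarrow> \<phi> T \<noteq> 0 \<Longrightarrow> e = - d"
  using dual_part_supp trees_unique(3) by metis

lemma collection_governing:
  fixes R :: "('g tree \<Rightarrow>\<^sub>0 'k::field) set"
  shows "collection (governing_cooperad \<Sigma> R)"
proof -
  let ?C = "governing_cooperad \<Sigma> R"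
  have ag: "abelian_group ?C"
    by (rule abelian_groupI) (auto simp: fun_eq_iff algebra_simps intro: exI[of _ "\<lambda>T. - _ T"])
  interpret M: Module.module "scalars :: 'k ring" ?C
    by (rule Module.moduleI[OF cring_scalars ag]) (auto simp: scalars_def algebra_simps)
  have inv: "\<ominus>\<^bsub>?C\<^esub> \<phi> = (\<lambda>T. - 1 * \<phi> T)" for \<phi>
    by (rule M.minus_equality) auto
  show ?thesis
  proof (rule collection.intro[OF M.module_axioms], rule collection_axioms.intro, goal_cases)
    case (1 w x d)
    show ?case
    proof (rule M.submoduleI)
      fix \<phi> assume "\<phi> \<in> part ?C w x d"
      then show "\<ominus>\<^bsub>?C\<^esub> \<phi> \<in> part ?C w x d"
        unfolding inv by (simp only: governing_simps dual_part_scale)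
    qed (auto simp: dual_part_add dual_part_scale dual_part_zero)
  next
    case (2 \<sigma> w \<phi> x d)
    have "pairing (\<lambda>T. \<phi> (relabel \<sigma> T)) r = 0" if r: "rel_ideal \<Sigma> R (permw \<sigma> w) x (- d) r" for r
    proof -
      have p: "pinv \<sigma> permutes {..<length (permw \<sigma> w)}" using permutes_inv[OF 2(1)] by simp
      \<comment> \<open>The function \<open>\<lambda>T. \<phi> (relabel \<sigma> T)\<close> pairs
        with \<open>r\<close> as \<open>\<phi>\<close> does with \<open>rel \<sigma> r\<close>, and
        the latter is the action of the inverse permutation on \<open>r\<close>, an ideal element of
        profile \<open>w\<close>.\<close>
      have "rel_ideal \<Sigma> R (permw (pinv \<sigma>) (permw \<sigma> w)) x (- d) (free_act (pinv \<sigma>) r)"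
        by (rule rel_ideal.act[OF r p])
      moreover have "permw (pinv \<sigma>) (permw \<sigma> w) = w"
        using permutes_inv[OF 2(1)] by (simp add: permw_permw permutes_inv_o[OF 2(1)])
      moreover have "free_act (pinv \<sigma>) r = rel \<sigma> r"
        using free_act_rel[OF rel_ideal_homog[OF r] p] by (simp add: permutes_inv_inv[OF 2(1)])
      ultimately have "pairing \<phi> (rel \<sigma> r) = 0"
        using 2 by (auto simp: dual_part_def)
      then show ?thesis by (simp add: rel_def pairing_lin_ext)
    qed
    moreover have "\<phi> (relabel \<sigma> T) = 0" if "T \<notin> trees \<Sigma> (permw \<sigma> w) x (- d)" for T
    proof (rule dual_part_supp)
      show "relabel \<sigma> T \<notin> trees \<Sigma> w x (- d)"
      proof
        assume "relabel \<sigma> T \<in> trees \<Sigma> w x (- d)"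
        from relabel_trees'[OF this 2(1)] that show False
          by (simp add: relabel_relabel permutes_inv_o[OF 2(1)])
      qed
    qed (use 2 in simp)
    ultimately show ?case by (simp add: dual_part_def)
  qed (auto simp: relabel_relabel)
qed

text \<open>Finiteness makes the transpose of a composition a finite sum of pure tensors. The
  condition on leaves makes the function dual to the trivial tree vanish on the relations, which
  gives the coaugmentation.\<close>

locale finite_presentation =
  fixes \<Sigma> :: "'g signature" and R :: "('g tree \<Rightarrow>\<^sub>0 'k::field) set"
  assumes finite_trees: "finite (\<Union>d. trees \<Sigma> w x d)"
    and no_leaf: "r \<in> R \<Longrightarrow> T \<in> Poly_Mapping.keys r \<Longrightarrow> \<not> is_leaf T"
begin

abbreviation C :: "('k, 'g tree \<Rightarrow> 'k) cooperad" where
  "C \<equiv> governing_cooperad \<Sigma> R"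

definition profile_trees :: "color list \<Rightarrow> color \<Rightarrow> 'g tree set" where
  "profile_trees w x = (\<Union>d. trees \<Sigma> w x d)"

lemma profile_trees_iff: "T \<in> profile_trees w x \<longleftrightarrow> T \<in> trees \<Sigma> w x (tdeg \<Sigma> T)"
  using treesD(3) by (fastforce simp: profile_trees_def)

lemma finite_profile_trees [simp]: "finite (profile_trees w x)"
  unfolding profile_trees_def by (rule finite_trees)

lemma trees_profile: "T \<in> trees \<Sigma> w x d \<Longrightarrow> T \<in> profile_trees w x"
  by (auto simp: profile_trees_def)

lemma dual_basis:
  "\<exists>E. \<forall>w x. (\<forall>p\<in>profile_trees w x. E w x p \<in> dual_part \<Sigma> R w x (- tdeg \<Sigma> p)) \<and>
    (\<forall>d. \<forall>\<phi>\<in>dual_part \<Sigma> R w x d. \<forall>T. \<phi> T = (\<Sum>p\<in>profile_trees w x. \<phi> p * E w x p T))"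
proof -
  have "\<exists>E. (\<forall>p\<in>profile_trees w x. E p \<in> dual_part \<Sigma> R w x (- tdeg \<Sigma> p)) \<and>
    (\<forall>d. \<forall>\<phi>\<in>dual_part \<Sigma> R w x d. \<forall>T. \<phi> T = (\<Sum>p\<in>profile_trees w x. \<phi> p * E p T))" for w x
  proof -
    have "\<exists>E. (\<forall>p\<in>profile_trees w x. E p \<in> dual_part \<Sigma> R w x d) \<and>
        (\<forall>\<phi>\<in>dual_part \<Sigma> R w x d. \<forall>T. \<phi> T = (\<Sum>p\<in>profile_trees w x. \<phi> p * E p T))" for d
      by (rule function_space_basis)
         (auto simp: dual_part_add dual_part_scale dual_part_zero intro: dual_part_supp dest: trees_profile)
    then obtain E where E: "\<And>d p. p \<in> profile_trees w x \<Longrightarrow> E d p \<in> dual_part \<Sigma> R w x d"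
        "\<And>d \<phi> T. \<phi> \<in> dual_part \<Sigma> R w x d \<Longrightarrow> \<phi> T = (\<Sum>p\<in>profile_trees w x. \<phi> p * E d p T)"
      by metis
    \<comment> \<open>The families of the single degrees merge into one: \<open>\<phi> p\<close>
      vanishes unless the degree of \<open>p\<close> is \<open>- d\<close>, so for \<open>p\<close>
      only the family in degree \<open>- tdeg \<Sigma> p\<close> contributes.\<close>
    have "\<phi> T = (\<Sum>p\<in>profile_trees w x. \<phi> p * E (- tdeg \<Sigma> p) p T)" if "\<phi> \<in> dual_part \<Sigma> R w x d" for \<phi> d T
    proof -
      have "\<phi> p * E d p T = \<phi> p * E (- tdeg \<Sigma> p) p T" if "p \<in> profile_trees w x" for p
        using dual_part_degree[OF \<open>\<phi> \<in> dual_part \<Sigma> R w x d\<close>, of p w x "tdeg \<Sigma> p"] that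
        by (cases "\<phi> p = 0") (auto simp: profile_trees_iff)
      then have "(\<Sum>p\<in>profile_trees w x. \<phi> p * E d p T) = (\<Sum>p\<in>profile_trees w x. \<phi> p * E (- tdeg \<Sigma> p) p T)"
        by (rule sum.cong[OF refl])
      then show ?thesis using E(2)[OF that, of T] by simp
    qed
    then show ?thesis using E(1) by (intro exI[of _ "\<lambda>p. E (- tdeg \<Sigma> p) p"]) auto
  qed
  then show ?thesis by metis
qed

definition basis :: "color list \<Rightarrow> color \<Rightarrow> 'g tree \<Rightarrow> 'g tree \<Rightarrow> 'k" where
  "basis = (SOME E. \<forall>w x. (\<forall>p\<in>profile_trees w x. E w x p \<in> dual_part \<Sigma> R w x (- tdeg \<Sigma> p)) \<and>
    (\<forall>d. \<forall>\<phi>\<in>dual_part \<Sigma> R w x d. \<forall>T. \<phi> T = (\<Sum>p\<in>profile_trees w x. \<phi> p * E w x p T)))"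

lemma basis_dual: "p \<in> profile_trees w x \<Longrightarrow> basis w x p \<in> dual_part \<Sigma> R w x (- tdeg \<Sigma> p)"
  and basis_expand: "\<phi> \<in> dual_part \<Sigma> R w x d \<Longrightarrow> \<phi> T = (\<Sum>p\<in>profile_trees w x. \<phi> p * basis w x p T)"
  using someI_ex[OF dual_basis] unfolding basis_def by blast+

text \<open>Used for one tensor factor after the other, this expresses a multilinear form by its
  values on the chosen families, with coefficients that are evaluations at trees.\<close>

lemma multilinear_expand:
  assumes B: "multilinear C ps B" and ps: "ps = ps1 @ (w, x) # ps2"
    and l: "pure_tensor C ps1 l" and r: "pure_tensor C ps2 r" and a: "a \<in> dual_part \<Sigma> R w x d"
  shows "B (l @ (d, a) # r) = (\<Sum>p\<in>profile_trees w x. a p * B (l @ (- tdeg \<Sigma> p, basis w x p) # r))"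
proof -
  have pure: "pure_tensor C ps (l @ (d, b) # r)" if "b \<in> dual_part \<Sigma> R w x d" for b d
    using l r that unfolding pure_tensor_def ps by (intro list_all2_appendI) auto
  have add: "B (l @ (d, \<lambda>T. b T + c T) # r) = B (l @ (d, b) # r) + B (l @ (d, c) # r)"
    and scale: "B (l @ (d, \<lambda>T. t * b T) # r) = t * B (l @ (d, b) # r)"
    if "b \<in> dual_part \<Sigma> R w x d" "c \<in> dual_part \<Sigma> R w x d" for b c t d
    using B[unfolded multilinear_def governing_simps, rule_format, OF conjI[OF pure[OF that(1)] pure[OF that(2)]]]
    by blast+
  \<comment> \<open>Vectors of the wrong degree have coefficient zero. Replacing them by zero keeps
    the whole sum in degree \<open>d\<close>, the only place where additivity of \<open>B\<close> is
    available for the tag \<open>d\<close>.\<close>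
  let ?g = "\<lambda>p. if - tdeg \<Sigma> p = d then basis w x p else (\<lambda>T. 0)"
  have g: "?g p \<in> dual_part \<Sigma> R w x d" if "p \<in> profile_trees w x" for p
    using basis_dual[OF that] by (auto simp: dual_part_zero)
  have zero: "B (l @ (d, \<lambda>T. 0) # r) = 0"
    using scale[OF a a, of 0] by simp
  have "(\<lambda>T. \<Sum>p\<in>F. a p * ?g p T) \<in> dual_part \<Sigma> R w x d \<and>
      B (l @ (d, \<lambda>T. \<Sum>p\<in>F. a p * ?g p T) # r) = (\<Sum>p\<in>F. a p * B (l @ (d, ?g p) # r))"
    if "finite F" "F \<subseteq> profile_trees w x" for F
    using that
  proof (induction F)
    case (insert q F)
    have "(\<lambda>T. a q * ?g q T) \<in> dual_part \<Sigma> R w x d"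
      using insert.prems by (intro dual_part_scale g) auto
    with insert show ?case
      using add scale[OF g g, of q q] by (simp add: dual_part_add)
  qed (simp add: zero dual_part_zero)
  from this[OF finite_profile_trees]
  have "B (l @ (d, \<lambda>T. \<Sum>p\<in>profile_trees w x. a p * ?g p T) # r)
      = (\<Sum>p\<in>profile_trees w x. a p * B (l @ (d, ?g p) # r))" by blast
  moreover have deg: "a p = 0 \<or> - tdeg \<Sigma> p = d" if "p \<in> profile_trees w x" for p
    using dual_part_degree[OF a, of p w x "tdeg \<Sigma> p"] that
    by (cases "a p = 0") (auto simp: profile_trees_iff)
  moreover have "(\<lambda>T. \<Sum>p\<in>profile_trees w x. a p * ?g p T) = a"
  proof
    fix T
    show "(\<Sum>p\<in>profile_trees w x. a p * ?g p T) = a T"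
      unfolding basis_expand[OF a, of T] by (rule sum.cong) (use deg in auto)
  qed
  moreover have "(\<Sum>p\<in>profile_trees w x. a p * B (l @ (d, ?g p) # r))
      = (\<Sum>p\<in>profile_trees w x. a p * B (l @ (- tdeg \<Sigma> p, basis w x p) # r))"
    by (rule sum.cong) (use deg in auto)
  ultimately show ?thesis by simp
qed

text \<open>Evaluations at pairs of trees separate tensors: by \<open>multilinear_expand\<close>
  every bilinear form is a combination of such evaluations. This turns the cooperad axioms into
  identities between values on trees.\<close>

lemma tensor_eq2I:
  assumes s: "\<And>d a e b. ((d, a), (e, b)) \<in> set s \<Longrightarrow> a \<in> dual_part \<Sigma> R w x d \<and> b \<in> dual_part \<Sigma> R u y e"
    and t: "\<And>d a e b. ((d, a), (e, b)) \<in> set t \<Longrightarrow> a \<in> dual_part \<Sigma> R w x d \<and> b \<in> dual_part \<Sigma> R u y e"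
    and eq: "\<And>d e T S. T \<in> trees \<Sigma> w x d \<Longrightarrow> S \<in> trees \<Sigma> u y e \<Longrightarrow>
      (\<Sum>((d, a), (e, b))\<leftarrow>s. a T * b S) = (\<Sum>((d, a), (e, b))\<leftarrow>t. a T * b S)"
  shows "tensor_eq C [(w, x), (u, y)] (ten2 s) (ten2 t)"
  unfolding tensor_eq_def
proof (intro allI impI)
  fix B assume B: "multilinear C [(w, x), (u, y)] B"
  let ?\<beta> = "\<lambda>p q. B [(- tdeg \<Sigma> p, basis w x p), (- tdeg \<Sigma> q, basis u y q)]"
  have expand: "B [(d, a), (e, b)] = (\<Sum>p\<in>profile_trees w x. \<Sum>q\<in>profile_trees u y. a p * b q * ?\<beta> p q)"
    if "a \<in> dual_part \<Sigma> R w x d" "b \<in> dual_part \<Sigma> R u y e" for d a e b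
  proof -
    have "B [(d, a), (e, b)] = (\<Sum>p\<in>profile_trees w x. a p * B [(- tdeg \<Sigma> p, basis w x p), (e, b)])"
      using multilinear_expand[OF B, of "[]" w x "[(u, y)]" "[]" "[(e, b)]" a d] that
      by (simp add: pure_tensor_def)
    also have "\<dots> = (\<Sum>p\<in>profile_trees w x. a p * (\<Sum>q\<in>profile_trees u y. b q * ?\<beta> p q))"
    proof (rule sum.cong[OF refl])
      fix p assume "p \<in> profile_trees w x"
      then show "a p * B [(- tdeg \<Sigma> p, basis w x p), (e, b)] = a p * (\<Sum>q\<in>profile_trees u y. b q * ?\<beta> p q)"
        using multilinear_expand[OF B, of "[(w, x)]" u y "[]" "[(- tdeg \<Sigma> p, basis w x p)]" "[]" b e] that
        by (simp add: pure_tensor_def basis_dual)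
    qed
    finally show ?thesis by (simp add: sum_distrib_left mult.assoc)
  qed
  have sums: "(\<Sum>l\<leftarrow>ten2 s. B l)
      = (\<Sum>p\<in>profile_trees w x. \<Sum>q\<in>profile_trees u y. (\<Sum>((d, a), (e, b))\<leftarrow>s. a p * b q) * ?\<beta> p q)"
    if "\<And>d a e b. ((d, a), (e, b)) \<in> set s \<Longrightarrow> a \<in> dual_part \<Sigma> R w x d \<and> b \<in> dual_part \<Sigma> R u y e" for s
  proof -
    have "(\<Sum>l\<leftarrow>ten2 s. B l) = (\<Sum>((d, a), (e, b))\<leftarrow>s.
        \<Sum>p\<in>profile_trees w x. \<Sum>q\<in>profile_trees u y. a p * b q * ?\<beta> p q)"
      unfolding ten2_def by (auto simp: comp_def expand that intro!: arg_cong[where f = sum_list])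
    also have "\<dots> = (\<Sum>p\<in>profile_trees w x. \<Sum>q\<in>profile_trees u y. \<Sum>((d, a), (e, b))\<leftarrow>s. a p * b q * ?\<beta> p q)"
      by (simp add: sum_list_sum_swap case_prod_unfold)
    finally show ?thesis by (simp add: sum_list_mult_const case_prod_unfold)
  qed
  have "(\<Sum>((d, a), (e, b))\<leftarrow>s. a p * b q) * ?\<beta> p q = (\<Sum>((d, a), (e, b))\<leftarrow>t. a p * b q) * ?\<beta> p q"
    if "p \<in> profile_trees w x" "q \<in> profile_trees u y" for p q
    using eq that by (simp add: profile_trees_iff)
  note eq' = this
  show "(\<Sum>l\<leftarrow>ten2 s. B l) = (\<Sum>l\<leftarrow>ten2 t. B l)"
    by (rule trans[OF sums[OF s] trans[OF _ sums[OF t, symmetric]]]) (assumption | intro sum.cong refl eq')+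
qed

lemma tensor_eq3I:
  assumes s: "\<And>l. l \<in> set s \<Longrightarrow> pure_tensor C [(w, x), (u, y), (v, z)] l"
    and t: "\<And>l. l \<in> set t \<Longrightarrow> pure_tensor C [(w, x), (u, y), (v, z)] l"
    and eq: "\<And>d e f T S U. T \<in> trees \<Sigma> w x d \<Longrightarrow> S \<in> trees \<Sigma> u y e \<Longrightarrow> U \<in> trees \<Sigma> v z f \<Longrightarrow>
      (\<Sum>l\<leftarrow>s. snd (l ! 0) T * snd (l ! 1) S * snd (l ! 2) U) = (\<Sum>l\<leftarrow>t. snd (l ! 0) T * snd (l ! 1) S * snd (l ! 2) U)"
  shows "tensor_eq C [(w, x), (u, y), (v, z)] s t"
  unfolding tensor_eq_def
proof (intro allI impI)
  fix B assume B: "multilinear C [(w, x), (u, y), (v, z)] B"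
  let ?b = "\<lambda>w x p. (- tdeg \<Sigma> p, basis w x p)"
  let ?\<beta> = "\<lambda>p q r. B [?b w x p, ?b u y q, ?b v z r]"
  have expand: "B l = (\<Sum>p\<in>profile_trees w x. \<Sum>q\<in>profile_trees u y. \<Sum>r\<in>profile_trees v z.
      snd (l ! 0) p * snd (l ! 1) q * snd (l ! 2) r * ?\<beta> p q r)"
    if pl: "pure_tensor C [(w, x), (u, y), (v, z)] l" for l
  proof -
    obtain d a e b f c where l: "l = [(d, a), (e, b), (f, c)]" and abc: "a \<in> dual_part \<Sigma> R w x d"
      "b \<in> dual_part \<Sigma> R u y e" "c \<in> dual_part \<Sigma> R v z f"
      using pl unfolding pure_tensor_def by (auto simp: list_all2_Cons1)
    have "B [(d, a), (e, b), (f, c)] = (\<Sum>p\<in>profile_trees w x. a p * B [?b w x p, (e, b), (f, c)])"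
      using multilinear_expand[OF B, of "[]" w x "[(u, y), (v, z)]" "[]" "[(e, b), (f, c)]" a d] abc
      by (simp add: pure_tensor_def)
    also have "\<dots> = (\<Sum>p\<in>profile_trees w x. a p * (\<Sum>q\<in>profile_trees u y. b q *
        (\<Sum>r\<in>profile_trees v z. c r * ?\<beta> p q r)))"
    proof (rule sum.cong[OF refl], rule arg_cong[where f = "(*) _"])
      fix p assume p: "p \<in> profile_trees w x"
      have "B [?b w x p, (e, b), (f, c)] = (\<Sum>q\<in>profile_trees u y. b q * B [?b w x p, ?b u y q, (f, c)])"
        using multilinear_expand[OF B, of "[(w, x)]" u y "[(v, z)]" "[?b w x p]" "[(f, c)]" b e] abc p
        by (simp add: pure_tensor_def basis_dual)
      also have "\<dots> = (\<Sum>q\<in>profile_trees u y. b q * (\<Sum>r\<in>profile_trees v z. c r * ?\<beta> p q r))"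
      proof (rule sum.cong[OF refl], rule arg_cong[where f = "(*) _"])
        fix q assume q: "q \<in> profile_trees u y"
        show "B [?b w x p, ?b u y q, (f, c)] = (\<Sum>r\<in>profile_trees v z. c r * ?\<beta> p q r)"
          using multilinear_expand[OF B, of "[(w, x), (u, y)]" v z "[]" "[?b w x p, ?b u y q]" "[]" c f] abc p q
          by (simp add: pure_tensor_def basis_dual)
      qed
      finally show "B [?b w x p, (e, b), (f, c)]
        = (\<Sum>q\<in>profile_trees u y. b q * (\<Sum>r\<in>profile_trees v z. c r * ?\<beta> p q r))" .
    qed
    finally show ?thesis by (simp add: l sum_distrib_left mult.assoc)
  qed
  have sums: "(\<Sum>l\<leftarrow>s. B l) = (\<Sum>p\<in>profile_trees w x. \<Sum>q\<in>profile_trees u y. \<Sum>r\<in>profile_trees v z.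
      (\<Sum>l\<leftarrow>s. snd (l ! 0) p * snd (l ! 1) q * snd (l ! 2) r) * ?\<beta> p q r)"
    if "\<And>l. l \<in> set s \<Longrightarrow> pure_tensor C [(w, x), (u, y), (v, z)] l" for s
  proof -
    have "(\<Sum>l\<leftarrow>s. B l) = (\<Sum>l\<leftarrow>s. \<Sum>p\<in>profile_trees w x. \<Sum>q\<in>profile_trees u y. \<Sum>r\<in>profile_trees v z.
      snd (l ! 0) p * snd (l ! 1) q * snd (l ! 2) r * ?\<beta> p q r)"
      by (intro arg_cong[where f = sum_list] map_cong refl expand that)
    then show ?thesis by (simp add: sum_list_sum_swap sum_list_mult_const)
  qed
  have "(\<Sum>l\<leftarrow>s. snd (l ! 0) p * snd (l ! 1) q * snd (l ! 2) r) * ?\<beta> p q r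
      = (\<Sum>l\<leftarrow>t. snd (l ! 0) p * snd (l ! 1) q * snd (l ! 2) r) * ?\<beta> p q r"
    if "p \<in> profile_trees w x" "q \<in> profile_trees u y" "r \<in> profile_trees v z" for p q r
    using eq that by (simp add: profile_trees_iff)
  note eq' = this
  show "(\<Sum>l\<leftarrow>s. B l) = (\<Sum>l\<leftarrow>t. B l)"
    by (rule trans[OF sums[OF s] trans[OF _ sums[OF t, symmetric]]]) (assumption | intro sum.cong refl eq')+
qed

text \<open>The prescribed values form a matrix \<open>F\<close> whose rows and columns vanish on
  the ideal. Expanding it in the first argument along \<open>basis\<close> writes it as the sum over
  \<open>p\<close> of \<open>basis w x p\<close> times the row of \<open>p\<close>, which is a
  finite sum of pure tensors of dual elements.\<close>

lemma is_cocomp_exists: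
  assumes i: "i < length w" and \<phi>: "\<phi> \<in> dual_part \<Sigma> R (ins w i u) x n"
  shows "\<exists>s. is_cocomp \<Sigma> R w x i u n \<phi> s"
proof -
  define F where "F T S = graft_sign \<Sigma> i T S * \<phi> (graft i T S)" for T S
  have deg0: "F T S = 0" if "T \<in> trees \<Sigma> w x d" "S \<in> trees \<Sigma> u (w ! i) e" "d + e \<noteq> - n" for T S d e
    using dual_part_degree[OF \<phi> graft_trees[OF that(1) i that(2)]] that(3) unfolding F_def by auto
  \<comment> \<open>For fixed \<open>S\<close> this is \<open>\<phi>\<close> transposed along
    grafting with \<open>S\<close>, and the ideal is closed under that composition.\<close>
  have left: "(\<lambda>T. if T \<in> trees \<Sigma> w x (- n - e) then F T S else 0) \<in> dual_part \<Sigma> R w x (n + e)"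
    if S: "S \<in> trees \<Sigma> u (w ! i) e" for S e
  proof -
    have "pairing (\<lambda>T. if T \<in> trees \<Sigma> w x (- n - e) then F T S else 0) r = 0"
      if r: "rel_ideal \<Sigma> R w x (- (n + e)) r" for r
    proof -
      have "free_comp \<Sigma> i r (mon S) = lin_ext (\<lambda>T. Poly_Mapping.single (graft i T S) (graft_sign \<Sigma> i T S)) r"
        using rel_ideal_homog[OF r]
        by (induction r rule: homog_induct) (auto simp: free_comp_bilinear lin_ext_linear free_comp_mon[OF _ i S])
      moreover have "pairing \<phi> (free_comp \<Sigma> i r (mon S)) = 0"
        using rel_ideal.comp_left[OF r i S] \<phi> by (auto simp: dual_part_def)
      ultimately have "pairing (\<lambda>T. F T S) r = 0"
        by (simp add: pairing_lin_ext F_def)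
      moreover have "pairing (\<lambda>T. if T \<in> trees \<Sigma> w x (- n - e) then F T S else 0) r = pairing (\<lambda>T. F T S) r"
        using rel_ideal_homog[OF r] by (intro pairing_cong) (auto simp: homog_def)
      ultimately show ?thesis by simp
    qed
    then show ?thesis by (simp add: dual_part_def)
  qed
  \<comment> \<open>The same for fixed \<open>T\<close>; the scalar \<open>c\<close> leaves room for
    the sign of the pairing.\<close>
  have right: "(\<lambda>S. if S \<in> trees \<Sigma> u (w ! i) (- n - d) then c * F T S else 0) \<in> dual_part \<Sigma> R u (w ! i) (n + d)"
    if T: "T \<in> trees \<Sigma> w x d" for T d c
  proof -
    have "pairing (\<lambda>S. if S \<in> trees \<Sigma> u (w ! i) (- n - d) then F T S else 0) r = 0"
      if r: "rel_ideal \<Sigma> R u (w ! i) (- (n + d)) r" for r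
    proof -
      have "free_comp \<Sigma> i (mon T) r = lin_ext (\<lambda>S. Poly_Mapping.single (graft i T S) (graft_sign \<Sigma> i T S)) r"
        using rel_ideal_homog[OF r]
        by (induction r rule: homog_induct) (auto simp: free_comp_bilinear lin_ext_linear free_comp_mon[OF T i])
      moreover have "pairing \<phi> (free_comp \<Sigma> i (mon T) r) = 0"
        using rel_ideal.comp_right[OF T i r] \<phi> by (auto simp: dual_part_def)
      ultimately have "pairing (\<lambda>S. F T S) r = 0"
        by (simp add: pairing_lin_ext F_def)
      moreover have "pairing (\<lambda>S. if S \<in> trees \<Sigma> u (w ! i) (- n - d) then F T S else 0) r = pairing (F T) r"
        using rel_ideal_homog[OF r] by (intro pairing_cong) (auto simp: homog_def)
      ultimately show ?thesis by simp
    qed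
    then have "(\<lambda>S. if S \<in> trees \<Sigma> u (w ! i) (- n - d) then F T S else 0) \<in> dual_part \<Sigma> R u (w ! i) (n + d)"
      by (simp add: dual_part_def)
    from dual_part_scale[OF this, of c] show ?thesis by (simp add: if_distrib cong: if_cong)
  qed
  obtain ps where ps: "set ps = profile_trees w x" "distinct ps"
    using finite_distinct_list[OF finite_profile_trees] by blast
  let ?t = "tdeg \<Sigma>"
  \<comment> \<open>The partner of \<open>basis w x p\<close>, which has degree
    \<open>- tdeg p\<close>, must have degree \<open>n + tdeg p\<close>. The sign cancels the one in
    the pairing of tensors with trees.\<close>
  define b where "b p = (\<lambda>S. if S \<in> trees \<Sigma> u (w ! i) (- n - ?t p) then ksign ((n + ?t p) * ?t p) * F p S else 0)" for p
  define s where "s = map (\<lambda>p. ((- ?t p, basis w x p), (n + ?t p, b p))) ps"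
  have 1: "a \<in> dual_part \<Sigma> R w x d \<and> b' \<in> dual_part \<Sigma> R u (w ! i) e \<and> d + e = n"
    if "((d, a), (e, b')) \<in> set s" for d a e b'
  proof -
    from that obtain p where p: "p \<in> profile_trees w x" "((d, a), (e, b')) = ((- ?t p, basis w x p), (n + ?t p, b p))"
      by (auto simp: s_def ps)
    then show ?thesis
      using basis_dual[OF p(1)] right[of p "?t p"] by (simp add: b_def profile_trees_iff)
  qed
  have 2: "(\<Sum>((_, a), (e', b))\<leftarrow>s. ksign (e' * d) * a T * b S) = graft_sign \<Sigma> i T S * \<phi> (graft i T S)"
    if T: "T \<in> trees \<Sigma> w x d" and S: "S \<in> trees \<Sigma> u (w ! i) e" for d e T S
  proof -
    have "(\<Sum>((_, a), (e', b))\<leftarrow>s. ksign (e' * d) * a T * b S)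
        = (\<Sum>p\<in>profile_trees w x. ksign ((n + ?t p) * d) * basis w x p T * b p S)"
      by (simp add: s_def comp_def sum_list_distinct_conv_sum_set[OF ps(2)] ps(1))
    also have "\<dots> = (\<Sum>p\<in>profile_trees w x. F p S * basis w x p T)"
    proof (rule sum.cong[OF refl])
      fix p assume p: "p \<in> profile_trees w x"
      have "basis w x p T = 0 \<or> ?t p = d"
        using dual_part_degree[OF basis_dual[OF p] T] by auto
      moreover have "F p S = 0 \<or> ?t p + e = - n"
        using deg0[of p "?t p" S e] p S by (auto simp: profile_trees_iff)
      moreover have "b p S = ksign ((n + ?t p) * ?t p) * F p S" if "?t p + e = - n"
      proof -
        have "- n - ?t p = e" using that by simp
        then show ?thesis using S by (simp add: b_def)
      qed
      moreover have "b p S = 0" if "F p S = 0"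
        using that by (simp add: b_def)
      ultimately show "ksign ((n + ?t p) * d) * basis w x p T * b p S = F p S * basis w x p T"
        by (auto simp: mult_ac)
    qed
    \<comment> \<open>Cut off outside one degree, the column of \<open>S\<close> is the dual element
      provided by \<open>left\<close>, to which \<open>basis_expand\<close> applies.\<close>
    also have "\<dots> = (\<Sum>p\<in>profile_trees w x. (if p \<in> trees \<Sigma> w x (- n - e) then F p S else 0) * basis w x p T)"
    proof (rule sum.cong[OF refl])
      fix p assume p: "p \<in> profile_trees w x"
      have "F p S = 0" if "p \<notin> trees \<Sigma> w x (- n - e)"
      proof -
        have "?t p \<noteq> - n - e" using that p by (auto simp: profile_trees_iff)
        then have "?t p + e \<noteq> - n" by linarith
        then show ?thesis using deg0[of p "?t p" S e] p S by (simp add: profile_trees_iff)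
      qed
      then show "F p S * basis w x p T = (if p \<in> trees \<Sigma> w x (- n - e) then F p S else 0) * basis w x p T"
        by simp
    qed
    also have "\<dots> = (if T \<in> trees \<Sigma> w x (- n - e) then F T S else 0)"
      using basis_expand[OF left[OF S], of T] by simp
    also have "\<dots> = F T S"
    proof (cases "d + e = - n")
      case True
      then have "- n - e = d" by simp
      then show ?thesis using T by simp
    qed (simp add: deg0[OF T S])
    finally show ?thesis
      by (simp add: F_def)
  qed
  have "is_cocomp \<Sigma> R w x i u n \<phi> s"
    unfolding is_cocomp_def using 1 2 by blast
  then show ?thesis ..
qed

lemma cocomp_spec:
  assumes "i < length w" "\<phi> \<in> dual_part \<Sigma> R (ins w i u) x n"
  shows "is_cocomp \<Sigma> R w x i u n \<phi> (cocomp C w x i u n \<phi>)"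
  using someI_ex[OF is_cocomp_exists[OF assms]] by (simp add: governing_cooperad_def)

lemma cocomp_dual:
  assumes "i < length w" "\<phi> \<in> dual_part \<Sigma> R (ins w i u) x n" "((d, a), (e, b)) \<in> set (cocomp C w x i u n \<phi>)"
  shows "a \<in> dual_part \<Sigma> R w x d" "b \<in> dual_part \<Sigma> R u (w ! i) e" "d + e = n"
  using cocomp_spec[OF assms(1,2)] assms(3) unfolding is_cocomp_def by auto

text \<open>Where \<open>b S\<close> is nonzero, the tag \<open>e'\<close> equals
  \<open>- e\<close>. So the sign in the specification depends on the two trees alone and can be
  moved out of the sum.\<close>

lemma is_cocomp_eval:
  assumes "is_cocomp \<Sigma> R w x i u n \<phi> s" "T \<in> trees \<Sigma> w x d" "S \<in> trees \<Sigma> u (w ! i) e"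
  shows "(\<Sum>((d', a), (e', b))\<leftarrow>s. a T * b S) = ksign (d * e) * graft_sign \<Sigma> i T S * \<phi> (graft i T S)"
proof -
  have "(\<Sum>((d', a), (e', b))\<leftarrow>s. a T * b S) = (\<Sum>((d', a), (e', b))\<leftarrow>s. ksign (d * e) * (ksign (e' * d) * a T * b S))"
  proof (intro arg_cong[where f = sum_list] map_cong refl, clarify)
    fix d' a e' b assume "((d', a), (e', b)) \<in> set s"
    then have "b \<in> dual_part \<Sigma> R u (w ! i) e'" using assms(1) unfolding is_cocomp_def by auto
    then have "b S = 0 \<or> e = - e'" using dual_part_degree[OF _ assms(3)] by blast
    then show "a T * b S = ksign (d * e) * (ksign (e' * d) * a T * b S)" by (auto simp: ksign_def)
  qed
  also have "\<dots> = ksign (d * e) * (\<Sum>((d', a), (e', b))\<leftarrow>s. ksign (e' * d) * a T * b S)"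
    by (simp add: sum_list_const_mult case_prod_unfold)
  also have "(\<Sum>((d', a), (e', b))\<leftarrow>s. ksign (e' * d) * a T * b S) = graft_sign \<Sigma> i T S * \<phi> (graft i T S)"
    using assms unfolding is_cocomp_def by blast
  finally show ?thesis by (simp add: mult.assoc)
qed

lemmas cocomp_eval = is_cocomp_eval[OF cocomp_spec]

end

section \<open>The cooperad axioms as transposed operad axioms\<close>

lemma sum_list_concat: "sum_list (concat xss) = (\<Sum>xs\<leftarrow>xss. sum_list xs)"
  by (induction xss) auto

lemma ins_append: "ins (a @ x # b) (length a) u = a @ u @ b"
  by (simp add: ins_def)

lemma ins_parallel:
  assumes "i < k" "k < length w"
  shows "ins (ins w i u) (k + length u - 1) v = ins (ins w k v) i u"
proof -
  define a b c where "a = take i w" and "b = take (k - i - 1) (drop (i + 1) w)" and "c = drop (Suc k) w"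
  have "drop (Suc i) w = b @ drop k w"
    using append_take_drop_id[of "k - i - 1" "drop (Suc i) w"] assms by (simp add: b_def)
  then have w: "w = a @ w ! i # b @ w ! k # c"
    using assms id_take_nth_drop[of i w] Cons_nth_drop_Suc[of k w] by (simp add: a_def c_def)
  have l: "length a = i" "length (a @ w ! i # b) = k" "length (a @ u @ b) = k + length u - 1"
    using assms by (auto simp: a_def b_def)
  have 1: "ins w i u = (a @ u @ b) @ w ! k # c"
    using ins_append[of a "w ! i" "b @ w ! k # c" u] w l(1) by simp
  have 2: "ins w k v = a @ w ! i # (b @ v @ c)"
    using ins_append[of "a @ w ! i # b" "w ! k" c v] w l(2) by simp
  show ?thesis
    unfolding 1 2 using ins_append[of "a @ u @ b" "w ! k" c v] ins_append[of a "w ! i" "b @ v @ c" u] l by simp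
qed

lemma graft_eq_Leaf: "graft i T S = Leaf x j \<Longrightarrow> is_leaf T"
  by (cases T) (auto simp: graft_def)

context finite_presentation
begin

text \<open>A graft is a trivial tree only if its lower factor is one, and grafting onto a trivial
  tree only renumbers the upper factor. So composites of ideal elements again avoid trivial
  trees.\<close>

lemma ideal_no_leaf: "rel_ideal \<Sigma> R w x d r \<Longrightarrow> T \<in> Poly_Mapping.keys r \<Longrightarrow> \<not> is_leaf T"
proof (induction arbitrary: T rule: rel_ideal.induct)
  case (add w x d r s)
  then show ?case using keys_add[of r s] by blast
next
  case (scale w x d r c)
  then show ?case using keys_scale[of c r] by blast
next
  case (act w x d r \<sigma>)
  then show ?case
    unfolding free_act_def by (auto dest!: keys_lin_ext split: if_splits simp: is_leaf_def) (metis relabel.simps tree.exhaust tree.distinct(1))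
next
  case (comp_left w x d r i S u e)
  then show ?case
    unfolding free_comp_def by (auto dest!: keys_lin_ext split: if_splits) (metis graft_eq_Leaf is_leaf_def)
next
  case (comp_right T' w x d i u e r)
  from comp_right.prems obtain S where S: "S \<in> Poly_Mapping.keys r" "T = graft i T' S" 
    unfolding free_comp_def by (auto dest!: keys_lin_ext split: if_splits)
  have "\<not> is_leaf S" by (rule comp_right.IH[OF S(1)])
  moreover have "T' = Leaf x i" if l: "is_leaf T'"
  proof -
    obtain c j where T': "T' = Leaf c j" using l by (auto simp: is_leaf_def)
    then show ?thesis using treesD(2,6)[OF comp_right.hyps(1)] comp_right.hyps(2)
      by (metis labels_simps(1) lessThan_iff root_col.simps(1) set_ConsD list.set_intros(1) empty_iff list.set(1))
  qed
  ultimately show ?case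
    using graft_eq_Leaf[of i T' S] unfolding S(2) is_leaf_def
    by (cases S) (auto simp: graft_def)
qed (use no_leaf in auto)

lemma coaug_dual: "(\<lambda>T. if T = Leaf x 0 then 1 else 0) \<in> dual_part \<Sigma> R [x] x 0"
proof -
  have "pairing (\<lambda>T. if T = Leaf x 0 then 1 else 0) r = 0" if r: "rel_ideal \<Sigma> R [x] x 0 r" for r
    using ideal_no_leaf[OF r, of "Leaf x 0"] by (auto simp: pairing_def in_keys_iff intro!: sum.neutral)
  then show ?thesis using Leaf_trees[of x \<Sigma>] by (auto simp: dual_part_def)
qed

lemma ten2_simps: "set (ten2 s) = (\<lambda>(p, q). [p, q]) ` set s"
  by (simp add: ten2_def)

lemma cocomp_coaug_governing:
  assumes i: "i < length w" and w: "ins w i u = [x]"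
  shows "tensor_eq C [(w, x), (u, w ! i)] (ten2 (cocomp C w x i u 0 (coaug C x)))
            (if w = [x] \<and> u = [x] then [[(0, coaug C x), (0, coaug C x)]] else [])"
proof -
  let ?t = "if w = [x] \<and> u = [x] then [((0::int, coaug C x), (0::int, coaug C x))] else []"
  have c: "coaug C x \<in> dual_part \<Sigma> R (ins w i u) x 0"
    using coaug_dual by (simp add: w)
  have "tensor_eq C [(w, x), (u, w ! i)] (ten2 (cocomp C w x i u 0 (coaug C x))) (ten2 ?t)"
  proof (rule tensor_eq2I)
    fix d a e b assume "((d, a), (e, b)) \<in> set (cocomp C w x i u 0 (coaug C x))"
    from cocomp_dual[OF i c this] show "a \<in> dual_part \<Sigma> R w x d \<and> b \<in> dual_part \<Sigma> R u (w ! i) e" by simp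
  next
    fix d a e b assume "((d, a), (e, b)) \<in> set ?t"
    then show "a \<in> dual_part \<Sigma> R w x d \<and> b \<in> dual_part \<Sigma> R u (w ! i) e"
      using coaug_dual i by (auto split: if_splits)
  next
    fix d e T S assume T: "T \<in> trees \<Sigma> w x d" and S: "S \<in> trees \<Sigma> u (w ! i) e"
    \<comment> \<open>The trivial tree decomposes in one way only, which gives the cocomposition of
      the coaugmentation element.\<close>
    have "graft i T S = Leaf x 0 \<longleftrightarrow> T = Leaf x 0 \<and> S = Leaf x 0"
    proof
      assume g: "graft i T S = Leaf x 0"
      then obtain c j where Tl: "T = Leaf c j" using graft_eq_Leaf[OF g] by (auto simp: is_leaf_def)
      have "length w = 1" "c = x" using treesD(2,4)[OF T] Tl by auto
      moreover from this have "i = 0" "j = 0" using i treesD(6)[OF T] Tl by (auto simp: lessThan_Suc)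
      ultimately show "T = Leaf x 0 \<and> S = Leaf x 0" using g Tl by simp
    next
      assume l: "T = Leaf x 0 \<and> S = Leaf x 0"
      then have "i = 0" using i treesD(4)[OF T] by simp
      with l show "graft i T S = Leaf x 0" by simp
    qed
    moreover have "w = [x] \<and> u = [x]" if "T = Leaf x 0" "S = Leaf x 0"
      using that trees_unique(1)[OF T, of "[x]" x 0] trees_unique(1)[OF S, of "[x]" x 0] by (simp add: Leaf_trees)
    moreover have "d = 0" "e = 0" if "T = Leaf x 0" "S = Leaf x 0"
      using that treesD(3)[OF T] treesD(3)[OF S] by auto
    ultimately show "(\<Sum>((d, a), (e, b))\<leftarrow>cocomp C w x i u 0 (coaug C x). a T * b S) = (\<Sum>((d, a), (e, b))\<leftarrow>?t. a T * b S)"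
      unfolding cocomp_eval[OF i c T S] by (auto simp: graft_sign_def deg_after_def)
  qed
  then show ?thesis by (cases "w = [x] \<and> u = [x]") (auto simp: ten2_def)
qed

lemma sum_list_tensor3:
  "(\<Sum>l\<leftarrow>[[p', q', r]. (p, r) \<leftarrow> s, (p', q') \<leftarrow> f p]. snd (l ! 0) T * snd (l ! 1) S * snd (l ! 2) U)
    = (\<Sum>(p, r)\<leftarrow>s. (\<Sum>((d, a), (e, b))\<leftarrow>f p. a T * b S) * snd r (U :: 't) :: 'b::field)"
  by (simp add: sum_list_concat map_concat comp_def case_prod_unfold sum_list_mult_const)

lemma sum_list_tensor3':
  "(\<Sum>l\<leftarrow>[[p, q', r']. (p, q) \<leftarrow> s, (q', r') \<leftarrow> f q]. snd (l ! 0) T * snd (l ! 1) S * snd (l ! 2) U)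
    = (\<Sum>(p, q)\<leftarrow>s. snd p (T :: 't) * (\<Sum>((d, a), (e, b))\<leftarrow>f q. a S * b U) :: 'b::field)"
  by (simp add: sum_list_concat map_concat comp_def case_prod_unfold sum_list_const_mult mult.assoc)

lemma sum_list_pair_cong:
  "(\<And>p q. (p, q) \<in> set s \<Longrightarrow> f p q = g p q) \<Longrightarrow> (\<Sum>(p, q)\<leftarrow>s. f p q) = (\<Sum>(p, q)\<leftarrow>s. g p q)"
  by (auto intro!: arg_cong[where f = sum_list])

text \<open>Evaluated at trees \<open>T\<close>, \<open>S\<close>, \<open>U\<close>, both sides are
  a sign times the value of \<open>\<phi>\<close> on the same iterated graft. What remains is the
  sign check based on \<open>deg_after_graft_inside\<close>.\<close>

lemma cocomp_sequential_governing:
  assumes i: "i < length w" and j: "j < length u" and a: "\<phi> \<in> dual_part \<Sigma> R (ins w i (ins u j v)) x n"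
  shows "tensor_eq C [(w, x), (u, w ! i), (v, u ! j)]
            [[p', q', r]. (p, r) \<leftarrow> cocomp C (ins w i u) x (i + j) v n \<phi>,
                          (p', q') \<leftarrow> cocomp C w x i u (fst p) (snd p)]
            [[p, q', r']. (p, q) \<leftarrow> cocomp C w x i (ins u j v) n \<phi>,
                          (q', r') \<leftarrow> cocomp C u (w ! i) j v (fst q) (snd q)]"
proof (rule tensor_eq3I)
  have ij: "i + j < length (ins w i u)" "ins w i u ! (i + j) = u ! j"
    using i j by (auto simp: length_ins nth_ins)
  have ins: "ins (ins w i u) (i + j) v = ins w i (ins u j v)"
    using i j by (auto simp: ins_def)
  have a': "\<phi> \<in> dual_part \<Sigma> R (ins (ins w i u) (i + j) v) x n" using a by (simp add: ins)
  have 1: "snd p \<in> dual_part \<Sigma> R (ins w i u) x (fst p)" "snd r \<in> dual_part \<Sigma> R v (u ! j) (fst r)"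
    if "(p, r) \<in> set (cocomp C (ins w i u) x (i + j) v n \<phi>)" for p r
    using cocomp_dual[OF ij(1) a', of "fst p" "snd p" "fst r" "snd r"] that by (simp_all add: ij)
  have 2: "snd p \<in> dual_part \<Sigma> R w x (fst p)" "snd q \<in> dual_part \<Sigma> R (ins u j v) (w ! i) (fst q)"
    if "(p, q) \<in> set (cocomp C w x i (ins u j v) n \<phi>)" for p q
    using cocomp_dual[OF i a, of "fst p" "snd p" "fst q" "snd q"] that by simp_all
  show "pure_tensor C [(w, x), (u, w ! i), (v, u ! j)] l"
    if "l \<in> set [[p', q', r]. (p, r) \<leftarrow> cocomp C (ins w i u) x (i + j) v n \<phi>,
                          (p', q') \<leftarrow> cocomp C w x i u (fst p) (snd p)]" for l
    using that by (auto simp: pure_tensor_def dest: 1 cocomp_dual[OF i 1(1)])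
  show "pure_tensor C [(w, x), (u, w ! i), (v, u ! j)] l"
    if "l \<in> set [[p, q', r']. (p, q) \<leftarrow> cocomp C w x i (ins u j v) n \<phi>,
                          (q', r') \<leftarrow> cocomp C u (w ! i) j v (fst q) (snd q)]" for l
    using that by (auto simp: pure_tensor_def dest: 2 cocomp_dual[OF j 2(2)])
  fix d e f T S U
  assume T: "T \<in> trees \<Sigma> w x d" and S: "S \<in> trees \<Sigma> u (w ! i) e" and U: "U \<in> trees \<Sigma> v (u ! j) f"
  note T' = treesD[OF T] and S' = treesD[OF S]
  have g: "graft (i + j) (graft i T S) U = graft i T (graft j S U)"
    by (rule graft_sequential) (use S' j in auto)
  have da: "deg_after \<Sigma> (i + j) (graft i T S) = deg_after \<Sigma> j S + deg_after \<Sigma> i T"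
    by (rule deg_after_graft_inside) (use S' T' i j in auto)
  have t: "tdeg \<Sigma> (graft j S U) = e + f"
    by (rule treesD(3)[OF graft_trees[OF S j U]])
  have "(\<Sum>(p, r)\<leftarrow>cocomp C (ins w i u) x (i + j) v n \<phi>. (\<Sum>((d, a), (e, b))\<leftarrow>cocomp C w x i u (fst p) (snd p). a T * b S) * snd r U)
      = (\<Sum>(p, r)\<leftarrow>cocomp C (ins w i u) x (i + j) v n \<phi>. ksign (d * e) * graft_sign \<Sigma> i T S * (snd p (graft i T S) * snd r U))"
  proof (rule sum_list_pair_cong)
    fix p r assume m: "(p, r) \<in> set (cocomp C (ins w i u) x (i + j) v n \<phi>)"
    show "(\<Sum>((d, a), (e, b))\<leftarrow>cocomp C w x i u (fst p) (snd p). a T * b S) * snd r U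
        = ksign (d * e) * graft_sign \<Sigma> i T S * (snd p (graft i T S) * snd r U)"
      unfolding cocomp_eval[OF i 1(1)[OF m] T S] by (simp add: mult.assoc)
  qed
  also have "\<dots> = ksign (d * e) * graft_sign \<Sigma> i T S *
      (\<Sum>((d, a), (e, b))\<leftarrow>cocomp C (ins w i u) x (i + j) v n \<phi>. a (graft i T S) * b U)"
    by (simp add: sum_list_const_mult case_prod_unfold)
  also have "(\<Sum>((d, a), (e, b))\<leftarrow>cocomp C (ins w i u) x (i + j) v n \<phi>. a (graft i T S) * b U)
      = ksign ((d + e) * f) * graft_sign \<Sigma> (i + j) (graft i T S) U * \<phi> (graft (i + j) (graft i T S) U)"
    by (rule cocomp_eval[OF ij(1) a' graft_trees[OF T i S]]) (use U ij in simp)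
  also have "ksign (d * e) * graft_sign \<Sigma> i T S * (ksign ((d + e) * f) * graft_sign \<Sigma> (i + j) (graft i T S) U * \<phi> (graft (i + j) (graft i T S) U))
     = ksign (e * f) * graft_sign \<Sigma> j S U * (ksign (d * (e + f)) * graft_sign \<Sigma> i T (graft j S U) * \<phi> (graft i T (graft j S U)))"
    unfolding graft_sign_def g da t S'(3) treesD(3)[OF U]
    by (auto simp: ksign_def)
  also have "ksign (d * (e + f)) * graft_sign \<Sigma> i T (graft j S U) * \<phi> (graft i T (graft j S U))
     = (\<Sum>((d, a), (e, b))\<leftarrow>cocomp C w x i (ins u j v) n \<phi>. a T * b (graft j S U))"
    by (rule cocomp_eval[OF i a T graft_trees[OF S j U], symmetric])
  also have "ksign (e * f) * graft_sign \<Sigma> j S U * \<dots>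
     = (\<Sum>(p, q)\<leftarrow>cocomp C w x i (ins u j v) n \<phi>. ksign (e * f) * graft_sign \<Sigma> j S U * (snd p T * snd q (graft j S U)))"
    by (simp add: sum_list_const_mult case_prod_unfold)
  also have "\<dots> = (\<Sum>(p, q)\<leftarrow>cocomp C w x i (ins u j v) n \<phi>. snd p T *
       (\<Sum>((d, a), (e, b))\<leftarrow>cocomp C u (w ! i) j v (fst q) (snd q). a S * b U))"
  proof (rule sum_list_pair_cong)
    fix p q assume m: "(p, q) \<in> set (cocomp C w x i (ins u j v) n \<phi>)"
    show "ksign (e * f) * graft_sign \<Sigma> j S U * (snd p T * snd q (graft j S U))
        = snd p T * (\<Sum>((d, a), (e, b))\<leftarrow>cocomp C u (w ! i) j v (fst q) (snd q). a S * b U)"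
      unfolding cocomp_eval[OF j 2(2)[OF m] S U] by (simp add: mult_ac)
  qed
  finally show "(\<Sum>l\<leftarrow>[[p', q', r]. (p, r) \<leftarrow> cocomp C (ins w i u) x (i + j) v n \<phi>,
                          (p', q') \<leftarrow> cocomp C w x i u (fst p) (snd p)]. snd (l ! 0) T * snd (l ! 1) S * snd (l ! 2) U)
    = (\<Sum>l\<leftarrow>[[p, q', r']. (p, q) \<leftarrow> cocomp C w x i (ins u j v) n \<phi>,
                          (q', r') \<leftarrow> cocomp C u (w ! i) j v (fst q) (snd q)]. snd (l ! 0) T * snd (l ! 1) S * snd (l ! 2) U)"
    unfolding sum_list_tensor3 sum_list_tensor3' .
qed

text \<open>Evaluation at three trees reduces the claim to \<open>graft_parallel\<close> and
  \<open>parallel_sign\<close>; the Koszul sign of the axiom is compared with the sign for trees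
  below.\<close>

lemma cocomp_parallel_governing:
  assumes ik: "i < k" and k: "k < length w" and a: "\<phi> \<in> dual_part \<Sigma> R (ins (ins w k v) i u) x n"
  shows "tensor_eq C [(w, x), (u, w ! i), (v, w ! k)]
            [[p', q', r]. (p, r) \<leftarrow> cocomp C (ins w i u) x (k + length u - 1) v n \<phi>,
                          (p', q') \<leftarrow> cocomp C w x i u (fst p) (snd p)]
            [[(fst p', ksign (fst q * fst r') \<odot>\<^bsub>C\<^esub> snd p'), q, r'].
                          (p, q) \<leftarrow> cocomp C (ins w k v) x i u n \<phi>,
                          (p', r') \<leftarrow> cocomp C w x k v (fst p) (snd p)]"
proof (rule tensor_eq3I)
  let ?k = "k + length u - 1"
  have i: "i < length w" using ik k by simp
  have ki: "?k < length (ins w i u)" "ins w i u ! ?k = w ! k"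
    "i < length (ins w k v)" "ins w k v ! i = w ! i"
    using ik k by (auto simp: length_ins nth_ins)
  have ins: "ins (ins w i u) ?k v = ins (ins w k v) i u"
    by (rule ins_parallel[OF ik k])
  have a': "\<phi> \<in> dual_part \<Sigma> R (ins (ins w i u) ?k v) x n" using a by (simp only: ins)
  have 1: "snd p \<in> dual_part \<Sigma> R (ins w i u) x (fst p)" "snd r \<in> dual_part \<Sigma> R v (w ! k) (fst r)"
    if "(p, r) \<in> set (cocomp C (ins w i u) x ?k v n \<phi>)" for p r
    using cocomp_dual[OF ki(1) a', of "fst p" "snd p" "fst r" "snd r"] that by (simp_all only: ki prod.collapse)
  have 2: "snd p \<in> dual_part \<Sigma> R (ins w k v) x (fst p)" "snd q \<in> dual_part \<Sigma> R u (w ! i) (fst q)"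
    if "(p, q) \<in> set (cocomp C (ins w k v) x i u n \<phi>)" for p q
    using cocomp_dual[OF ki(3) a, of "fst p" "snd p" "fst q" "snd q"] that by (simp_all add: ki)
  show "pure_tensor C [(w, x), (u, w ! i), (v, w ! k)] l"
    if "l \<in> set [[p', q', r]. (p, r) \<leftarrow> cocomp C (ins w i u) x ?k v n \<phi>,
                          (p', q') \<leftarrow> cocomp C w x i u (fst p) (snd p)]" for l
  proof -
    from that obtain p r p' q' where m: "(p, r) \<in> set (cocomp C (ins w i u) x ?k v n \<phi>)"
      "(p', q') \<in> set (cocomp C w x i u (fst p) (snd p))" and l: "l = [p', q', r]" by auto
    show ?thesis
      using 1[OF m(1)] cocomp_dual[OF i 1(1)[OF m(1)], of "fst p'" "snd p'" "fst q'" "snd q'"] m(2)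
      by (simp add: pure_tensor_def case_prod_unfold l)
  qed
  show "pure_tensor C [(w, x), (u, w ! i), (v, w ! k)] l"
    if "l \<in> set [[(fst p', ksign (fst q * fst r') \<odot>\<^bsub>C\<^esub> snd p'), q, r'].
                          (p, q) \<leftarrow> cocomp C (ins w k v) x i u n \<phi>,
                          (p', r') \<leftarrow> cocomp C w x k v (fst p) (snd p)]" for l
    using that by (auto simp: pure_tensor_def intro!: dual_part_scale dest: 2 cocomp_dual[OF k 2(1)])
  fix d e f T S U
  assume T: "T \<in> trees \<Sigma> w x d" and S: "S \<in> trees \<Sigma> u (w ! i) e" and U: "U \<in> trees \<Sigma> v (w ! k) f"
  note T' = treesD[OF T] and S' = treesD[OF S] and U' = treesD[OF U]
  have g: "graft ?k (graft i T S) U = graft i (graft k T U) S"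
    using graft_parallel[OF ik, of S T U] S' by simp
  have sh: "?k = shift i (length (leaves S)) k" "i = shift k (length (leaves U)) i"
    using ik S' by (auto simp: shift_def)
  have ST: "distinct (labels T)" "i \<in> set (labels T)" "k \<in> set (labels T)" "i \<noteq> k"
    "set (labels S) = {..<length (leaves S)}" "set (labels U) = {..<length (leaves U)}"
    "tdeg \<Sigma> S = e" "tdeg \<Sigma> U = f"
    using T' S' U' ik k i by simp_all
  have sgn: "graft_sign \<Sigma> i T S * graft_sign \<Sigma> ?k (graft i T S) U
     = (ksign (e * f) * (graft_sign \<Sigma> k T U * graft_sign \<Sigma> i (graft k T U) S) :: 'k)"
    unfolding graft_sign_def S'(3) U'(3) sh(1)
    using parallel_sign[where T = T and S = S and U = U and i = i and k = k and \<Sigma> = \<Sigma> and e = e and l = f] ST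
    by (metis sh(2))
  have "(\<Sum>(p, r)\<leftarrow>cocomp C (ins w i u) x ?k v n \<phi>. (\<Sum>((d, a), (e, b))\<leftarrow>cocomp C w x i u (fst p) (snd p). a T * b S) * snd r U)
      = (\<Sum>(p, r)\<leftarrow>cocomp C (ins w i u) x ?k v n \<phi>. ksign (d * e) * graft_sign \<Sigma> i T S * (snd p (graft i T S) * snd r U))"
  proof (rule sum_list_pair_cong)
    fix p r assume m: "(p, r) \<in> set (cocomp C (ins w i u) x ?k v n \<phi>)"
    show "(\<Sum>((d, a), (e, b))\<leftarrow>cocomp C w x i u (fst p) (snd p). a T * b S) * snd r U
        = ksign (d * e) * graft_sign \<Sigma> i T S * (snd p (graft i T S) * snd r U)"
      unfolding cocomp_eval[OF i 1(1)[OF m] T S] by (simp add: mult.assoc)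
  qed
  also have "\<dots> = ksign (d * e) * graft_sign \<Sigma> i T S *
      (\<Sum>((d, a), (e, b))\<leftarrow>cocomp C (ins w i u) x ?k v n \<phi>. a (graft i T S) * b U)"
    by (simp add: sum_list_const_mult case_prod_unfold)
  also have "(\<Sum>((d, a), (e, b))\<leftarrow>cocomp C (ins w i u) x ?k v n \<phi>. a (graft i T S) * b U)
      = ksign ((d + e) * f) * graft_sign \<Sigma> ?k (graft i T S) U * \<phi> (graft ?k (graft i T S) U)"
    by (rule cocomp_eval[OF ki(1) a' graft_trees[OF T i S]]) (use U ki in simp)
  also have "ksign (d * e) * graft_sign \<Sigma> i T S * (ksign ((d + e) * f) * graft_sign \<Sigma> ?k (graft i T S) U * \<phi> (graft ?k (graft i T S) U))
      = (ksign (d * e) * ksign ((d + e) * f)) * (graft_sign \<Sigma> i T S * graft_sign \<Sigma> ?k (graft i T S) U) * \<phi> (graft ?k (graft i T S) U)"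
    by (simp only: mult_ac)
  also have "\<dots> = ksign (d * f) * graft_sign \<Sigma> k T U * ksign (e * f) * (ksign ((d + f) * e) * graft_sign \<Sigma> i (graft k T U) S * \<phi> (graft i (graft k T U) S))"
    unfolding sgn g by (auto simp: ksign_def mult_ac)
  also have "ksign ((d + f) * e) * graft_sign \<Sigma> i (graft k T U) S * \<phi> (graft i (graft k T U) S)
     = (\<Sum>((d, a), (e, b))\<leftarrow>cocomp C (ins w k v) x i u n \<phi>. a (graft k T U) * b S)"
    by (rule cocomp_eval[OF ki(3) a graft_trees[OF T k U], symmetric]) (use S ki in simp)
  also have "ksign (d * f) * graft_sign \<Sigma> k T U * ksign (e * f) * \<dots>
     = (\<Sum>(p, q)\<leftarrow>cocomp C (ins w k v) x i u n \<phi>. ksign (e * f) * (ksign (d * f) * graft_sign \<Sigma> k T U * snd p (graft k T U)) * snd q S)"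
    by (simp add: case_prod_unfold mult_ac flip: sum_list_const_mult)
  also have "\<dots> = (\<Sum>(p, q)\<leftarrow>cocomp C (ins w k v) x i u n \<phi>.
       \<Sum>((d, a), (e', b))\<leftarrow>cocomp C w x k v (fst p) (snd p). ksign (fst q * e') * a T * snd q S * b U)"
  proof (intro arg_cong[where f = sum_list] map_cong refl, clarify)
    fix l a e' b assume m: "((l, a), (e', b)) \<in> set (cocomp C (ins w k v) x i u n \<phi>)"
    note a = 2(1)[OF m, unfolded fst_conv snd_conv] and b = 2(2)[OF m, unfolded fst_conv snd_conv]
    \<comment> \<open>Where the values do not vanish, degrees of dual elements are minus the degrees
      of the trees. Hence the Koszul sign is the constant \<open>ksign (e * f)\<close>.\<close>
    have e: "b S = 0 \<or> e' = - e" using dual_part_degree[OF b S] by (cases "b S = 0") auto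
    have "(\<Sum>((d, a), (l', c))\<leftarrow>cocomp C w x k v l a. ksign (e' * l') * a T * b S * c U)
        = (\<Sum>((d, a), (l', c))\<leftarrow>cocomp C w x k v l a. ksign (e * f) * b S * (a T * c U))"
    proof (intro arg_cong[where f = sum_list] map_cong refl, clarify)
      fix d' a' l' c assume m': "((d', a'), (l', c)) \<in> set (cocomp C w x k v l a)"
      have "c U = 0 \<or> l' = - f"
        using dual_part_degree[OF cocomp_dual(2)[OF k a m'] U] by (cases "c U = 0") auto
      then show "ksign (e' * l') * a' T * b S * c U = ksign (e * f) * b S * (a' T * c U)"
        using e by (auto simp: ksign_def)
    qed
    also have "\<dots> = ksign (e * f) * b S * (\<Sum>((d, a), (l', c))\<leftarrow>cocomp C w x k v l a. a T * c U)"
      by (simp add: sum_list_const_mult case_prod_unfold)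
    also have "\<dots> = ksign (e * f) * (ksign (d * f) * graft_sign \<Sigma> k T U * a (graft k T U)) * b S"
      unfolding cocomp_eval[OF k a T U] by (simp add: mult_ac)
    finally show "ksign (e * f) * (ksign (d * f) * graft_sign \<Sigma> k T U * snd (l, a) (graft k T U)) * snd (e', b) S
      = (\<Sum>((d, a), (e'', c))\<leftarrow>cocomp C w x k v (fst (l, a)) (snd (l, a)). ksign (fst (e', b) * e'') * a T * snd (e', b) S * c U)"
      by simp
  qed
  finally show "(\<Sum>l\<leftarrow>[[p', q', r]. (p, r) \<leftarrow> cocomp C (ins w i u) x ?k v n \<phi>,
                          (p', q') \<leftarrow> cocomp C w x i u (fst p) (snd p)]. snd (l ! 0) T * snd (l ! 1) S * snd (l ! 2) U)
    = (\<Sum>l\<leftarrow>[[(fst p', ksign (fst q * fst r') \<odot>\<^bsub>C\<^esub> snd p'), q, r'].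
                          (p, q) \<leftarrow> cocomp C (ins w k v) x i u n \<phi>,
                          (p', r') \<leftarrow> cocomp C w x k v (fst p) (snd p)]. snd (l ! 0) T * snd (l ! 1) S * snd (l ! 2) U)"
    unfolding sum_list_tensor3
    by (simp add: sum_list_concat map_concat comp_def case_prod_unfold)
qed

text \<open>The action on functions is precomposition with relabeling, so evaluation leads to
  \<open>graft_relabel\<close>. The signs agree because relabeling does not affect planar
  order.\<close>

lemma cocomp_equivariant_governing:
  assumes \<sigma>: "\<sigma> permutes {..<length w}" and \<tau>: "\<tau> permutes {..<length u}" and i: "i < length w"
    and a: "\<phi> \<in> dual_part \<Sigma> R (ins w (\<sigma> i) u) x n"
  shows "tensor_eq C [(permw \<sigma> w, x), (permw \<tau> u, w ! \<sigma> i)]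
            (ten2 (cocomp C (permw \<sigma> w) x i (permw \<tau> u) n (act C (perm_comp (length u) \<sigma> i \<tau>) \<phi>)))
            (ten2 (map (\<lambda>((d, b), (e, c)). ((d, act C \<sigma> b), (e, act C \<tau> c))) (cocomp C w x (\<sigma> i) u n \<phi>)))"
proof (rule tensor_eq2I)
  let ?h = "perm_comp (length u) \<sigma> i \<tau>"
  interpret collection C by (rule collection_governing)
  have si: "\<sigma> i < length w" using i \<sigma> by (simp add: permutes_less)
  have "act C ?h \<phi> \<in> part C (permw ?h (ins w (\<sigma> i) u)) x n"
    by (rule act_closed) (use a perm_comp_permutes[OF \<sigma> \<tau> i] in \<open>auto simp: length_ins[OF si]\<close>)
  then have h: "act C ?h \<phi> \<in> dual_part \<Sigma> R (ins (permw \<sigma> w) i (permw \<tau> u)) x n"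
    by (simp add: permw_perm_comp[OF \<sigma> \<tau> i])
  have i': "i < length (permw \<sigma> w)" using i by simp
  have wi: "permw \<sigma> w ! i = w ! \<sigma> i" using i by simp
  show "a \<in> dual_part \<Sigma> R (permw \<sigma> w) x d \<and> b \<in> dual_part \<Sigma> R (permw \<tau> u) (w ! \<sigma> i) e"
    if "((d, a), (e, b)) \<in> set (cocomp C (permw \<sigma> w) x i (permw \<tau> u) n (act C ?h \<phi>))" for d a e b
    using cocomp_dual[OF i' h that] by (simp add: wi)
  show "a \<in> dual_part \<Sigma> R (permw \<sigma> w) x d \<and> b \<in> dual_part \<Sigma> R (permw \<tau> u) (w ! \<sigma> i) e"
    if m: "((d, a), (e, b)) \<in> set (map (\<lambda>((d, b), (e, c)). ((d, act C \<sigma> b), (e, act C \<tau> c))) (cocomp C w x (\<sigma> i) u n \<phi>))" for d a e b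
  proof -
    from m obtain a' b' where "((d, a'), (e, b')) \<in> set (cocomp C w x (\<sigma> i) u n \<phi>)" "a = act C \<sigma> a'" "b = act C \<tau> b'"
      by auto
    then show ?thesis
      using cocomp_dual[OF si a, of d a' e b'] act_closed[OF \<sigma>, of a' x d] act_closed[OF \<tau>, of b' "w ! \<sigma> i" e] by simp
  qed
  fix d e T S assume T: "T \<in> trees \<Sigma> (permw \<sigma> w) x d" and S: "S \<in> trees \<Sigma> (permw \<tau> u) (w ! \<sigma> i) e"
  have S': "S \<in> trees \<Sigma> (permw \<tau> u) (permw \<sigma> w ! i) e" using S by (simp add: wi)
  have len: "length (leaves S) = length u" "set (labels S) = {..<length u}" using treesD(4,6)[OF S] by auto
  have "(\<Sum>((d, a), (e, b))\<leftarrow>cocomp C (permw \<sigma> w) x i (permw \<tau> u) n (act C ?h \<phi>). a T * b S)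
     = ksign (d * e) * graft_sign \<Sigma> i T S * \<phi> (relabel ?h (graft i T S))"
    using cocomp_eval[OF i' h T S'] by simp
  also have "\<dots> = ksign (d * e) * graft_sign \<Sigma> (\<sigma> i) (relabel \<sigma> T) (relabel \<tau> S) * \<phi> (graft (\<sigma> i) (relabel \<sigma> T) (relabel \<tau> S))"
    using graft_relabel[OF \<sigma>, of \<tau> S i T] \<tau> len
    by (simp add: graft_sign_def deg_after_relabel_permutes[OF \<sigma>])
  also have "\<dots> = (\<Sum>((d, a), (e, b))\<leftarrow>cocomp C w x (\<sigma> i) u n \<phi>. a (relabel \<sigma> T) * b (relabel \<tau> S))"
    by (rule cocomp_eval[OF si a relabel_trees[OF T \<sigma>] relabel_trees[OF S \<tau>], symmetric])
  finally show "(\<Sum>((d, a), (e, b))\<leftarrow>cocomp C (permw \<sigma> w) x i (permw \<tau> u) n (act C ?h \<phi>). a T * b S)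
    = (\<Sum>((d, a), (e, b))\<leftarrow>map (\<lambda>((d, b), (e, c)). ((d, act C \<sigma> b), (e, act C \<tau> c))) (cocomp C w x (\<sigma> i) u n \<phi>). a T * b S)"
    by (simp add: comp_def case_prod_unfold)
qed

lemma lsum_apply: "lsum C fs T = (\<Sum>f\<leftarrow>fs. f T)"
  by (induction fs) (auto simp: lsum_def)

lemma counit_left_governing:
  assumes "\<phi> \<in> dual_part \<Sigma> R u x n"
  shows "lsum C (map (\<lambda>((d, b), (e, c)). counit C x b \<odot>\<^bsub>C\<^esub> c) (cocomp C [x] x 0 u n \<phi>)) = \<phi>"
proof
  fix S
  have \<phi>: "\<phi> \<in> dual_part \<Sigma> R (ins [x] 0 u) x n" using assms by (simp add: ins_def)
  let ?s = "cocomp C [x] x 0 u n \<phi>"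
  have "lsum C (map (\<lambda>((d, b), (e, c)). counit C x b \<odot>\<^bsub>C\<^esub> c) ?s) S = (\<Sum>((d, b), (e, c))\<leftarrow>?s. b (Leaf x 0) * c S)"
    by (simp add: lsum_apply comp_def case_prod_unfold)
  also have "\<dots> = \<phi> S"
  proof (cases "\<exists>e. S \<in> trees \<Sigma> u x e")
    case True
    then obtain e where S: "S \<in> trees \<Sigma> u ([x] ! 0) e" by auto
    show ?thesis
      using cocomp_eval[OF _ \<phi> Leaf_trees S] by (simp add: graft_sign_def deg_after_def)
  next
    case False
    have "(\<Sum>((d, b), (e, c))\<leftarrow>?s. b (Leaf x 0) * c S) = (\<Sum>q\<leftarrow>?s. 0)"
    proof (intro arg_cong[where f = sum_list] map_cong refl, clarify)
      fix d b e c assume "((d, b), (e, c)) \<in> set ?s"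
      then have "c \<in> dual_part \<Sigma> R u ([x] ! 0) e" using cocomp_dual[OF _ \<phi>] by auto
      then show "b (Leaf x 0) * c S = 0" using dual_part_supp False by fastforce
    qed
    then show ?thesis using dual_part_supp[OF assms] False by (simp add: comp_def)
  qed
  finally show "lsum C (map (\<lambda>((d, b), (e, c)). counit C x b \<odot>\<^bsub>C\<^esub> c) ?s) S = \<phi> S" .
qed

lemma counit_right_governing:
  assumes i: "i < length w" and "\<phi> \<in> dual_part \<Sigma> R w x n"
  shows "lsum C (map (\<lambda>((d, b), (e, c)). counit C (w ! i) c \<odot>\<^bsub>C\<^esub> b) (cocomp C w x i [w ! i] n \<phi>)) = \<phi>"
proof
  fix T
  have "ins w i [w ! i] = w" using i by (simp add: ins_def id_take_nth_drop[symmetric])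
  then have \<phi>: "\<phi> \<in> dual_part \<Sigma> R (ins w i [w ! i]) x n" using assms by simp
  let ?s = "cocomp C w x i [w ! i] n \<phi>"
  have "lsum C (map (\<lambda>((d, b), (e, c)). counit C (w ! i) c \<odot>\<^bsub>C\<^esub> b) ?s) T = (\<Sum>((d, b), (e, c))\<leftarrow>?s. b T * c (Leaf (w ! i) 0))"
    by (simp add: lsum_apply comp_def case_prod_unfold mult.commute)
  also have "\<dots> = \<phi> T"
  proof (cases "\<exists>d. T \<in> trees \<Sigma> w x d")
    case True
    then obtain d where T: "T \<in> trees \<Sigma> w x d" by auto
    show ?thesis
      using cocomp_eval[OF i \<phi> T Leaf_trees] by (simp add: graft_sign_def graft_Leaf_right[OF T])
  next
    case False
    have "(\<Sum>((d, b), (e, c))\<leftarrow>?s. b T * c (Leaf (w ! i) 0)) = (\<Sum>q\<leftarrow>?s. 0)"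
    proof (intro arg_cong[where f = sum_list] map_cong refl, clarify)
      fix d b e c assume "((d, b), (e, c)) \<in> set ?s"
      then have "b \<in> dual_part \<Sigma> R w x d" using cocomp_dual[OF i \<phi>] by auto
      then show "b T * c (Leaf (w ! i) 0) = 0" using dual_part_supp False by fastforce
    qed
    then show ?thesis using dual_part_supp[OF assms(2)] False by (simp add: comp_def)
  qed
  finally show "lsum C (map (\<lambda>((d, b), (e, c)). counit C (w ! i) c \<odot>\<^bsub>C\<^esub> b) ?s) T = \<phi> T" .
qed

theorem cooperad_governing: "cooperad C"
proof (rule cooperad.intro[OF collection_governing], rule cooperad_axioms.intro, goal_cases)
  case (3 a x d)
  then show ?case using dual_part_degree[of a \<Sigma> R "[x]" x d "Leaf x 0" "[x]" x 0] Leaf_trees[of x \<Sigma>] by auto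
next
  case (4 x)
  then show ?case using coaug_dual by simp
next
  case (6 i w u x)
  then show ?case by (rule cocomp_coaug_governing)
next
  case (7 i w a u x n d b e c)
  then show ?case using cocomp_dual[OF 7(1), of a u x n d b e c] by simp
next
  case (8 i w a u x n b)
  then have a: "a \<in> dual_part \<Sigma> R (ins w i u) x n" and b: "b \<in> dual_part \<Sigma> R (ins w i u) x n" by auto
  show ?case
  proof (rule tensor_eq2I)
    fix d e T S assume T: "T \<in> trees \<Sigma> w x d" and S: "S \<in> trees \<Sigma> u (w ! i) e"
    show "(\<Sum>((d, a), (e, b))\<leftarrow>cocomp C w x i u n (a \<oplus>\<^bsub>C\<^esub> b). a T * b S)
        = (\<Sum>((d, a), (e, b))\<leftarrow>cocomp C w x i u n a @ cocomp C w x i u n b. a T * b S)"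
      using cocomp_eval[OF 8(1) dual_part_add[OF a b] T S] cocomp_eval[OF 8(1) a T S] cocomp_eval[OF 8(1) b T S]
      by (simp add: distrib_left)
  qed (use 8(1) a b dual_part_add[OF a b] in \<open>auto dest: cocomp_dual(1,2)\<close>)
next
  case (9 i w a u x n t)
  then have a: "a \<in> dual_part \<Sigma> R (ins w i u) x n" by auto
  show ?case
  proof (rule tensor_eq2I)
    fix d e T S assume T: "T \<in> trees \<Sigma> w x d" and S: "S \<in> trees \<Sigma> u (w ! i) e"
    have "(\<Sum>((d, a), (e, b))\<leftarrow>map (\<lambda>((d, b), q). ((d, t \<odot>\<^bsub>C\<^esub> b), q)) (cocomp C w x i u n a). a T * b S)
       = t * (\<Sum>((d, a), (e, b))\<leftarrow>cocomp C w x i u n a. a T * b S)"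
      by (simp add: comp_def case_prod_unfold mult.assoc sum_list_const_mult)
    then show "(\<Sum>((d, a), (e, b))\<leftarrow>cocomp C w x i u n (t \<odot>\<^bsub>C\<^esub> a). a T * b S)
        = (\<Sum>((d, a), (e, b))\<leftarrow>map (\<lambda>((d, b), q). ((d, t \<odot>\<^bsub>C\<^esub> b), q)) (cocomp C w x i u n a). a T * b S)"
      using cocomp_eval[OF 9(1) dual_part_scale[OF a] T S, of t] cocomp_eval[OF 9(1) a T S] by (simp add: mult_ac)
  next
    fix d b e c assume "((d, b), (e, c)) \<in> set (cocomp C w x i u n (t \<odot>\<^bsub>C\<^esub> a))"
    then show "b \<in> dual_part \<Sigma> R w x d \<and> c \<in> dual_part \<Sigma> R u (w ! i) e"
      using cocomp_dual[OF 9(1) dual_part_scale[OF a]] by simp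
  next
    fix d b e c assume "((d, b), (e, c)) \<in> set (map (\<lambda>((d, b), q). ((d, t \<odot>\<^bsub>C\<^esub> b), q)) (cocomp C w x i u n a))"
    then show "b \<in> dual_part \<Sigma> R w x d \<and> c \<in> dual_part \<Sigma> R u (w ! i) e"
      using cocomp_dual[OF 9(1) a] by (auto intro!: dual_part_scale)
  qed
next
  case (10 a u x n)
  then show ?case using counit_left_governing by simp
next
  case (11 i w a x n)
  then show ?case using counit_right_governing by simp
next
  case (12 i w j u a v x n)
  then show ?case using cocomp_sequential_governing by simp
next
  case (13 i k w a v u x n)
  then show ?case using cocomp_parallel_governing[OF 13(1,2)] by simp
next
  case (14 \<sigma> w \<tau> u i a x n)
  then show ?case using cocomp_equivariant_governing[OF 14(1-3)] by simp
qed auto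

end

section \<open>The cooperads of S- and OC-coalgebras\<close>

lemma signature_simps [simp]:
  "gens S_signature = UNIV" "gens OC_signature = {Delta_c, Delta_o, rho}"
  "in_cols OC_signature = in_cols S_signature" "out_col OC_signature = out_col S_signature"
  "gdeg OC_signature = gdeg S_signature"
  by (simp_all add: S_signature_def OC_signature_def)

lemma in_OC_gens: "g \<in> gens OC_signature \<longleftrightarrow> g \<noteq> delta_c"
  by (cases g) auto

lemma root_col_OC [simp]: "root_col OC_signature = root_col S_signature"
proof
  show "root_col OC_signature T = root_col S_signature T" for T by (cases T) auto
qed

lemma tdeg_OC [simp]: "tdeg OC_signature = tdeg S_signature"
proof
  show "tdeg OC_signature T = tdeg S_signature T" for T by (induction T) (auto cong: map_cong)
qed

lemma wf_tree_OC: "wf_tree OC_signature T \<longleftrightarrow> wf_tree S_signature T \<and> delta_c \<notin> set_tree T"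
proof (induction T)
  case (Node g ts)
  show ?case using Node in_OC_gens[of g] by (auto simp: list_all_iff)
qed auto

lemma trees_OC: "T \<in> trees OC_signature w x d \<longleftrightarrow> T \<in> trees S_signature w x d \<and> delta_c \<notin> set_tree T"
  by (auto simp: trees_def wf_tree_OC)

lemma deg_after_OC [simp]: "deg_after OC_signature i T = deg_after S_signature i T"
  by (simp add: deg_after_def)

lemma free_comp_OC: "free_comp OC_signature = (free_comp S_signature :: nat \<Rightarrow> (_ \<Rightarrow>\<^sub>0 'k::field) \<Rightarrow> _)"
proof -
  have "graft_sign OC_signature = (graft_sign S_signature :: _ \<Rightarrow> _ \<Rightarrow> _ \<Rightarrow> 'k)"
    by (intro ext) (simp add: graft_sign_def)
  then show ?thesis by (intro ext) (simp only: free_comp_def root_col_OC)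
qed

section \<open>Removing the trees that contain the cobracket\<close>

lemma set_tree_relabel [simp]: "set_tree (relabel \<pi> T) = set_tree T"
  by (induction T) auto

lemma set_tree_graft: "i \<in> set (labels T) \<Longrightarrow> set_tree (graft i T S) = set_tree T \<union> set_tree S"
proof -
  have "set_tree (plug i S' m T) = set_tree T \<union> (if i \<in> set (labels T) then set_tree S' else {})" for S' m
    by (induction T) (auto split: if_splits)
  then show "i \<in> set (labels T) \<Longrightarrow> ?thesis" by (simp add: graft_def)
qed

text \<open>The projection of free operads that sends the cobracket to zero. Its transpose extends
  functions on OC trees by zero.\<close>

definition oc_proj :: "(cooperation tree \<Rightarrow>\<^sub>0 'k::field) \<Rightarrow> cooperation tree \<Rightarrow>\<^sub>0 'k" where
  "oc_proj = lin_ext (\<lambda>T. if delta_c \<notin> set_tree T then mon T else 0)"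

lemma oc_proj_single [simp]:
  "oc_proj (Poly_Mapping.single T c) = (if delta_c \<notin> set_tree T then Poly_Mapping.single T c else 0)"
  by (simp add: oc_proj_def)

lemmas oc_proj_linear = lin_ext_linear[of "\<lambda>T. if delta_c \<notin> set_tree T then mon T else 0", folded oc_proj_def]

lemma oc_proj_zero [simp]: "oc_proj 0 = 0"
  by (simp add: oc_proj_def)

lemma oc_proj_free_act: "oc_proj (free_act \<sigma> r) = free_act \<sigma> (oc_proj r)"
  unfolding oc_proj_def free_act_def lin_ext_lin_ext
  by (rule lin_ext_cong) auto

text \<open>A graft contains \<open>delta_c\<close> exactly if one of its factors does, so killing
  such trees is multiplicative.\<close>

lemma oc_proj_free_comp:
  "oc_proj (free_comp S_signature i a b) = free_comp S_signature i (oc_proj a) (oc_proj b)"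
proof -
  have *: "(i, c) \<in> set (leaves T) \<Longrightarrow> set_tree (graft i T S) = set_tree T \<union> set_tree S" for c and T S :: "cooperation tree"
    by (rule set_tree_graft) (force simp: labels_def)
  show ?thesis
    unfolding oc_proj_def free_comp_def lin_ext_lin_ext
  proof (rule lin_ext_cong)
    let ?p = "\<lambda>T. if delta_c \<notin> set_tree T then mon T else 0"
    let ?f = "\<lambda>T S. if (i, root_col S_signature S) \<in> set (leaves T)
        then Poly_Mapping.single (graft i T S) (graft_sign S_signature i T S) else 0"
    fix T
    show "lin_ext (\<lambda>S. lin_ext ?p (?f T S)) b = lin_ext (\<lambda>T. lin_ext (\<lambda>S. lin_ext (?f T) (?p S)) b) (?p T)"
    proof (cases "delta_c \<in> set_tree T")
      case True
      then have "lin_ext (\<lambda>S. lin_ext ?p (?f T S)) b = lin_ext (\<lambda>S. 0) b"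
        by (intro lin_ext_cong) (auto simp: *)
      then show ?thesis using True by simp
    next
      case False
      then show ?thesis by (auto simp: * intro!: lin_ext_cong)
    qed
  qed
qed

lemma oc_proj_OC_relations: "r \<in> OC_relations \<Longrightarrow> oc_proj r = r"
  by (auto simp: OC_relations_def Let_def oc_proj_linear)

lemma oc_proj_keys: "oc_proj r = r \<Longrightarrow> T \<in> Poly_Mapping.keys r \<Longrightarrow> delta_c \<notin> set_tree T"
  using keys_lin_ext[of T "\<lambda>T. if delta_c \<notin> set_tree T then mon T else 0" r]
  by (auto simp: oc_proj_def split: if_splits)

lemma oc_proj_S_relations: "r \<in> S_relations \<Longrightarrow> r \<notin> OC_relations \<Longrightarrow> oc_proj r = 0"
  by (auto simp: S_relations_def Let_def oc_proj_linear)

text \<open>On the given relations, \<open>oc_proj\<close> is the identity for those of OC and zero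
  for the others. Closure operations are respected since a composition with a tree containing
  \<open>delta_c\<close> is projected to zero.\<close>

lemma oc_proj_ideal:
  "rel_ideal S_signature S_relations w x d r \<Longrightarrow> rel_ideal OC_signature OC_relations w x d (oc_proj r)"
proof (induction rule: rel_ideal.induct)
  case (gen r w x d)
  show ?case
  proof (cases "r \<in> OC_relations")
    case True
    have "Poly_Mapping.keys r \<subseteq> trees OC_signature w x d"
      using gen(2) oc_proj_keys[OF oc_proj_OC_relations[OF True]] by (auto simp: trees_OC)
    then show ?thesis using True by (simp add: oc_proj_OC_relations rel_ideal.gen)
  next
    case False
    then show ?thesis using gen(1) by (simp add: oc_proj_S_relations rel_ideal.zero)
  qed
next
  case (comp_left w x d r i S u e)
  show ?case
  proof (cases "delta_c \<in> set_tree S")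
    case True
    then show ?thesis by (simp add: oc_proj_free_comp rel_ideal.zero)
  next
    case False
    then show ?thesis
      using rel_ideal.comp_left[OF comp_left.IH comp_left.hyps(2), of S u e] comp_left.hyps(3)
      by (simp add: oc_proj_free_comp trees_OC free_comp_OC)
  qed
next
  case (comp_right T w x d i u e r)
  show ?case
  proof (cases "delta_c \<in> set_tree T")
    case True
    then show ?thesis by (simp add: oc_proj_free_comp rel_ideal.zero)
  next
    case False
    then show ?thesis
      using rel_ideal.comp_right[of T OC_signature w x d i, OF _ comp_right.hyps(2) comp_right.IH] comp_right.hyps(1)
      by (simp add: oc_proj_free_comp trees_OC free_comp_OC)
  qed
qed (auto simp: oc_proj_linear oc_proj_free_act intro: rel_ideal.intros)

lemma OC_ideal_S: "rel_ideal OC_signature OC_relations w x d r \<Longrightarrow> rel_ideal S_signature S_relations w x d r"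
proof (induction rule: rel_ideal.induct)
  case (gen r w x d)
  then show ?case by (intro rel_ideal.gen) (auto simp: S_relations_def trees_OC)
next
  case (comp_left w x d r i S u e)
  then show ?case by (simp add: rel_ideal.comp_left trees_OC free_comp_OC)
next
  case (comp_right T w x d i u e r)
  then show ?case by (simp add: rel_ideal.comp_right trees_OC free_comp_OC)
qed (auto intro: rel_ideal.intros)

text \<open>A function supported on trees without \<open>delta_c\<close> does not distinguish
  \<open>r\<close> from \<open>oc_proj r\<close>, and the latter is an ideal element for OC.\<close>

lemma dual_part_OC_S:
  "(dual_part OC_signature OC_relations w x d :: (cooperation tree \<Rightarrow> 'k::field) set) \<subseteq> dual_part S_signature S_relations w x d"
proof
  fix \<phi> :: "cooperation tree \<Rightarrow> 'k::field"
  assume \<phi>: "\<phi> \<in> dual_part OC_signature OC_relations w x d"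
  have "pairing \<phi> r = 0" if r: "rel_ideal S_signature S_relations w x (- d) r" for r
  proof -
    have "pairing \<phi> r = pairing \<phi> (oc_proj r)"
      unfolding oc_proj_def pairing_lin_ext
      by (rule pairing_cong) (use dual_part_supp[OF \<phi>] trees_OC in auto)
    also have "\<dots> = 0" using oc_proj_ideal[OF r] \<phi> by (auto simp: dual_part_def)
    finally show ?thesis .
  qed
  then show "\<phi> \<in> dual_part S_signature S_relations w x d"
    using dual_part_supp[OF \<phi>] by (auto simp: dual_part_def trees_OC)
qed

text \<open>The transpose of the inclusion of the free operad on the generators of OC. As this
  inclusion maps ideal to ideal, the restriction preserves dual elements and is a left inverse of
  the extension by zero.\<close>

definition oc_restrict :: "(cooperation tree \<Rightarrow> 'k::field) \<Rightarrow> cooperation tree \<Rightarrow> 'k" where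
  "oc_restrict \<phi> = (\<lambda>T. if delta_c \<notin> set_tree T then \<phi> T else 0)"

lemma oc_restrict_dual:
  assumes "\<phi> \<in> dual_part S_signature S_relations w x d"
  shows "oc_restrict \<phi> \<in> dual_part OC_signature OC_relations w x d"
proof -
  have "pairing (oc_restrict \<phi>) r = 0" if r: "rel_ideal OC_signature OC_relations w x (- d) r" for r
  proof -
    have "pairing (oc_restrict \<phi>) r = pairing \<phi> r"
      by (rule pairing_cong) (use rel_ideal_homog[OF r] in \<open>auto simp: homog_def trees_OC oc_restrict_def\<close>)
    then show ?thesis using OC_ideal_S[OF r] assms by (auto simp: dual_part_def)
  qed
  then show ?thesis
    using dual_part_supp[OF assms] by (auto simp: dual_part_def trees_OC oc_restrict_def)
qed

lemma oc_restrict_OC: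
  assumes "\<phi> \<in> dual_part OC_signature OC_relations w x d"
  shows "oc_restrict \<phi> = \<phi>"
  using dual_part_supp[OF assms] by (auto simp: trees_OC oc_restrict_def fun_eq_iff)


section \<open>Finiteness of the set of trees of a profile\<close>

primrec nodes :: "'g tree \<Rightarrow> nat" where
  "nodes (Leaf c j) = 0"
| "nodes (Node g ts) = Suc (sum_list (map nodes ts))"

text \<open>With \<open>l\<close> leaves there are \<open>l - 1\<close> binary vertices. The only
  unary generator \<open>rho\<close> leads from closed to open and no generator leads back, so the
  subtrees above the \<open>rho\<close> vertices are disjoint and there are at most \<open>l\<close>
  of these; a closed tree has none.\<close>

lemma nodes_S_tree:
  assumes "wf_tree S_signature T"
  shows "length (leaves T) \<ge> 1 \<and> nodes T + 1 \<le> (if root_col S_signature T = Closed then length (leaves T) else 2 * length (leaves T))"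
  using assms
proof (induction T)
  case (Node g ts)
  have cols: "map (root_col S_signature) ts = in_cols S_signature g"
    and wf: "\<And>t. t \<in> set ts \<Longrightarrow> wf_tree S_signature t"
    using Node.prems by (auto simp: list_all_iff)
  show ?case
  proof (cases "g = rho")
    case True
    then obtain t where t: "ts = [t]" "root_col S_signature t = Closed"
      using cols by (auto simp: S_signature_def)
    then show ?thesis using Node.IH[of t] wf[of t] True by (auto simp: S_signature_def)
  next
    case False
    then have "length (in_cols S_signature g) = 2" by (cases g) (auto simp: S_signature_def)
    then have "length ts = 2" using arg_cong[OF cols, of length] by simp
    then obtain s t where ts: "ts = [s, t]" by (auto simp: numeral_2_eq_2 length_Suc_conv)
    have c: "root_col S_signature s = out_col S_signature g" "root_col S_signature t = out_col S_signature g"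
      using cols False ts by (cases g; simp add: S_signature_def)+
    show ?thesis using Node.IH[of s] Node.IH[of t] wf[of s] wf[of t] c ts by (auto split: if_splits)
  qed
qed auto

text \<open>A finite set that contains all trees with at most \<open>h\<close> vertices of arity at
  most 2 and labels below \<open>n\<close>; the number of vertices also bounds the height.\<close>

fun bounded_trees :: "nat \<Rightarrow> nat \<Rightarrow> 'g tree set" where
  "bounded_trees n 0 = (\<lambda>(c, j). Leaf c j) ` (UNIV \<times> {..<n})"
| "bounded_trees n (Suc h) = (\<lambda>(c, j). Leaf c j) ` (UNIV \<times> {..<n})
     \<union> (\<lambda>(g, ts). Node g ts) ` (UNIV \<times> {ts. set ts \<subseteq> bounded_trees n h \<and> length ts \<le> 2})"

lemma finite_color: "finite (UNIV :: color set)"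
proof -
  have "(UNIV :: color set) = {Closed, Open}" using color.exhaust by blast
  then show ?thesis by (metis finite.simps)
qed

lemma finite_bounded_trees: "finite (UNIV :: 'g set) \<Longrightarrow> finite (bounded_trees n h :: 'g tree set)"
  by (induction h) (auto intro!: finite_imageI finite_cartesian_product finite_color finite_lists_length_le)

lemma tree_bounded:
  assumes "wf_tree S_signature T" "set (labels T) \<subseteq> {..<n}" "nodes T \<le> h"
  shows "T \<in> bounded_trees n h"
  using assms
proof (induction T arbitrary: h)
  case (Leaf c j)
  then show ?case by (cases h) auto
next
  case (Node g ts)
  then obtain h' where h: "h = Suc h'" by (cases h) auto
  have "length ts = length (in_cols S_signature g)"
    using Node.prems(1) by (metis length_map wf_tree.simps(2))
  then have len: "length ts \<le> 2" by (cases g) (auto simp: S_signature_def)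
  have "t \<in> bounded_trees n h'" if t: "t \<in> set ts" for t
  proof (rule Node.IH[OF t])
    have "nodes t \<le> sum_list (map nodes ts)" using t by (simp add: member_le_sum_list)
    then show "nodes t \<le> h'" using Node.prems(3) h by simp
  qed (use Node.prems t in \<open>auto simp: list_all_iff\<close>)
  then show ?case using len h by auto
qed

lemma finite_S_trees: "finite (\<Union>d. trees S_signature w x d)"
proof (rule finite_subset)
  have "(UNIV :: cooperation set) = {Delta_c, delta_c, Delta_o, rho}" using cooperation.exhaust by blast
  then have "finite (UNIV :: cooperation set)" by (metis finite.simps)
  then show "finite (bounded_trees (length w) (2 * length w) :: cooperation tree set)"
    by (rule finite_bounded_trees)
  show "(\<Union>d. trees S_signature w x d) \<subseteq> bounded_trees (length w) (2 * length w)"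
  proof
    fix T assume "T \<in> (\<Union>d. trees S_signature w x d)"
    then obtain d where "T \<in> trees S_signature w x d" by auto
    note T = treesD[OF this]
    show "T \<in> bounded_trees (length w) (2 * length w)"
      by (rule tree_bounded[OF T(1)]) (use T nodes_S_tree[OF T(1)] in \<open>auto split: if_splits\<close>)
  qed
qed

lemma keys_relations_no_leaf:
  assumes "r \<in> S_relations" "T \<in> Poly_Mapping.keys r"
  shows "\<not> is_leaf T"
proof -
  have "Poly_Mapping.lookup r (Leaf c j) = 0" for c j
    using assms(1) by (auto simp: S_relations_def OC_relations_def Let_def lookup_add lookup_minus lookup_single)
  then show ?thesis using assms(2) by (auto simp: is_leaf_def in_keys_iff)
qed

interpretation S: finite_presentation S_signature "S_relations :: (cooperation tree \<Rightarrow>\<^sub>0 'k::field) set"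
  by unfold_locales (use finite_S_trees keys_relations_no_leaf in auto)

interpretation OC: finite_presentation OC_signature "OC_relations :: (cooperation tree \<Rightarrow>\<^sub>0 'k::field) set"
proof
  show "finite (\<Union>d. trees OC_signature w x d)" for w x
    by (rule finite_subset[OF _ finite_S_trees[of w x]]) (auto simp: trees_OC)
  show "r \<in> OC_relations \<Longrightarrow> T \<in> Poly_Mapping.keys r \<Longrightarrow> \<not> is_leaf T" for r :: "cooperation tree \<Rightarrow>\<^sub>0 'k" and T
    by (rule keys_relations_no_leaf[of r]) (auto simp: S_relations_def)
qed

lemma cooperad_S: "cooperad (S_cooperad :: ('k::field, cooperation tree \<Rightarrow> 'k) cooperad)"
  unfolding S_cooperad_def by (rule S.cooperad_governing)

lemma cooperad_OC: "cooperad (OC_cooperad :: ('k::field, cooperation tree \<Rightarrow> 'k) cooperad)"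
  unfolding OC_cooperad_def by (rule OC.cooperad_governing)

text \<open>The two cocompositions are chosen independently and may be different lists. They are
  compared as tensors over S, by evaluation at trees.\<close>

theorem subcooperad_OC_S:
  "subcooperad (OC_cooperad :: ('k::field, cooperation tree \<Rightarrow> 'k) cooperad) S_cooperad"
proof -
  have coc: "tensor_eq S_cooperad [(w, x), (u, w ! i)]
      (ten2 (cocomp OC_cooperad w x i u n \<phi>)) (ten2 (cocomp S_cooperad w x i u n \<phi>))"
    if i: "i < length w" and \<phi>: "\<phi> \<in> dual_part OC_signature OC_relations (ins w i u) x n"
    for w x i u n and \<phi> :: "cooperation tree \<Rightarrow> 'k"
    unfolding S_cooperad_def OC_cooperad_def
  proof (rule S.tensor_eq2I)
    have \<phi>S: "\<phi> \<in> dual_part S_signature S_relations (ins w i u) x n" using \<phi> dual_part_OC_S by blast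
    show "a \<in> dual_part S_signature S_relations w x d \<and> b \<in> dual_part S_signature S_relations u (w ! i) e"
      if "((d, a), (e, b)) \<in> set (cocomp OC.C w x i u n \<phi>)" for d a e b
      using OC.cocomp_dual[OF i \<phi> that] dual_part_OC_S by blast
    show "a \<in> dual_part S_signature S_relations w x d \<and> b \<in> dual_part S_signature S_relations u (w ! i) e"
      if "((d, a), (e, b)) \<in> set (cocomp S.C w x i u n \<phi>)" for d a e b
      using S.cocomp_dual[OF i \<phi>S that] by blast
    fix d e T U assume T: "T \<in> trees S_signature w x d" and U: "U \<in> trees S_signature u (w ! i) e"
    show "(\<Sum>((d, a), (e, b))\<leftarrow>cocomp OC.C w x i u n \<phi>. a T * b U) = (\<Sum>((d, a), (e, b))\<leftarrow>cocomp S.C w x i u n \<phi>. a T * b U)"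
    proof (cases "delta_c \<in> set_tree T \<union> set_tree U")
      case False
      then have "T \<in> trees OC_signature w x d" "U \<in> trees OC_signature u (w ! i) e" using T U by (auto simp: trees_OC)
      then show ?thesis
        unfolding OC.cocomp_eval[OF i \<phi> \<open>T \<in> trees OC_signature w x d\<close> \<open>U \<in> trees OC_signature u (w ! i) e\<close>]
          S.cocomp_eval[OF i \<phi>S T U]
        by (simp add: graft_sign_def)
    next
      \<comment> \<open>If the cobracket occurs in one of the trees, it occurs in the graft. Then
        both sides vanish, on the OC side termwise.\<close>
      case True
      have "i \<in> set (labels T)" using treesD(6)[OF T] i by simp
      then have "delta_c \<in> set_tree (graft i T U)" using True by (simp add: set_tree_graft)
      then have "\<phi> (graft i T U) = 0" using dual_part_supp[OF \<phi>] by (auto simp: trees_OC)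
      moreover have "(\<Sum>((d, a), (e, b))\<leftarrow>cocomp OC.C w x i u n \<phi>. a T * b U) = (\<Sum>q\<leftarrow>cocomp OC.C w x i u n \<phi>. 0)"
      proof (intro arg_cong[where f = sum_list] map_cong refl, clarify)
        fix d a e b assume m: "((d, a), (e, b)) \<in> set (cocomp OC.C w x i u n \<phi>)"
        show "a T * b U = 0"
          using True dual_part_supp[OF OC.cocomp_dual(1)[OF i \<phi> m], of T] dual_part_supp[OF OC.cocomp_dual(2)[OF i \<phi> m], of U]
          by (auto simp: trees_OC)
      qed
      ultimately show ?thesis
        unfolding S.cocomp_eval[OF i \<phi>S T U] by (simp add: comp_def)
    qed
  qed
  show ?thesis
    unfolding subcooperad_def
    using cooperad_S cooperad_OC coc dual_part_OC_S
    by (auto simp: S_cooperad_def OC_cooperad_def intro: subsetD[OF dual_part_OC_S])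
qed

section \<open>The cobar differential\<close>

lemma keys_addD: "T \<in> Poly_Mapping.keys (a + b) \<Longrightarrow> T \<in> Poly_Mapping.keys a \<or> T \<in> Poly_Mapping.keys b"
  using keys_add[of a b] by blast

section \<open>Signs of unshuffles\<close>

lemma mset_nths_compl: "mset (nths xs J @ nths xs (- J)) = mset xs"
proof (induction xs arbitrary: J)
  case (Cons x xs)
  have "{j. Suc j \<in> - J} = - {j. Suc j \<in> J}" by auto
  then show ?case using Cons[of "{j. Suc j \<in> J}"] by (auto simp: nths_Cons)
qed auto

lemma sum_list_nths_compl:
  "sum_list (map f (nths xs J)) + sum_list (map f (nths xs (- J))) = (sum_list (map f xs) :: int)"
  using arg_cong[OF mset_nths_compl[of xs J], of "\<lambda>M. sum_mset (image_mset f M)"]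
  by (simp flip: sum_mset_sum_list)

lemma sum_list_nths: "sum_list (nths ds J) = (\<Sum>j<length ds. if j \<in> J then ds ! j else 0 :: int)"
  by (induction ds arbitrary: J) (auto simp: nths_Cons sum.lessThan_Suc_shift simp del: sum.lessThan_Suc cong: if_cong)

text \<open>The exponent of \<open>unshuffle_sign\<close>, kept as an integer so that its dependence
  on one of the degrees can be computed additively.\<close>

definition inversions :: "int list \<Rightarrow> nat set \<Rightarrow> int" where
  "inversions ds J = (\<Sum>(i, j) | i < j \<and> j < length ds \<and> i \<notin> J \<and> j \<in> J. ds ! i * ds ! j)"

lemma inversions_altdef:
  "inversions ds J = (\<Sum>i<length ds. \<Sum>j<length ds. if i < j \<and> i \<notin> J \<and> j \<in> J then ds ! i * ds ! j else 0)"
proof -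
  have "inversions ds J = (\<Sum>(i, j)\<in>{..<length ds} \<times> {..<length ds}.
      if i < j \<and> i \<notin> J \<and> j \<in> J then ds ! i * ds ! j else 0)"
    unfolding inversions_def by (rule sum.mono_neutral_cong_left) (auto split: if_splits)
  then show ?thesis by (simp add: sum.cartesian_product)
qed

lemma inversions_Cons:
  "inversions (d # ds) J = (if 0 \<in> J then 0 else d * sum_list (nths ds {j. Suc j \<in> J}))
     + inversions ds {j. Suc j \<in> J}"
proof -
  have "(\<Sum>j<length ds. if Suc j \<in> J then d * ds ! j else 0) = d * sum_list (nths ds {j. Suc j \<in> J})"
    by (simp add: sum_list_nths sum_distrib_left if_distrib cong: if_cong)
  then show ?thesis
    unfolding inversions_altdef
    by (simp add: sum.lessThan_Suc_shift del: sum.lessThan_Suc cong: if_cong)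
qed

lemma sum_list_nths_update:
  "sum_list (nths (A @ (d + s) # B) J) = sum_list (nths (A @ d # B) J) + (if length A \<in> J then s else 0 :: int)"
  by (induction A arbitrary: J) (auto simp: nths_Cons)

text \<open>The entry at position \<open>length A\<close> is passed by the earlier entries outside
  \<open>J\<close> if it belongs to \<open>J\<close>, and otherwise by the later entries inside
  \<open>J\<close>.\<close>

lemma inversions_update:
  "inversions (A @ (d + s) # B) J = inversions (A @ d # B) J
     + s * (if length A \<in> J then sum_list (nths A (- J)) else sum_list (nths B {j. j + Suc (length A) \<in> J}))"
proof (induction A arbitrary: J)
  case Nil
  then show ?case by (simp add: inversions_Cons algebra_simps)
next
  case (Cons a A)
  have "{j. Suc j \<in> - J} = - {j. Suc j \<in> J}" by auto
  then show ?case
    using Cons[of "{j. Suc j \<in> J}"]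
    by (simp add: inversions_Cons sum_list_nths_update nths_Cons) (auto simp: algebra_simps)
qed

lemma unshuffle_sign_inversions: "unshuffle_sign ds J = ksign (inversions ds J)"
  by (simp add: unshuffle_sign_def inversions_def)

definition unshuffle_list :: "nat \<Rightarrow> nat set \<Rightarrow> nat list" where
  "unshuffle_list n J = nths [0..<n] J @ nths [0..<n] (- J)"

lemma unshuffle_list: "mset (unshuffle_list n J) = mset [0..<n]" "length (unshuffle_list n J) = n"
  "distinct (unshuffle_list n J)" "set (unshuffle_list n J) = {..<n}"
proof -
  show m: "mset (unshuffle_list n J) = mset [0..<n]" unfolding unshuffle_list_def by (rule mset_nths_compl)
  show "length (unshuffle_list n J) = n" using mset_eq_length[OF m] by simp
  show "distinct (unshuffle_list n J)" using mset_eq_imp_distinct_iff[OF m] by simp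
  show "set (unshuffle_list n J) = {..<n}" using mset_eq_setD[OF m] by (simp add: atLeast0LessThan)
qed

lemma map_unshuffle: "map (unshuffle n J) [0..<n] = unshuffle_list n J"
  by (rule nth_equalityI) (auto simp: unshuffle_list, simp add: unshuffle_def unshuffle_list_def)

lemma permutes_list:
  assumes "distinct (map \<sigma> [0..<n])" "set (map \<sigma> [0..<n]) = {..<n}" "\<And>j. j \<ge> n \<Longrightarrow> \<sigma> j = j"
  shows "\<sigma> permutes {..<n}"
proof (rule bij_imp_permutes)
  show "bij_betw \<sigma> {..<n} {..<n}"
    using assms(1,2) by (auto simp: bij_betw_def distinct_map atLeast0LessThan)
qed (use assms(3) in auto)

lemma unshuffle_permutes: "unshuffle n J permutes {..<n}"
  by (rule permutes_list) (auto simp only: map_unshuffle unshuffle_list, simp add: unshuffle_def)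

lemma permw_unshuffle: "permw (unshuffle (length w) J) w = nths w J @ nths w (- J)"
proof -
  have "permw (unshuffle (length w) J) w = map ((!) w) (map (unshuffle (length w) J) [0..<length w])"
    by (simp add: permw_def)
  also have "\<dots> = nths (map ((!) w) [0..<length w]) J @ nths (map ((!) w) [0..<length w]) (- J)"
    unfolding map_unshuffle by (simp add: unshuffle_list_def nths_map)
  finally show ?thesis by (simp add: map_nth)
qed

lemma sum_list_incr: "k < length xs \<Longrightarrow> sum_list (xs[k := xs ! k + 1]) = sum_list xs + (1::int)"
  by (induction xs arbitrary: k) (auto split: nat.splits)

lemma ins_Cons_0: "ins (y # v) 0 u = u @ v"
  by (simp add: ins_def)

lemma deg_after_Node:
  assumes "\<And>a. a \<in> set A \<Longrightarrow> i \<notin> set (labels a)" "i \<in> set (labels t)"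
  shows "deg_after \<Sigma> i (Node g (A @ t # B)) = deg_after \<Sigma> i t + sum_list (map (tdeg \<Sigma>) B)"
proof -
  let ?p = "\<lambda>s. s \<noteq> Inr i"
  have A: "\<forall>s \<in> set (concat (map preorder A)). ?p s"
    using assms(1) set_labels_preorder by fastforce
  have t: "\<exists>s. s \<in> set (preorder t) \<and> \<not> ?p s"
    using assms(2) set_labels_preorder by auto
  have "dropWhile ?p (preorder (Node g (A @ t # B))) = dropWhile ?p (preorder t) @ concat (map preorder B)"
  proof -
    obtain s where s: "s \<in> set (preorder t)" "\<not> ?p s" using t by blast
    have "preorder (Node g (A @ t # B)) = (Inl g # concat (map preorder A)) @ (preorder t @ concat (map preorder B))"
      by simp
    moreover have "\<And>s. s \<in> set (Inl g # concat (map preorder A)) \<Longrightarrow> ?p s" using A by auto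
    ultimately show ?thesis
      using dropWhile_append2[of "Inl g # concat (map preorder A)" ?p] dropWhile_append1[of s _ ?p, OF s] by metis
  qed
  then show ?thesis by (simp add: deg_after_pdeg pdeg_concat comp_def)
qed

lemma length_nths_compl: "length (nths xs J) + length (nths xs (- J)) = length xs"
  using arg_cong[OF mset_nths_compl[of xs J], of size] by simp

section \<open>The differential on trees and its Leibniz rule\<close>

context cooperad
begin

abbreviation Sg :: "'a cobar_gen signature" where
  "Sg \<equiv> cobar_signature C"

lemma cobar_simps [simp]:
  "g \<in> gens Sg \<longleftrightarrow> (case g of (w, x, d, a) \<Rightarrow> a \<in> part C w x d \<and> (w = [x] \<longrightarrow> counit C x a = 0))"
  "in_cols Sg (w, x, d, a) = w" "out_col Sg (w, x, d, a) = x" "gdeg Sg (w, x, d, a) = d + 1"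
  by (auto simp: cobar_signature_def)

lemma part_subgroup: "subgroup (part C w x d) (add_monoid C)"
  using part_submodule by (rule submodule.axioms)

lemma part_carrier: "a \<in> part C w x d \<Longrightarrow> a \<in> carrier C"
  using subgroup.subset[OF part_subgroup] by auto

lemma part_add: "a \<in> part C w x d \<Longrightarrow> b \<in> part C w x d \<Longrightarrow> a \<oplus> b \<in> part C w x d"
  using subgroup.m_closed[OF part_subgroup] by simp

lemma part_zero: "\<zero> \<in> part C w x d"
  using subgroup.one_closed[OF part_subgroup] by simp

lemma part_smult: "a \<in> part C w x d \<Longrightarrow> c \<odot> a \<in> part C w x d"
  using submodule.smult_closed[OF part_submodule] by (simp add: scalars_def)

lemma minus_smult: "a \<in> carrier C \<Longrightarrow> \<ominus> a = (- 1) \<odot> a"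
proof -
  assume a: "a \<in> carrier C"
  have "\<ominus>\<^bsub>scalars\<^esub> (1 :: 'k) = - 1"
    by (rule R.minus_equality) (simp_all add: scalars_def)
  then show ?thesis
    using smult_l_minus[of 1 a] smult_one[of a] a by (simp add: scalars_def)
qed

lemma part_minus: "a \<in> part C w x d \<Longrightarrow> b \<in> part C w x d \<Longrightarrow> a \<ominus> b \<in> part C w x d"
  unfolding a_minus_def by (simp add: minus_smult part_carrier part_add part_smult)

lemma smult_zero: "a \<in> carrier C \<Longrightarrow> 0 \<odot> a = \<zero>"
  using smult_l_null[of a] by (simp add: scalars_def)

lemma counit_minus:
  "a \<in> part C [x] x d \<Longrightarrow> b \<in> part C [x] x d \<Longrightarrow> counit C x (a \<ominus> b) = counit C x a - counit C x b"
  unfolding a_minus_def by (simp add: minus_smult part_carrier counit_add counit_smult part_smult)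

lemma reduce_smult_coaug:
  assumes "a \<in> part C [x] x d"
  shows "counit C x a \<odot> coaug C x \<in> part C [x] x d"
proof (cases "d = 0")
  case False
  then show ?thesis
    using counit_degree[OF assms] smult_zero[OF part_carrier[OF coaug_closed]] by (simp add: part_zero)
qed (simp add: part_smult coaug_closed)

lemma reduce_part: "a \<in> part C w x d \<Longrightarrow> reduce C w x a \<in> part C w x d"
  by (auto simp: reduce_def intro!: part_minus reduce_smult_coaug)

lemma counit_reduce: "a \<in> part C [x] x d \<Longrightarrow> counit C x (reduce C [x] x a) = 0"
  using counit_smult[OF coaug_closed] counit_coaug
  by (simp add: reduce_def counit_minus[OF _ reduce_smult_coaug])

lemma reduce_gen: "a \<in> part C w x d \<Longrightarrow> (w, x, d, reduce C w x a) \<in> gens Sg"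
  using reduce_part counit_reduce by auto

lemma cocomp_unshuffle:
  assumes "a \<in> part C w x n"
    and "((d, b), (e, c)) \<in> set (cocomp C (y # nths w (- J)) x 0 (nths w J) n (act C (unshuffle (length w) J) a))"
  shows "b \<in> part C (y # nths w (- J)) x d" "c \<in> part C (nths w J) y e" "d + e = n"
proof -
  have "act C (unshuffle (length w) J) a \<in> part C (ins (y # nths w (- J)) 0 (nths w J)) x n"
    using act_closed[OF unshuffle_permutes assms(1)] by (simp add: permw_unshuffle ins_Cons_0)
  from cocomp_closed[OF _ this assms(2)] show "b \<in> part C (y # nths w (- J)) x d" "c \<in> part C (nths w J) y e" "d + e = n"
    by auto
qed

lemma cobar_vertex_keys:
  assumes a: "a \<in> part C w x n" and T: "T \<in> Poly_Mapping.keys (cobar_vertex C (w, x, n, a) ts)"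
  obtains y J d b e c where "J \<subseteq> {..<length w}" "b \<in> part C (y # nths w (- J)) x d" "c \<in> part C (nths w J) y e"
    "d + e = n" "T = Node (y # nths w (- J), x, d, reduce C (y # nths w (- J)) x b)
       (Node (nths w J, y, e, reduce C (nths w J) y c) (nths ts J) # nths ts (- J))"
proof -
  define Z where "Z y J = (\<Sum>((d, b), (e, c))\<leftarrow>cocomp C (y # nths w (- J)) x 0 (nths w J) n (act C (unshuffle (length w) J) a).
      Poly_Mapping.single
        (Node (y # nths w (- J), x, d, reduce C (y # nths w (- J)) x b)
          (Node (nths w J, y, e, reduce C (nths w J) y c) (nths ts J) # nths ts (- J)))
        (ksign d * unshuffle_sign (map (tdeg Sg) ts) J :: 'k))" for y J
  have "cobar_vertex C (w, x, n, a) ts = - (\<Sum>y\<in>{Closed, Open}. \<Sum>J\<in>Pow {..<length w}. Z y J)"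
    unfolding cobar_vertex_def Z_def by (simp add: Let_def)
  with T have "T \<in> Poly_Mapping.keys (\<Sum>y\<in>{Closed, Open}. \<Sum>J\<in>Pow {..<length w}. Z y J)"
    by (simp only: keys_uminus)
  from keys_sum[OF this] obtain y where "T \<in> Poly_Mapping.keys (\<Sum>J\<in>Pow {..<length w}. Z y J)"
    by blast
  from keys_sum[OF this] obtain J where J: "J \<subseteq> {..<length w}" "T \<in> Poly_Mapping.keys (Z y J)"
    by blast
  from keys_sum_list[OF J(2)[unfolded Z_def]] obtain q where
    q: "q \<in> set (cocomp C (y # nths w (- J)) x 0 (nths w J) n (act C (unshuffle (length w) J) a))"
      "T \<in> Poly_Mapping.keys ((\<lambda>((d, b), (e, c)). Poly_Mapping.single
        (Node (y # nths w (- J), x, d, reduce C (y # nths w (- J)) x b)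
          (Node (nths w J, y, e, reduce C (nths w J) y c) (nths ts J) # nths ts (- J)))
        (ksign d * unshuffle_sign (map (tdeg Sg) ts) J :: 'k)) q)" by (rule bexE)
  obtain d b e c where q': "q = ((d, b), (e, c))" by (metis surj_pair)
  from q(1) have m: "((d, b), (e, c)) \<in> set (cocomp C (y # nths w (- J)) x 0 (nths w J) n (act C (unshuffle (length w) J) a))"
    unfolding q' .
  from q(2) have "T \<in> Poly_Mapping.keys (Poly_Mapping.single
        (Node (y # nths w (- J), x, d, reduce C (y # nths w (- J)) x b)
          (Node (nths w J, y, e, reduce C (nths w J) y c) (nths ts J) # nths ts (- J)))
        (ksign d * unshuffle_sign (map (tdeg Sg) ts) J :: 'k))"
    unfolding q' by (simp only: prod.case)
  then have "T = Node (y # nths w (- J), x, d, reduce C (y # nths w (- J)) x b)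
          (Node (nths w J, y, e, reduce C (nths w J) y c) (nths ts J) # nths ts (- J))"
    by (metis empty_iff keys_single singletonD)
  from that[OF J(1) cocomp_unshuffle[OF a m] this] show ?thesis .
qed

text \<open>Splitting a vertex reorders its branches, so the leaves are preserved only as a
  multiset.\<close>

lemma tree_diff_keys:
  assumes "wf_tree Sg T" "T' \<in> Poly_Mapping.keys (cobar_tree_diff C T)"
  shows "wf_tree Sg T' \<and> root_col Sg T' = root_col Sg T \<and> tdeg Sg T' = tdeg Sg T + 1 \<and> mset (leaves T') = mset (leaves T)"
  using assms
proof (induction T arbitrary: T')
  case (Node g ts)
  obtain w x n a where g: "g = (w, x, n, a)" by (cases g)
  have a: "a \<in> part C w x n" and cols: "map (root_col Sg) ts = w" and wf: "\<And>t. t \<in> set ts \<Longrightarrow> wf_tree Sg t"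
    using Node.prems(1) by (auto simp: g list_all_iff)
  consider "T' \<in> Poly_Mapping.keys (cobar_vertex C g ts)"
    | j where "j < length ts" "T' \<in> Poly_Mapping.keys (lin_ext (\<lambda>t. mon (Node g (ts[j := t]))) (map (cobar_tree_diff C) ts ! j))"
  proof -
    let ?X = "\<lambda>j. lin_ext (\<lambda>t. mon (Node g (ts[j := t]))) (map (cobar_tree_diff C) ts ! j)"
    have "T' \<in> Poly_Mapping.keys (cobar_vertex C g ts) \<or> T' \<in> Poly_Mapping.keys (\<Sum>j<length ts.
        scale (ksign (gdeg Sg g + sum_list (map (tdeg Sg) (take j ts)))) (?X j))"
      by (rule keys_addD[OF Node.prems(2)[unfolded cobar_tree_diff.simps]])
    then show ?thesis
    proof
      assume "T' \<in> Poly_Mapping.keys (\<Sum>j<length ts.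
        scale (ksign (gdeg Sg g + sum_list (map (tdeg Sg) (take j ts)))) (?X j))"
      from keys_sum[OF this] obtain j where "j < length ts"
        "T' \<in> Poly_Mapping.keys (scale (ksign (gdeg Sg g + sum_list (map (tdeg Sg) (take j ts)))) (?X j))"
        by blast
      from that(2)[OF this(1) subsetD[OF keys_scale this(2)]] show ?thesis .
    qed (rule that(1))
  qed
  then show ?case
  proof cases
    case 1
    then obtain y J d b e c where J: "J \<subseteq> {..<length w}" and bc: "b \<in> part C (y # nths w (- J)) x d"
      "c \<in> part C (nths w J) y e" "d + e = n"
      and T': "T' = Node (y # nths w (- J), x, d, reduce C (y # nths w (- J)) x b)
       (Node (nths w J, y, e, reduce C (nths w J) y c) (nths ts J) # nths ts (- J))"
      using cobar_vertex_keys[OF a] unfolding g by metis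
    have "map (root_col Sg) (nths ts K) = nths w K" for K
      by (simp add: cols flip: nths_map)
    moreover have "wf_tree Sg t" if "t \<in> set (nths ts K)" for t K
      using wf set_nths_subset that by (metis subsetD)
    ultimately have "wf_tree Sg T'"
      using reduce_gen[OF bc(1)] reduce_gen[OF bc(2)] unfolding T' by (simp add: list_all_iff)
    moreover have "tdeg Sg T' = tdeg Sg (Node g ts) + 1"
      using bc(3) sum_list_nths_compl[of "tdeg Sg" ts J] by (simp add: T' g)
    moreover have "mset (leaves T') = mset (leaves (Node g ts))"
      using arg_cong[OF mset_nths_compl[of ts J], of "\<lambda>M. sum_mset (image_mset (\<lambda>t. mset (leaves t)) M)"]
      by (simp add: T' mset_concat comp_def flip: sum_mset_sum_list)
    ultimately show ?thesis by (simp add: T' g)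
  next
    case 2
    then obtain t where t: "t \<in> Poly_Mapping.keys (cobar_tree_diff C (ts ! j))" "T' = Node g (ts[j := t])"
      by (auto dest!: keys_lin_ext)
    from 2(1) have j: "ts ! j \<in> set ts" by simp
    note IH = Node.IH[OF j wf[OF j] t(1)]
    have split: "ts = take j ts @ ts ! j # drop (Suc j) ts" "ts[j := t] = take j ts @ t # drop (Suc j) ts"
      using 2(1) by (auto simp: id_take_nth_drop[symmetric] upd_conv_take_nth_drop)
    have r: "map (root_col Sg) (ts[j := t]) = map (root_col Sg) ts"
      using IH by (simp add: map_update) (metis 2(1) list_update_id map_update nth_map)
    have w: "\<forall>s\<in>set (ts[j := t]). wf_tree Sg s"
      using IH wf set_update_subset_insert[of ts j t] by blast
    have "tdeg Sg T' = tdeg Sg (Node g ts) + 1"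
      unfolding t(2) using IH by (subst (2) split(1), subst split(2)) simp
    moreover have "mset (leaves T') = mset (leaves (Node g ts))"
      unfolding t(2) using IH by (subst (2) split(1), subst split(2)) simp
    ultimately show ?thesis using r w Node.prems(1) by (simp add: t(2) list_all_iff)
  qed
qed auto

lemma tree_diff_homog: "T \<in> trees Sg w x d \<Longrightarrow> cobar_tree_diff C T \<in> homog Sg w x (d + 1)"
  unfolding homog_def
proof (clarify)
  fix T' assume T: "T \<in> trees Sg w x d" and T': "T' \<in> Poly_Mapping.keys (cobar_tree_diff C T)"
  note k = tree_diff_keys[OF treesD(1)[OF T] T']
  then have m: "mset (leaves T') = mset (leaves T)" by blast
  show "T' \<in> trees Sg w x (d + 1)"
    using T k mset_eq_setD[OF m] mset_eq_imp_distinct_iff[OF m] by (auto simp: trees_def)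
qed

text \<open>The differential never looks at the numbers of the leaves. Hence this holds exactly,
  even for renumberings that are not injective.\<close>

lemma tree_diff_relabel: "cobar_tree_diff C (relabel \<pi> T) = rel \<pi> (cobar_tree_diff C T)"
proof (induction T)
  case (Node g ts)
  obtain w x n a where g: "g = (w, x, n, a)" by (cases g)
  have tdeg: "map (tdeg Sg) (map (relabel \<pi>) l) = map (tdeg Sg) l" for l by simp
  have "cobar_vertex C g (map (relabel \<pi>) ts) = rel \<pi> (cobar_vertex C g ts)"
    unfolding cobar_vertex_def g
    by (simp add: rel_linear Let_def case_prod_unfold nths_map comp_def)
  moreover have "lin_ext (\<lambda>t. mon (Node g ((map (relabel \<pi>) ts)[j := t]))) (cobar_tree_diff C (relabel \<pi> (ts ! j)))
      = rel \<pi> (lin_ext (\<lambda>t. mon (Node g (ts[j := t]))) (cobar_tree_diff C (ts ! j)))"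
    if "j < length ts" for j
    using Node.IH[of "ts ! j"] that by (simp add: rel_def lin_ext_lin_ext map_update)
  ultimately show ?case
    by (simp add: rel_linear comp_def take_map)
qed auto

text \<open>Plugging \<open>S\<close> into the branch \<open>t\<close> raises the degree of this
  branch by \<open>s\<close>, which changes the unshuffle sign. The change equals the sign by which
  \<open>S\<close> passes the branches that the splitting carries across \<open>t\<close>, that is,
  the change of \<open>deg_after\<close>.\<close>

lemma cobar_vertex_plug:
  assumes a: "a \<in> part C w x n" and ts: "ts = A @ t # B"
    and A: "\<And>a. a \<in> set A \<Longrightarrow> i \<notin> set (labels a)" and B: "\<And>b. b \<in> set B \<Longrightarrow> i \<notin> set (labels b)"
    and t: "i \<in> set (labels t)" "distinct (labels t)" and s: "tdeg Sg S = s"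
  shows "cobar_vertex C (w, x, n, a) (map (plug i S m) ts)
    = lin_ext (\<lambda>T. Poly_Mapping.single (plug i S m T) (ksign (s * (deg_after Sg i T + deg_after Sg i (Node g ts)))))
        (cobar_vertex C (w, x, n, a) ts)"
proof -
  let ?p = "plug i S m" and ?td = "map (tdeg Sg)"
  have no: "map (tdeg Sg) (map ?p l) = map (tdeg Sg) l" if "\<And>b. b \<in> set l \<Longrightarrow> i \<notin> set (labels b)" for l
    using that by (auto simp: plug_notin)
  have td: "?td (map ?p ts) = ?td A @ (tdeg Sg t + s) # ?td B"
    using no[OF A] no[OF B] by (simp add: ts tdeg_plug[OF t(2,1)] s)
  have sgn: "unshuffle_sign (?td (map ?p ts)) J
     = (unshuffle_sign (?td ts) J * ksign (s * (deg_after Sg i (Node h (Node h' (nths ts J) # nths ts (- J)))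
         + deg_after Sg i (Node g ts))) :: 'k)" for J h h'
  proof -
    let ?J' = "{j. j + Suc (length A) \<in> J}"
    have JB: "{j. j + length (t # A) \<in> - J} = - ?J'" by auto
    have nth: "nths ts K = nths A K @ (if length A \<in> K then [t] else []) @ nths B {j. j + Suc (length A) \<in> K}" for K
      by (auto simp: ts nths_append nths_Cons)
    have JB: "{j. j + Suc (length A) \<in> - J} = - ?J'" by auto
    have nA: "i \<notin> set (labels b)" if "b \<in> set (nths A K)" for b K
      using A that set_nths_subset by (metis subsetD)
    have af: "deg_after Sg i (Node g ts) = deg_after Sg i t + sum_list (?td B)"
      unfolding ts by (rule deg_after_Node[OF A t(1)])
    have inv: "inversions (?td (map ?p ts)) J = inversions (?td ts) J
      + s * (if length A \<in> J then sum_list (?td (nths A (- J))) else sum_list (?td (nths B ?J')))"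
      unfolding td using inversions_update[of "?td A" "tdeg Sg t" s "?td B" J] by (simp add: ts nths_map)
    have cB: "sum_list (?td (nths B ?J')) + sum_list (?td (nths B (- ?J'))) = sum_list (?td B)"
      by (rule sum_list_nths_compl)
    show ?thesis
    proof (cases "length A \<in> J")
      case True
      have "deg_after Sg i (Node h' (nths ts J)) = deg_after Sg i t + sum_list (?td (nths B ?J'))"
        using deg_after_Node[of "nths A J" i t Sg h' "nths B ?J'"] nA t(1) True by (simp add: nth[of J])
      moreover have "i \<in> set (labels (Node h' (nths ts J)))"
        using t(1) True by (simp add: nth[of J])
      ultimately have "deg_after Sg i (Node h (Node h' (nths ts J) # nths ts (- J)))
          = deg_after Sg i t + sum_list (?td (nths B ?J')) + sum_list (?td (nths ts (- J)))"
        using deg_after_Node[of "[]" i "Node h' (nths ts J)" Sg h "nths ts (- J)"] by simp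
      also have "sum_list (?td (nths ts (- J))) = sum_list (?td (nths A (- J))) + sum_list (?td (nths B (- ?J')))"
        using True JB by (simp add: nth[of "- J"])
      \<comment> \<open>Modulo 2 only the branches that change sides with respect to
        \<open>t\<close> survive, here those of \<open>A\<close> outside \<open>J\<close>. These are
        the ones counted by \<open>inversions_update\<close>.\<close>
      finally have "deg_after Sg i (Node h (Node h' (nths ts J) # nths ts (- J))) + deg_after Sg i (Node g ts)
         = 2 * (deg_after Sg i t + sum_list (?td B)) + sum_list (?td (nths A (- J)))"
        unfolding af using cB by simp
      then show ?thesis
        unfolding unshuffle_sign_inversions inv using True by (simp add: ksign_add[symmetric]) (rule ksign_eqI, simp add: algebra_simps)
    next
      case False
      have "i \<notin> set (labels (Node h' (nths ts J)))"
        using A B False set_nths_subset[of A J] set_nths_subset[of B ?J'] by (auto simp: nth[of J])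
      then have nb: "i \<notin> set (labels b)" if "b \<in> set (Node h' (nths ts J) # nths A (- J))" for b
        using that nA by auto
      have "deg_after Sg i (Node h ((Node h' (nths ts J) # nths A (- J)) @ t # nths B (- ?J')))
          = deg_after Sg i t + sum_list (?td (nths B (- ?J')))"
        by (rule deg_after_Node[OF nb t(1)])
      then have "deg_after Sg i (Node h (Node h' (nths ts J) # nths ts (- J)))
          = deg_after Sg i t + sum_list (?td (nths B (- ?J')))"
        using False JB by (simp add: nth[of "- J"])
      then have "deg_after Sg i (Node h (Node h' (nths ts J) # nths ts (- J))) + deg_after Sg i (Node g ts)
         = 2 * (deg_after Sg i t + sum_list (?td (nths B (- ?J')))) + sum_list (?td (nths B ?J'))"
        unfolding af using cB by simp
      then show ?thesis
        unfolding unshuffle_sign_inversions inv using False by (simp add: ksign_add[symmetric]) (rule ksign_eqI, simp add: algebra_simps)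
    qed
  qed
  have "i \<in> set (labels (Node h ts))" for h :: "'a cobar_gen" using t(1) by (simp add: ts)
  show ?thesis
    unfolding cobar_vertex_def
    by (simp add: lin_ext_linear sum_list_linear[OF linear_lin_ext] Let_def case_prod_unfold nths_map mult.assoc
        sgn[symmetric] del: map_map)
qed

text \<open>The Leibniz rule for plugging. As \<open>plug\<close> carries no sign, the signs of
  grafting show up here: for \<open>D T\<close> the change of \<open>deg_after\<close>, multiplied
  by \<open>s\<close>; for \<open>D S\<close> the degree of everything before the leaf
  \<open>i\<close>, which modulo 2 is \<open>tdeg Sg T + deg_after Sg i T\<close>.\<close>

lemma tree_diff_plug:
  assumes "wf_tree Sg T" "distinct (labels T)" "i \<in> set (labels T)" "tdeg Sg S = s"
  shows "cobar_tree_diff C (plug i S m T)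
    = lin_ext (\<lambda>T'. Poly_Mapping.single (plug i S m T') (ksign (s * (deg_after Sg i T' + deg_after Sg i T))))
        (cobar_tree_diff C T)
      + scale (ksign (tdeg Sg T + deg_after Sg i T)) (lin_ext (\<lambda>X. mon (plug i X m T)) (cobar_tree_diff C S))"
  using assms(1-3)
proof (induction T)
  case (Leaf c j)
  then show ?case by (simp add: deg_after_pdeg)
next
  case (Node g ts)
  let ?D = "cobar_tree_diff C" and ?p = "plug i S m" and ?af = "deg_after Sg i" and ?td = "map (tdeg Sg)"
  obtain w x n a where g: "g = (w, x, n, a)" by (cases g)
  have a: "a \<in> part C w x n" and wf: "\<And>t. t \<in> set ts \<Longrightarrow> wf_tree Sg t"
    using Node.prems(1) by (auto simp: g list_all_iff)
  obtain t where "t \<in> set ts" and it: "i \<in> set (labels t)" using Node.prems(3) by auto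
  then obtain A B where ts: "ts = A @ t # B" by (auto dest: split_list)
  have nA: "i \<notin> set (labels b)" if "b \<in> set A" for b
    using Node.prems(2) it that unfolding ts by auto
  have nB: "i \<notin> set (labels b)" if "b \<in> set B" for b
    using Node.prems(2) it that unfolding ts by auto
  have dt: "distinct (labels t)" using Node.prems(2) unfolding ts by auto
  have wt: "wf_tree Sg t" using wf ts by simp
  have IH: "?D (?p t) = lin_ext (\<lambda>T'. Poly_Mapping.single (?p T') (ksign (s * (?af T' + ?af t)))) (?D t)
      + scale (ksign (tdeg Sg t + ?af t)) (lin_ext (\<lambda>X. mon (plug i X m t)) (?D S))"
    by (rule Node.IH) (use ts wt dt it in auto)
  let ?T = "Node g ts" and ?q = "length A"
  let ?F = "\<lambda>T'. Poly_Mapping.single (?p T') (ksign (s * (?af T' + ?af ?T)) :: 'k)"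
  define Z where "Z j = scale (ksign (gdeg Sg g + sum_list (?td (take j ts))))
     (lin_ext (\<lambda>t. mon (Node g (ts[j := t]))) (?D (ts ! j)))" for j
  define Z' where "Z' j = scale (ksign (gdeg Sg g + sum_list (?td (take j (map ?p ts)))))
     (lin_ext (\<lambda>t. mon (Node g ((map ?p ts)[j := t]))) (?D (map ?p ts ! j)))" for j
  define E where "E = scale (ksign (tdeg Sg ?T + ?af ?T)) (lin_ext (\<lambda>X. mon (plug i X m ?T)) (?D S))"
  have afT: "?af ?T = ?af t + sum_list (?td B)"
    unfolding ts by (rule deg_after_Node[OF nA it])
  have D: "?D ?T = cobar_vertex C g ts + (\<Sum>j<length ts. Z j)"
    by (simp add: Z_def)
  have D': "?D (?p ?T) = cobar_vertex C g (map ?p ts) + (\<Sum>j<length ts. Z' j)"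
    unfolding Z'_def by (simp del: map_map)
  have tdp: "tdeg Sg (?p b) = tdeg Sg b" if "i \<notin> set (labels b)" for b
    using that by (simp add: plug_notin)
  have tdA: "?td (map ?p A) = ?td A" and tdB: "?td (map ?p B) = ?td B"
    using nA nB by (auto simp: plug_notin)
  have tdt: "tdeg Sg (?p t) = tdeg Sg t + s" using tdeg_plug[OF dt it] assms(4) by simp
  \<comment> \<open>The differential acts on a branch without the leaf \<open>i\<close>. If this
    branch lies to the right of \<open>t\<close>, the differential has to pass \<open>S\<close>, at
    the cost of \<open>ksign s\<close>; the same sign appears on the right because
    \<open>deg_after\<close> has grown by 1.\<close>
  have Zother: "Z' j = lin_ext ?F (Z j)" if j: "j < length ts" "j \<noteq> ?q" for j
  proof -
    let ?b = "ts ! j"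
    have nb: "i \<notin> set (labels ?b)"
      using j nA nB unfolding ts by (auto simp: nth_append nth_Cons' split: if_splits)
    have wb: "wf_tree Sg ?b" using wf j by simp
    have sgn: "(ksign (gdeg Sg g + sum_list (?td (take j (map ?p ts)))) :: 'k)
        = ksign (gdeg Sg g + sum_list (?td (take j ts))) * ksign (s * (if ?q < j then 1 else 0))"
    proof (cases "?q < j")
      case True
      then obtain k where k: "j = Suc (?q + k)" using less_iff_Suc_add by blast
      have "?td (map ?p (take k B)) = ?td (take k B)"
        using nB by (auto simp: plug_notin dest: in_set_takeD)
      then have "sum_list (?td (take j (map ?p ts))) = sum_list (?td (take j ts)) + s"
        using tdA tdt by (simp add: ts k take_map del: map_map)
      then show ?thesis using True by (simp add: ksign_add[symmetric] add.assoc)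
    next
      case False
      then have "j < ?q" using j by simp
      moreover have "?td (map ?p (take j A)) = ?td (take j A)"
        using nA by (auto simp: plug_notin dest: in_set_takeD)
      ultimately show ?thesis using False by (simp add: ts take_map del: map_map)
    qed
    have "Z' j = scale (ksign (gdeg Sg g + sum_list (?td (take j (map ?p ts)))))
       (lin_ext (\<lambda>b. mon (Node g ((map ?p ts)[j := b]))) (rel (shift i m) (?D ?b)))"
      unfolding Z'_def using j(1) by (simp add: plug_notin[OF nb] tree_diff_relabel)
    also have "\<dots> = scale (ksign (gdeg Sg g + sum_list (?td (take j (map ?p ts)))))
       (lin_ext (\<lambda>b. mon (Node g ((map ?p ts)[j := relabel (shift i m) b]))) (?D ?b))"
      by (simp add: rel_def lin_ext_lin_ext)
    also have "lin_ext (\<lambda>b. mon (Node g ((map ?p ts)[j := relabel (shift i m) b]))) (?D ?b)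
       = lin_ext (\<lambda>b. scale (ksign (s * (if ?q < j then 1 else 0))) (?F (Node g (ts[j := b])))) (?D ?b)"
    proof (rule lin_ext_cong)
      fix b assume b: "b \<in> Poly_Mapping.keys (?D ?b)"
      note k = tree_diff_keys[OF wb b]
      have "set (labels b) = set (labels ?b)"
        using k mset_eq_setD[of "leaves b" "leaves ?b"] by (simp add: labels_def)
      then have ib: "i \<notin> set (labels b)" using nb by simp
      have "?af (Node g (ts[j := b])) = ?af ?T + (if ?q < j then 1 else 0)"
      proof (cases "?q < j")
        case True
        then obtain k where k': "j = Suc (?q + k)" using less_iff_Suc_add by blast
        have kB: "k < length B" using j k' by (simp add: ts)
        have "ts[j := b] = A @ t # B[k := b]" by (simp add: ts k' list_update_append)
        then have "?af (Node g (ts[j := b])) = ?af t + sum_list (?td (B[k := b]))"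
          using deg_after_Node[OF nA it] by simp
        moreover have "sum_list (?td (B[k := b])) = sum_list (?td B) + 1"
        proof -
          have "tdeg Sg b = tdeg Sg (B ! k) + 1" using k by (simp add: ts k' nth_append)
          then show ?thesis
            using kB sum_list_incr[of k "?td B"] by (simp add: map_update)
        qed
        ultimately show ?thesis using True afT by simp
      next
        case False
        then have jq: "j < ?q" using j by simp
        then have "ts[j := b] = A[j := b] @ t # B" by (simp add: ts list_update_append)
        moreover have "i \<notin> set (labels c)" if "c \<in> set (A[j := b])" for c
          using that nA ib set_update_subset_insert[of A j b] by auto
        ultimately have "?af (Node g (ts[j := b])) = ?af t + sum_list (?td B)"
          using deg_after_Node[of "A[j := b]" i t Sg g B] it by simp
        then show ?thesis using False afT by simp
      qed
      then have "(ksign (s * (if ?q < j then 1 else 0)) * ksign (s * (?af (Node g (ts[j := b])) + ?af ?T)) :: 'k) = 1"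
        by (auto simp: ksign_def)
      moreover have "?p (Node g (ts[j := b])) = Node g ((map ?p ts)[j := relabel (shift i m) b])"
        by (simp add: map_update plug_notin[OF ib])
      ultimately show "mon (Node g ((map ?p ts)[j := relabel (shift i m) b]))
          = scale (ksign (s * (if ?q < j then 1 else 0))) (?F (Node g (ts[j := b])))"
        by simp
    qed
    also have "scale (ksign (gdeg Sg g + sum_list (?td (take j (map ?p ts))))) \<dots>
      = scale (ksign (gdeg Sg g + sum_list (?td (take j ts)))) (lin_ext (\<lambda>b. ?F (Node g (ts[j := b]))) (?D ?b))"
      unfolding sgn lin_ext_fun_scale pm.scale_scale by (simp only: mult.assoc ksign_simps mult_1_right)
    also have "\<dots> = lin_ext ?F (Z j)"
      unfolding Z_def by (simp add: lin_ext_linear lin_ext_lin_ext del: scale_single)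
    finally show ?thesis .
  qed
  \<comment> \<open>On the branch \<open>t\<close> with the leaf \<open>i\<close>, the induction
    hypothesis gives a term with \<open>D t\<close> and the term \<open>E\<close> with
    \<open>D S\<close>. The branches \<open>B\<close> enter both values of \<open>deg_after\<close>,
    hence drop out modulo 2.\<close>
  have Zq: "Z' ?q = lin_ext ?F (Z ?q) + E"
  proof -
    have q: "map ?p ts ! ?q = ?p t" "ts ! ?q = t" "take ?q ts = A" "take ?q (map ?p ts) = map ?p A"
      "\<And>b. ts[?q := b] = A @ b # B" "\<And>b. (map ?p ts)[?q := b] = map ?p A @ b # map ?p B"
      using list_update_length[of "map ?p A" "?p t" "map ?p B"] by (simp_all add: ts nth_append)
    let ?s = "ksign (gdeg Sg g + sum_list (?td A)) :: 'k"
    have "Z' ?q = scale ?s (lin_ext (\<lambda>b. mon (Node g (map ?p A @ b # map ?p B))) (?D (?p t)))"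
      unfolding Z'_def q tdA ..
    also have "\<dots> = scale ?s (lin_ext (\<lambda>T'. Poly_Mapping.single (Node g (map ?p A @ ?p T' # map ?p B)) (ksign (s * (?af T' + ?af t)))) (?D t))
      + scale ?s (scale (ksign (tdeg Sg t + ?af t)) (lin_ext (\<lambda>X. mon (Node g (map ?p A @ plug i X m t # map ?p B))) (?D S)))"
      unfolding IH by (simp add: lin_ext_add lin_ext_scale lin_ext_lin_ext pm.scale_right_distrib)
    also have "lin_ext (\<lambda>T'. Poly_Mapping.single (Node g (map ?p A @ ?p T' # map ?p B)) (ksign (s * (?af T' + ?af t)) :: 'k)) (?D t)
       = lin_ext (\<lambda>T'. ?F (Node g (A @ T' # B))) (?D t)"
    proof (rule lin_ext_cong)
      fix T' assume T': "T' \<in> Poly_Mapping.keys (?D t)"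
      have "set (labels T') = set (labels t)"
        using tree_diff_keys[OF wt T'] mset_eq_setD[of "leaves T'" "leaves t"] by (simp add: labels_def)
      then have "?af (Node g (A @ T' # B)) = ?af T' + sum_list (?td B)"
        using deg_after_Node[OF nA, where t = T' and \<Sigma> = Sg and g = g and B = B] it by simp
      then have "(ksign (s * (?af T' + ?af t)) :: 'k) = ksign (s * (?af (Node g (A @ T' # B)) + ?af ?T))"
        unfolding afT by (intro ksign_eqI) auto
      then show "Poly_Mapping.single (Node g (map ?p A @ ?p T' # map ?p B)) (ksign (s * (?af T' + ?af t)) :: 'k) = ?F (Node g (A @ T' # B))"
        by simp
    qed
    also have "scale ?s \<dots> = lin_ext ?F (Z ?q)"
      unfolding Z_def q by (simp add: lin_ext_linear lin_ext_lin_ext)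
    also have "scale ?s (scale (ksign (tdeg Sg t + ?af t)) (lin_ext (\<lambda>X. mon (Node g (map ?p A @ plug i X m t # map ?p B))) (?D S))) = E"
    proof -
      have *: "map (plug i X m) A = map (relabel (shift i m)) A" "map (plug i X m) B = map (relabel (shift i m)) B" for X
        using nA nB by (auto simp: plug_notin)
      have "(?s * ksign (tdeg Sg t + ?af t)) = ksign (tdeg Sg ?T + ?af ?T)"
        unfolding ksign_add[symmetric] afT by (rule ksign_eqI) (auto simp: ts)
      then show ?thesis by (simp add: E_def ts *)
    qed
    finally show ?thesis .
  qed
  have q: "?q \<in> {..<length ts}" by (simp add: ts)
  have "(\<Sum>j<length ts. Z' j) = Z' ?q + (\<Sum>j\<in>{..<length ts} - {?q}. Z' j)"
    by (rule sum.remove[OF _ q]) simp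
  also have "(\<Sum>j\<in>{..<length ts} - {?q}. Z' j) = (\<Sum>j\<in>{..<length ts} - {?q}. lin_ext ?F (Z j))"
    by (rule sum.cong) (auto intro!: Zother)
  also have "Z' ?q + \<dots> = (\<Sum>j<length ts. lin_ext ?F (Z j)) + E"
    unfolding Zq using sum.remove[OF _ q, of "\<lambda>j. lin_ext ?F (Z j)"] by (simp add: add_ac)
  finally have "?D (?p ?T) = cobar_vertex C g (map ?p ts) + ((\<Sum>j<length ts. lin_ext ?F (Z j)) + E)"
    unfolding D' by simp
  also have "cobar_vertex C g (map ?p ts) = lin_ext ?F (cobar_vertex C g ts)"
    using cobar_vertex_plug[OF a ts nA nB it dt assms(4), of m g] by (simp add: g)
  finally show ?case
    unfolding D E_def by (simp only: lin_ext_add lin_ext_sum add.assoc)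
qed

definition cobar_diff :: "('a cobar_gen tree \<Rightarrow>\<^sub>0 'k) \<Rightarrow> 'a cobar_gen tree \<Rightarrow>\<^sub>0 'k" where
  "cobar_diff = lin_ext (cobar_tree_diff C)"

lemma linear_cobar_diff: "module_hom scale scale cobar_diff"
  unfolding cobar_diff_def by (rule linear_lin_ext)

lemmas cobar_diff_linear = lin_ext_linear[of "cobar_tree_diff C", folded cobar_diff_def]

lemma cobar_diff_mon: "cobar_diff (Poly_Mapping.single T c) = scale c (cobar_tree_diff C T)"
  by (simp add: cobar_diff_def)

lemma cobar_diff_zero [simp]: "cobar_diff 0 = 0"
  by (simp add: cobar_diff_def)

lemma cobar_diff_homog: "a \<in> homog Sg w x d \<Longrightarrow> cobar_diff a \<in> homog Sg w x (d + 1)"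
  by (induction rule: homog_induct) (auto simp: cobar_diff_linear cobar_diff_mon tree_diff_homog)

lemma cobar_diff_rel: "cobar_diff (rel \<pi> a) = rel \<pi> (cobar_diff a)"
  unfolding cobar_diff_def rel_def lin_ext_lin_ext
  by (rule lin_ext_cong) (simp add: tree_diff_relabel rel_def)

text \<open>An equality and not only a congruence: the factors \<open>graft_sign\<close> contained
  in \<open>free_comp\<close> turn the rule for \<open>plug\<close> into the usual Leibniz
  rule.\<close>

lemma cobar_diff_comp:
  assumes "a \<in> homog Sg w x d" "i < length w" "b \<in> homog Sg u (w ! i) e"
  shows "cobar_diff (free_comp Sg i a b)
    = free_comp Sg i (cobar_diff a) b + scale (ksign d) (free_comp Sg i a (cobar_diff b))"
  using assms(1)
proof (induction a rule: homog_induct)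
  case T: (mon T)
  from assms(3) show ?case
  proof (induction b rule: homog_induct)
    case S: (mon S)
    note T' = treesD[OF T] and S' = treesD[OF S]
    let ?S = "relabel ((+) i) S" and ?m = "length (leaves S)" and ?af = "deg_after Sg i"
    have i: "i \<in> set (labels T)" using T'(6) assms(2) by simp
    have s: "tdeg Sg ?S = e" using S' by simp
    have 1: "free_comp Sg i (cobar_tree_diff C T) (mon S)
        = lin_ext (\<lambda>T'. Poly_Mapping.single (plug i ?S ?m T') (ksign (e * ?af T'))) (cobar_tree_diff C T)"
    proof -
      have "free_comp Sg i a (mon S) = lin_ext (\<lambda>T'. Poly_Mapping.single (plug i ?S ?m T') (ksign (e * ?af T'))) a"
        if "a \<in> homog Sg w x (d + 1)" for a :: "'a cobar_gen tree \<Rightarrow>\<^sub>0 'k"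
        using that
        by (induction a rule: homog_induct)
           (auto simp: free_comp_bilinear lin_ext_linear free_comp_mon[OF _ assms(2) S] graft_def graft_sign_def S'(3))
      then show ?thesis using tree_diff_homog[OF T] by blast
    qed
    have 2: "free_comp Sg i (mon T) (cobar_tree_diff C S)
        = scale (ksign ((e + 1) * ?af T)) (lin_ext (\<lambda>X. mon (plug i X ?m T)) (cobar_tree_diff C ?S))"
    proof -
      have "free_comp Sg i (mon T) b = scale (ksign ((e + 1) * ?af T)) (lin_ext (\<lambda>X. mon (plug i X ?m T)) (rel ((+) i) b))"
        if "b \<in> homog Sg u (w ! i) (e + 1)" for b :: "'a cobar_gen tree \<Rightarrow>\<^sub>0 'k"
        using that
      proof (induction b rule: homog_induct)
        case (mon X)
        then show ?case
          using free_comp_mon[OF T assms(2) mon] treesD(3,4)[OF mon] S'(4) by (simp add: graft_def graft_sign_def)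
      qed (auto simp: free_comp_bilinear lin_ext_linear rel_linear pm.scale_right_distrib mult.commute)
      then show ?thesis using tree_diff_homog[OF S] by (simp add: tree_diff_relabel)
    qed
    have "cobar_diff (free_comp Sg i (mon T) (mon S)) = scale (ksign (e * ?af T)) (cobar_tree_diff C (plug i ?S ?m T))"
      unfolding free_comp_mon[OF T assms(2) S] by (simp add: cobar_diff_mon graft_def graft_sign_def S'(3))
    also have "\<dots> = scale (ksign (e * ?af T)) (lin_ext (\<lambda>T'. Poly_Mapping.single (plug i ?S ?m T')
          (ksign (e * (?af T' + ?af T)))) (cobar_tree_diff C T))
       + scale (ksign (e * ?af T)) (scale (ksign (d + ?af T)) (lin_ext (\<lambda>X. mon (plug i X ?m T)) (cobar_tree_diff C ?S)))"
      using tree_diff_plug[OF T'(1,5) i s, of ?m] T'(3) by (simp add: pm.scale_right_distrib)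
    also have "scale (ksign (e * ?af T)) (lin_ext (\<lambda>T'. Poly_Mapping.single (plug i ?S ?m T')
          (ksign (e * (?af T' + ?af T)))) (cobar_tree_diff C T)) = free_comp Sg i (cobar_tree_diff C T) (mon S)"
    proof -
      have "ksign (e * ?af T) * ksign (e * (?af T' + ?af T)) = (ksign (e * ?af T') :: 'k)" for T'
        by (auto simp: ksign_def)
      then show ?thesis unfolding 1 by (simp flip: lin_ext_fun_scale)
    qed
    also have "scale (ksign (e * ?af T)) (scale (ksign (d + ?af T)) (lin_ext (\<lambda>X. mon (plug i X ?m T)) (cobar_tree_diff C ?S)))
       = scale (ksign d) (free_comp Sg i (mon T) (cobar_tree_diff C S))"
    proof -
      have "ksign (e * ?af T) * ksign (d + ?af T) = (ksign d * ksign ((e + 1) * ?af T) :: 'k)"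
        by (auto simp: ksign_def)
      then show ?thesis unfolding 2 by simp
    qed
    finally show ?case by (simp add: cobar_diff_mon)
  qed (auto simp: free_comp_bilinear cobar_diff_linear pm.scale_right_distrib mult.commute add_ac)
qed (auto simp: free_comp_bilinear cobar_diff_linear pm.scale_right_distrib mult.commute add_ac)

end

section \<open>The differential on corollas\<close>

interpretation pm_functional: vector_space_pair "scale :: 'k::field \<Rightarrow> ('t \<Rightarrow>\<^sub>0 'k) \<Rightarrow> ('t \<Rightarrow>\<^sub>0 'k)" "(*) :: 'k \<Rightarrow> 'k \<Rightarrow> 'k"
  by unfold_locales (auto simp: algebra_simps pm.scale_right_distrib pm.scale_left_distrib)

text \<open>Equality of tensors is defined by forms with values in the field. Functionals that
  vanish on the ideal transfer it to maps with values in the quotient by the ideal.\<close>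

lemma functional_separation:
  fixes I :: "('t \<Rightarrow>\<^sub>0 'k::field) set"
  assumes "pm.subspace I" "v \<notin> I"
  shows "\<exists>f. module_hom scale (*) f \<and> (\<forall>a\<in>I. f a = 0) \<and> f v \<noteq> (0 :: 'k)"
proof -
  obtain B where B: "B \<subseteq> I" "pm.independent B" "I \<subseteq> pm.span B"
    using pm.maximal_independent_subset[of I] by metis
  have "pm.span B = I" using B assms(1) pm.span_minimal by blast
  then have "v \<notin> pm.span B" using assms(2) by simp
  then have ind: "pm.independent (insert v B)" using B(2) by (simp add: pm.independent_insertI)
  obtain g where g: "Vector_Spaces.linear scale (*) g" "\<forall>b\<in>insert v B. g b = (if b = v then 1 else 0 :: 'k)"
    using pm_functional.linear_independent_extend[OF ind, of "\<lambda>b. if b = v then 1 else 0"] by blast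
  have "g a = 0" if "a \<in> I" for a
  proof (rule pm_functional.linear_eq_0_on_span[OF g(1)])
    show "a \<in> pm.span B" using that B by blast
    show "\<And>b. b \<in> B \<Longrightarrow> g b = 0" using g(2) \<open>v \<notin> pm.span B\<close> pm.span_base by force
  qed
  moreover have "g v \<noteq> 0" using g(2) by simp
  moreover have "module_hom scale (*) g" using g(1) by (rule module_hom_linearI)
  ultimately show ?thesis by blast
qed

lemma linear_scale: "module_hom scale scale (scale c)"
  by unfold_locales (auto simp: pm.scale_right_distrib pm.scale_left_distrib mult.commute)

lemma subspace_total_ideal: "pm.subspace (total_ideal \<Sigma> R)"
  by (auto simp: pm.subspace_def intro: total_ideal_add total_ideal_scale)

lemma permw_split:
  "i + k \<le> length w \<Longrightarrow> ins (take i w @ y # drop (i + k) w) i (take k (drop i w)) = w"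
  by (simp add: ins_def) (metis append_take_drop_id drop_drop add.commute)

lemma ins_split:
  assumes "i < length v" "ins v i u = w"
  shows "v = take i w @ v ! i # drop (i + length u) w" "u = take (length u) (drop i w)" "i + length u \<le> length w"
  using assms by (auto simp: ins_def id_take_nth_drop[symmetric])

section \<open>Corollas and sums over cocompositions modulo the relations\<close>

context cooperad
begin

abbreviation cong_cobar (infix "\<approx>" 50) where
  "a \<approx> b \<equiv> cong_mod Sg (cobar_relations C) a b"

lemma sm_add: "a \<in> carrier C \<Longrightarrow> (c + d) \<odot> a = c \<odot> a \<oplus> d \<odot> a"
  using smult_l_distr[of c d a] by (simp add: scalars_def)

lemma sm_mult: "a \<in> carrier C \<Longrightarrow> c \<odot> (d \<odot> a) = (c * d) \<odot> a"
  using smult_assoc1[of c d a] by (simp add: scalars_def)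

lemma sm_distrib: "a \<in> carrier C \<Longrightarrow> b \<in> carrier C \<Longrightarrow> c \<odot> (a \<oplus> b) = c \<odot> a \<oplus> c \<odot> b"
  using smult_r_distr[of c a b] by (simp add: scalars_def)

lemma sm_one: "a \<in> carrier C \<Longrightarrow> 1 \<odot> a = a"
  using smult_one[of a] by (simp add: scalars_def)

lemma sm_closed: "a \<in> carrier C \<Longrightarrow> c \<odot> a \<in> carrier C"
  using smult_closed[of c a] by (simp add: scalars_def)

lemma coaug_carrier: "coaug C x \<in> carrier C"
  by (rule part_carrier[OF coaug_closed])

lemma reduce_altdef: "a \<in> carrier C \<Longrightarrow> reduce C w x a = (if w = [x] then a \<oplus> (- counit C x a) \<odot> coaug C x else a)"
  by (simp add: reduce_def a_minus_def minus_smult sm_closed coaug_carrier sm_mult)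

lemma reduce_add: "a \<in> part C w x d \<Longrightarrow> b \<in> part C w x d \<Longrightarrow> reduce C w x (a \<oplus> b) = reduce C w x a \<oplus> reduce C w x b"
  using sm_add[OF coaug_carrier, of "- counit C x a" "- counit C x b" x]
  by (auto simp: reduce_altdef part_carrier counit_add coaug_carrier M.a_assoc M.a_comm M.a_lcomm sm_closed)

lemma reduce_smult: "a \<in> part C w x d \<Longrightarrow> reduce C w x (c \<odot> a) = c \<odot> reduce C w x a"
  by (auto simp: reduce_altdef part_carrier counit_smult sm_mult sm_distrib coaug_carrier sm_closed)

lemma reduce_coaug: "reduce C [x] x (coaug C x) = \<zero>"
proof -
  have "coaug C x \<oplus> (- 1) \<odot> coaug C x = (1 + (- 1)) \<odot> coaug C x"
    by (simp only: sm_add[OF coaug_carrier] sm_one[OF coaug_carrier])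
  then show ?thesis by (simp add: reduce_altdef coaug_carrier counit_coaug smult_zero)
qed

lemma reduce_id: "a \<in> part C w x d \<Longrightarrow> (w = [x] \<Longrightarrow> counit C x a = 0) \<Longrightarrow> reduce C w x a = a"
  by (auto simp: reduce_altdef part_carrier smult_zero coaug_carrier)

lemma permutes_singleton: "\<sigma> permutes {..<length [x]} \<Longrightarrow> \<sigma> = id"
  by (simp add: lessThan_Suc permutes_sing)

lemma reduce_act:
  assumes "a \<in> part C w x d" "\<sigma> permutes {..<length w}"
  shows "reduce C (permw \<sigma> w) x (act C \<sigma> a) = act C \<sigma> (reduce C w x a)"
proof (cases "w = [x]")
  case True
  have "\<sigma> = id" by (rule permutes_singleton[of \<sigma> x]) (use assms(2) in \<open>simp only: True\<close>)
  then show ?thesis by (simp only: permw_id act_id[OF assms(1)] act_id[OF reduce_part[OF assms(1)]])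
next
  case False
  \<comment> \<open>For a single input \<open>\<sigma>\<close> is the identity, so
    \<open>permw \<sigma> w\<close> is \<open>[x]\<close> only if \<open>w\<close> is; otherwise
    \<open>reduce\<close> does nothing on either side.\<close>
  have "permw \<sigma> w \<noteq> [x]"
  proof
    assume p: "permw \<sigma> w = [x]"
    then have "length w = 1" by (metis length_permw length_Cons list.size(3) One_nat_def)
    then obtain z where z: "w = [z]" by (auto simp: length_Suc_conv)
    have "\<sigma> = id" by (rule permutes_singleton[of \<sigma> z]) (use assms(2) in \<open>simp only: z\<close>)
    then show False using p z False by simp
  qed
  then show ?thesis using False by (simp add: reduce_def)
qed

text \<open>With \<open>reduce\<close> built in, the corolla of every element is a generator, and
  modulo the relations it depends linearly on the element and vanishes on the
  coaugmentation.\<close>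

definition cor :: "color list \<Rightarrow> color \<Rightarrow> int \<Rightarrow> 'a \<Rightarrow> 'a cobar_gen tree \<Rightarrow>\<^sub>0 'k" where
  "cor w x d a = mon (corolla (w, x, d, reduce C w x a))"

lemma corolla_trees:
  assumes "(w, x, d, a) \<in> gens Sg"
  shows "corolla (w, x, d, a) \<in> trees Sg w x (d + 1)"
proof (rule treesI)
  show "wf_tree Sg (corolla (w, x, d, a))"
    using assms by (simp add: corolla_def comp_def map_nth list_all_iff)
  show "set (leaves (corolla (w, x, d, a))) = {(j, w ! j) |j. j < length w}"
    by (auto simp: corolla_def)
qed (auto simp: corolla_def comp_def length_concat sum_list_triv)

lemma cor_homog: "a \<in> part C w x d \<Longrightarrow> cor w x d a \<in> homog Sg w x (d + 1)"
  unfolding cor_def by (intro homog_mon corolla_trees reduce_gen)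

lemma cor_spanned: "a \<in> part C w x d \<Longrightarrow> cor w x d a \<in> spanned Sg"
  by (rule homog_spanned[OF cor_homog])

lemma relation_cong:
  assumes "a - b \<in> cobar_relations C" "a \<in> homog Sg w x d" "b \<in> homog Sg w x d"
  shows "a \<approx> b"
  unfolding cong_mod_def using homog_diff[OF assms(2,3)]
  by (intro rel_ideal_total[OF rel_ideal.gen[OF assms(1)]]) (simp add: homog_def)

lemma cor_add:
  assumes "a \<in> part C w x d" "b \<in> part C w x d"
  shows "cor w x d (a \<oplus> b) \<approx> cor w x d a + cor w x d b"
proof (rule relation_cong)
  have "cor w x d (a \<oplus> b) - cor w x d a - cor w x d b \<in> cobar_relations C"
    unfolding cor_def reduce_add[OF assms] cobar_relations_def
    using reduce_gen[OF assms(1)] reduce_gen[OF assms(2)] by blast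
  then show "cor w x d (a \<oplus> b) - (cor w x d a + cor w x d b) \<in> cobar_relations C" by (simp add: diff_diff_eq)
qed (use assms in \<open>auto intro: cor_homog part_add\<close>)

lemma cor_smult:
  assumes "a \<in> part C w x d"
  shows "cor w x d (c \<odot> a) \<approx> scale c (cor w x d a)"
proof (rule relation_cong)
  show "cor w x d (c \<odot> a) - scale c (cor w x d a) \<in> cobar_relations C"
    unfolding cor_def reduce_smult[OF assms] cobar_relations_def
    using reduce_gen[OF assms(1)] by blast
qed (use assms in \<open>auto intro: cor_homog part_smult\<close>)

lemma cor_act:
  assumes "a \<in> part C w x d" "\<sigma> permutes {..<length w}"
  shows "cor (permw \<sigma> w) x d (act C \<sigma> a) \<approx> free_act \<sigma> (cor w x d a)"
proof (rule relation_cong)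
  show "cor (permw \<sigma> w) x d (act C \<sigma> a) - free_act \<sigma> (cor w x d a) \<in> cobar_relations C"
    unfolding cor_def reduce_act[OF assms] cobar_relations_def
    using reduce_gen[OF assms(1)] assms(2) by blast
qed (use assms in \<open>auto intro: cor_homog act_closed free_act_homog\<close>)

text \<open>The coaugmentation element reduces to zero, and the generator belonging to zero lies in
  the ideal by the relation for the scalar 0.\<close>

lemma cor_coaug: "cor [x] x 0 (coaug C x) \<approx> 0"
proof -
  have "reduce C [x] x (0 \<odot> coaug C x) = reduce C [x] x (coaug C x)"
    using reduce_smult[OF coaug_closed, of x 0] by (simp add: reduce_coaug smult_zero)
  then have "cor [x] x 0 (coaug C x) = cor [x] x 0 (0 \<odot> coaug C x)" by (simp add: cor_def)
  then show ?thesis using cor_smult[OF coaug_closed, of x 0] by simp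
qed

text \<open>If the two sums were not congruent, a functional vanishing on the ideal would separate
  them; composed with \<open>\<Psi>\<close> it is a multilinear form that contradicts
  \<open>eq\<close>.\<close>

lemma tensor_cong:
  assumes eq: "tensor_eq C ps s t"
    and add: "\<And>l d a b r. pure_tensor C ps (l @ (d, a) # r) \<Longrightarrow> pure_tensor C ps (l @ (d, b) # r) \<Longrightarrow>
      \<Psi> (l @ (d, a \<oplus> b) # r) \<approx> \<Psi> (l @ (d, a) # r) + \<Psi> (l @ (d, b) # r)"
    and smult: "\<And>l d a c r. pure_tensor C ps (l @ (d, a) # r) \<Longrightarrow>
      \<Psi> (l @ (d, c \<odot> a) # r) \<approx> scale c (\<Psi> (l @ (d, a) # r))"
  shows "(\<Sum>l\<leftarrow>s. \<Psi> l) \<approx> (\<Sum>l\<leftarrow>t. \<Psi> l)"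
proof (rule ccontr)
  assume "\<not> ?thesis"
  then have n: "(\<Sum>l\<leftarrow>s. \<Psi> l) - (\<Sum>l\<leftarrow>t. \<Psi> l) \<notin> total_ideal Sg (cobar_relations C)"
    by (simp add: cong_mod_def)
  from functional_separation[OF subspace_total_ideal n]
  obtain f :: "_ \<Rightarrow> 'k" where f: "module_hom scale (*) f" "\<And>a. a \<in> total_ideal Sg (cobar_relations C) \<Longrightarrow> f a = 0"
    "f ((\<Sum>l\<leftarrow>s. \<Psi> l) - (\<Sum>l\<leftarrow>t. \<Psi> l)) \<noteq> 0" by blast
  note lin = module_hom.add[OF f(1)] module_hom.scale[OF f(1)] module_hom.diff[OF f(1)] module_hom.zero[OF f(1)]
  have c: "f a = f b" if "a \<approx> b" for a b
    using f(2)[of "a - b"] that by (simp add: cong_mod_def lin)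
  have "multilinear C ps (\<lambda>l. f (\<Psi> l))"
    unfolding multilinear_def using c[OF add] c[OF smult] by (simp add: lin)
  then have "(\<Sum>l\<leftarrow>s. f (\<Psi> l)) = (\<Sum>l\<leftarrow>t. f (\<Psi> l))" using eq unfolding tensor_eq_def by blast
  moreover have "f (\<Sum>l\<leftarrow>s. \<Psi> l) = (\<Sum>l\<leftarrow>s. f (\<Psi> l))" for s
    by (induction s) (auto simp: lin)
  ultimately show False using f(3) by (simp add: lin)
qed

text \<open>Bilinearity modulo the relations, which is what makes a sum over a cocomposition
  independent of the chosen list.\<close>

definition bilin :: "color list \<Rightarrow> color \<Rightarrow> color list \<Rightarrow> color \<Rightarrow>
    (int \<Rightarrow> 'a \<Rightarrow> int \<Rightarrow> 'a \<Rightarrow> 'a cobar_gen tree \<Rightarrow>\<^sub>0 'k) \<Rightarrow> bool" where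
  "bilin v x u y \<Psi> \<longleftrightarrow> (\<forall>d e b b' c c' t. b \<in> part C v x d \<longrightarrow> b' \<in> part C v x d \<longrightarrow> c \<in> part C u y e \<longrightarrow> c' \<in> part C u y e \<longrightarrow>
     \<Psi> d (b \<oplus> b') e c \<approx> \<Psi> d b e c + \<Psi> d b' e c \<and> \<Psi> d (t \<odot> b) e c \<approx> scale t (\<Psi> d b e c) \<and>
     \<Psi> d b e (c \<oplus> c') \<approx> \<Psi> d b e c + \<Psi> d b e c' \<and> \<Psi> d b e (t \<odot> c) \<approx> scale t (\<Psi> d b e c))"

lemma bilinI:
  assumes "\<And>d e b b' c. b \<in> part C v x d \<Longrightarrow> b' \<in> part C v x d \<Longrightarrow> c \<in> part C u y e \<Longrightarrow> \<Psi> d (b \<oplus> b') e c \<approx> \<Psi> d b e c + \<Psi> d b' e c"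
    "\<And>d e b t c. b \<in> part C v x d \<Longrightarrow> c \<in> part C u y e \<Longrightarrow> \<Psi> d (t \<odot> b) e c \<approx> scale t (\<Psi> d b e c)"
    "\<And>d e b c c'. b \<in> part C v x d \<Longrightarrow> c \<in> part C u y e \<Longrightarrow> c' \<in> part C u y e \<Longrightarrow> \<Psi> d b e (c \<oplus> c') \<approx> \<Psi> d b e c + \<Psi> d b e c'"
    "\<And>d e b c t. b \<in> part C v x d \<Longrightarrow> c \<in> part C u y e \<Longrightarrow> \<Psi> d b e (t \<odot> c) \<approx> scale t (\<Psi> d b e c)"
  shows "bilin v x u y \<Psi>"
  using assms unfolding bilin_def by blast

lemma bilinD:
  assumes "bilin v x u y \<Psi>" "b \<in> part C v x d" "c \<in> part C u y e"
  shows "b' \<in> part C v x d \<Longrightarrow> \<Psi> d (b \<oplus> b') e c \<approx> \<Psi> d b e c + \<Psi> d b' e c"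
    "\<Psi> d (t \<odot> b) e c \<approx> scale t (\<Psi> d b e c)"
    "c' \<in> part C u y e \<Longrightarrow> \<Psi> d b e (c \<oplus> c') \<approx> \<Psi> d b e c + \<Psi> d b e c'"
    "\<Psi> d b e (t \<odot> c) \<approx> scale t (\<Psi> d b e c)"
  using assms unfolding bilin_def by blast+

lemma tensor2_cong:
  assumes eq: "tensor_eq C [(v, x), (u, y)] (ten2 s) (ten2 t)" and \<Psi>: "bilin v x u y \<Psi>"
  shows "(\<Sum>((d, b), (e, c))\<leftarrow>s. \<Psi> d b e c) \<approx> (\<Sum>((d, b), (e, c))\<leftarrow>t. \<Psi> d b e c)"
proof -
  let ?\<Psi> = "\<lambda>l. \<Psi> (fst (l ! 0)) (snd (l ! 0)) (fst (l ! 1)) (snd (l ! 1))"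
  have "(\<Sum>l\<leftarrow>ten2 s. ?\<Psi> l) \<approx> (\<Sum>l\<leftarrow>ten2 t. ?\<Psi> l)"
  proof (rule tensor_cong[OF eq])
    fix l d a b r
    assume "pure_tensor C [(v, x), (u, y)] (l @ (d, a) # r)" "pure_tensor C [(v, x), (u, y)] (l @ (d, b) # r)"
    then consider (1) e c where "l = []" "r = [(e, c)]" "a \<in> part C v x d" "b \<in> part C v x d" "c \<in> part C u y e"
      | (2) e c where "l = [(e, c)]" "r = []" "a \<in> part C u y d" "b \<in> part C u y d" "c \<in> part C v x e"
      unfolding pure_tensor_def by (cases l) (auto simp: list_all2_Cons1 list_all2_Cons2 append_eq_Cons_conv)
    then show "?\<Psi> (l @ (d, a \<oplus> b) # r) \<approx> ?\<Psi> (l @ (d, a) # r) + ?\<Psi> (l @ (d, b) # r)"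
      by cases (auto intro: bilinD[OF \<Psi>])
  next
    fix l d a t r
    assume "pure_tensor C [(v, x), (u, y)] (l @ (d, a) # r)"
    then consider (1) e c where "l = []" "r = [(e, c)]" "a \<in> part C v x d" "c \<in> part C u y e"
      | (2) e c where "l = [(e, c)]" "r = []" "a \<in> part C u y d" "c \<in> part C v x e"
      unfolding pure_tensor_def by (cases l) (auto simp: list_all2_Cons1 list_all2_Cons2 append_eq_Cons_conv)
    then show "?\<Psi> (l @ (d, t \<odot> a) # r) \<approx> scale t (?\<Psi> (l @ (d, a) # r))"
      by cases (auto intro: bilinD[OF \<Psi>])
  qed
  then show ?thesis by (simp add: ten2_def comp_def case_prod_unfold)
qed

definition csum where
  "csum v x i u n \<Psi> a = (\<Sum>((d, b), (e, c))\<leftarrow>cocomp C v x i u n a. \<Psi> d b e c :: 'a cobar_gen tree \<Rightarrow>\<^sub>0 'k)"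

lemma csum_cong:
  assumes "i < length v" "a \<in> part C (ins v i u) x n"
    and "\<And>d b e c. b \<in> part C v x d \<Longrightarrow> c \<in> part C u (v ! i) e \<Longrightarrow> d + e = n \<Longrightarrow> \<Psi> d b e c \<approx> \<Psi>' d b e c"
  shows "csum v x i u n \<Psi> a \<approx> csum v x i u n \<Psi>' a"
  unfolding csum_def
proof (rule cong_sum_list, clarify)
  fix d b e c assume "((d, b), (e, c)) \<in> set (cocomp C v x i u n a)"
  from cocomp_closed[OF assms(1,2) this] assms(3) show "\<Psi> d b e c \<approx> \<Psi>' d b e c" by blast
qed

lemma csum_eq:
  assumes "i < length v" "a \<in> part C (ins v i u) x n"
    and "\<And>d b e c. b \<in> part C v x d \<Longrightarrow> c \<in> part C u (v ! i) e \<Longrightarrow> d + e = n \<Longrightarrow> \<Psi> d b e c = \<Psi>' d b e c"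
  shows "csum v x i u n \<Psi> a = csum v x i u n \<Psi>' a"
  unfolding csum_def
proof (rule arg_cong[where f = sum_list], rule map_cong[OF refl], clarify)
  fix d b e c assume "((d, b), (e, c)) \<in> set (cocomp C v x i u n a)"
  from cocomp_closed[OF assms(1,2) this] assms(3) show "\<Psi> d b e c = \<Psi>' d b e c" by blast
qed

lemma csum_homog:
  assumes "i < length v" "a \<in> part C (ins v i u) x n"
    and "\<And>d b e c. b \<in> part C v x d \<Longrightarrow> c \<in> part C u (v ! i) e \<Longrightarrow> d + e = n \<Longrightarrow> \<Psi> d b e c \<in> homog Sg w z m"
  shows "csum v x i u n \<Psi> a \<in> homog Sg w z m"
  unfolding csum_def
proof (rule homog_sum_list, clarify)
  fix d b e c assume "((d, b), (e, c)) \<in> set (cocomp C v x i u n a)"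
  from cocomp_closed[OF assms(1,2) this] assms(3) show "\<Psi> d b e c \<in> homog Sg w z m" by blast
qed

lemma csum_linear:
  assumes "module_hom scale scale f"
  shows "f (csum v x i u n \<Psi> a) = csum v x i u n (\<lambda>d b e c. f (\<Psi> d b e c)) a"
  unfolding csum_def by (simp add: sum_list_linear[OF assms] case_prod_unfold)

lemma csum_add:
  assumes "i < length v" "a \<in> part C (ins v i u) x n" "b \<in> part C (ins v i u) x n" "bilin v x u (v ! i) \<Psi>"
  shows "csum v x i u n \<Psi> (a \<oplus> b) \<approx> csum v x i u n \<Psi> a + csum v x i u n \<Psi> b"
  using tensor2_cong[OF cocomp_add[OF assms(1-3)] assms(4)] by (simp add: csum_def)

lemma csum_smult:
  assumes "i < length v" "a \<in> part C (ins v i u) x n" "bilin v x u (v ! i) \<Psi>"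
  shows "csum v x i u n \<Psi> (t \<odot> a) \<approx> scale t (csum v x i u n \<Psi> a)"
proof -
  have "csum v x i u n \<Psi> (t \<odot> a) \<approx> csum v x i u n (\<lambda>d b e c. \<Psi> d (t \<odot> b) e c) a"
    using tensor2_cong[OF cocomp_smult[OF assms(1,2)] assms(3)] by (simp add: csum_def comp_def case_prod_unfold)
  also have "\<dots> \<approx> csum v x i u n (\<lambda>d b e c. scale t (\<Psi> d b e c)) a"
    by (rule csum_cong[OF assms(1,2)]) (rule bilinD[OF assms(3)])
  also have "\<dots> = scale t (csum v x i u n \<Psi> a)"
    by (rule csum_linear[OF linear_scale, symmetric])
  finally show ?thesis .
qed

lemma csum_equivariant:
  assumes "\<sigma> permutes {..<length v}" "\<tau> permutes {..<length u}" "i < length v"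
    "a \<in> part C (ins v (\<sigma> i) u) x n" "bilin (permw \<sigma> v) x (permw \<tau> u) (v ! \<sigma> i) \<Psi>"
  shows "csum (permw \<sigma> v) x i (permw \<tau> u) n \<Psi> (act C (perm_comp (length u) \<sigma> i \<tau>) a)
    \<approx> csum v x (\<sigma> i) u n (\<lambda>d b e c. \<Psi> d (act C \<sigma> b) e (act C \<tau> c)) a"
  using tensor2_cong[OF cocomp_equivariant[OF assms(1-4)] assms(5)]
  by (simp add: csum_def comp_def case_prod_unfold)

lemma csum_coaug:
  assumes "i < length v" "ins v i u = [x]" "bilin v x u (v ! i) \<Psi>"
    and "v = [x] \<Longrightarrow> u = [x] \<Longrightarrow> \<Psi> 0 (coaug C x) 0 (coaug C x) \<approx> 0"
  shows "csum v x i u 0 \<Psi> (coaug C x) \<approx> 0"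
proof -
  let ?t = "if v = [x] \<and> u = [x] then [((0::int, coaug C x), (0::int, coaug C x))] else []"
  have "tensor_eq C [(v, x), (u, v ! i)] (ten2 (cocomp C v x i u 0 (coaug C x))) (ten2 ?t)"
    using cocomp_coaug[OF assms(1,2)] by (auto simp: ten2_def)
  from tensor2_cong[OF this assms(3)] show ?thesis
    using assms(4) by (auto simp: csum_def intro: cong_trans split: if_splits)
qed

text \<open>Reducing \<open>a\<close> changes it by a multiple of the coaugmentation element, whose
  cocomposition has at most one term, and by hypothesis \<open>\<Psi>\<close> kills this
  term.\<close>

lemma csum_reduce:
  assumes "i < length v" "a \<in> part C (ins v i u) x n" "bilin v x u (v ! i) \<Psi>"
    and "v = [x] \<Longrightarrow> u = [x] \<Longrightarrow> \<Psi> 0 (coaug C x) 0 (coaug C x) \<approx> 0"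
  shows "csum v x i u n \<Psi> (reduce C (ins v i u) x a) \<approx> csum v x i u n \<Psi> a"
\<comment> \<open>In degree \<open>n \<noteq> 0\<close> the counit vanishes and
  \<open>reduce\<close> is the identity. The restriction to \<open>n = 0\<close> matters because the
  coaugmentation element is known to be homogeneous only there.\<close>
proof (cases "ins v i u = [x] \<and> n = 0")
  case True
  then have a: "a \<in> part C (ins v i u) x 0" and u: "coaug C x \<in> part C (ins v i u) x 0"
    using assms(2) coaug_closed[of x] by auto
  let ?c = "- counit C x a"
  have "csum v x i u n \<Psi> (reduce C (ins v i u) x a) = csum v x i u 0 \<Psi> (a \<oplus> ?c \<odot> coaug C x)"
    using True reduce_altdef[OF part_carrier[OF a]] by simp
  also have "\<dots> \<approx> csum v x i u 0 \<Psi> a + csum v x i u 0 \<Psi> (?c \<odot> coaug C x)"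
    by (rule csum_add[OF assms(1) a part_smult[OF u] assms(3)])
  also have "\<dots> \<approx> csum v x i u 0 \<Psi> a + scale ?c (csum v x i u 0 \<Psi> (coaug C x))"
    by (rule cong_add[OF cong_refl csum_smult[OF assms(1) u assms(3)]])
  also have "\<dots> \<approx> csum v x i u 0 \<Psi> a + scale ?c 0"
    by (intro cong_add cong_refl cong_scale csum_coaug) (use True assms in auto)
  finally show ?thesis using True by simp
next
  case False
  have "reduce C (ins v i u) x a = a"
  proof (rule reduce_id[OF assms(2)])
    assume e: "ins v i u = [x]"
    then show "counit C x a = 0" using False assms(2) counit_degree[of a x n] by auto
  qed
  then show ?thesis by simp
qed

text \<open>The summand \<open>(-1)^|a'| s a' \<circ> s a''\<close> of the cobar differential; the
  global minus sign is left out.\<close>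

definition kterm where
  "kterm v x i u y = (\<lambda>d b e c. scale (ksign d) (free_comp Sg i (cor v x d b) (cor u y e c)))"

lemma bilin_comp:
  assumes "\<And>d b. b \<in> part C v x d \<Longrightarrow> f d b \<in> spanned Sg" "\<And>e c. c \<in> part C u y e \<Longrightarrow> g e c \<in> spanned Sg"
    and f: "\<And>d b b'. b \<in> part C v x d \<Longrightarrow> b' \<in> part C v x d \<Longrightarrow> f d (b \<oplus> b') \<approx> f d b + f d b'"
      "\<And>d b t. b \<in> part C v x d \<Longrightarrow> f d (t \<odot> b) \<approx> scale t (f d b)"
    and g: "\<And>e c c'. c \<in> part C u y e \<Longrightarrow> c' \<in> part C u y e \<Longrightarrow> g e (c \<oplus> c') \<approx> g e c + g e c'"
      "\<And>e c t. c \<in> part C u y e \<Longrightarrow> g e (t \<odot> c) \<approx> scale t (g e c)"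
  shows "bilin v x u y (\<lambda>d b e c. scale (h d e) (free_comp Sg i (f d b) (g e c)))"
proof (rule bilinI, goal_cases)
  case (1 d e b b' c)
  show ?case using cong_scale[OF cong_comp_left[OF f(1)[OF 1(1,2)] assms(2)[OF 1(3)]], of "h d e" i]
    by (simp add: free_comp_bilinear pm.scale_right_distrib)
next
  case (2 d e b t c)
  show ?case using cong_scale[OF cong_comp_left[OF f(2)[OF 2(1)] assms(2)[OF 2(2)]], of "h d e" i]
    by (simp add: free_comp_bilinear mult.commute)
next
  case (3 d e b c c')
  show ?case using cong_scale[OF cong_comp_right[OF g(1)[OF 3(2,3)] assms(1)[OF 3(1)]], of "h d e" i]
    by (simp add: free_comp_bilinear pm.scale_right_distrib)
next
  case (4 d e b c t)
  show ?case using cong_scale[OF cong_comp_right[OF g(2)[OF 4(2)] assms(1)[OF 4(1)]], of "h d e" i]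
    by (simp add: free_comp_bilinear mult.commute)
qed

lemma bilin_kterm: "bilin v x u y (kterm v x i u y)"
  unfolding kterm_def
  by (rule bilin_comp[where h = "\<lambda>d e. ksign d"]) (auto intro: cor_spanned cor_add cor_smult)

lemma kterm_coaug: "kterm [x] x i [x] x 0 (coaug C x) 0 (coaug C x) \<approx> 0"
proof -
  have "free_comp Sg i (cor [x] x 0 (coaug C x)) (cor [x] x 0 (coaug C x)) \<approx> free_comp Sg i 0 (cor [x] x 0 (coaug C x))"
    by (intro cong_comp_left cor_coaug cor_spanned coaug_closed)
  then show ?thesis by (simp add: kterm_def)
qed

text \<open>Up to the global minus sign, the part of the differential of \<open>s a\<close> with
  inner color \<open>v ! i\<close> whose upper vertex takes the consecutive inputs from
  \<open>i\<close> to \<open>i + length u - 1\<close>.\<close>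

definition kappa where
  "kappa v x i u n a = csum v x i u n (kterm v x i u (v ! i)) a"

lemma kterm_homog:
  assumes "i < length v" "b \<in> part C v x d" "c \<in> part C u (v ! i) e" "d + e = n"
  shows "kterm v x i u (v ! i) d b e c \<in> homog Sg (ins v i u) x (n + 2)"
proof -
  have "free_comp Sg i (cor v x d b) (cor u (v ! i) e c) \<in> homog Sg (ins v i u) x ((d + 1) + (e + 1))"
    by (rule free_comp_homog[OF cor_homog[OF assms(2)] assms(1) cor_homog[OF assms(3)]])
  moreover have "(d + 1) + (e + 1) = n + 2" using assms(4) by simp
  ultimately show ?thesis by (auto simp: kterm_def)
qed

lemma kappa_homog:
  assumes "i < length v" "a \<in> part C (ins v i u) x n"
  shows "kappa v x i u n a \<in> homog Sg (ins v i u) x (n + 2)"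
  unfolding kappa_def by (rule csum_homog[OF assms]) (rule kterm_homog[OF assms(1)])

lemma kappa_add:
  assumes "i < length v" "a \<in> part C (ins v i u) x n" "b \<in> part C (ins v i u) x n"
  shows "kappa v x i u n (a \<oplus> b) \<approx> kappa v x i u n a + kappa v x i u n b"
  unfolding kappa_def by (rule csum_add[OF assms bilin_kterm])

lemma kappa_smult:
  assumes "i < length v" "a \<in> part C (ins v i u) x n"
  shows "kappa v x i u n (t \<odot> a) \<approx> scale t (kappa v x i u n a)"
  unfolding kappa_def by (rule csum_smult[OF assms bilin_kterm])

lemma kappa_reduce:
  assumes "i < length v" "a \<in> part C (ins v i u) x n"
  shows "kappa v x i u n (reduce C (ins v i u) x a) \<approx> kappa v x i u n a"
  unfolding kappa_def
  by (rule csum_reduce[OF assms bilin_kterm]) (use assms(1) kterm_coaug in auto)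

lemma free_comp_act:
  assumes "\<sigma> permutes {..<length w}" "\<tau> permutes {..<length u}"
    "a \<in> homog Sg w x d" "i < length w" "b \<in> homog Sg u (w ! \<sigma> i) e"
  shows "free_comp Sg i (free_act \<sigma> a) (free_act \<tau> b) = free_act (perm_comp (length u) \<sigma> i \<tau>) (free_comp Sg (\<sigma> i) a b)"
proof -
  have i: "\<sigma> i < length w" using assms by (simp add: permutes_less)
  have inv: "pinv \<sigma> permutes {..<length w}" "pinv \<tau> permutes {..<length u}" "pinv \<sigma> (\<sigma> i) = i"
    using assms by (auto intro: permutes_inv simp: permutes_inverses)
  have "perm_comp (length u) \<sigma> i \<tau> permutes {..<length (ins w (\<sigma> i) u)}"
    using perm_comp_permutes[OF assms(1,2,4)] by (simp add: length_ins[OF i])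
  then have "free_act (perm_comp (length u) \<sigma> i \<tau>) (free_comp Sg (\<sigma> i) a b)
      = rel (pinv (perm_comp (length u) \<sigma> i \<tau>)) (free_comp Sg (\<sigma> i) a b)"
    using free_act_rel[OF free_comp_homog[OF assms(3) i assms(5)]] by blast
  also have "\<dots> = free_comp Sg i (free_act \<sigma> a) (free_act \<tau> b)"
    using free_comp_rel[OF inv(1,2) assms(3) i assms(5)] assms
    by (simp add: free_act_rel[OF assms(3)] free_act_rel[OF assms(5)] inv(3) pinv_perm_comp)
  finally show ?thesis by simp
qed

lemma kappa_equivariant:
  assumes "\<sigma> permutes {..<length v}" "\<tau> permutes {..<length u}" "i < length v" "a \<in> part C (ins v (\<sigma> i) u) x n"
  shows "kappa (permw \<sigma> v) x i (permw \<tau> u) n (act C (perm_comp (length u) \<sigma> i \<tau>) a)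
    \<approx> free_act (perm_comp (length u) \<sigma> i \<tau>) (kappa v x (\<sigma> i) u n a)"
proof -
  let ?h = "perm_comp (length u) \<sigma> i \<tau>"
  have si: "\<sigma> i < length v" using assms by (simp add: permutes_less)
  have vi: "permw \<sigma> v ! i = v ! \<sigma> i" using assms(3) by simp
  have "kappa (permw \<sigma> v) x i (permw \<tau> u) n (act C ?h a)
      \<approx> csum v x (\<sigma> i) u n (\<lambda>d b e c. kterm (permw \<sigma> v) x i (permw \<tau> u) (v ! \<sigma> i) d (act C \<sigma> b) e (act C \<tau> c)) a"
    unfolding kappa_def vi by (rule csum_equivariant[OF assms bilin_kterm])
  also have "\<dots> \<approx> csum v x (\<sigma> i) u n (\<lambda>d b e c. free_act ?h (kterm v x (\<sigma> i) u (v ! \<sigma> i) d b e c)) a"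
  proof (rule csum_cong[OF si assms(4)])
    fix d b e c assume b: "b \<in> part C v x d" and c: "c \<in> part C u (v ! \<sigma> i) e"
    have "free_comp Sg i (cor (permw \<sigma> v) x d (act C \<sigma> b)) (cor (permw \<tau> u) (v ! \<sigma> i) e (act C \<tau> c))
        \<approx> free_comp Sg i (free_act \<sigma> (cor v x d b)) (cor (permw \<tau> u) (v ! \<sigma> i) e (act C \<tau> c))"
      by (rule cong_comp_left[OF cor_act[OF b assms(1)] cor_spanned[OF act_closed[OF assms(2) c]]])
    also have "\<dots> \<approx> free_comp Sg i (free_act \<sigma> (cor v x d b)) (free_act \<tau> (cor u (v ! \<sigma> i) e c))"
      by (rule cong_comp_right[OF cor_act[OF c assms(2)] homog_spanned[OF free_act_homog[OF cor_homog[OF b] assms(1)]]])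
    also have "\<dots> = free_act ?h (free_comp Sg (\<sigma> i) (cor v x d b) (cor u (v ! \<sigma> i) e c))"
      by (rule free_comp_act[OF assms(1,2) cor_homog[OF b] assms(3) cor_homog[OF c]])
    finally show "kterm (permw \<sigma> v) x i (permw \<tau> u) (v ! \<sigma> i) d (act C \<sigma> b) e (act C \<tau> c)
        \<approx> free_act ?h (kterm v x (\<sigma> i) u (v ! \<sigma> i) d b e c)"
      unfolding kterm_def by (simp add: module_hom.scale[OF linear_free_act] cong_scale)
  qed
  also have "\<dots> = free_act ?h (kappa v x (\<sigma> i) u n a)"
    unfolding kappa_def by (rule csum_linear[OF linear_free_act, symmetric])
  finally show ?thesis .
qed

text \<open>Up to the global minus sign, the part of \<open>D (s a)\<close> whose upper vertex has
  color \<open>y\<close> and takes the inputs \<open>\<sigma> i, ..., \<sigma> (i + k - 1)\<close>: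
  the action makes them consecutive and \<open>rel \<sigma>\<close> restores their numbers.\<close>

definition blk where
  "blk w x n a y \<sigma> i k = rel \<sigma> (kappa (take i (permw \<sigma> w) @ y # drop (i + k) (permw \<sigma> w)) x i
     (take k (drop i (permw \<sigma> w))) n (act C \<sigma> a))"

lemma blk_part:
  assumes "a \<in> part C w x n" "\<sigma> permutes {..<length w}" "i + k \<le> length w"
  shows "act C \<sigma> a \<in> part C (ins (take i (permw \<sigma> w) @ y # drop (i + k) (permw \<sigma> w)) i (take k (drop i (permw \<sigma> w)))) x n"
    "i < length (take i (permw \<sigma> w) @ y # drop (i + k) (permw \<sigma> w))"
  using assms act_closed[OF assms(2,1)] by (auto simp: permw_split)

lemma blk_kappa_homog:
  assumes "a \<in> part C w x n" "\<sigma> permutes {..<length w}" "i + k \<le> length w"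
  shows "kappa (take i (permw \<sigma> w) @ y # drop (i + k) (permw \<sigma> w)) x i
     (take k (drop i (permw \<sigma> w))) n (act C \<sigma> a) \<in> homog Sg (permw \<sigma> w) x (n + 2)"
  using kappa_homog[OF blk_part(2)[OF assms] blk_part(1)[OF assms]] assms by (simp add: permw_split)

lemma blk_homog:
  assumes "a \<in> part C w x n" "\<sigma> permutes {..<length w}" "i + k \<le> length w"
  shows "blk w x n a y \<sigma> i k \<in> homog Sg w x (n + 2)"
  unfolding blk_def by (rule rel_homog[OF blk_kappa_homog[OF assms] assms(2)])

end

section \<open>Permutations that map an interval to an interval\<close>

lemma permutes_if_inj:
  assumes "finite S" "inj_on f S" "f ` S \<subseteq> S" "\<And>x. x \<notin> S \<Longrightarrow> f x = x"
  shows "f permutes S"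
  by (rule bij_imp_permutes) (use assms endo_inj_surj[OF assms(1,3,2)] in \<open>auto simp: bij_betw_def\<close>)

text \<open>Contracting both intervals to a point gives \<open>\<rho>\<close>, restricting
  \<open>\<mu>\<close> to the interval gives \<open>\<tau>\<close>. So such permutations are covered
  by the equivariance axiom of cooperads.\<close>

lemma perm_decompose:
  assumes \<mu>: "\<mu> permutes {..<N}" and i: "i + k \<le> N" and i': "i' + k \<le> N"
    and img: "\<mu> ` {i'..<i' + k} = {i..<i + k}"
  shows "\<exists>\<rho> \<tau>. \<rho> permutes {..<N - k + 1} \<and> \<tau> permutes {..<k} \<and> \<rho> i' = i \<and> \<mu> = perm_comp k \<rho> i' \<tau>"
proof -
  have inj: "\<mu> p = \<mu> q \<longleftrightarrow> p = q" for p q using permutes_inj[OF \<mu>] by (auto simp: inj_def)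
  have lt: "\<mu> p < N \<longleftrightarrow> p < N" for p by (rule permutes_less[OF \<mu>])
  have blk: "i \<le> \<mu> p \<and> \<mu> p < i + k \<longleftrightarrow> i' \<le> p \<and> p < i' + k" for p
  proof -
    have "\<mu> p \<in> \<mu> ` {i'..<i' + k} \<longleftrightarrow> p \<in> {i'..<i' + k}" using inj by auto
    then show ?thesis unfolding img by auto
  qed
  \<comment> \<open>\<open>col\<close> contracts the interval in the target, \<open>unc\<close>
    expands the slot \<open>i'\<close> in the source; both matter only outside the
    intervals.\<close>
  define col where "col q = (if q < i then q else Suc q - k)" for q
  define unc where "unc p = (if p < i' then p else p + k - 1)" for p
  define \<rho> where "\<rho> p = (if p = i' then i else if p < N - k + 1 then col (\<mu> (unc p)) else p)" for p
  define \<tau> where "\<tau> q = (if q < k then \<mu> (i' + q) - i else q)" for q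
  have unc: "unc p < N" "\<not> (i' \<le> unc p \<and> unc p < i' + k)" if "p \<noteq> i'" "p < N - k + 1" for p
    using that i i' by (auto simp: unc_def)
  have off: "\<mu> (unc p) < N" "\<not> (i \<le> \<mu> (unc p) \<and> \<mu> (unc p) < i + k)" if "p \<noteq> i'" "p < N - k + 1" for p
    using unc[OF that] lt blk[of "unc p"] by auto
  have col: "col q < N - k + 1" "col q \<noteq> i" if "q < N" "\<not> (i \<le> q \<and> q < i + k)" for q
    using that i by (auto simp: col_def)
  have "\<rho> permutes {..<N - k + 1}"
  proof (rule permutes_if_inj)
    show "inj_on \<rho> {..<N - k + 1}"
    proof (rule inj_onI)
      fix p q assume p: "p \<in> {..<N - k + 1}" and q: "q \<in> {..<N - k + 1}" and e: "\<rho> p = \<rho> q"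
      show "p = q"
      proof (cases "p = i' \<or> q = i'")
        case True
        then show ?thesis using e p q col(2)[OF off] by (auto simp: \<rho>_def split: if_splits)
      next
        case False
        then have "col (\<mu> (unc p)) = col (\<mu> (unc q))" using e p q by (simp add: \<rho>_def)
        then have "\<mu> (unc p) = \<mu> (unc q)"
          using off[of p] off[of q] False p q by (auto simp: col_def split: if_splits)
        then have "unc p = unc q" using inj by simp
        then show ?thesis using False by (auto simp: unc_def split: if_splits)
      qed
    qed
    show "\<rho> ` {..<N - k + 1} \<subseteq> {..<N - k + 1}"
      using col(1)[OF off] i i' by (auto simp: \<rho>_def)
    show "\<rho> p = p" if "p \<notin> {..<N - k + 1}" for p
      using that i' by (auto simp: \<rho>_def)
  qed simp
  moreover have "\<tau> permutes {..<k}"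
  proof (rule permutes_if_inj)
    have b: "i \<le> \<mu> (i' + q) \<and> \<mu> (i' + q) < i + k" if "q < k" for q
      using that blk[of "i' + q"] by auto
    show "inj_on \<tau> {..<k}"
    proof (rule inj_onI)
      fix p q assume pq: "p \<in> {..<k}" "q \<in> {..<k}" "\<tau> p = \<tau> q"
      then have "\<mu> (i' + p) = \<mu> (i' + q)" using b[of p] b[of q] by (auto simp: \<tau>_def)
      then show "p = q" using inj by simp
    qed
    show "\<tau> ` {..<k} \<subseteq> {..<k}" using b by (force simp: \<tau>_def)
  qed (auto simp: \<tau>_def)
  moreover have "\<rho> i' = i" by (simp add: \<rho>_def)
  moreover have "\<mu> p = perm_comp k \<rho> i' \<tau> p" for p
  proof -
    have place: "(if col q < i then col q else col q + k - 1) = q" if "\<not> (i \<le> q \<and> q < i + k)" for q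
      using that by (auto simp: col_def)
    consider "p < i'" | "i' \<le> p" "p < i' + k" | "i' + k \<le> p" "p < N" | "i' + k \<le> p" "N \<le> p" by linarith
    then show ?thesis
    proof cases
      case 1
      then have "\<not> (i \<le> \<mu> p \<and> \<mu> p < i + k)" "p < N - k + 1" using blk[of p] i' by auto
      with 1 show ?thesis using place[of "\<mu> p"] by (simp add: perm_comp_def Let_def \<rho>_def unc_def)
    next
      case 2
      then have "i \<le> \<mu> p" "p - i' < k" using blk[of p] by auto
      with 2 show ?thesis by (simp add: perm_comp_def Let_def \<rho>_def \<tau>_def)
    next
      case 3
      then have "\<not> (i \<le> \<mu> p \<and> \<mu> p < i + k)" using blk[of p] by auto
      moreover have "Suc p - k \<noteq> i'" "Suc p - k < N - k + 1" "unc (Suc p - k) = p" "\<not> p < i'" "\<not> p < i' + k"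
        using 3 by (auto simp: unc_def)
      ultimately show ?thesis using place[of "\<mu> p"] by (simp add: perm_comp_def Let_def \<rho>_def)
    next
      case 4
      then have "\<mu> p = p" using permutes_not_in[OF \<mu>] by simp
      with 4 i show ?thesis by (auto simp: perm_comp_def Let_def \<rho>_def)
    qed
  qed
  ultimately show ?thesis by blast
qed

lemma nths_upt: "nths [0..<n] J = filter (\<lambda>j. j \<in> J) [0..<n]"
  by (induction n) (auto simp: nths_append)

lemma length_nths_upt: "J \<subseteq> {..<n} \<Longrightarrow> length (nths [0..<n] J) = card J"
proof -
  assume "J \<subseteq> {..<n}"
  then have "{i. i < n \<and> i \<in> J} = J" by auto
  then show ?thesis by (simp add: length_nths)
qed

lemma length_nths_card: "J \<subseteq> {..<length w} \<Longrightarrow> length (nths w J) = card J"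
proof -
  assume "J \<subseteq> {..<length w}"
  then have "{i. i < length w \<and> i \<in> J} = J" by auto
  then show ?thesis by (simp add: length_nths)
qed

lemma image_take:
  assumes "k \<le> n"
  shows "\<sigma> ` {..<k} = set (take k (map \<sigma> [0..<n]))"
  using assms by (simp add: take_map take_upt atLeast0LessThan)

lemma unshuffle_image:
  assumes "J \<subseteq> {..<n}"
  shows "unshuffle n J ` {..<card J} = J"
proof -
  have "card J \<le> n" using card_mono[OF _ assms] by simp
  then have "unshuffle n J ` {..<card J} = set (nths [0..<n] J)"
    by (simp add: image_take map_unshuffle unshuffle_list_def length_nths_upt[OF assms])
  then show ?thesis using assms by (auto simp: nths_upt)
qed

section \<open>Trees with leaves numbered in planar order\<close>

definition idx :: "'x list \<Rightarrow> 'x \<Rightarrow> nat" where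
  "idx L l = length (takeWhile (\<lambda>x. x \<noteq> l) L)"

lemma idx_append: "idx (A @ B) l = (if l \<in> set A then idx A l else length A + idx B l)"
  by (induction A) (auto simp: idx_def)

lemma idx_less: "l \<in> set L \<Longrightarrow> idx L l < length L"
  by (induction L) (auto simp: idx_def)

lemma idx_nth: "l \<in> set L \<Longrightarrow> L ! idx L l = l"
  by (induction L) (auto simp: idx_def)

lemma idx_Cons: "idx (x # L) l = (if x = l then 0 else Suc (idx L l))"
  by (simp add: idx_def)

lemma idx_nth_distinct: "distinct L \<Longrightarrow> k < length L \<Longrightarrow> idx L (L ! k) = k"
  using idx_nth[of "L ! k" L] idx_less[of "L ! k" L] nth_eq_iff_index_eq[of L] by auto

text \<open>The leaves of \<open>std T\<close> are numbered in planar order.\<close>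

definition std :: "'g tree \<Rightarrow> 'g tree" where
  "std T = relabel (idx (labels T)) T"

lemma leaves_std:
  assumes "distinct (labels T)" "k < length (leaves T)"
  shows "leaves (std T) ! k = (k, snd (leaves T ! k))"
proof -
  have "idx (labels T) (fst (leaves T ! k)) = k"
    using idx_nth_distinct[OF assms(1), of k] assms(2) by (simp add: labels_def)
  then show ?thesis using assms(2) by (simp add: std_def leaves_relabel case_prod_unfold)
qed

lemma std_trees:
  assumes "wf_tree \<Sigma> T" "distinct (labels T)"
  shows "std T \<in> trees \<Sigma> (map snd (leaves T)) (root_col \<Sigma> T) (tdeg \<Sigma> T)"
proof (rule treesI)
  have "set (leaves (std T)) = (\<lambda>k. leaves (std T) ! k) ` {..<length (leaves T)}"
    by (auto simp: set_conv_nth std_def)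
  also have "\<dots> = (\<lambda>k. (k, snd (leaves T ! k))) ` {..<length (leaves T)}"
    by (rule image_cong) (auto simp: leaves_std[OF assms(2)])
  finally show "set (leaves (std T)) = {(j, map snd (leaves T) ! j) |j. j < length (map snd (leaves T))}"
    by auto
qed (use assms in \<open>simp_all add: std_def\<close>)

lemma std_inverse:
  assumes T: "T \<in> trees \<Sigma> w x d"
  defines "\<pi> \<equiv> \<lambda>j. if j < length w then labels T ! j else j"
  shows "\<pi> permutes {..<length w}" "relabel \<pi> (std T) = T" "permw \<pi> w = map snd (leaves T)"
proof -
  note T' = treesD[OF T]
  have m: "map \<pi> [0..<length w] = labels T"
    by (rule nth_equalityI) (use T' in \<open>auto simp: length_labels \<pi>_def\<close>)
  show "\<pi> permutes {..<length w}"
    by (rule permutes_list; (simp only: m T')?) (simp add: \<pi>_def)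
  have "relabel \<pi> (std T) = relabel id T"
    unfolding std_def relabel_relabel
  proof (rule relabel_cong)
    fix j assume "j \<in> set (labels T)"
    then show "(\<pi> \<circ> idx (labels T)) j = id j"
      using idx_less[of j "labels T"] idx_nth[of j "labels T"] T'(4) by (simp add: \<pi>_def length_labels)
  qed
  then show "relabel \<pi> (std T) = T" by simp
  show "permw \<pi> w = map snd (leaves T)"
  proof (rule nth_equalityI)
    fix j assume "j < length (permw \<pi> w)"
    then have j: "j < length w" "j < length (leaves T)" using T'(4) by auto
    then have "leaves T ! j \<in> set (leaves T)" by simp
    then have "snd (leaves T ! j) = w ! fst (leaves T ! j)" using T'(7)[of "fst (leaves T ! j)" "snd (leaves T ! j)"] by simp
    then show "permw \<pi> w ! j = map snd (leaves T) ! j"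
      using j by (simp add: \<pi>_def labels_def)
  qed (simp add: T'(4))
qed

lemma labels_all_leaf:
  assumes "\<And>t. t \<in> set us \<Longrightarrow> is_leaf t"
  shows "concat (map labels us) = map (\<lambda>t. hd (labels t)) us"
proof -
  have "labels t = [hd (labels t)]" if "t \<in> set us" for t
    using assms[OF that] by (auto simp: is_leaf_def)
  then show ?thesis by (intro concat_map_notin)
qed

text \<open>The fresh number \<open>N\<close> marks the place where the branch \<open>S\<close> was
  cut off. In planar numbering this place is the number of leaves to its left.\<close>

lemma std_Node:
  assumes "distinct (labels (Node g (A @ S # B)))" "N \<notin> set (labels (Node g (A @ S # B)))"
  shows "std (Node g (A @ S # B)) = graft (length (concat (map labels A))) (std (Node g (A @ Leaf c N # B))) (std S)"
proof -
  let ?LA = "concat (map labels A)" and ?LB = "concat (map labels B)" and ?LS = "labels S"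
  let ?i = "length ?LA" and ?m = "length (leaves S)" and ?L = "?LA @ ?LS @ ?LB" and ?M = "?LA @ N # ?LB"
  have d: "distinct ?L" using assms(1) by auto
  have N: "N \<notin> set ?L" using assms(2) by auto
  have m: "length ?LS = ?m" by (rule length_labels)
  \<comment> \<open>The branches beside \<open>S\<close> avoid the number of the marked leaf, so
    plugging only shifts their labels, from positions counted without the leaves of \<open>S\<close>
    to positions counted with them.\<close>
  have out: "plug ?i X ?m (relabel (idx ?M) t) = relabel (idx ?L) t" if t: "t \<in> set A \<union> set B" for t X
  proof -
    have lab: "l \<in> set ?LA \<or> l \<in> set ?LB" "l \<noteq> N" if "l \<in> set (labels t)" for l
      using that t N by auto
    have ne: "idx ?M l \<noteq> ?i" if "l \<in> set (labels t)" for l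
    proof (cases "l \<in> set ?LA")
      case True
      then show ?thesis using idx_less[OF True] by (simp only: idx_append if_True)
    next
      case False
      then have "idx ?M l = ?i + idx (N # ?LB) l" by (simp only: idx_append if_False)
      then show ?thesis using lab(2)[OF that] by (simp add: idx_Cons)
    qed
    then have "plug ?i X ?m (relabel (idx ?M) t) = relabel (shift ?i ?m) (relabel (idx ?M) t)"
      by (intro plug_notin) (simp add: labels_relabel image_iff, metis)
    also have "\<dots> = relabel (idx ?L) t"
      unfolding relabel_relabel
    proof (rule relabel_cong)
      fix l assume l: "l \<in> set (labels t)"
      show "(shift ?i ?m \<circ> idx ?M) l = idx ?L l"
      proof (cases "l \<in> set ?LA")
        case True
        then show ?thesis using idx_less[OF True] by (simp add: idx_append shift_def)
      next
        case False
        then have lB: "l \<in> set ?LB" using lab[OF l] by blast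
        then have "l \<notin> set ?LS" using d by auto
        then show ?thesis using False lab[OF l] m by (simp add: idx_append idx_Cons shift_def)
      qed
    qed
    finally show ?thesis .
  qed
  have S: "relabel ((+) ?i) (std S) = relabel (idx ?L) S"
    unfolding std_def relabel_relabel
  proof (rule relabel_cong)
    fix l assume "l \<in> set ?LS"
    moreover from this have "l \<notin> set ?LA" using d by auto
    ultimately show "((+) ?i \<circ> idx ?LS) l = idx ?L l" by (simp add: idx_append)
  qed
  have N': "idx ?M N = ?i" using N by (simp add: idx_append idx_Cons)
  have "graft ?i (std (Node g (A @ Leaf c N # B))) (std S)
      = Node g (map (\<lambda>t. plug ?i (relabel ((+) ?i) (std S)) ?m (relabel (idx ?M) t)) A
         @ relabel ((+) ?i) (std S) # map (\<lambda>t. plug ?i (relabel ((+) ?i) (std S)) ?m (relabel (idx ?M) t)) B)"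
    unfolding graft_def by (simp add: std_def[of "Node g _"] N' comp_def) (simp add: std_def)
  also have "\<dots> = Node g (map (relabel (idx ?L)) A @ relabel (idx ?L) S # map (relabel (idx ?L)) B)"
    unfolding S using out by simp
  also have "\<dots> = std (Node g (A @ S # B))" by (simp add: std_def)
  finally show ?thesis by simp
qed

section \<open>Generation by corollas, and the differential of a corolla\<close>

context cooperad
begin

lemma std_corolla:
  assumes "wf_tree Sg (Node g ts)" "\<And>t. t \<in> set ts \<Longrightarrow> is_leaf t" "distinct (labels (Node g ts))"
  shows "std (Node g ts) = corolla g"
proof -
  obtain w x n a where g: "g = (w, x, n, a)" by (cases g)
  have cols: "map (root_col Sg) ts = w" using assms(1) by (simp add: g)
  then have len: "length ts = length w" by auto
  have leaf: "ts ! k = Leaf (w ! k) (labels (Node g ts) ! k)" if k: "k < length ts" for k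
  proof -
    note ll = labels_all_leaf
    obtain c j where "ts ! k = Leaf c j" using assms(2)[of "ts ! k"] k by (auto simp: is_leaf_def)
    moreover from this have "c = w ! k" using cols k by (metis nth_map root_col.simps(1))
    ultimately show ?thesis using ll[of ts] assms(2) k by simp
  qed
  have n: "length (labels (Node g ts)) = length ts"
    using labels_all_leaf[OF assms(2)] by simp
  have "map (relabel (idx (labels (Node g ts)))) ts = map (\<lambda>j. Leaf (w ! j) j) [0..<length w]"
  proof (rule nth_equalityI)
    fix k assume "k < length (map (relabel (idx (labels (Node g ts)))) ts)"
    then have k: "k < length ts" by simp
    then show "map (relabel (idx (labels (Node g ts)))) ts ! k = map (\<lambda>j. Leaf (w ! j) j) [0..<length w] ! k"
      using leaf[OF k] idx_nth_distinct[OF assms(3), of k] n len by simp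
  qed (simp add: len)
  then show ?thesis by (simp add: std_def corolla_def g)
qed

text \<open>The free operad is generated by corollas: up to relabeling the leaves are in planar
  order, and a tree that is neither trivial nor a corolla has a branch that is not a leaf and can be
  cut off by \<open>std_Node\<close>.\<close>

lemma operad_induct [consumes 1, case_names leaf corolla graft relabel]:
  assumes T: "T \<in> trees Sg w x d"
    and leaf: "\<And>x. P (Leaf x 0)"
    and corolla: "\<And>g. g \<in> gens Sg \<Longrightarrow> P (corolla g)"
    and graft: "\<And>T S w x d i u e. T \<in> trees Sg w x d \<Longrightarrow> i < length w \<Longrightarrow> S \<in> trees Sg u (w ! i) e \<Longrightarrow>
      P T \<Longrightarrow> P S \<Longrightarrow> P (graft i T S)"
    and relabel: "\<And>T \<sigma> w x d. T \<in> trees Sg (permw \<sigma> w) x d \<Longrightarrow> \<sigma> permutes {..<length w} \<Longrightarrow> P T \<Longrightarrow> P (relabel \<sigma> T)"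
  shows "P T"
proof -
  have std: "P (std T)" if "wf_tree Sg T" "distinct (labels T)" for T
    using that
  proof (induction "nodes T" arbitrary: T rule: less_induct)
    case less
    show ?case
    proof (cases T)
      case (Leaf c j)
      then show ?thesis using leaf by (simp add: std_def idx_def)
    next
      case (Node g ts)
      show ?thesis
      proof (cases "\<forall>t\<in>set ts. is_leaf t")
        case True
        then show ?thesis using std_corolla[of g ts] less.prems corolla[of g] by (simp add: Node)
      next
        case False
        \<comment> \<open>As \<open>S\<close> is not a leaf, both the branch and the tree that
          remains after cutting it off have fewer vertices.\<close>
        then obtain S where S: "S \<in> set ts" "\<not> is_leaf S" by blast
        then obtain A B where ts: "ts = A @ S # B" by (auto dest: split_list)
        define N where "N = Suc (Max (insert 0 (set (labels T))))"
        have N: "N \<notin> set (labels T)"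
        proof
          assume "N \<in> set (labels T)"
          then have "N \<le> Max (insert 0 (set (labels T)))" by (intro Max_ge) auto
          then show False by (simp add: N_def)
        qed
        let ?T0 = "Node g (A @ Leaf (root_col Sg S) N # B)"
        have wS: "wf_tree Sg S" and w0: "wf_tree Sg ?T0"
          using less.prems(1) by (auto simp: Node ts list_all_iff)
        have dS: "distinct (labels S)" and d0: "distinct (labels ?T0)"
          using less.prems(2) N by (auto simp: Node ts)
        have nS: "nodes S > 0" using S(2) by (cases S) auto
        have "nodes S < nodes T" "nodes ?T0 < nodes T" using nS by (auto simp: Node ts)
        then have P: "P (std S)" "P (std ?T0)" using less.hyps wS dS w0 d0 by blast+
        let ?i = "length (concat (map labels A))" and ?w = "map snd (leaves ?T0)"
        have l: "length (concat (map leaves A)) = ?i"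
          by (simp add: length_concat comp_def length_labels)
        have i: "?i < length ?w" "?w ! ?i = root_col Sg S"
          using l by (simp_all add: nth_append del: length_concat)
        have "P (graft ?i (std ?T0) (std S))"
          by (rule graft[OF std_trees[OF w0 d0] i(1) _ P(2,1)]) (use std_trees[OF wS dS] in \<open>simp only: i(2)\<close>)
        then show ?thesis
          using std_Node[of g A S B N "root_col Sg S"] less.prems(2) N by (simp add: Node ts)
      qed
    qed
  qed
  note T' = treesD[OF T] and inv = std_inverse[OF T]
  have "std T \<in> trees Sg (permw (\<lambda>j. if j < length w then labels T ! j else j) w) x d"
    using std_trees[OF T'(1,5)] T'(2,3) unfolding inv(3) by simp
  from relabel[OF this inv(1) std[OF T'(1,5)]] show ?thesis unfolding inv(2) .
qed

text \<open>Only the set of inputs at the upper vertex matters. The permutation leading from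
  \<open>\<sigma>\<close> to \<open>\<sigma>'\<close> maps one block to the other, so by
  \<open>perm_decompose\<close> it is of the form treated by
  \<open>kappa_equivariant\<close>.\<close>

lemma blk_cong:
  assumes a: "a \<in> part C w x n" and \<sigma>: "\<sigma> permutes {..<length w}" and \<sigma>': "\<sigma>' permutes {..<length w}"
    and i: "i + k \<le> length w" and i': "i' + k \<le> length w" and img: "\<sigma> ` {i..<i + k} = \<sigma>' ` {i'..<i' + k}"
  shows "blk w x n a y \<sigma> i k \<approx> blk w x n a y \<sigma>' i' k"
proof -
  define \<mu> where "\<mu> = pinv \<sigma> \<circ> \<sigma>'"
  have \<mu>: "\<mu> permutes {..<length w}" unfolding \<mu>_def by (rule permutes_compose[OF \<sigma>' permutes_inv[OF \<sigma>]])
  have s: "\<sigma> \<circ> \<mu> = \<sigma>'" by (simp add: \<mu>_def comp_assoc[symmetric] permutes_inv_o[OF \<sigma>])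
  have "\<mu> ` {i'..<i' + k} = {i..<i + k}"
    unfolding \<mu>_def image_comp[symmetric] img[symmetric] using permutes_inv_o(2)[OF \<sigma>] by (simp add: image_comp)
  from perm_decompose[OF \<mu> i i' this] obtain \<rho> \<tau> where \<rho>: "\<rho> permutes {..<length w - k + 1}"
    and \<tau>: "\<tau> permutes {..<k}" and \<rho>i: "\<rho> i' = i" and \<mu>e: "\<mu> = perm_comp k \<rho> i' \<tau>" by blast
  let ?w = "permw \<sigma> w" and ?w' = "permw \<sigma>' w"
  define v u where "v = take i ?w @ y # drop (i + k) ?w" and "u = take k (drop i ?w)"
  have lu: "length u = k" and lv: "length v = length w - k + 1" using i by (auto simp: u_def v_def)
  have ins: "ins v i u = ?w" unfolding v_def u_def using i by (simp add: permw_split)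
  have vi: "v ! i = y" using i by (simp add: v_def nth_append)
  have i'v: "i' < length v" using lv i' by simp
  have iv: "i < length v" using lv i by simp
  have p: "permw \<mu> (permw \<sigma> w) = ?w'" using permw_permw[OF \<mu>] s by simp
  have "ins (permw \<rho> v) i' (permw \<tau> u) = ?w'"
    using permw_perm_comp[of \<rho> v \<tau> u i'] \<rho> \<tau> i'v lu lv \<rho>i ins p by (simp add: \<mu>e)
  moreover have "i' < length (permw \<rho> v)" using i'v by simp
  ultimately have "permw \<rho> v = take i' ?w' @ permw \<rho> v ! i' # drop (i' + length (permw \<tau> u)) ?w'"
      "permw \<tau> u = take (length (permw \<tau> u)) (drop i' ?w')" using ins_split(1,2) by blast+
  then have v': "permw \<rho> v = take i' ?w' @ y # drop (i' + k) ?w'" and u': "permw \<tau> u = take k (drop i' ?w')"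
    using i'v lu vi \<rho>i by (simp_all only: length_permw nth_permw)
  have aa: "act C \<sigma> a \<in> part C (ins v (\<rho> i') u) x n" using act_closed[OF \<sigma> a] by (simp add: \<rho>i ins)
  have act: "act C \<sigma>' a = act C \<mu> (act C \<sigma> a)" using act_act[OF \<sigma> \<mu> a] s by simp
  have k: "kappa (permw \<rho> v) x i' (permw \<tau> u) n (act C \<mu> (act C \<sigma> a)) \<approx> free_act \<mu> (kappa v x i u n (act C \<sigma> a))"
    using kappa_equivariant[of \<rho> v \<tau> u, OF _ _ i'v aa] \<rho> \<tau> lu lv by (simp add: \<mu>e \<rho>i)
  have h: "kappa v x i u n (act C \<sigma> a) \<in> homog Sg ?w x (n + 2)"
    using kappa_homog[OF iv aa[unfolded \<rho>i]] unfolding ins .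
  have h1: "free_act \<mu> (kappa v x i u n (act C \<sigma> a)) \<in> homog Sg ?w' x (n + 2)"
    using free_act_homog[OF h, of \<mu>] \<mu> by (simp add: p)
  have h2: "kappa (permw \<rho> v) x i' (permw \<tau> u) n (act C \<mu> (act C \<sigma> a)) \<in> homog Sg ?w' x (n + 2)"
    using blk_kappa_homog[OF a \<sigma>' i', of y] by (simp add: v' u' act)
  have "blk w x n a y \<sigma>' i' k = rel \<sigma>' (kappa (permw \<rho> v) x i' (permw \<tau> u) n (act C \<mu> (act C \<sigma> a)))"
    by (simp add: blk_def v' u' act)
  also have "\<dots> \<approx> rel \<sigma>' (free_act \<mu> (kappa v x i u n (act C \<sigma> a)))"
    by (rule cong_rel[OF k _ h2 h1]) (use \<sigma>' in simp)
  also have "\<dots> = rel (\<sigma>' \<circ> pinv \<mu>) (kappa v x i u n (act C \<sigma> a))"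
    using free_act_rel[OF h, of \<mu>] \<mu> by (simp only: length_permw rel_rel)
  also have "\<sigma>' \<circ> pinv \<mu> = \<sigma>"
    unfolding s[symmetric] comp_assoc permutes_inv_o(1)[OF \<mu>] by simp
  also have "rel \<sigma> (kappa v x i u n (act C \<sigma> a)) = blk w x n a y \<sigma> i k" by (simp add: blk_def v_def u_def)
  finally show ?thesis by (rule cong_sym)
qed

lemma deg_after_corolla: "deg_after Sg 0 (corolla g) = 0"
proof -
  have "pdeg Sg (map Inr l) = 0" for l :: "nat list"
    by (induction l) auto
  then have "pdeg Sg (dropWhile p (map Inr l)) = 0" for p and l :: "nat list"
    by (simp add: dropWhile_map)
  moreover have "concat (map (\<lambda>j. [Inr j]) l) = map Inr l" for l :: "nat list" by (induction l) auto
  ultimately show ?thesis by (simp add: deg_after_pdeg corolla_def comp_def)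
qed

text \<open>Connects the trees written down in \<open>cobar_vertex\<close> with operadic
  composition: the inner edge is slot 0 of the lower corolla, and the unshuffle restores the numbers
  of the inputs.\<close>

lemma vertex_corolla:
  fixes w :: "color list" and J :: "nat set"
  assumes J: "J \<subseteq> {..<length w}"
  defines "L \<equiv> map (\<lambda>j. Leaf (w ! j) j) [0..<length w]"
  shows "Node (y # nths w (- J), x, d, b) (Node (nths w J, y, e, c) (nths L J) # nths L (- J))
    = relabel (unshuffle (length w) J) (graft 0 (corolla (y # nths w (- J), x, d, b)) (corolla (nths w J, y, e, c)))"
proof -
  let ?s = "unshuffle (length w) J" and ?u = "nths w J" and ?v = "y # nths w (- J)"
  let ?A = "nths [0..<length w] J" and ?B = "nths [0..<length w] (- J)"
  have nL: "nths L K = map (\<lambda>j. Leaf (w ! j) j) (nths [0..<length w] K)" for K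
    by (simp add: L_def nths_map)
  have w: "nths w K = map ((!) w) (nths [0..<length w] K)" for K
    using nths_map[of "(!) w" "[0..<length w]" K] by (simp add: map_nth)
  have nw: "nths w K ! j = w ! (nths [0..<length w] K ! j)" if "j < length (nths [0..<length w] K)" for K j
    using that by (simp only: w nth_map)
  have lA: "length ?A = length ?u" and lB: "length ?B = length (nths w (- J))" by (simp_all add: w[of J] w[of "- J"])
  have len: "length ?u + length (nths w (- J)) = length w" by (rule length_nths_compl)
  have s: "?s j = (?A @ ?B) ! j" if "j < length w" for j using that by (simp add: unshuffle_def)
  have 1: "map (\<lambda>j. Leaf (?u ! j) (?s j)) [0..<length ?u] = nths L J"
  proof (rule nth_equalityI)
    show "length (map (\<lambda>j. Leaf (?u ! j) (?s j)) [0..<length ?u]) = length (nths L J)" by (simp add: nL lA)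
    fix j assume "j < length (map (\<lambda>j. Leaf (?u ! j) (?s j)) [0..<length ?u])"
    then show "map (\<lambda>j. Leaf (?u ! j) (?s j)) [0..<length ?u] ! j = nths L J ! j"
      using lA len s[of j] nw[of j J] by (simp add: nL nth_append)
  qed
  have 2: "map (\<lambda>j. Leaf (?v ! j) (?s (j + length ?u - 1))) [Suc 0..<length ?v] = nths L (- J)"
  proof (rule nth_equalityI)
    show "length (map (\<lambda>j. Leaf (?v ! j) (?s (j + length ?u - 1))) [Suc 0..<length ?v]) = length (nths L (- J))"
      by (simp add: nL lB del: upt_Suc)
    fix j assume "j < length (map (\<lambda>j. Leaf (?v ! j) (?s (j + length ?u - 1))) [Suc 0..<length ?v])"
    then have j: "j < length (nths w (- J))" by (simp del: upt_Suc)
    have "?s (Suc j + length ?u - 1) = ?B ! j" using j lA lB len s[of "j + length ?u"] by (simp add: nth_append)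
    then show "map (\<lambda>j. Leaf (?v ! j) (?s (j + length ?u - 1))) [Suc 0..<length ?v] ! j = nths L (- J) ! j"
      using j lB nw[of j "- J"] by (simp add: nL del: upt_Suc)
  qed
  have up: "[0..<length ?v] = 0 # [Suc 0..<length ?v]" by (rule upt_conv_Cons) simp
  have "length (leaves (corolla (?u, y, e, c))) = length ?u"
    by (simp add: corolla_def comp_def length_concat sum_list_triv)
  then have "graft 0 (corolla (?v, x, d, b)) (corolla (?u, y, e, c))
     = Node (?v, x, d, b) (Node (?u, y, e, c) (map (\<lambda>j. Leaf (?u ! j) j) [0..<length ?u])
         # map (\<lambda>j. Leaf (?v ! j) (j + length ?u - 1)) [Suc 0..<length ?v])"
  proof -
    assume l: "length (leaves (corolla (?u, y, e, c))) = length ?u"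
    let ?X = "corolla (?u, y, e, c)"
    have c: "corolla (?v, x, d, b) = Node (?v, x, d, b) (Leaf (?v ! 0) 0 # map (\<lambda>j. Leaf (?v ! j) j) [Suc 0..<length ?v])"
      by (simp only: corolla_def fst_conv up list.map)
    have "map (plug 0 ?X (length ?u)) (map (\<lambda>j. Leaf (?v ! j) j) [Suc 0..<length ?v])
        = map (\<lambda>j. Leaf (?v ! j) (j + length ?u - 1)) [Suc 0..<length ?v]"
      by (simp del: upt_Suc)
    moreover have "relabel ((+) 0) ?X = relabel id ?X" by (rule relabel_cong) simp
    then have "relabel ((+) 0) ?X = ?X" by simp
    moreover have "?X = Node (?u, y, e, c) (map (\<lambda>j. Leaf (?u ! j) j) [0..<length ?u])"
      by (simp add: corolla_def)
    ultimately show ?thesis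
      unfolding graft_def l c by (simp only: plug.simps list.map if_True refl)
  qed
  then show ?thesis using 1 2 by (simp add: comp_def del: upt_Suc)
qed

text \<open>From here on the differential is handled through the terms \<open>blk\<close>, which are
  linear and equivariant modulo the relations, rather than through explicit trees.\<close>

lemma cobar_diff_cor:
  assumes a: "a \<in> part C w x n"
  shows "cobar_diff (cor w x n a)
    \<approx> - (\<Sum>y\<in>{Closed, Open}. \<Sum>J\<in>Pow {..<length w}. blk w x n a y (unshuffle (length w) J) 0 (card J))"
proof -
  let ?L = "map (\<lambda>j. Leaf (w ! j) j) [0..<length w] :: 'a cobar_gen tree list" and ?s = "unshuffle (length w)"
  define ab where "ab = reduce C w x a"
  have ab: "ab \<in> part C w x n" unfolding ab_def by (rule reduce_part[OF a])
  have vt: "(\<Sum>((d, b), (e, c))\<leftarrow>cocomp C (y # nths w (- J)) x 0 (nths w J) n (act C (?s J) ab).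
        Poly_Mapping.single (Node (y # nths w (- J), x, d, reduce C (y # nths w (- J)) x b)
           (Node (nths w J, y, e, reduce C (nths w J) y c) (nths ?L J) # nths ?L (- J)))
          (ksign d * unshuffle_sign (map (tdeg Sg) ?L) J))
      \<approx> blk w x n a y (?s J) 0 (card J)" if J: "J \<subseteq> {..<length w}" for y J
  proof -
    let ?v = "y # nths w (- J)" and ?u = "nths w J"
    have pw: "permw (?s J) w = ?u @ nths w (- J)" by (rule permw_unshuffle)
    have lu: "length ?u = card J" by (rule length_nths_card[OF J])
    have sp: "?s J permutes {..<length w}" by (rule unshuffle_permutes)
    have "act C (?s J) ab \<in> part C (ins ?v 0 ?u) x n" "act C (?s J) a \<in> part C (ins ?v 0 ?u) x n"
      using act_closed[OF sp ab] act_closed[OF sp a] by (simp_all add: pw ins_Cons_0)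
    note aa = this
    have v0: "0 < length ?v" by simp
    \<comment> \<open>All branches of a corolla are leaves, of degree 0, so moving them costs no
      sign.\<close>
    have sg: "unshuffle_sign (map (tdeg Sg) ?L) J = (1 :: 'k)"
    proof -
      have "inversions (map (\<lambda>j. 0) [0..<length w]) J = 0"
        unfolding inversions_def by (rule sum.neutral) auto
      then show ?thesis by (simp add: unshuffle_sign_inversions comp_def)
    qed
    have "(\<Sum>((d, b), (e, c))\<leftarrow>cocomp C ?v x 0 ?u n (act C (?s J) ab).
        Poly_Mapping.single (Node (?v, x, d, reduce C ?v x b)
           (Node (?u, y, e, reduce C ?u y c) (nths ?L J) # nths ?L (- J)))
          (ksign d * unshuffle_sign (map (tdeg Sg) ?L) J))
       = csum ?v x 0 ?u n (\<lambda>d b e c. Poly_Mapping.single (Node (?v, x, d, reduce C ?v x b)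
           (Node (?u, y, e, reduce C ?u y c) (nths ?L J) # nths ?L (- J))) (ksign d)) (act C (?s J) ab)"
      unfolding csum_def sg by simp
    also have "\<dots> = csum ?v x 0 ?u n (\<lambda>d b e c. rel (?s J) (kterm ?v x 0 ?u (?v ! 0) d b e c)) (act C (?s J) ab)"
    proof (rule csum_eq[OF v0 aa(1)])
      fix d b e c assume b: "b \<in> part C ?v x d" and c: "c \<in> part C ?u (?v ! 0) e"
      have "corolla (?u, y, e, reduce C ?u y c) \<in> trees Sg ?u (?v ! 0) (e + 1)"
        using corolla_trees[OF reduce_gen, of c ?u y e] c by simp
      from free_comp_mon[OF corolla_trees[OF reduce_gen[OF b]] v0 this]
      have "free_comp Sg 0 (cor ?v x d b) (cor ?u y e c)
          = mon (graft 0 (corolla (?v, x, d, reduce C ?v x b)) (corolla (?u, y, e, reduce C ?u y c)))"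
        by (simp add: cor_def graft_sign_def deg_after_corolla)
      then show "Poly_Mapping.single (Node (?v, x, d, reduce C ?v x b)
           (Node (?u, y, e, reduce C ?u y c) (nths ?L J) # nths ?L (- J))) (ksign d)
         = rel (?s J) (kterm ?v x 0 ?u (?v ! 0) d b e c)"
        using vertex_corolla[OF J, of y x d "reduce C ?v x b" e "reduce C ?u y c"]
        by (simp add: kterm_def)
    qed
    also have "\<dots> = rel (?s J) (kappa ?v x 0 ?u n (act C (?s J) ab))"
      unfolding kappa_def by (rule csum_linear[OF linear_rel, symmetric])
    also have "\<dots> \<approx> rel (?s J) (kappa ?v x 0 ?u n (act C (?s J) a))"
    proof (rule cong_rel)
      \<comment> \<open>The generator is decorated with the reduced element. The action commutes
        with \<open>reduce\<close>, and modulo the relations \<open>kappa\<close> does not see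
        \<open>reduce\<close>.\<close>
      have "act C (?s J) ab = reduce C (ins ?v 0 ?u) x (act C (?s J) a)"
        unfolding ab_def using reduce_act[OF a sp] by (simp add: pw ins_Cons_0)
      then show "kappa ?v x 0 ?u n (act C (?s J) ab) \<approx> kappa ?v x 0 ?u n (act C (?s J) a)"
        using kappa_reduce[OF v0 aa(2)] by simp
      show "kappa ?v x 0 ?u n (act C (?s J) ab) \<in> homog Sg (ins ?v 0 ?u) x (n + 2)"
        "kappa ?v x 0 ?u n (act C (?s J) a) \<in> homog Sg (ins ?v 0 ?u) x (n + 2)"
        using kappa_homog[OF v0] aa by blast+
      show "?s J permutes {..<length (ins ?v 0 ?u)}"
        using sp length_nths_compl[of w J] by (simp add: ins_Cons_0)
    qed
    also have "\<dots> = blk w x n a y (?s J) 0 (card J)"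
      by (simp add: blk_def pw flip: lu)
    finally show ?thesis .
  qed
  have "cobar_diff (cor w x n a) = cobar_tree_diff C (corolla (w, x, n, ab))"
    by (simp add: cor_def ab_def cobar_diff_mon)
  also have "\<dots> = cobar_vertex C (w, x, n, ab) ?L"
  proof -
    have "(\<Sum>j<length ?L. scale (ksign (gdeg Sg (w, x, n, ab) + sum_list (map (tdeg Sg) (take j ?L))))
            (lin_ext (\<lambda>t. mon (Node (w, x, n, ab) (?L[j := t]))) (map (cobar_tree_diff C) ?L ! j))) = 0"
      by (rule sum.neutral) auto
    then show ?thesis by (simp add: corolla_def del: cobar_simps)
  qed
  also have "\<dots> = - (\<Sum>y\<in>{Closed, Open}. \<Sum>J\<in>Pow {..<length w}.
      \<Sum>((d, b), (e, c))\<leftarrow>cocomp C (y # nths w (- J)) x 0 (nths w J) n (act C (?s J) ab).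
        Poly_Mapping.single (Node (y # nths w (- J), x, d, reduce C (y # nths w (- J)) x b)
           (Node (nths w J, y, e, reduce C (nths w J) y c) (nths ?L J) # nths ?L (- J)))
          (ksign d * unshuffle_sign (map (tdeg Sg) ?L) J))"
    unfolding cobar_vertex_def by (simp add: Let_def)
  also have "\<dots> \<approx> - (\<Sum>y\<in>{Closed, Open}. \<Sum>J\<in>Pow {..<length w}. blk w x n a y (?s J) 0 (card J))"
    by (intro cong_uminus cong_sum vt) auto
  finally show ?thesis .
qed

end

section \<open>Compatibility of the differential with the relations\<close>

lemma cobar_relationsI:
  "\<lbrakk>(w, x, d, a) \<in> gens (cobar_signature C); (w, x, d, b) \<in> gens (cobar_signature C)\<rbrakk>
   \<Longrightarrow> mon (corolla (w, x, d, a \<oplus>\<^bsub>C\<^esub> b)) - mon (corolla (w, x, d, a)) - mon (corolla (w, x, d, b)) \<in> cobar_relations C"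
  "(w, x, d, a) \<in> gens (cobar_signature C)
   \<Longrightarrow> mon (corolla (w, x, d, c \<odot>\<^bsub>C\<^esub> a)) - scale c (mon (corolla (w, x, d, a))) \<in> cobar_relations C"
  "\<lbrakk>(w, x, d, a) \<in> gens (cobar_signature C); \<sigma> permutes {..<length w}\<rbrakk>
   \<Longrightarrow> mon (corolla (permw \<sigma> w, x, d, act C \<sigma> a)) - free_act \<sigma> (mon (corolla (w, x, d, a))) \<in> cobar_relations C"
  unfolding cobar_relations_def by blast+

lemma cobar_relations_cases [consumes 1, case_names add smult act]:
  assumes "r \<in> cobar_relations C"
  obtains w x d a b where "r = mon (corolla (w, x, d, a \<oplus>\<^bsub>C\<^esub> b)) - mon (corolla (w, x, d, a)) - mon (corolla (w, x, d, b))"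
      "(w, x, d, a) \<in> gens (cobar_signature C)" "(w, x, d, b) \<in> gens (cobar_signature C)"
    | w x d c a where "r = mon (corolla (w, x, d, c \<odot>\<^bsub>C\<^esub> a)) - scale c (mon (corolla (w, x, d, a)))"
      "(w, x, d, a) \<in> gens (cobar_signature C)"
    | w x d \<sigma> a where "r = mon (corolla (permw \<sigma> w, x, d, act C \<sigma> a)) - free_act \<sigma> (mon (corolla (w, x, d, a)))"
      "(w, x, d, a) \<in> gens (cobar_signature C)" "\<sigma> permutes {..<length w}"
  using assms unfolding cobar_relations_def by blast

lemma sum_Pow_image: "bij_betw g A B \<Longrightarrow> (\<Sum>K\<in>Pow B. f K) = (\<Sum>K\<in>Pow A. f (g ` K))"
  by (rule sum.reindex_bij_betw[OF bij_betw_Pow, symmetric])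

context cooperad
begin

lemma kappa_spanned: "i < length v \<Longrightarrow> a \<in> part C (ins v i u) x n \<Longrightarrow> kappa v x i u n a \<in> spanned Sg"
  by (rule homog_spanned[OF kappa_homog])

lemma blk_add:
  assumes "a \<in> part C w x n" "b \<in> part C w x n" "\<sigma> permutes {..<length w}" "i + k \<le> length w"
  shows "blk w x n (a \<oplus> b) y \<sigma> i k \<approx> blk w x n a y \<sigma> i k + blk w x n b y \<sigma> i k"
proof -
  have "act C \<sigma> (a \<oplus> b) = act C \<sigma> a \<oplus> act C \<sigma> b" by (rule act_add[OF assms(3,1,2)])
  then show ?thesis
    unfolding blk_def rel_linear(1)[symmetric]
    using kappa_add[OF blk_part(2,1)[OF assms(1,3,4)] blk_part(1)[OF assms(2-4)]]
      blk_kappa_homog[OF part_add[OF assms(1,2)] assms(3,4), of y]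
      blk_kappa_homog[OF assms(1,3,4), of y] blk_kappa_homog[OF assms(2-4), of y] assms(3)
    by (intro cong_rel[where w = "permw \<sigma> w" and x = x and d = "n + 2"] homog_add) auto
qed

lemma blk_smult:
  assumes "a \<in> part C w x n" "\<sigma> permutes {..<length w}" "i + k \<le> length w"
  shows "blk w x n (c \<odot> a) y \<sigma> i k \<approx> scale c (blk w x n a y \<sigma> i k)"
proof -
  have "act C \<sigma> (c \<odot> a) = c \<odot> act C \<sigma> a" by (rule act_smult[OF assms(2,1)])
  then show ?thesis
    unfolding blk_def rel_linear(2)[symmetric]
    using kappa_smult[OF blk_part(2,1)[OF assms]] blk_kappa_homog[OF part_smult[OF assms(1)] assms(2,3), where y = y, unfolded act_smult[OF assms(2,1)]]
      blk_kappa_homog[OF assms, of y] assms(2)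
    by (intro cong_rel[where w = "permw \<sigma> w" and x = x and d = "n + 2"] homog_scale) auto
qed

lemma blk_act:
  assumes "a \<in> part C w x n" "\<tau> permutes {..<length w}" "\<sigma> permutes {..<length w}"
  shows "rel \<tau> (blk (permw \<tau> w) x n (act C \<tau> a) y \<sigma> i k) = blk w x n a y (\<tau> \<circ> \<sigma>) i k"
  using act_act[OF assms(2,3,1)] permw_permw[OF assms(3), of \<tau>] by (simp add: blk_def rel_rel)

abbreviation cols :: "color set" where "cols \<equiv> {Closed, Open}"

definition corolla_diff where
  "corolla_diff w x n a = - (\<Sum>y\<in>cols. \<Sum>J\<in>Pow {..<length w}. blk w x n a y (unshuffle (length w) J) 0 (card J))"

lemma card_le: "J \<in> Pow {..<n::nat} \<Longrightarrow> card J \<le> n"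
  using card_mono[of "{..<n}" J] by simp

lemma cobar_diff_relation:
  assumes "r \<in> cobar_relations C"
  shows "cobar_diff r \<in> total_ideal Sg (cobar_relations C)"
proof -
  note D = cobar_diff_cor[folded corolla_diff_def]
  have cor: "mon (corolla (w, x, d, a)) = cor w x d a" if "(w, x, d, a) \<in> gens Sg" for w x d a
    using reduce_id[of a w x d] that by (simp add: cor_def)
  have gp: "a \<in> part C w x d" if "(w, x, d, a) \<in> gens Sg" for w x d a using that by simp
  show ?thesis
    using assms
  proof (cases rule: cobar_relations_cases)
    case (add w x d a b)
    note a = gp[OF add(2)] and b = gp[OF add(3)]
    have g: "(w, x, d, a \<oplus> b) \<in> gens Sg" using add(2,3) counit_add[of a x d b] by (auto simp: part_add)
    have "corolla_diff w x d (a \<oplus> b) \<approx> - (\<Sum>y\<in>cols. \<Sum>J\<in>Pow {..<length w}. blk w x d a y (unshuffle (length w) J) 0 (card J)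
        + blk w x d b y (unshuffle (length w) J) 0 (card J))"
      unfolding corolla_diff_def by (intro cong_uminus cong_sum blk_add a b unshuffle_permutes) (auto intro: card_le[OF PowI])
    also have "\<dots> = corolla_diff w x d a + corolla_diff w x d b" by (simp add: corolla_diff_def sum.distrib)
    finally have "corolla_diff w x d (a \<oplus> b) \<approx> corolla_diff w x d a + corolla_diff w x d b" .
    then have "cobar_diff (cor w x d (a \<oplus> b)) \<approx> cobar_diff (cor w x d a) + cobar_diff (cor w x d b)"
      using D[OF part_add[OF a b]] cong_add[OF D[OF a] D[OF b]] by (meson cong_trans cong_sym)
    then show ?thesis
      unfolding add(1) cor[OF g] cor[OF add(2)] cor[OF add(3)]
      by (simp add: cobar_diff_linear cong_mod_def diff_diff_eq)
  next
    case (smult w x d c a)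
    note a = gp[OF smult(2)]
    have g: "(w, x, d, c \<odot> a) \<in> gens Sg" using smult(2) counit_smult[of a x d c] by (auto simp: part_smult)
    have "corolla_diff w x d (c \<odot> a) \<approx> - (\<Sum>y\<in>cols. \<Sum>J\<in>Pow {..<length w}. scale c (blk w x d a y (unshuffle (length w) J) 0 (card J)))"
      unfolding corolla_diff_def by (intro cong_uminus cong_sum blk_smult a unshuffle_permutes) (auto intro: card_le[OF PowI])
    also have "\<dots> = scale c (corolla_diff w x d a)"
      by (simp add: corolla_diff_def pm.scale_sum_right pm.scale_right_distrib pm.scale_right_diff_distrib pm.scale_minus_right)
    finally have "corolla_diff w x d (c \<odot> a) \<approx> scale c (corolla_diff w x d a)" .
    then have "cobar_diff (cor w x d (c \<odot> a)) \<approx> scale c (cobar_diff (cor w x d a))"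
      using D[OF part_smult[OF a]] cong_scale[OF D[OF a]] by (meson cong_trans cong_sym)
    then show ?thesis
      unfolding smult(1) cor[OF g] cor[OF smult(2)] by (simp add: cobar_diff_linear cong_mod_def)
  next
    case (act w x d \<sigma> a)
    note a = gp[OF act(2)] and \<sigma> = act(3)
    let ?N = "length w"
    have aa: "act C \<sigma> a \<in> part C (permw \<sigma> w) x d" by (rule act_closed[OF \<sigma> a])
    have bij: "bij_betw \<sigma> {..<?N} {..<?N}" by (rule permutes_imp_bij[OF \<sigma>])
    have "mon (corolla (permw \<sigma> w, x, d, act C \<sigma> a)) = cor (permw \<sigma> w) x d (act C \<sigma> a)"
      unfolding cor_def reduce_act[OF a \<sigma>] using reduce_id[of a w x d] act(2) by simp
    note r = act(1)[unfolded this cor[OF act(2)]]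
    have "rel \<sigma> (corolla_diff (permw \<sigma> w) x d (act C \<sigma> a))
        = - (\<Sum>y\<in>cols. \<Sum>J\<in>Pow {..<?N}. blk w x d a y (\<sigma> \<circ> unshuffle ?N J) 0 (card J))"
      by (simp add: corolla_diff_def rel_linear blk_act[OF a \<sigma> unshuffle_permutes])
    also have "\<dots> \<approx> - (\<Sum>y\<in>cols. \<Sum>J\<in>Pow {..<?N}. blk w x d a y (unshuffle ?N (\<sigma> ` J)) 0 (card (\<sigma> ` J)))"
    proof (intro cong_uminus cong_sum)
      fix y J assume J: "J \<in> Pow {..<?N}"
      have cJ: "card (\<sigma> ` J) = card J" using permutes_inj[OF \<sigma>] by (simp add: card_image inj_on_subset)
      have sJ: "\<sigma> ` J \<subseteq> {..<?N}" using J permutes_less[OF \<sigma>] by auto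
      show "blk w x d a y (\<sigma> \<circ> unshuffle ?N J) 0 (card J) \<approx> blk w x d a y (unshuffle ?N (\<sigma> ` J)) 0 (card (\<sigma> ` J))"
        unfolding cJ
      proof (rule blk_cong[OF a permutes_compose[OF unshuffle_permutes \<sigma>] unshuffle_permutes])
        show "(\<sigma> \<circ> unshuffle ?N J) ` {0..<0 + card J} = unshuffle ?N (\<sigma> ` J) ` {0..<0 + card J}"
        proof -
          have "(\<sigma> \<circ> unshuffle ?N J) ` {..<card J} = \<sigma> ` (unshuffle ?N J ` {..<card J})"
            by (simp only: image_comp)
          also have "\<dots> = \<sigma> ` J" using unshuffle_image[of J ?N] J by simp
          also have "\<dots> = unshuffle ?N (\<sigma> ` J) ` {..<card J}" using unshuffle_image[OF sJ] cJ by simp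
          finally show ?thesis by (simp only: atLeast0LessThan add_0)
        qed
      qed (use card_le[OF J] in auto)
    qed
    also have "\<dots> = corolla_diff w x d a"
      unfolding corolla_diff_def by (intro arg_cong[where f = uminus] sum.cong refl sum_Pow_image[OF bij, symmetric])
    finally have 1: "rel \<sigma> (corolla_diff (permw \<sigma> w) x d (act C \<sigma> a)) \<approx> corolla_diff w x d a" .
    have h: "cobar_diff (cor (permw \<sigma> w) x d (act C \<sigma> a)) \<in> homog Sg (permw \<sigma> w) x (d + 1 + 1)"
      by (rule cobar_diff_homog[OF cor_homog[OF aa]])
    have h2: "corolla_diff (permw \<sigma> w) x d (act C \<sigma> a) \<in> homog Sg (permw \<sigma> w) x (d + 1 + 1)"
    proof -
      have "blk (permw \<sigma> w) x d (act C \<sigma> a) y (unshuffle (length (permw \<sigma> w)) J) 0 (card J) \<in> homog Sg (permw \<sigma> w) x (d + 2)"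
        if "J \<in> Pow {..<length (permw \<sigma> w)}" for y J
        by (rule blk_homog[OF aa unshuffle_permutes]) (use card_le[OF that] in simp)
      then show ?thesis
        unfolding corolla_diff_def by (intro homog_uminus homog_sum) (simp add: add.assoc)
    qed
    have "rel \<sigma> (cobar_diff (cor (permw \<sigma> w) x d (act C \<sigma> a))) \<approx> rel \<sigma> (corolla_diff (permw \<sigma> w) x d (act C \<sigma> a))"
      by (rule cong_rel[OF D[OF aa] _ h h2]) (use \<sigma> in simp)
    also note 1
    also have "corolla_diff w x d a \<approx> cobar_diff (cor w x d a)" by (rule cong_sym[OF D[OF a]])
    \<comment> \<open>The comparison was made after relabeling by \<open>\<sigma>\<close>; acting
      with \<open>\<sigma>\<close> cancels this.\<close>
    finally have "free_act \<sigma> (rel \<sigma> (cobar_diff (cor (permw \<sigma> w) x d (act C \<sigma> a)))) \<approx> free_act \<sigma> (cobar_diff (cor w x d a))"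
      by (rule cong_act)
    moreover have "free_act \<sigma> (rel \<sigma> (cobar_diff (cor (permw \<sigma> w) x d (act C \<sigma> a)))) = cobar_diff (cor (permw \<sigma> w) x d (act C \<sigma> a))"
      by (simp add: free_act_rel[OF rel_homog[OF h \<sigma>] \<sigma>] rel_rel permutes_inv_o[OF \<sigma>])
    moreover have "free_act \<sigma> (cobar_diff (cor w x d a)) = cobar_diff (free_act \<sigma> (cor w x d a))"
      by (simp add: free_act_rel[OF cor_homog[OF a] \<sigma>] free_act_rel[OF cobar_diff_homog[OF cor_homog[OF a]] \<sigma>] cobar_diff_rel)
    ultimately show ?thesis unfolding r by (simp add: cobar_diff_linear cong_mod_def)
  qed
qed

lemma cobar_diff_rel_ideal:
  "rel_ideal Sg (cobar_relations C) w x d r \<Longrightarrow> cobar_diff r \<in> total_ideal Sg (cobar_relations C)"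
proof (induction rule: rel_ideal.induct)
  case (gen r w x d)
  then show ?case by (intro cobar_diff_relation)
next
  case (act w x d r \<sigma>)
  note h = rel_ideal_homog[OF act.hyps(1)]
  have "cobar_diff (free_act \<sigma> r) = free_act \<sigma> (cobar_diff r)"
    using free_act_rel[OF h act.hyps(2)] free_act_rel[OF cobar_diff_homog[OF h] act.hyps(2)] by (simp add: cobar_diff_rel)
  then show ?case using total_ideal_act[OF act.IH] by simp
next
  case (comp_left w x d r i S u e)
  note h = rel_ideal_homog[OF comp_left.hyps(1)]
  have S: "mon S \<in> homog Sg u (w ! i) e" using comp_left.hyps(3) by simp
  show ?case
    unfolding cobar_diff_comp[OF h comp_left.hyps(2) S]
    using total_ideal_comp_left[OF comp_left.IH homog_spanned[OF S]]
      total_ideal_comp_left[OF rel_ideal_total[OF comp_left.hyps(1)] homog_spanned[OF cobar_diff_homog[OF S]]]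
    by (intro total_ideal_add total_ideal_scale)
next
  case (comp_right T w x d i u e r)
  note h = rel_ideal_homog[OF comp_right.hyps(3)]
  have T: "mon T \<in> homog Sg w x d" using comp_right.hyps(1) by simp
  show ?case
    unfolding cobar_diff_comp[OF T comp_right.hyps(2) h]
    using total_ideal_comp_right[OF comp_right.IH homog_spanned[OF T]]
      total_ideal_comp_right[OF rel_ideal_total[OF comp_right.hyps(3)] homog_spanned[OF cobar_diff_homog[OF T]]]
    by (intro total_ideal_add total_ideal_scale)
qed (auto simp: cobar_diff_linear intro: total_ideal_add total_ideal_scale)

lemma cobar_diff_ideal:
  "r \<in> total_ideal Sg (cobar_relations C) \<Longrightarrow> cobar_diff r \<in> total_ideal Sg (cobar_relations C)"
  by (rule total_ideal_linear[OF linear_cobar_diff _ cobar_diff_rel_ideal])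

lemma cong_cobar_diff: "a \<approx> b \<Longrightarrow> cobar_diff a \<approx> cobar_diff b"
  using cobar_diff_ideal[of "a - b"] by (simp add: cong_mod_def cobar_diff_linear)

section \<open>Trilinear sums over iterated cocompositions\<close>

lemma tensor3_cong:
  fixes \<Psi> :: "int \<times> 'a \<Rightarrow> int \<times> 'a \<Rightarrow> int \<times> 'a \<Rightarrow> 'a cobar_gen tree \<Rightarrow>\<^sub>0 'k"
  assumes eq: "tensor_eq C [(w, x), (u, y), (v, z)] s t"
    and 1: "\<And>e q f r. q \<in> part C u y e \<Longrightarrow> r \<in> part C v z f \<Longrightarrow> (\<forall>d a b. a \<in> part C w x d \<longrightarrow> b \<in> part C w x d \<longrightarrow>
        \<Psi> (d, a \<oplus> b) (e, q) (f, r) \<approx> \<Psi> (d, a) (e, q) (f, r) + \<Psi> (d, b) (e, q) (f, r)) \<and>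
        (\<forall>d a c. a \<in> part C w x d \<longrightarrow> \<Psi> (d, c \<odot> a) (e, q) (f, r) \<approx> scale c (\<Psi> (d, a) (e, q) (f, r)))"
    and 2: "\<And>d p f r. p \<in> part C w x d \<Longrightarrow> r \<in> part C v z f \<Longrightarrow> (\<forall>e a b. a \<in> part C u y e \<longrightarrow> b \<in> part C u y e \<longrightarrow>
        \<Psi> (d, p) (e, a \<oplus> b) (f, r) \<approx> \<Psi> (d, p) (e, a) (f, r) + \<Psi> (d, p) (e, b) (f, r)) \<and>
        (\<forall>e a c. a \<in> part C u y e \<longrightarrow> \<Psi> (d, p) (e, c \<odot> a) (f, r) \<approx> scale c (\<Psi> (d, p) (e, a) (f, r)))"
    and 3: "\<And>d p e q. p \<in> part C w x d \<Longrightarrow> q \<in> part C u y e \<Longrightarrow> (\<forall>f a b. a \<in> part C v z f \<longrightarrow> b \<in> part C v z f \<longrightarrow>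
        \<Psi> (d, p) (e, q) (f, a \<oplus> b) \<approx> \<Psi> (d, p) (e, q) (f, a) + \<Psi> (d, p) (e, q) (f, b)) \<and>
        (\<forall>f a c. a \<in> part C v z f \<longrightarrow> \<Psi> (d, p) (e, q) (f, c \<odot> a) \<approx> scale c (\<Psi> (d, p) (e, q) (f, a)))"
  shows "(\<Sum>l\<leftarrow>s. \<Psi> (l ! 0) (l ! 1) (l ! 2)) \<approx> (\<Sum>l\<leftarrow>t. \<Psi> (l ! 0) (l ! 1) (l ! 2))"
proof (rule tensor_cong[OF eq])
  have pos: thesis
    if p: "pure_tensor C [(w, x), (u, y), (v, z)] (l @ (d, a) # r)"
      and "\<And>e q f s. l = [] \<Longrightarrow> r = [(e, q), (f, s)] \<Longrightarrow> a \<in> part C w x d \<Longrightarrow> q \<in> part C u y e \<Longrightarrow> s \<in> part C v z f \<Longrightarrow> thesis"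
      "\<And>e p f s. l = [(e, p)] \<Longrightarrow> r = [(f, s)] \<Longrightarrow> p \<in> part C w x e \<Longrightarrow> a \<in> part C u y d \<Longrightarrow> s \<in> part C v z f \<Longrightarrow> thesis"
      "\<And>e p f q. l = [(e, p), (f, q)] \<Longrightarrow> r = [] \<Longrightarrow> p \<in> part C w x e \<Longrightarrow> q \<in> part C u y f \<Longrightarrow> a \<in> part C v z d \<Longrightarrow> thesis"
    for l d a r thesis
    using that unfolding pure_tensor_def
    by (cases l; cases "tl l"; cases "tl (tl l)") (auto simp: list_all2_Cons1 list_all2_Cons2 append_eq_Cons_conv)
  fix l d a r assume p: "pure_tensor C [(w, x), (u, y), (v, z)] (l @ (d, a) # r)"
  show "\<Psi> ((l @ (d, a \<oplus> b) # r) ! 0) ((l @ (d, a \<oplus> b) # r) ! 1) ((l @ (d, a \<oplus> b) # r) ! 2)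
     \<approx> \<Psi> ((l @ (d, a) # r) ! 0) ((l @ (d, a) # r) ! 1) ((l @ (d, a) # r) ! 2)
      + \<Psi> ((l @ (d, b) # r) ! 0) ((l @ (d, b) # r) ! 1) ((l @ (d, b) # r) ! 2)"
    if p': "pure_tensor C [(w, x), (u, y), (v, z)] (l @ (d, b) # r)" for b
  proof (rule pos[OF p], goal_cases)
    case (1 e q f s)
    then have "b \<in> part C w x d" using p' by (simp add: pure_tensor_def)
    then show ?thesis using assms(2)[OF 1(4,5)] 1 by simp
  next
    case (2 e p f s)
    then have "b \<in> part C u y d" using p' by (simp add: pure_tensor_def)
    then show ?thesis using assms(3)[OF 2(3,5)] 2 by simp
  next
    case (3 e p f q)
    then have "b \<in> part C v z d" using p' by (simp add: pure_tensor_def)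
    then show ?thesis using assms(4)[OF 3(3,4)] 3 by simp
  qed
  show "\<Psi> ((l @ (d, c \<odot> a) # r) ! 0) ((l @ (d, c \<odot> a) # r) ! 1) ((l @ (d, c \<odot> a) # r) ! 2)
     \<approx> scale c (\<Psi> ((l @ (d, a) # r) ! 0) ((l @ (d, a) # r) ! 1) ((l @ (d, a) # r) ! 2))" for c
  proof (rule pos[OF p], goal_cases)
    case (1 e q f s)
    then show ?thesis using assms(2)[OF 1(4,5)] by simp
  next
    case (2 e p f s)
    then show ?thesis using assms(3)[OF 2(3,5)] by simp
  next
    case (3 e p f q)
    then show ?thesis using assms(4)[OF 3(3,4)] by simp
  qed
qed

text \<open>A composite of three corollas. Its sign is the product of the signs of two successive
  splittings of the lower vertex: with intermediate degree \<open>d = d1 + e1\<close>,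
  \<open>ksign d * ksign d1\<close> is \<open>ksign e1\<close>, the sign of the middle
  factor.\<close>

definition triple where
  "triple w x i u y k v z = (\<lambda>p q r. scale (ksign (fst q)) (free_comp Sg k (free_comp Sg i (cor w x (fst p) (snd p)) (cor u y (fst q) (snd q)))
     (cor v z (fst r) (snd r))))"

text \<open>Each of the three factors of \<open>triple\<close> enters through a corolla inside a
  linear map that respects congruence, so linearity in each factor comes from \<open>cor_add\<close>
  and \<open>cor_smult\<close>.\<close>

lemma cor_transfer:
  assumes F: "\<And>d X Y. X \<approx> Y \<Longrightarrow> F d X \<approx> F d Y" and add: "\<And>d X Y. F d (X + Y) = F d X + F d Y"
    and scale: "\<And>d c X. F d (scale c X) = scale c (F d X)"
  shows "(\<forall>d a b. a \<in> part C w x d \<longrightarrow> b \<in> part C w x d \<longrightarrow> F d (cor w x d (a \<oplus> b)) \<approx> F d (cor w x d a) + F d (cor w x d b)) \<and>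
    (\<forall>d a c. a \<in> part C w x d \<longrightarrow> F d (cor w x d (c \<odot> a)) \<approx> scale c (F d (cor w x d a)))"
  using F[OF cor_add] F[OF cor_smult] unfolding add scale by blast

lemma triple_linear:
  assumes "i < length w"
  shows "q \<in> part C u (w ! i) e \<Longrightarrow> r \<in> part C v z f \<Longrightarrow> (\<forall>d a b. a \<in> part C w x d \<longrightarrow> b \<in> part C w x d \<longrightarrow>
        triple w x i u (w ! i) k v z (d, a \<oplus> b) (e, q) (f, r) \<approx> triple w x i u (w ! i) k v z (d, a) (e, q) (f, r) + triple w x i u (w ! i) k v z (d, b) (e, q) (f, r)) \<and>
        (\<forall>d a c. a \<in> part C w x d \<longrightarrow> triple w x i u (w ! i) k v z (d, c \<odot> a) (e, q) (f, r) \<approx> scale c (triple w x i u (w ! i) k v z (d, a) (e, q) (f, r)))"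
    and "p \<in> part C w x d \<Longrightarrow> r \<in> part C v z f \<Longrightarrow> (\<forall>e a b. a \<in> part C u (w ! i) e \<longrightarrow> b \<in> part C u (w ! i) e \<longrightarrow>
        triple w x i u (w ! i) k v z (d, p) (e, a \<oplus> b) (f, r) \<approx> triple w x i u (w ! i) k v z (d, p) (e, a) (f, r) + triple w x i u (w ! i) k v z (d, p) (e, b) (f, r)) \<and>
        (\<forall>e a c. a \<in> part C u (w ! i) e \<longrightarrow> triple w x i u (w ! i) k v z (d, p) (e, c \<odot> a) (f, r) \<approx> scale c (triple w x i u (w ! i) k v z (d, p) (e, a) (f, r)))"
    and "p \<in> part C w x d \<Longrightarrow> q \<in> part C u (w ! i) e \<Longrightarrow> (\<forall>f a b. a \<in> part C v z f \<longrightarrow> b \<in> part C v z f \<longrightarrow>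
        triple w x i u (w ! i) k v z (d, p) (e, q) (f, a \<oplus> b) \<approx> triple w x i u (w ! i) k v z (d, p) (e, q) (f, a) + triple w x i u (w ! i) k v z (d, p) (e, q) (f, b)) \<and>
        (\<forall>f a c. a \<in> part C v z f \<longrightarrow> triple w x i u (w ! i) k v z (d, p) (e, q) (f, c \<odot> a) \<approx> scale c (triple w x i u (w ! i) k v z (d, p) (e, q) (f, a)))"
proof (goal_cases)
  case 1
  show ?case
    unfolding triple_def fst_conv snd_conv
    by (rule cor_transfer)
       (intro cong_scale cong_comp_left cor_spanned 1 | simp add: free_comp_bilinear pm.scale_right_distrib mult.commute)+
next
  case 2
  show ?case
    unfolding triple_def fst_conv snd_conv
    by (rule cor_transfer)
       (intro cong_scale cong_comp_left cong_comp_right cor_spanned 2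
         | simp add: free_comp_bilinear pm.scale_right_distrib mult.commute)+
next
  case 3
  have "free_comp Sg i (cor w x d p) (cor u (w ! i) e q) \<in> spanned Sg"
    by (rule homog_spanned[OF free_comp_homog[OF cor_homog[OF 3(1)] assms cor_homog[OF 3(2)]]])
  then show ?case
    unfolding triple_def fst_conv snd_conv
    by (intro cor_transfer)
       (intro cong_scale cong_comp_right, simp_all add: free_comp_bilinear pm.scale_right_distrib mult.commute)
qed

lemma triple_cong:
  assumes "tensor_eq C [(w, x), (u, w ! i), (v, z)] s t" "i < length w"
  shows "(\<Sum>l\<leftarrow>s. triple w x i u (w ! i) k v z (l ! 0) (l ! 1) (l ! 2))
    \<approx> (\<Sum>l\<leftarrow>t. triple w x i u (w ! i) k v z (l ! 0) (l ! 1) (l ! 2))"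
  by (rule tensor3_cong[OF assms(1)]) (rule triple_linear[OF assms(2)]; assumption)+

end

section \<open>The differential squares to zero\<close>

text \<open>Splitting off two blocks, in either order and at either vertex, reads the inputs in such
  an order. It is the normal form in which the terms of \<open>D^2\<close> are compared.\<close>

definition unshuffle3_list :: "nat \<Rightarrow> nat set \<Rightarrow> nat set \<Rightarrow> nat list" where
  "unshuffle3_list n A B = filter (\<lambda>j. j \<in> A) [0..<n] @ filter (\<lambda>j. j \<in> B) [0..<n] @ filter (\<lambda>j. j \<notin> A \<and> j \<notin> B) [0..<n]"

definition unshuffle3 :: "nat \<Rightarrow> nat set \<Rightarrow> nat set \<Rightarrow> nat \<Rightarrow> nat" where
  "unshuffle3 n A B j = (if j < n then unshuffle3_list n A B ! j else j)"

lemma permutes_list_eq: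
  assumes "\<sigma> permutes {..<n}" "map \<sigma> [0..<n] = L" "length L = n"
  shows "\<sigma> = (\<lambda>j. if j < n then L ! j else j)"
proof
  fix j
  show "\<sigma> j = (if j < n then L ! j else j)"
    using assms(2) permutes_not_in[OF assms(1), of j] by auto
qed

lemma length_filter_upt: "A \<subseteq> {..<n} \<Longrightarrow> length (filter (\<lambda>j. j \<in> A) [0..<n]) = card A"
  using length_nths_upt by (simp add: nths_upt)

lemma perm_eq_unshuffle3:
  assumes "\<sigma> permutes {..<n}" "map \<sigma> [0..<n] = unshuffle3_list n A B"
  shows "\<sigma> = unshuffle3 n A B"
proof -
  have "length (unshuffle3_list n A B) = n" using arg_cong[OF assms(2), of length] by simp
  from permutes_list_eq[OF assms this] show ?thesis by (simp add: unshuffle3_def fun_eq_iff)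
qed

lemma unshuffle_list_filter: "unshuffle_list n J = filter (\<lambda>j. j \<in> J) [0..<n] @ filter (\<lambda>j. j \<notin> J) [0..<n]"
  by (simp add: unshuffle_list_def nths_upt)

text \<open>The expanded slot is the inner edge, input 0 of the lower vertex, hence
  \<open>\<rho> q = 0\<close>; the values of the other inputs move behind the block, by
  \<open>j - 1\<close>.\<close>

lemma map_perm_comp:
  assumes "\<rho> permutes {..<m}" "q < m" "\<rho> q = 0"
  shows "map (perm_comp j \<rho> q id) [0..<m + j - 1]
    = map (\<lambda>p. \<rho> p + j - 1) [0..<q] @ [0..<j] @ map (\<lambda>p. \<rho> p + j - 1) [Suc q..<m]"
proof -
  have "m + j - 1 = q + j + (m - Suc q)" using assms(2) by simp
  then have "[0..<m + j - 1] = [0..<q] @ map (\<lambda>p. p + q) [0..<j] @ map (\<lambda>p. p + (q + j)) [0..<m - Suc q]"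
    by (simp add: upt_add_eq_append[of 0] map_add_upt del: upt_Suc) (simp add: upt_add_eq_append[of q] map_add_upt add.commute)
  moreover have "map (perm_comp j \<rho> q id) [0..<q] = map (\<lambda>p. \<rho> p + j - 1) [0..<q]"
    using assms(3) by (simp add: perm_comp_def Let_def)
  moreover have "map (perm_comp j \<rho> q id) (map (\<lambda>p. p + q) [0..<j]) = [0..<j]"
    using assms(3) by (auto simp: perm_comp_def Let_def intro!: nth_equalityI)
  moreover have "map (perm_comp j \<rho> q id) (map (\<lambda>p. p + (q + j)) [0..<m - Suc q]) = map (\<lambda>p. \<rho> p + j - 1) [Suc q..<m]"
    using assms(3) by (auto simp: perm_comp_def Let_def add.commute intro!: nth_equalityI)
  ultimately show ?thesis by simp
qed

text \<open>The inputs of the lower vertex of a two-vertex tree are the inner edge, numbered 0, and the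
  complement \<open>{..<n} - J\<close>; \<open>lower n J\<close> translates subsets of the latter.\<close>

definition lower :: "nat \<Rightarrow> nat set \<Rightarrow> nat set \<Rightarrow> nat set" where
  "lower n J B = (\<lambda>z. Suc (idx (filter (\<lambda>j. j \<notin> J) [0..<n]) z)) ` B"

lemma lower_facts:
  fixes n :: nat
  assumes J: "J \<subseteq> {..<n}"
  defines "ys \<equiv> filter (\<lambda>j. j \<notin> J) [0..<n]" and "m \<equiv> n - card J + 1"
  shows "length ys = n - card J" "set ys = {..<n} - J"
    "bij_betw (\<lambda>z. Suc (idx ys z)) ({..<n} - J) (Suc ` {..<n - card J})"
    "B \<subseteq> {..<n} - J \<Longrightarrow> t < n - card J \<Longrightarrow> Suc t \<in> lower n J B \<longleftrightarrow> ys ! t \<in> B"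
    "B \<subseteq> {..<n} - J \<Longrightarrow> card (lower n J B) = card B"
    "0 \<notin> lower n J B" "B \<subseteq> {..<n} - J \<Longrightarrow> lower n J B \<subseteq> {..<m}"
proof -
  have "length (filter (\<lambda>j. j \<in> J) [0..<n]) + length ys = n"
    unfolding ys_def using sum_length_filter_compl[of "\<lambda>j. j \<in> J" "[0..<n]"] by simp
  then show l: "length ys = n - card J" using length_filter_upt[OF J] by simp
  show s: "set ys = {..<n} - J" by (auto simp: ys_def)
  have d: "distinct ys" by (simp add: ys_def)
  show bij: "bij_betw (\<lambda>z. Suc (idx ys z)) ({..<n} - J) (Suc ` {..<n - card J})"
  proof (rule bij_betwI[where g = "\<lambda>p. ys ! (p - 1)"])
    show "(\<lambda>z. Suc (idx ys z)) \<in> {..<n} - J \<rightarrow> Suc ` {..<n - card J}"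
      using idx_less[of _ ys] l s by auto
    show "(\<lambda>p. ys ! (p - 1)) \<in> Suc ` {..<n - card J} \<rightarrow> {..<n} - J"
    proof
      fix p assume "p \<in> Suc ` {..<n - card J}"
      then have "ys ! (p - 1) \<in> set ys" using l by auto
      then show "ys ! (p - 1) \<in> {..<n} - J" using s by simp
    qed
    show "ys ! (Suc (idx ys z) - 1) = z" if "z \<in> {..<n} - J" for z
      using idx_nth[of z ys] that s by simp
    show "Suc (idx ys (ys ! (p - 1))) = p" if "p \<in> Suc ` {..<n - card J}" for p
      using idx_nth_distinct[OF d] that l by auto
  qed
  show "Suc t \<in> lower n J B \<longleftrightarrow> ys ! t \<in> B" if B: "B \<subseteq> {..<n} - J" and t: "t < n - card J"
  proof
    assume "Suc t \<in> lower n J B"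
    then obtain z where z: "z \<in> B" "t = idx ys z" by (auto simp: lower_def ys_def)
    then show "ys ! t \<in> B" using idx_nth[of z ys] B s by auto
  next
    assume "ys ! t \<in> B"
    moreover have "idx ys (ys ! t) = t" using idx_nth_distinct[OF d] t l by simp
    ultimately show "Suc t \<in> lower n J B" unfolding lower_def ys_def by force
  qed
  show "card (lower n J B) = card B" if "B \<subseteq> {..<n} - J"
    unfolding lower_def ys_def[symmetric]
    by (rule card_image[OF inj_on_subset[OF bij_betw_imp_inj_on[OF bij] that]])
  show "0 \<notin> lower n J B" by (auto simp: lower_def)
  show "lower n J B \<subseteq> {..<m}" if "B \<subseteq> {..<n} - J"
  proof
    fix p assume "p \<in> lower n J B"
    then obtain z where z: "z \<in> B" "p = Suc (idx ys z)" by (auto simp: lower_def ys_def)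
    have "z \<in> set ys" using z(1) that s by auto
    then show "p \<in> {..<m}" using idx_less[of z ys] l z(2) by (simp add: m_def)
  qed
qed

text \<open>A second block of inputs of the lower vertex either contains the inner edge or not. In
  the first case the three vertices lie on a path, in the second there are two upper vertices side
  by side.\<close>

lemma sum_Pow_lower:
  fixes f :: "nat set \<Rightarrow> 'x::comm_monoid_add"
  assumes J: "J \<subseteq> {..<n}"
  shows "(\<Sum>K\<in>Pow {..<n - card J + 1}. f K)
    = (\<Sum>B\<in>Pow ({..<n} - J). f (insert 0 (lower n J B)) + f (lower n J B))"
proof -
  let ?X = "Suc ` {..<n - card J}"
  have X: "{..<n - card J + 1} = insert 0 ?X" by (auto simp: less_Suc_eq_0_disj image_iff)
  have "(\<Sum>K\<in>Pow (insert 0 ?X). f K) = (\<Sum>K\<in>Pow ?X. f K) + (\<Sum>K\<in>insert 0 ` Pow ?X. f K)"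
    unfolding Pow_insert by (rule sum.union_disjoint) auto
  also have "(\<Sum>K\<in>insert 0 ` Pow ?X. f K) = (\<Sum>K\<in>Pow ?X. f (insert 0 K))"
  proof (rule sum.reindex_cong[where l = "insert 0"])
    show "inj_on (insert 0) (Pow ?X)" by (rule inj_onI) (metis Pow_iff Diff_insert_absorb zero_notin_Suc_image subset_iff)
  qed auto
  also have "(\<Sum>K\<in>Pow ?X. f K) + (\<Sum>K\<in>Pow ?X. f (insert 0 K)) = (\<Sum>K\<in>Pow ?X. f (insert 0 K) + f K)"
    by (simp add: sum.distrib add.commute)
  also have "\<dots> = (\<Sum>B\<in>Pow ({..<n} - J). f (insert 0 (lower n J B)) + f (lower n J B))"
    unfolding lower_def by (rule sum_Pow_image[OF lower_facts(3)[OF J]])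
  finally show ?thesis unfolding X .
qed

lemma unshuffle_lower_list:
  assumes J: "J \<subseteq> {..<n}" and B: "B \<subseteq> {..<n} - J" and K: "K = lower n J B \<or> K = insert 0 (lower n J B)"
  defines "ys \<equiv> filter (\<lambda>j. j \<notin> J) [0..<n]"
  defines "F1 \<equiv> filter (\<lambda>t. ys ! t \<in> B) [0..<n - card J]" and "F2 \<equiv> filter (\<lambda>t. ys ! t \<notin> B) [0..<n - card J]"
  shows "map (unshuffle (n - card J + 1) K) [0..<n - card J + 1]
     = (if 0 \<in> K then 0 # map Suc F1 @ map Suc F2 else map Suc F1 @ 0 # map Suc F2)"
    "length F1 = card B" "map ((!) ys) F1 = filter (\<lambda>j. j \<in> B) [0..<n]"
    "map ((!) ys) F2 = filter (\<lambda>j. j \<notin> J \<and> j \<notin> B) [0..<n]"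
proof -
  note l = lower_facts[OF J, folded ys_def]
  have up: "[0..<n - card J + 1] = 0 # map Suc [0..<n - card J]"
    by (simp add: upt_conv_Cons map_Suc_upt del: upt_Suc)
  have Kt: "Suc t \<in> K \<longleftrightarrow> ys ! t \<in> B" if "t < n - card J" for t
    using K l(4)[OF B that] by auto
  have "filter (\<lambda>j. j \<in> K) (map Suc [0..<n - card J]) = map Suc F1"
    unfolding F1_def filter_map comp_def by (rule arg_cong[where f = "map Suc"], rule filter_cong) (use Kt in auto)
  moreover have "filter (\<lambda>j. j \<notin> K) (map Suc [0..<n - card J]) = map Suc F2"
    unfolding F2_def filter_map comp_def by (rule arg_cong[where f = "map Suc"], rule filter_cong) (use Kt in auto)
  ultimately show "map (unshuffle (n - card J + 1) K) [0..<n - card J + 1]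
     = (if 0 \<in> K then 0 # map Suc F1 @ map Suc F2 else map Suc F1 @ 0 # map Suc F2)"
    unfolding map_unshuffle unshuffle_list_filter unfolding up by auto
  have ys: "map ((!) ys) [0..<n - card J] = ys" using map_nth[of ys] l(1) by simp
  have fl: "map ((!) ys) (filter (\<lambda>t. P (ys ! t)) [0..<n - card J]) = filter P ys" for P
    using filter_map[of P "(!) ys" "[0..<n - card J]"] unfolding ys by (simp add: comp_def)
  show 1: "map ((!) ys) F1 = filter (\<lambda>j. j \<in> B) [0..<n]"
    unfolding F1_def fl[of "\<lambda>j. j \<in> B"] unfolding ys_def filter_filter by (rule filter_cong) (use B in auto)
  show "map ((!) ys) F2 = filter (\<lambda>j. j \<notin> J \<and> j \<notin> B) [0..<n]"
    unfolding F2_def fl[of "\<lambda>j. j \<notin> B"] unfolding ys_def filter_filter by (rule filter_cong) auto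
  show "length F1 = card B"
    using arg_cong[OF 1, of length] length_filter_upt[of B n] B by auto
qed

text \<open>If the second block contains the inner edge, the inputs in \<open>J\<close> stay in
  front. If not, the second unshuffle moves \<open>B\<close> before the inner edge, so that
  \<open>J\<close> is read after \<open>B\<close> and its slot becomes
  \<open>card B\<close>.\<close>

lemma unshuffle_comp_lower:
  fixes n :: nat
  assumes J: "J \<subseteq> {..<n}" and B: "B \<subseteq> {..<n} - J"
  defines "m \<equiv> n - card J + 1"
  shows "unshuffle n J \<circ> perm_comp (card J) (unshuffle m (insert 0 (lower n J B))) 0 id = unshuffle3 n J B"
    "unshuffle n J \<circ> perm_comp (card J) (unshuffle m (lower n J B)) (card B) id = unshuffle3 n B J"
    "unshuffle m (insert 0 (lower n J B)) 0 = 0" "unshuffle m (lower n J B) (card B) = 0" "card B < m"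
proof -
  let ?ys = "filter (\<lambda>j. j \<notin> J) [0..<n]"
  let ?F1 = "filter (\<lambda>t. ?ys ! t \<in> B) [0..<n - card J]" and ?F2 = "filter (\<lambda>t. ?ys ! t \<notin> B) [0..<n - card J]"
  have cJ: "card J \<le> n" using card_mono[of "{..<n}" J] J by simp
  have cB: "card B + card J \<le> n"
  proof -
    have "finite B" "finite J" "B \<inter> J = {}" using J B by (auto intro: finite_subset)
    then have "card (B \<union> J) = card B + card J" by (rule card_Un_disjoint)
    moreover have "card (B \<union> J) \<le> n" using card_mono[of "{..<n}" "B \<union> J"] J B by auto
    ultimately show ?thesis by simp
  qed
  show cm: "card B < m" using cB by (simp add: m_def)
  have mj: "m + card J - 1 = n" using cJ by (simp add: m_def)
  let ?K1 = "insert 0 (lower n J B)" and ?K2 = "lower n J B"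
  note u1 = unshuffle_lower_list[OF J B, of ?K1, folded m_def] and u2 = unshuffle_lower_list[OF J B, of ?K2, folded m_def]
  have m1: "map (unshuffle m ?K1) [0..<m] = 0 # map Suc ?F1 @ map Suc ?F2" using u1(1) by simp
  have m2: "map (unshuffle m ?K2) [0..<m] = map Suc ?F1 @ 0 # map Suc ?F2" using u2(1) lower_facts(6)[OF J] by simp
  have lF: "length ?F1 = card B" using u1(2) by simp
  have m0: "0 < m" by (simp add: m_def)
  show z1: "unshuffle m ?K1 0 = 0" using arg_cong[OF m1, of "\<lambda>l. l ! 0"] m0 by simp
  show z2: "unshuffle m ?K2 (card B) = 0" using arg_cong[OF m2, of "\<lambda>l. l ! card B"] cm lF by (simp add: nth_append)
  have split: "[0..<m] = [0..<q] @ q # [Suc q..<m]" if "q < m" for q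
    using upt_add_eq_append[of 0 q "m - q"] that upt_conv_Cons[of q m] by simp
  have r1: "map (unshuffle m ?K1) [Suc 0..<m] = map Suc ?F1 @ map Suc ?F2"
    using m1 unfolding split[OF m0] by simp
  have r2: "map (unshuffle m ?K2) [0..<card B] = map Suc ?F1" "map (unshuffle m ?K2) [Suc (card B)..<m] = map Suc ?F2"
    using m2 lF unfolding split[OF cm] by (simp_all add: append_eq_append_conv)
  have uJ: "map (unshuffle n J) [0..<card J] = filter (\<lambda>j. j \<in> J) [0..<n]"
  proof -
    have "map (unshuffle n J) [0..<card J] = take (card J) (map (unshuffle n J) [0..<n])"
      using cJ by (simp add: take_map take_upt)
    then show ?thesis unfolding map_unshuffle unshuffle_list_filter using length_filter_upt[OF J] by simp
  qed
  \<comment> \<open>Input \<open>Suc t\<close> of the lower vertex is the \<open>t\<close>-th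
    element of the complement of \<open>J\<close>; expanding the inner edge to \<open>card J\<close>
    inputs moves it to position \<open>t + card J\<close>.\<close>
  have us: "unshuffle n J (Suc t + card J - 1) = ?ys ! t" if "t < n - card J" for t
    using that cJ length_filter_upt[OF J]
    unfolding unshuffle_def nths_upt by (auto simp: nth_append)
  have mF: "map (\<lambda>p. unshuffle n J (p + card J - 1)) (map Suc F) = map ((!) ?ys) F" if "set F \<subseteq> {..<n - card J}" for F
    using us that by auto
  have pm: "unshuffle m K permutes {..<m}" for K by (rule unshuffle_permutes)
  show "unshuffle n J \<circ> perm_comp (card J) (unshuffle m ?K1) 0 id = unshuffle3 n J B"
  proof (rule perm_eq_unshuffle3)
    show "(unshuffle n J \<circ> perm_comp (card J) (unshuffle m ?K1) 0 id) permutes {..<n}"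
      by (rule permutes_compose[OF perm_comp_permutes[OF pm permutes_id m0, of "card J", unfolded mj] unshuffle_permutes])
    have "map (unshuffle n J \<circ> perm_comp (card J) (unshuffle m ?K1) 0 id) [0..<n]
        = map (unshuffle n J) (map (perm_comp (card J) (unshuffle m ?K1) 0 id) [0..<m + card J - 1])"
      by (simp only: mj map_map)
    also have "\<dots> = map (unshuffle n J) [0..<card J]
        @ map (\<lambda>p. unshuffle n J (p + card J - 1)) (map (unshuffle m ?K1) [Suc 0..<m])"
      unfolding map_perm_comp[OF pm m0 z1] by (simp add: comp_def)
    also have "\<dots> = filter (\<lambda>j. j \<in> J) [0..<n] @ map ((!) ?ys) ?F1 @ map ((!) ?ys) ?F2"
      unfolding r1 map_append uJ using mF[of ?F1] mF[of ?F2] by (auto simp del: map_map)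
    also have "\<dots> = unshuffle3_list n J B"
      using u1(3,4) by (simp add: unshuffle3_list_def)
    finally show "map (unshuffle n J \<circ> perm_comp (card J) (unshuffle m ?K1) 0 id) [0..<n] = unshuffle3_list n J B" .
  qed
  show "unshuffle n J \<circ> perm_comp (card J) (unshuffle m ?K2) (card B) id = unshuffle3 n B J"
  proof (rule perm_eq_unshuffle3)
    show "(unshuffle n J \<circ> perm_comp (card J) (unshuffle m ?K2) (card B) id) permutes {..<n}"
      by (rule permutes_compose[OF perm_comp_permutes[OF pm permutes_id cm, of "card J", unfolded mj] unshuffle_permutes])
    have "map (unshuffle n J \<circ> perm_comp (card J) (unshuffle m ?K2) (card B) id) [0..<n]
        = map (unshuffle n J) (map (perm_comp (card J) (unshuffle m ?K2) (card B) id) [0..<m + card J - 1])"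
      by (simp only: mj map_map)
    also have "\<dots> = map (\<lambda>p. unshuffle n J (p + card J - 1)) (map (unshuffle m ?K2) [0..<card B])
        @ map (unshuffle n J) [0..<card J]
        @ map (\<lambda>p. unshuffle n J (p + card J - 1)) (map (unshuffle m ?K2) [Suc (card B)..<m])"
      unfolding map_perm_comp[OF pm cm z2] by (simp add: comp_def)
    also have "\<dots> = map ((!) ?ys) ?F1 @ filter (\<lambda>j. j \<in> J) [0..<n] @ map ((!) ?ys) ?F2"
      unfolding r2 uJ using mF[of ?F1] mF[of ?F2] by (auto simp del: map_map)
    also have "\<dots> = unshuffle3_list n B J"
      using u1(3,4) by (simp add: unshuffle3_list_def conj_commute)
    finally show "map (unshuffle n J \<circ> perm_comp (card J) (unshuffle m ?K2) (card B) id) [0..<n] = unshuffle3_list n B J" .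
  qed
qed

lemma perm_comp_id_0: "\<rho> permutes {..<m} \<Longrightarrow> perm_comp m id 0 \<rho> = \<rho>"
  using permutes_not_in[of \<rho> "{..<m}"] by (auto simp: perm_comp_def Let_def fun_eq_iff)

text \<open>Here the second splitting concerns the upper vertex, whose inputs are \<open>M\<close>
  in increasing order; \<open>idx xs\<close> translates subsets of \<open>M\<close> into
  positions.\<close>

lemma unshuffle_comp_upper:
  fixes n :: nat
  assumes M: "M \<subseteq> {..<n}" and A: "A \<subseteq> M"
  defines "xs \<equiv> filter (\<lambda>j. j \<in> M) [0..<n]"
  shows "unshuffle n M \<circ> unshuffle (card M) (idx xs ` A) = unshuffle3 n A (M - A)"
    "card (idx xs ` A) = card A" "bij_betw (idx xs) M {..<card M}"
proof -
  let ?m = "card M"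
  have l: "length xs = ?m" unfolding xs_def by (rule length_filter_upt[OF M])
  have s: "set xs = M" using M by (auto simp: xs_def)
  have d: "distinct xs" by (simp add: xs_def)
  have mn: "?m \<le> n" using card_mono[of "{..<n}" M] M by simp
  show bij: "bij_betw (idx xs) M {..<?m}"
    by (rule bij_betwI[where g = "(!) xs"])
       (use idx_less[of _ xs] idx_nth[of _ xs] idx_nth_distinct[OF d] l s nth_mem in auto)
  show "card (idx xs ` A) = card A"
    by (rule card_image[OF inj_on_subset[OF bij_betw_imp_inj_on[OF bij] A]])
  let ?\<rho> = "unshuffle ?m (idx xs ` A)"
  have t: "t \<in> idx xs ` A \<longleftrightarrow> xs ! t \<in> A" if "t < ?m" for t
  proof
    assume "t \<in> idx xs ` A"
    then obtain z where "z \<in> A" "t = idx xs z" by auto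
    then show "xs ! t \<in> A" using idx_nth[of z xs] A s by auto
  next
    assume "xs ! t \<in> A"
    then show "t \<in> idx xs ` A" using idx_nth_distinct[OF d, of t] that l by force
  qed
  have \<rho>: "?\<rho> permutes {..<?m}" by (rule unshuffle_permutes)
  have \<rho>n: "?\<rho> permutes {..<n}" by (rule permutes_subset[OF \<rho>]) (use mn in auto)
  show "unshuffle n M \<circ> ?\<rho> = unshuffle3 n A (M - A)"
  proof (rule perm_eq_unshuffle3)
    show "(unshuffle n M \<circ> ?\<rho>) permutes {..<n}"
      by (rule permutes_compose[OF \<rho>n unshuffle_permutes])
    have up: "[0..<n] = [0..<?m] @ [?m..<n]" using upt_add_eq_append[of 0 ?m "n - ?m"] mn by simp
    have \<rho>2: "map ?\<rho> [?m..<n] = [?m..<n]"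
      using permutes_not_in[OF \<rho>] by (intro map_idI) auto
    have uM: "map (unshuffle n M) [0..<n] = xs @ filter (\<lambda>j. j \<notin> M) [0..<n]"
      unfolding map_unshuffle unshuffle_list_filter xs_def ..
    then have uM1: "map (unshuffle n M) [0..<?m] = xs" and uM2: "map (unshuffle n M) [?m..<n] = filter (\<lambda>j. j \<notin> M) [0..<n]"
      unfolding up map_append using l by (auto simp: append_eq_append_conv up[symmetric])
    have un: "unshuffle n M t = xs ! t" if "t < ?m" for t
      using arg_cong[OF uM1, of "\<lambda>l. l ! t"] that by simp
    have xs: "map ((!) xs) [0..<?m] = xs" using map_nth[of xs] l by simp
    have fl: "map (unshuffle n M) (filter (\<lambda>t. P (xs ! t)) [0..<?m]) = filter P xs" for P
    proof -
      have "map (unshuffle n M) (filter (\<lambda>t. P (xs ! t)) [0..<?m]) = map ((!) xs) (filter (\<lambda>t. P (xs ! t)) [0..<?m])"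
        using un by auto
      then show ?thesis using filter_map[of P "(!) xs" "[0..<?m]"] unfolding xs by (simp add: comp_def)
    qed
    have "map ?\<rho> [0..<?m] = filter (\<lambda>t. xs ! t \<in> A) [0..<?m] @ filter (\<lambda>t. xs ! t \<notin> A) [0..<?m]"
      unfolding map_unshuffle unshuffle_list_filter by (intro arg_cong2[where f = "(@)"] filter_cong) (use t in auto)
    then have "map (unshuffle n M) (map ?\<rho> [0..<?m]) = filter (\<lambda>j. j \<in> A) xs @ filter (\<lambda>j. j \<notin> A) xs"
      by (simp only: map_append fl[of "\<lambda>j. j \<in> A"] fl[of "\<lambda>j. j \<notin> A"])
    moreover have "map (unshuffle n M \<circ> ?\<rho>) [0..<n] = map (unshuffle n M) (map ?\<rho> [0..<?m]) @ map (unshuffle n M) (map ?\<rho> [?m..<n])"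
      by (simp only: map_map[symmetric] map_append[symmetric] up[symmetric])
    ultimately have "map (unshuffle n M \<circ> ?\<rho>) [0..<n] = filter (\<lambda>j. j \<in> A) xs @ filter (\<lambda>j. j \<notin> A) xs @ filter (\<lambda>j. j \<notin> M) [0..<n]"
      unfolding \<rho>2 uM2 by simp
    also have "\<dots> = unshuffle3_list n A (M - A)"
      unfolding unshuffle3_list_def xs_def filter_filter
      by (intro arg_cong2[where f = "(@)"] filter_cong) (use A in auto)
    finally show "map (unshuffle n M \<circ> ?\<rho>) [0..<n] = unshuffle3_list n A (M - A)" .
  qed
qed

lemma unshuffle3_permutes:
  assumes "A \<subseteq> {..<n}" "B \<subseteq> {..<n} - A"
  shows "unshuffle3 n A B permutes {..<n}"
proof -
  let ?U = "A \<union> B"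
  have U: "?U \<subseteq> {..<n}" "?U - A = B" using assms by auto
  have "card ?U \<le> n" using card_mono[OF _ U(1)] by simp
  then have "{..<card ?U} \<subseteq> {..<n}" by auto
  then have "unshuffle (card ?U) K permutes {..<n}" for K by (rule permutes_subset[OF unshuffle_permutes])
  then show ?thesis
    using permutes_compose[OF _ unshuffle_permutes] unfolding unshuffle_comp_upper(1)[OF U(1) Un_upper1, unfolded U(2), symmetric] by blast
qed

abbreviation (input) seg :: "nat \<Rightarrow> nat \<Rightarrow> 'c list \<Rightarrow> 'c list" where
  "seg i k L \<equiv> take k (drop i L)"

abbreviation (input) splice :: "'c \<Rightarrow> nat \<Rightarrow> nat \<Rightarrow> 'c list \<Rightarrow> 'c list" where
  "splice y i k L \<equiv> take i L @ y # drop (i + k) L"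

section \<open>Two successive splittings of a vertex\<close>

context cooperad
begin

definition lower_kappa where
  "lower_kappa V x q u v i t n = csum V x q u n
     (\<lambda>d b e c. scale (ksign d) (free_comp Sg q (kappa v x i t d b) (cor u (V ! q) e c)))"

text \<open>No sign occurs: the sign \<open>ksign d\<close> of the first splitting and the sign
  \<open>ksign (d + 1)\<close> of moving the differential past the lower corolla combine to a
  constant, which is accounted for in \<open>cobar_diff_kappa\<close>.\<close>

definition upper_kappa where
  "upper_kappa v x i u s j t n = csum v x i u n (\<lambda>d b e c. free_comp Sg i (cor v x d b) (kappa s (v ! i) j t e c))"

lemma csum_sum: "csum v x i u n (\<lambda>d b e c. \<Sum>K\<in>A. \<Psi> K d b e c) a = (\<Sum>K\<in>A. csum v x i u n (\<Psi> K) a)"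
proof (induction A rule: infinite_finite_induct)
  case (insert K A)
  then show ?case by (simp add: csum_def case_prod_unfold sum_list_addf)
qed (simp_all add: csum_def case_prod_unfold)

lemma lower_kappa_bilin:
  assumes "V = ins v i t" "i < length v"
  shows "bilin V x u y (\<lambda>d b e c. scale (ksign d) (free_comp Sg q (kappa v x i t d b) (cor u y e c)))"
  unfolding assms(1) by (rule bilin_comp) (simp_all add: kappa_spanned kappa_add kappa_smult cor_spanned cor_add cor_smult assms(2))

lemma upper_kappa_bilin:
  assumes "u = ins s j t" "j < length s"
  shows "bilin v x u y (\<lambda>d b e c. free_comp Sg i (cor v x d b) (kappa s y j t e c))"
proof -
  have "bilin v x u y (\<lambda>d b e c. scale 1 (free_comp Sg i (cor v x d b) (kappa s y j t e c)))"
    unfolding assms(1) by (rule bilin_comp) (simp_all add: kappa_spanned kappa_add kappa_smult cor_spanned cor_add cor_smult assms(2))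
  then show ?thesis by (simp add: pm.scale_one)
qed

lemma lower_kappa_homog:
  assumes "V = ins v i t" "i < length v" "q < length V" "a \<in> part C (ins V q u) x n"
  shows "lower_kappa V x q u v i t n a \<in> homog Sg (ins V q u) x (n + 3)"
  unfolding lower_kappa_def
proof (rule csum_homog[OF assms(3,4)])
  fix d b e c assume "b \<in> part C V x d" "c \<in> part C u (V ! q) e" "d + e = n"
  then show "scale (ksign d) (free_comp Sg q (kappa v x i t d b) (cor u (V ! q) e c)) \<in> homog Sg (ins V q u) x (n + 3)"
    using free_comp_homog[OF kappa_homog[OF assms(2)] _ cor_homog, of b t x d q c u e] assms(1,3)
    by (auto simp: ac_simps)
qed

lemma upper_kappa_homog:
  assumes "u = ins s j t" "j < length s" "i < length v" "a \<in> part C (ins v i u) x n"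
  shows "upper_kappa v x i u s j t n a \<in> homog Sg (ins v i u) x (n + 3)"
  unfolding upper_kappa_def
proof (rule csum_homog[OF assms(3,4)])
  fix d b e c assume "b \<in> part C v x d" "c \<in> part C u (v ! i) e" "d + e = n"
  then show "free_comp Sg i (cor v x d b) (kappa s (v ! i) j t e c) \<in> homog Sg (ins v i u) x (n + 3)"
    using free_comp_homog[OF cor_homog assms(3) kappa_homog[OF assms(2)], of b x d c t e] assms(1)
    by (auto simp: ac_simps)
qed

lemma lower_kappa_triple:
  assumes V: "V = ins v i t" "i < length v" and q: "q < length V" and a: "a \<in> part C (ins V q u) x n"
  shows "lower_kappa V x q u v i t n a
    = (\<Sum>l\<leftarrow>[[p', q', r]. (p, r) \<leftarrow> cocomp C V x q u n a, (p', q') \<leftarrow> cocomp C v x i t (fst p) (snd p)].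
        triple v x i t (v ! i) q u (V ! q) (l ! 0) (l ! 1) (l ! 2))"
proof -
  have "lower_kappa V x q u v i t n a = csum V x q u n (\<lambda>d b e c. csum v x i t d
      (\<lambda>d1 b1 e1 c1. triple v x i t (v ! i) q u (V ! q) (d1, b1) (e1, c1) (e, c)) b) a"
    unfolding lower_kappa_def
  proof (rule csum_eq[OF q a])
    fix d b e c assume b: "b \<in> part C V x d" and c: "c \<in> part C u (V ! q) e"
    have lin: "module_hom scale scale (\<lambda>X. scale (ksign d) (free_comp Sg q X (cor u (V ! q) e c)))"
      using linear_free_comp_left linear_scale by (rule module_hom_compose[unfolded comp_def])
    have "scale (ksign d) (free_comp Sg q (kappa v x i t d b) (cor u (V ! q) e c))
        = csum v x i t d (\<lambda>d1 b1 e1 c1. scale (ksign d) (free_comp Sg q (kterm v x i t (v ! i) d1 b1 e1 c1) (cor u (V ! q) e c))) b"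
      unfolding kappa_def by (rule csum_linear[OF lin])
    also have "\<dots> = csum v x i t d (\<lambda>d1 b1 e1 c1. triple v x i t (v ! i) q u (V ! q) (d1, b1) (e1, c1) (e, c)) b"
      by (rule csum_eq[OF V(2) b[unfolded V(1)]])
         (auto simp: kterm_def triple_def free_comp_scale_left intro!: arg_cong[where f = "\<lambda>t. scale t _"] ksign_eqI simp flip: ksign_add)
    finally show "scale (ksign d) (free_comp Sg q (kappa v x i t d b) (cor u (V ! q) e c))
        = csum v x i t d (\<lambda>d1 b1 e1 c1. triple v x i t (v ! i) q u (V ! q) (d1, b1) (e1, c1) (e, c)) b" .
  qed
  then show ?thesis
    by (simp add: csum_def case_prod_unfold map_concat sum_list_concat comp_def)
qed

text \<open>The two ways to reach three vertices on a path agree without a sign. They cancel in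
  \<open>D^2\<close> because they enter \<open>cobar_diff_kappa\<close> with opposite signs.\<close>

lemma lower_kappa_sequential:
  assumes i: "i < length w" and j: "j < length u" and a: "a \<in> part C (ins w i (ins u j v)) x n"
  shows "lower_kappa (ins w i u) x (i + j) v w i u n a \<approx> upper_kappa w x i (ins u j v) u j v n a"
proof -
  have ij: "i + j < length (ins w i u)" "ins w i u ! (i + j) = u ! j" "ins (ins w i u) (i + j) v = ins w i (ins u j v)"
    using i j by (auto simp: ins_def nth_append)
  have "lower_kappa (ins w i u) x (i + j) v w i u n a
    \<approx> (\<Sum>l\<leftarrow>[[p, q', r']. (p, q) \<leftarrow> cocomp C w x i (ins u j v) n a, (q', r') \<leftarrow> cocomp C u (w ! i) j v (fst q) (snd q)].
        triple w x i u (w ! i) (i + j) v (u ! j) (l ! 0) (l ! 1) (l ! 2))"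
    unfolding lower_kappa_triple[OF refl i ij(1) a[folded ij(3)], unfolded ij(2)]
    by (rule triple_cong[OF cocomp_sequential[OF i j a] i])
  also have "\<dots> = csum w x i (ins u j v) n (\<lambda>d b e c. csum u (w ! i) j v e
      (\<lambda>d1 b1 e1 c1. triple w x i u (w ! i) (i + j) v (u ! j) (d, b) (d1, b1) (e1, c1)) c) a"
    by (simp add: csum_def case_prod_unfold map_concat sum_list_concat comp_def)
  also have "\<dots> = upper_kappa w x i (ins u j v) u j v n a"
    unfolding upper_kappa_def
  proof (rule csum_eq[OF i a])
    fix d b e c assume b: "b \<in> part C w x d" and c: "c \<in> part C (ins u j v) (w ! i) e"
    show "csum u (w ! i) j v e (\<lambda>d1 b1 e1 c1. triple w x i u (w ! i) (i + j) v (u ! j) (d, b) (d1, b1) (e1, c1)) c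
        = free_comp Sg i (cor w x d b) (kappa u (w ! i) j v e c)"
      unfolding kappa_def csum_linear[OF linear_free_comp_right]
    proof (rule csum_eq[OF j c])
      fix d1 b1 e1 c1 assume h: "b1 \<in> part C u (w ! i) d1" "c1 \<in> part C v (u ! j) e1"
      show "triple w x i u (w ! i) (i + j) v (u ! j) (d, b) (d1, b1) (e1, c1)
          = free_comp Sg i (cor w x d b) (kterm u (w ! i) j v (u ! j) d1 b1 e1 c1)"
        using free_comp_sequential[OF cor_homog[OF b] i cor_homog[OF h(1)] j cor_homog[OF h(2)]]
        by (simp add: triple_def kterm_def free_comp_scale_right)
    qed
  qed
  finally show ?thesis .
qed

text \<open>Exchanging the upper corollas, of degrees \<open>e + 1\<close> and
  \<open>e1 + 1\<close>, gives the exponent \<open>(e + 1) * (e1 + 1)\<close>, and the cocomposition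
  contributes \<open>e * e1\<close>. Together with \<open>ksign e\<close> from \<open>triple\<close>
  this is minus the sign \<open>ksign e1\<close> of the other order.\<close>

lemma lower_kappa_parallel:
  assumes ik: "i < k" "k < length w" and a: "a \<in> part C (ins (ins w k v) i u) x n"
  shows "lower_kappa (ins w i u) x (k + length u - 1) v w i u n a \<approx> - lower_kappa (ins w k v) x i u w k v n a"
proof -
  let ?q = "k + length u - 1"
  have i: "i < length w" using ik by simp
  have q: "?q < length (ins w i u)" "ins w i u ! ?q = w ! k" "ins (ins w i u) ?q v = ins (ins w k v) i u"
  proof -
    have l: "length (ins w i u) = length w + length u - 1" using i by (simp add: ins_def)
    show "?q < length (ins w i u)" using l ik by simp
    obtain A x B y D where w: "w = A @ x # B @ y # D" "length A = i" "length B = k - Suc i"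
    proof
      show "w = take i w @ w ! i # take (k - Suc i) (drop (Suc i) w) @ w ! k # drop (Suc k) w"
        using id_take_nth_drop[of i w] id_take_nth_drop[of "k - Suc i" "drop (Suc i) w"] ik by (auto simp: add.commute)
    qed (use ik in auto)
    have k: "k = Suc (length A + length B)" using w ik by simp
    show "ins w i u ! ?q = w ! k" unfolding w(1) k w(2)[symmetric] by (simp add: ins_def nth_append)
    show "ins (ins w i u) ?q v = ins (ins w k v) i u" unfolding w(1) k w(2)[symmetric] by (simp add: ins_def)
  qed
  have i': "i < length (ins w k v)" "ins w k v ! i = w ! i" using ik by (auto simp: ins_def nth_append)
  have "lower_kappa (ins w i u) x ?q v w i u n a
    \<approx> (\<Sum>l\<leftarrow>[[(fst p', ksign (fst q * fst r') \<odot> snd p'), q, r']. (p, q) \<leftarrow> cocomp C (ins w k v) x i u n a, (p', r') \<leftarrow> cocomp C w x k v (fst p) (snd p)].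
        triple w x i u (w ! i) ?q v (w ! k) (l ! 0) (l ! 1) (l ! 2))"
    unfolding lower_kappa_triple[OF refl i q(1) a[folded q(3)], unfolded q(2)]
    by (rule triple_cong[OF cocomp_parallel[OF ik a] i])
  also have "\<dots> = csum (ins w k v) x i u n (\<lambda>d b e c. csum w x k v d
      (\<lambda>d1 b1 e1 c1. triple w x i u (w ! i) ?q v (w ! k) (d1, ksign (e * e1) \<odot> b1) (e, c) (e1, c1)) b) a"
    by (simp add: csum_def case_prod_unfold map_concat sum_list_concat comp_def)
  also have "\<dots> \<approx> csum (ins w k v) x i u n (\<lambda>d b e c. - scale (ksign d) (free_comp Sg i (kappa w x k v d b) (cor u (ins w k v ! i) e c))) a"
  proof (rule csum_cong[OF i'(1) a])
    fix d b e c assume b: "b \<in> part C (ins w k v) x d" and c: "c \<in> part C u (ins w k v ! i) e"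
    have lin: "module_hom scale scale (\<lambda>X. - scale (ksign d) (free_comp Sg i X (cor u (ins w k v ! i) e c)))"
    proof -
      have "module_hom scale scale (\<lambda>X. free_comp Sg i X (cor u (ins w k v ! i) e c))" by (rule linear_free_comp_left)
      moreover have "module_hom scale scale (scale (- ksign d :: 'k))" by (rule linear_scale)
      ultimately show ?thesis using module_hom_compose by (fastforce simp: comp_def pm.scale_minus_left)
    qed
    show "csum w x k v d (\<lambda>d1 b1 e1 c1. triple w x i u (w ! i) ?q v (w ! k) (d1, ksign (e * e1) \<odot> b1) (e, c) (e1, c1)) b
       \<approx> - scale (ksign d) (free_comp Sg i (kappa w x k v d b) (cor u (ins w k v ! i) e c))"
      unfolding kappa_def csum_linear[OF lin]
    proof (rule csum_cong[OF ik(2) b])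
      fix d1 b1 e1 c1 assume h: "b1 \<in> part C w x d1" "c1 \<in> part C v (w ! k) e1" "d1 + e1 = d"
      note c' = c[unfolded i'(2)]
      have "triple w x i u (w ! i) ?q v (w ! k) (d1, ksign (e * e1) \<odot> b1) (e, c) (e1, c1)
          \<approx> scale (ksign (e * e1)) (triple w x i u (w ! i) ?q v (w ! k) (d1, b1) (e, c) (e1, c1))"
        using triple_linear(1)[OF i c' h(2)] h(1) by blast
      also have "\<dots> = - scale (ksign d) (free_comp Sg i (kterm w x k v (w ! k) d1 b1 e1 c1) (cor u (ins w k v ! i) e c))"
        using free_comp_parallel[OF cor_homog[OF h(1)] ik cor_homog[OF c'] cor_homog[OF h(2)]] h(3)
        by (auto simp: triple_def kterm_def i' free_comp_scale_left ksign_def pm.scale_minus_left pm.scale_one)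
      finally show "triple w x i u (w ! i) ?q v (w ! k) (d1, ksign (e * e1) \<odot> b1) (e, c) (e1, c1)
        \<approx> - scale (ksign d) (free_comp Sg i (kterm w x k v (w ! k) d1 b1 e1 c1) (cor u (ins w k v ! i) e c))" .
    qed
  qed
  also have "\<dots> = - lower_kappa (ins w k v) x i u w k v n a"
    unfolding lower_kappa_def by (simp add: csum_def case_prod_unfold uminus_sum_list_map comp_def)
  finally show ?thesis .
qed

end

context cooperad
begin

text \<open>Both are sums over trees with three vertices whose leaves, in planar order, are numbered by \<open>\<sigma>\<close>.
  The vertices of arity \<open>j\<close> and color \<open>y\<close> resp. \<open>k\<close> and \<open>y'\<close> are split off one after the other: in
  \<open>split_lower\<close> the second from the lower vertex left by the first, in \<open>split_upper\<close> from the upper one (there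
  with \<open>y\<close> and \<open>y'\<close> interchanged).\<close>

definition split_lower where
  "split_lower w x n a y y' \<sigma> q j i k = (let L = permw \<sigma> w; V = splice y q j L in
     rel \<sigma> (lower_kappa V x q (seg q j L) (splice y' i k V) i (seg i k V) n (act C \<sigma> a)))"

definition split_upper where
  "split_upper w x n a y y' \<sigma> j k = (let L = permw \<sigma> w; u = seg 0 j L in
     rel \<sigma> (upper_kappa (splice y' 0 j L) x 0 u (splice y 0 k u) 0 (seg 0 k u) n (act C \<sigma> a)))"

text \<open>The second splitting comes with its own permutation \<open>\<rho>\<close> of the inputs
  of the lower vertex. Equivariance of the cocomposition moves it into the permutation of all
  inputs, expanded along the inner edge, whose slot changes from 0 to \<open>q\<close>.\<close>

lemma split_lower_perm:
  fixes y :: color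
  assumes a: "a \<in> part C w x n" and \<sigma>: "\<sigma> permutes {..<length w}" and j: "j \<le> length w"
    and m: "m = length w - j + 1" and \<rho>: "\<rho> permutes {..<m}" and q: "q < m" "\<rho> q = 0" and ik: "i + k \<le> m"
  defines "V \<equiv> splice y 0 j (permw \<sigma> w)" and "u \<equiv> seg 0 j (permw \<sigma> w)"
  shows "rel \<sigma> (csum V x 0 u n (\<lambda>d b e c. scale (ksign d) (free_comp Sg 0 (blk V x d b y' \<rho> i k) (cor u y e c))) (act C \<sigma> a))
    \<approx> split_lower w x n a y y' (\<sigma> \<circ> perm_comp j \<rho> q id) q j i k"
proof -
  let ?\<mu> = "perm_comp j \<rho> q id" and ?V = "permw \<rho> V" and ?L = "permw \<sigma> w"
  have lu: "length u = j" and lV: "length V = m" using j m by (simp_all add: u_def V_def)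
  have V0: "V ! 0 = y" "ins V 0 u = ?L" using permw_split[of 0 j ?L y] j by (simp_all add: V_def u_def)
  note \<rho>' = \<rho>[folded lV] and q' = q(1)[folded lV]
  have mj: "m + j - 1 = length w" using m j by simp
  have \<mu>: "?\<mu> permutes {..<length w}" by (rule perm_comp_permutes[OF \<rho> permutes_id q(1), of j, unfolded mj])
  have \<sigma>\<mu>: "(\<sigma> \<circ> ?\<mu>) permutes {..<length w}" by (rule permutes_compose[OF \<mu> \<sigma>])
  have Vq: "?V ! q = y" using q' q(2) V0(1) by simp
  have insq: "ins ?V q u = permw ?\<mu> ?L"
    using permw_perm_comp[OF \<rho>' permutes_id q', of u] V0(2) lu q(2) by simp
  have L': "permw (\<sigma> \<circ> ?\<mu>) w = permw ?\<mu> ?L" by (rule permw_permw[OF \<mu>, symmetric])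
  have qV: "q < length ?V" using q' by simp
  note sp = ins_split[OF qV insq, unfolded Vq lu]
  define v t where "v = splice y' i k ?V" and "t = seg i k ?V"
  have vt: "?V = ins v i t" "i < length v"
    using permw_split[of i k ?V y'] ik lV by (auto simp: v_def t_def)
  have a': "act C \<sigma> a \<in> part C (ins V (\<rho> q) u) x n" using act_closed[OF \<sigma> a] V0(2) q(2) by simp
  have a'': "act C ?\<mu> (act C \<sigma> a) \<in> part C (ins ?V q u) x n"
    using act_closed[OF _ act_closed[OF \<sigma> a], of ?\<mu>] \<mu> insq by simp
  define \<Psi> where "\<Psi> = (\<lambda>d b e c. scale (ksign d) (free_comp Sg q (kappa v x i t d b) (cor u y e c)))"
  have bil: "bilin ?V x (permw id u) (V ! \<rho> q) \<Psi>"
    unfolding \<Psi>_def permw_id q(2) V0(1) by (rule lower_kappa_bilin[OF vt])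
  \<comment> \<open>On the composites, \<open>rel \<rho>\<close> of the lower factor is the expanded
    relabeling of the whole by \<open>free_comp_rel\<close>; the upper factor is relabeled
    trivially.\<close>
  have eq: "csum V x 0 u n (\<lambda>d b e c. scale (ksign d) (free_comp Sg 0 (blk V x d b y' \<rho> i k) (cor u y e c))) (act C \<sigma> a)
    = csum V x 0 u n (\<lambda>d b e c. rel ?\<mu> (\<Psi> d (act C \<rho> b) e (act C id c))) (act C \<sigma> a)"
  proof (rule csum_eq)
    show "0 < length V" using q' by linarith
    show "act C \<sigma> a \<in> part C (ins V 0 u) x n" using a' q(2) by simp
    fix d b e c assume b: "b \<in> part C V x d" and c: "c \<in> part C u (V ! 0) e"
    have c': "c \<in> part C u (?V ! q) e" using c V0(1) Vq by simp
    have h: "kappa v x i t d (act C \<rho> b) \<in> homog Sg ?V x (d + 2)"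
      unfolding v_def t_def by (rule blk_kappa_homog[OF b \<rho>']) (use ik lV in simp)
    have "free_comp Sg (\<rho> q) (rel \<rho> (kappa v x i t d (act C \<rho> b))) (rel id (cor u (?V ! q) e c))
        = rel (perm_comp (length u) \<rho> q id) (free_comp Sg q (kappa v x i t d (act C \<rho> b)) (cor u (?V ! q) e c))"
      by (rule free_comp_rel[OF _ permutes_id h _ cor_homog[OF c']]) (use \<rho>' q' in simp_all)
    then show "scale (ksign d) (free_comp Sg 0 (blk V x d b y' \<rho> i k) (cor u y e c)) = rel ?\<mu> (\<Psi> d (act C \<rho> b) e (act C id c))"
      unfolding blk_def \<Psi>_def act_id[OF c] Vq lu q(2) rel_id v_def[symmetric] t_def[symmetric] rel_linear(2) by simp
  qed
  have LXe: "split_lower w x n a y y' (\<sigma> \<circ> ?\<mu>) q j i k = rel \<sigma> (rel ?\<mu> (csum ?V x q u n \<Psi> (act C ?\<mu> (act C \<sigma> a))))"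
    unfolding split_lower_def Let_def L' sp(1)[symmetric] sp(2)[symmetric] act_act[OF \<sigma> \<mu> a] rel_rel lower_kappa_def Vq \<Psi>_def v_def t_def ..
  have h1: "csum ?V x q u n \<Psi> (act C ?\<mu> (act C \<sigma> a)) \<in> homog Sg (permw ?\<mu> ?L) x (n + 3)"
    using lower_kappa_homog[OF vt qV a''] unfolding lower_kappa_def Vq \<Psi>_def[symmetric] insq .
  have h2: "csum V x (\<rho> q) u n (\<lambda>d b e c. \<Psi> d (act C \<rho> b) e (act C id c)) (act C \<sigma> a) \<in> homog Sg (permw ?\<mu> ?L) x (n + 3)"
  proof (rule csum_homog[OF _ a'])
    show "\<rho> q < length V" using q' q(2) by linarith
    fix d b e c assume b: "b \<in> part C V x d" and c: "c \<in> part C u (V ! \<rho> q) e" and de: "d + e = n"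
    have c': "c \<in> part C u (?V ! q) e" using c V0(1) Vq q(2) by simp
    have h: "kappa v x i t d (act C \<rho> b) \<in> homog Sg ?V x (d + 2)"
      unfolding v_def t_def by (rule blk_kappa_homog[OF b \<rho>']) (use ik lV in simp)
    show "\<Psi> d (act C \<rho> b) e (act C id c) \<in> homog Sg (permw ?\<mu> ?L) x (n + 3)"
      using free_comp_homog[OF h qV cor_homog[OF c']] de
      unfolding \<Psi>_def act_id[OF c] insq Vq by (auto simp: ac_simps)
  qed
  have "csum ?V x q u n \<Psi> (act C ?\<mu> (act C \<sigma> a)) \<approx> csum V x (\<rho> q) u n (\<lambda>d b e c. \<Psi> d (act C \<rho> b) e (act C id c)) (act C \<sigma> a)"
    using csum_equivariant[OF \<rho>' permutes_id q' a' bil] by (simp add: lu)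
  from cong_rel[OF this _ h1 h2] have "rel ?\<mu> (csum ?V x q u n \<Psi> (act C ?\<mu> (act C \<sigma> a)))
      \<approx> rel ?\<mu> (csum V x (\<rho> q) u n (\<lambda>d b e c. \<Psi> d (act C \<rho> b) e (act C id c)) (act C \<sigma> a))"
    using \<mu> by simp
  moreover have "\<sigma> permutes {..<length ?L}" using \<sigma> by simp
  ultimately have "rel \<sigma> (rel ?\<mu> (csum ?V x q u n \<Psi> (act C ?\<mu> (act C \<sigma> a))))
      \<approx> rel \<sigma> (rel ?\<mu> (csum V x (\<rho> q) u n (\<lambda>d b e c. \<Psi> d (act C \<rho> b) e (act C id c)) (act C \<sigma> a)))"
    by (rule cong_rel) (use rel_homog[OF h1] rel_homog[OF h2] \<mu> in simp_all)
  then show ?thesis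
    unfolding LXe eq csum_linear[OF linear_rel[where \<pi> = ?\<mu>], symmetric] q(2) by (rule cong_sym)
qed

text \<open>The analogue for the upper vertex. Its inputs come first, so the expanded permutation is
  \<open>\<rho>\<close> itself by \<open>perm_comp_id_0\<close>.\<close>

lemma split_upper_perm:
  fixes y :: color
  assumes a: "a \<in> part C w x n" and \<sigma>: "\<sigma> permutes {..<length w}" and j: "j \<le> length w"
    and \<rho>: "\<rho> permutes {..<j}" and k: "k \<le> j"
  defines "v \<equiv> splice y 0 j (permw \<sigma> w)" and "u \<equiv> seg 0 j (permw \<sigma> w)"
  shows "rel \<sigma> (csum v x 0 u n (\<lambda>d b e c. free_comp Sg 0 (cor v x d b) (blk u y e c y' \<rho> 0 k)) (act C \<sigma> a))
    \<approx> split_upper w x n a y' y (\<sigma> \<circ> \<rho>) j k"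
proof -
  let ?u = "permw \<rho> u" and ?L = "permw \<sigma> w"
  have lu: "length u = j" using j by (simp add: u_def)
  have v0: "v ! 0 = y" "0 < length v" "ins v 0 u = ?L" using permw_split[of 0 j ?L y] j by (simp_all add: v_def u_def)
  note \<rho>' = \<rho>[folded lu]
  have \<rho>w: "\<rho> permutes {..<length w}" by (rule permutes_subset[OF \<rho>]) (use j in auto)
  have pc: "perm_comp (length u) id 0 \<rho> = \<rho>" by (rule perm_comp_id_0[OF \<rho>'])
  have ins: "ins v 0 ?u = permw \<rho> ?L"
    using permw_perm_comp[OF permutes_id \<rho>' v0(2)] v0(3) pc by simp
  have L': "permw (\<sigma> \<circ> \<rho>) w = permw \<rho> ?L" by (rule permw_permw[OF \<rho>w, symmetric])
  note sp = ins_split[OF v0(2) ins, unfolded v0(1) length_permw lu]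
  define s t where "s = splice y' 0 k ?u" and "t = seg 0 k ?u"
  have st: "?u = ins s 0 t" "0 < length s"
    using permw_split[of 0 k ?u y'] k lu by (auto simp: s_def t_def)
  have a': "act C \<sigma> a \<in> part C (ins v (id 0) u) x n" using act_closed[OF \<sigma> a] v0(3) by simp
  have a'': "act C \<rho> (act C \<sigma> a) \<in> part C (ins v 0 ?u) x n"
    using act_closed[OF _ act_closed[OF \<sigma> a], of \<rho>] \<rho>w ins by simp
  define \<Psi> where "\<Psi> = (\<lambda>d b e c. free_comp Sg 0 (cor v x d b) (kappa s y 0 t e c))"
  have bil: "bilin (permw id v) x ?u (v ! id 0) \<Psi>"
    unfolding \<Psi>_def permw_id id_apply v0(1) by (rule upper_kappa_bilin[OF st])
  have hk: "kappa s y 0 t e (act C \<rho> c) \<in> homog Sg ?u y (e + 2)" if "c \<in> part C u (v ! 0) e" for c e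
    unfolding s_def t_def using blk_kappa_homog[OF that[unfolded v0(1)] \<rho>', of 0 k y'] k lu by simp
  have eq: "csum v x 0 u n (\<lambda>d b e c. free_comp Sg 0 (cor v x d b) (blk u y e c y' \<rho> 0 k)) (act C \<sigma> a)
    = csum v x 0 u n (\<lambda>d b e c. rel \<rho> (\<Psi> d (act C id b) e (act C \<rho> c))) (act C \<sigma> a)"
  proof (rule csum_eq[OF v0(2)])
    show "act C \<sigma> a \<in> part C (ins v 0 u) x n" using a' by simp
    fix d b e c assume b: "b \<in> part C v x d" and c: "c \<in> part C u (v ! 0) e"
    have "free_comp Sg (id 0) (rel id (cor v x d b)) (rel \<rho> (kappa s y 0 t e (act C \<rho> c)))
        = rel (perm_comp (length ?u) id 0 \<rho>) (free_comp Sg 0 (cor v x d b) (kappa s y 0 t e (act C \<rho> c)))"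
      by (rule free_comp_rel[OF permutes_id _ cor_homog[OF b] v0(2)]) (use \<rho>' hk[OF c] v0(1) in simp_all)
    then show "free_comp Sg 0 (cor v x d b) (blk u y e c y' \<rho> 0 k) = rel \<rho> (\<Psi> d (act C id b) e (act C \<rho> c))"
      unfolding blk_def \<Psi>_def act_id[OF b] length_permw pc id_apply rel_id s_def t_def by simp
  qed
  have RXe: "split_upper w x n a y' y (\<sigma> \<circ> \<rho>) j k = rel \<sigma> (rel \<rho> (csum v x 0 ?u n \<Psi> (act C \<rho> (act C \<sigma> a))))"
    unfolding split_upper_def Let_def L' sp(1)[symmetric] sp(2)[symmetric] act_act[OF \<sigma> \<rho>w a] rel_rel upper_kappa_def v0(1) \<Psi>_def s_def t_def ..
  have h1: "csum v x 0 ?u n \<Psi> (act C \<rho> (act C \<sigma> a)) \<in> homog Sg (permw \<rho> ?L) x (n + 3)"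
    using upper_kappa_homog[OF st v0(2) a''] unfolding upper_kappa_def v0(1) \<Psi>_def[symmetric] ins .
  have h2: "csum v x (id 0) u n (\<lambda>d b e c. \<Psi> d (act C id b) e (act C \<rho> c)) (act C \<sigma> a) \<in> homog Sg (permw \<rho> ?L) x (n + 3)"
  proof (rule csum_homog[OF _ a'])
    show "id 0 < length v" using v0(2) by simp
    fix d b e c assume b: "b \<in> part C v x d" and c: "c \<in> part C u (v ! id 0) e" and de: "d + e = n"
    have "kappa s y 0 t e (act C \<rho> c) \<in> homog Sg ?u (v ! 0) (e + 2)" using hk c v0(1) by simp
    from free_comp_homog[OF cor_homog[OF b] v0(2) this]
    show "\<Psi> d (act C id b) e (act C \<rho> c) \<in> homog Sg (permw \<rho> ?L) x (n + 3)"
      using de unfolding \<Psi>_def act_id[OF b] ins by (auto simp: ac_simps)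
  qed
  have "csum v x 0 ?u n \<Psi> (act C \<rho> (act C \<sigma> a)) \<approx> csum v x (id 0) u n (\<lambda>d b e c. \<Psi> d (act C id b) e (act C \<rho> c)) (act C \<sigma> a)"
    using csum_equivariant[OF permutes_id \<rho>' v0(2) a' bil] unfolding permw_id pc .
  from cong_rel[OF this _ h1 h2] have "rel \<rho> (csum v x 0 ?u n \<Psi> (act C \<rho> (act C \<sigma> a)))
      \<approx> rel \<rho> (csum v x 0 u n (\<lambda>d b e c. \<Psi> d (act C id b) e (act C \<rho> c)) (act C \<sigma> a))"
    using \<rho>w by simp
  moreover have "\<sigma> permutes {..<length ?L}" using \<sigma> by simp
  ultimately have "rel \<sigma> (rel \<rho> (csum v x 0 ?u n \<Psi> (act C \<rho> (act C \<sigma> a))))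
      \<approx> rel \<sigma> (rel \<rho> (csum v x 0 u n (\<lambda>d b e c. \<Psi> d (act C id b) e (act C \<rho> c)) (act C \<sigma> a)))"
    by (rule cong_rel) (use rel_homog[OF h1] rel_homog[OF h2] \<rho>w in simp_all)
  then show ?thesis
    unfolding RXe eq csum_linear[OF linear_rel[where \<pi> = \<rho>], symmetric] by (rule cong_sym)
qed

text \<open>The second block has \<open>l + 1\<close> inputs, the inner edge and the
  \<open>l\<close> inputs behind the first block. The same tree results from splitting off all
  \<open>j + l\<close> inputs and then the first \<open>j\<close> of them from the upper
  vertex.\<close>

lemma split_lower_sequential:
  assumes a: "a \<in> part C w x n" and \<sigma>: "\<sigma> permutes {..<length w}" and jl: "j + l \<le> length w"
  shows "split_lower w x n a y y' \<sigma> 0 j 0 (l + 1) \<approx> split_upper w x n a y y' \<sigma> (j + l) j"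
proof -
  obtain A B D where L: "permw \<sigma> w = A @ B @ D" "length A = j" "length B = l"
  proof
    show "permw \<sigma> w = take j (permw \<sigma> w) @ take l (drop j (permw \<sigma> w)) @ drop (j + l) (permw \<sigma> w)"
      by (metis append_take_drop_id drop_drop add.commute)
  qed (use jl in auto)
  let ?W = "y' # D" and ?u = "y # B"
  have i: "0 < length ?W" "0 < length ?u" by auto
  have ins: "ins ?W 0 (ins ?u 0 A) = permw \<sigma> w" "ins ?W 0 ?u = y # B @ D" "ins ?u 0 A = A @ B" "0 < length (y # B @ D)"
    "ins (y # B @ D) 0 A = permw \<sigma> w" "ins ?W 0 (A @ B) = permw \<sigma> w" using L by (simp_all add: ins_Cons_0)
  have a': "act C \<sigma> a \<in> part C (permw \<sigma> w) x n" by (rule act_closed[OF \<sigma> a])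
  have "lower_kappa (y # B @ D) x 0 A ?W 0 ?u n (act C \<sigma> a) \<approx> upper_kappa ?W x 0 (A @ B) ?u 0 A n (act C \<sigma> a)"
    using lower_kappa_sequential[OF i, of "act C \<sigma> a" A x n] a' unfolding ins by simp
  moreover have "\<sigma> permutes {..<length (permw \<sigma> w)}" using \<sigma> by simp
  ultimately have "rel \<sigma> (lower_kappa (y # B @ D) x 0 A ?W 0 ?u n (act C \<sigma> a)) \<approx> rel \<sigma> (upper_kappa ?W x 0 (A @ B) ?u 0 A n (act C \<sigma> a))"
    by (rule cong_rel)
      (use lower_kappa_homog[OF ins(2)[symmetric] i(1) ins(4), of "act C \<sigma> a" A x n]
         upper_kappa_homog[OF ins(3)[symmetric] i(2) i(1), of "act C \<sigma> a" x n] a' in \<open>simp_all add: ins\<close>)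
  then show ?thesis
    using L(2,3) by (simp add: split_lower_def split_upper_def Let_def L(1))
qed

text \<open>On the left the block behind position \<open>j\<close> is split off before the initial
  one; on the right the initial one goes first, so that the other block starts at 1, behind the new
  inner edge.\<close>

lemma split_lower_parallel:
  assumes a: "a \<in> part C w x n" and \<sigma>: "\<sigma> permutes {..<length w}" and jl: "j + l \<le> length w"
  shows "split_lower w x n a y y' \<sigma> j l 0 j \<approx> - split_lower w x n a y' y \<sigma> 0 j 1 l"
proof -
  obtain A B D where L: "permw \<sigma> w = A @ B @ D" "length A = j" "length B = l"
  proof
    show "permw \<sigma> w = take j (permw \<sigma> w) @ take l (drop j (permw \<sigma> w)) @ drop (j + l) (permw \<sigma> w)"
      by (metis append_take_drop_id drop_drop add.commute)
  qed (use jl in auto)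
  let ?W = "y' # y # D"
  have i: "(0::nat) < 1" "1 < length ?W" "0 < length ?W" by auto
  have ins: "ins ?W 0 A = A @ y # D" "ins ?W 1 B = y' # B @ D" "ins (A @ y # D) j B = permw \<sigma> w"
    "ins (y' # B @ D) 0 A = permw \<sigma> w" "j < length (A @ y # D)" "0 < length (y' # B @ D)" "1 + length A - 1 = j"
    using L by (simp_all add: ins_def)
  have a': "act C \<sigma> a \<in> part C (permw \<sigma> w) x n" by (rule act_closed[OF \<sigma> a])
  have "lower_kappa (A @ y # D) x j B ?W 0 A n (act C \<sigma> a) \<approx> - lower_kappa (y' # B @ D) x 0 A ?W 1 B n (act C \<sigma> a)"
    using lower_kappa_parallel[OF i(1,2), of "act C \<sigma> a" B A x n] a' unfolding ins by simp
  moreover have "\<sigma> permutes {..<length (permw \<sigma> w)}" using \<sigma> by simp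
  ultimately have "rel \<sigma> (lower_kappa (A @ y # D) x j B ?W 0 A n (act C \<sigma> a)) \<approx> rel \<sigma> (- lower_kappa (y' # B @ D) x 0 A ?W 1 B n (act C \<sigma> a))"
    by (rule cong_rel)
      (use lower_kappa_homog[OF ins(1)[symmetric] i(3) ins(5), of "act C \<sigma> a" B x n]
         lower_kappa_homog[OF ins(2)[symmetric] i(2) ins(6), of "act C \<sigma> a" A x n] a' in \<open>auto simp add: ins\<close>)
  then show ?thesis
    using L(2,3) by (simp add: split_lower_def Let_def L(1) rel_linear)
qed

end

section \<open>Sums over pairs of disjoint subsets\<close>

lemma sum_Pow_Pow:
  assumes "finite N"
  shows "(\<Sum>M\<in>Pow N. \<Sum>A\<in>Pow M. g M A) = (\<Sum>A\<in>Pow N. \<Sum>B\<in>Pow (N - A). g (A \<union> B) A)"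
proof -
  have "(\<Sum>(M, A)\<in>(SIGMA M:Pow N. Pow M). g M A) = (\<Sum>(A, B)\<in>(SIGMA A:Pow N. Pow (N - A)). g (A \<union> B) A)"
    by (rule sum.reindex_bij_witness[where i = "\<lambda>(A, B). (A \<union> B, A)" and j = "\<lambda>(M, A). (A, M - A)"])
       (auto simp: Un_absorb1 Un_absorb2 Un_Diff Diff_triv Int_commute intro!: arg_cong2[where f = g])
  then show ?thesis using assms by (simp add: sum.Sigma finite_subset[of _ N])
qed

lemma sum_Pow_disjoint_swap:
  assumes "finite N"
  shows "(\<Sum>A\<in>Pow N. \<Sum>B\<in>Pow (N - A). g A B) = (\<Sum>A\<in>Pow N. \<Sum>B\<in>Pow (N - A). g B A)"
proof -
  have "(\<Sum>(A, B)\<in>(SIGMA A:Pow N. Pow (N - A)). g A B) = (\<Sum>(A, B)\<in>(SIGMA A:Pow N. Pow (N - A)). g B A)"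
    by (rule sum.reindex_bij_witness[where i = "\<lambda>(A, B). (B, A)" and j = "\<lambda>(A, B). (B, A)"]) auto
  then show ?thesis using assms by (simp add: sum.Sigma)
qed

context cooperad
begin

lemma csum_plus: "csum v x i u n (\<lambda>d b e c. F d b e c + G d b e c) a = csum v x i u n F a + csum v x i u n G a"
  by (simp add: csum_def case_prod_unfold sum_list_addf)

lemma csum_uminus: "csum v x i u n (\<lambda>d b e c. - F d b e c) a = - csum v x i u n F a"
  by (simp add: csum_def case_prod_unfold uminus_sum_list_map comp_def)

definition lower_blk where
  "lower_blk v x u y y' \<rho> i k = (\<lambda>d b e c. scale (ksign d) (free_comp Sg 0 (blk v x d b y' \<rho> i k) (cor u y e c)))"

definition upper_blk where
  "upper_blk v x u y y' \<rho> k = (\<lambda>d b e c. free_comp Sg 0 (cor v x d b) (blk u y e c y' \<rho> 0 k))"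

lemma lower_blk_homog:
  assumes "0 < length v" "\<rho> permutes {..<length v}" "i + k \<le> length v"
    "b \<in> part C v x d" "c \<in> part C u (v ! 0) e" "d + e = n"
  shows "lower_blk v x u (v ! 0) y' \<rho> i k d b e c \<in> homog Sg (ins v 0 u) x (n + 3)"
proof -
  have "d + 2 + (e + 1) = n + 3" using assms(6) by simp
  from free_comp_homog[OF blk_homog[OF assms(4,2,3)] assms(1) cor_homog[OF assms(5)], unfolded this]
  show ?thesis unfolding lower_blk_def by (rule homog_scale)
qed

lemma upper_blk_homog:
  assumes "0 < length v" "\<rho> permutes {..<length u}" "k \<le> length u"
    "b \<in> part C v x d" "c \<in> part C u (v ! 0) e" "d + e = n"
  shows "upper_blk v x u (v ! 0) y' \<rho> k d b e c \<in> homog Sg (ins v 0 u) x (n + 3)"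
proof -
  have "d + 1 + (e + 2) = n + 3" using assms(6) by simp
  moreover have "blk u (v ! 0) e c y' \<rho> 0 k \<in> homog Sg u (v ! 0) (e + 2)"
    by (rule blk_homog[OF assms(5,2)]) (use assms(3) in simp)
  ultimately show ?thesis
    unfolding upper_blk_def using free_comp_homog[OF cor_homog[OF assms(4)] assms(1)] by metis
qed

text \<open>For the lower corolla the minus sign of the differential remains. For the upper one it
  is cancelled by \<open>ksign d * ksign (d + 1) = - 1\<close>, which comes from passing the lower
  corolla.\<close>

lemma cobar_diff_kappa:
  assumes v: "0 < length v" and a: "a \<in> part C (ins v 0 u) x n"
  defines "X \<equiv> - (\<Sum>y'\<in>cols. \<Sum>K\<in>Pow {..<length v}.
        csum v x 0 u n (lower_blk v x u (v ! 0) y' (unshuffle (length v) K) 0 (card K)) a)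
      + (\<Sum>y'\<in>cols. \<Sum>A\<in>Pow {..<length u}. csum v x 0 u n (upper_blk v x u (v ! 0) y' (unshuffle (length u) A) (card A)) a)"
  shows "cobar_diff (kappa v x 0 u n a) \<approx> X" "X \<in> homog Sg (ins v 0 u) x (n + 3)"
proof -
  let ?l = "\<lambda>y' K. lower_blk v x u (v ! 0) y' (unshuffle (length v) K) 0 (card K)"
  let ?r = "\<lambda>y' A. upper_blk v x u (v ! 0) y' (unshuffle (length u) A) (card A)"
  have "cobar_diff (kappa v x 0 u n a) = csum v x 0 u n (\<lambda>d b e c. cobar_diff (kterm v x 0 u (v ! 0) d b e c)) a"
    unfolding kappa_def by (rule csum_linear[OF linear_cobar_diff])
  also have "\<dots> \<approx> csum v x 0 u n (\<lambda>d b e c. - (\<Sum>y'\<in>cols. \<Sum>K\<in>Pow {..<length v}. ?l y' K d b e c)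
      + (\<Sum>y'\<in>cols. \<Sum>A\<in>Pow {..<length u}. ?r y' A d b e c)) a"
  proof (rule csum_cong[OF v a])
    fix d b e c assume b: "b \<in> part C v x d" and c: "c \<in> part C u (v ! 0) e"
    let ?b = "cor v x d b" and ?c = "cor u (v ! 0) e c"
    have "cobar_diff (kterm v x 0 u (v ! 0) d b e c)
        = scale (ksign d) (free_comp Sg 0 (cobar_diff ?b) ?c) + scale (- 1) (free_comp Sg 0 ?b (cobar_diff ?c))"
      using cobar_diff_comp[OF cor_homog[OF b] v cor_homog[OF c]]
      by (auto simp: kterm_def cobar_diff_linear pm.scale_right_distrib ksign_def)
    also have "\<dots> \<approx> scale (ksign d) (free_comp Sg 0 (corolla_diff v x d b) ?c) + scale (- 1) (free_comp Sg 0 ?b (corolla_diff u (v ! 0) e c))"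
      unfolding corolla_diff_def
      by (intro cong_add cong_scale cong_comp_left cong_comp_right cobar_diff_cor cor_spanned b c)
    also have "\<dots> = - (\<Sum>y'\<in>cols. \<Sum>K\<in>Pow {..<length v}. ?l y' K d b e c) + (\<Sum>y'\<in>cols. \<Sum>A\<in>Pow {..<length u}. ?r y' A d b e c)"
      unfolding corolla_diff_def lower_blk_def upper_blk_def
      by (simp only: module_hom.neg[OF linear_free_comp_left] module_hom.neg[OF linear_free_comp_right]
          module_hom.sum[OF linear_free_comp_left] module_hom.sum[OF linear_free_comp_right]
          module_hom.sum[OF linear_scale] module_hom.neg[OF linear_scale] pm.scale_minus_left pm.scale_one sum_negf) simp
    finally show "cobar_diff (kterm v x 0 u (v ! 0) d b e c)
      \<approx> - (\<Sum>y'\<in>cols. \<Sum>K\<in>Pow {..<length v}. ?l y' K d b e c) + (\<Sum>y'\<in>cols. \<Sum>A\<in>Pow {..<length u}. ?r y' A d b e c)" .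
  qed
  also have "\<dots> = X"
    unfolding csum_plus csum_uminus csum_sum X_def ..
  finally show "cobar_diff (kappa v x 0 u n a) \<approx> X" .
  show "X \<in> homog Sg (ins v 0 u) x (n + 3)"
    unfolding X_def
    by (intro homog_add homog_uminus homog_sum csum_homog[OF v a] lower_blk_homog[OF v] upper_blk_homog[OF v] unshuffle_permutes)
       (auto dest: card_le[OF PowI])
qed

text \<open>The first form treats blocks that contain the inner edge. For the others, the second
  form keeps \<open>J\<close> in front and the third one uses the parallel law to put
  \<open>B\<close> in front; comparing these two exhibits the antisymmetry.\<close>

lemma left_terms:
  fixes y y' :: color
  assumes a: "a \<in> part C w x n" and J: "J \<subseteq> {..<length w}" and B: "B \<subseteq> {..<length w} - J"
  defines "N \<equiv> length w"
  defines "\<sigma> \<equiv> unshuffle N J" and "m \<equiv> N - card J + 1"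
  defines "v \<equiv> splice y 0 (card J) (permw \<sigma> w)" and "u \<equiv> seg 0 (card J) (permw \<sigma> w)"
  defines "f \<equiv> \<lambda>K. rel \<sigma> (csum v x 0 u n (lower_blk v x u y y' (unshuffle m K) 0 (card K)) (act C \<sigma> a))"
  shows "f (insert 0 (lower N J B)) \<approx> split_upper w x n a y y' (unshuffle3 N J B) (card (J \<union> B)) (card J)"
    "f (lower N J B) \<approx> split_lower w x n a y y' (unshuffle3 N J B) 0 (card J) 1 (card B)"
    "f (lower N J B) \<approx> - split_lower w x n a y' y (unshuffle3 N B J) 0 (card B) 1 (card J)"
proof -
  have fin: "finite J" "finite B" using J B by (auto intro: finite_subset)
  have dis: "J \<inter> B = {}" using B by auto
  have cJB: "card (J \<union> B) = card J + card B" by (rule card_Un_disjoint[OF fin dis])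
  have cN: "card J + card B \<le> N" using card_mono[of "{..<N}" "J \<union> B"] J B cJB by (auto simp: N_def)
  have \<sigma>: "\<sigma> permutes {..<length w}" unfolding \<sigma>_def N_def by (rule unshuffle_permutes)
  have cJ: "card J \<le> length w" using cN N_def by simp
  let ?K = "lower N J B"
  note JN = J[folded N_def] and BN = B[folded N_def]
  note uc = unshuffle_comp_lower[OF JN BN, folded m_def, folded \<sigma>_def]
  note lf = lower_facts(5-7)[OF JN, of B] lower_facts(7)[OF JN, folded m_def, of B]
  have cK: "card ?K = card B" and K0: "0 \<notin> ?K" and Km: "?K \<subseteq> {..<m}" using lf BN by auto
  have cK': "card (insert 0 ?K) = card B + 1" using K0 cK fin by (simp add: lower_def)
  have m: "m = length w - card J + 1" "0 < m" by (simp_all add: m_def N_def)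
  have lv: "length v = m" by (simp add: v_def m_def N_def)
  have v0: "0 < length v" "v ! 0 = y" by (simp_all add: v_def)
  have a': "act C \<sigma> a \<in> part C (ins v 0 u) x n" "ins v 0 u = permw \<sigma> w"
    using act_closed[OF \<sigma> a] permw_split[of 0 "card J" "permw \<sigma> w" y] cJ by (simp_all add: v_def u_def)
  note LXp = split_lower_perm[OF a \<sigma> cJ m(1) unshuffle_permutes, where y = y and y' = y', folded v_def u_def, folded lower_blk_def]
  have tp: "unshuffle3 N J B permutes {..<length w}" "unshuffle3 N B J permutes {..<length w}"
    using unshuffle3_permutes[of J "length w" B] unshuffle3_permutes[of B "length w" J] J B by (auto simp: N_def)
  have "f (insert 0 ?K) \<approx> split_lower w x n a y y' (unshuffle3 N J B) 0 (card J) 0 (card B + 1)"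
    unfolding f_def cK' uc(1)[symmetric] by (rule LXp) (use m uc(3,5) in auto)
  also have "\<dots> \<approx> split_upper w x n a y y' (unshuffle3 N J B) (card J + card B) (card J)"
    by (rule split_lower_sequential[OF a tp(1)]) (use cN N_def in simp)
  finally show "f (insert 0 ?K) \<approx> split_upper w x n a y y' (unshuffle3 N J B) (card (J \<union> B)) (card J)" unfolding cJB .
  have "f ?K \<approx> split_lower w x n a y y' (unshuffle3 N B J) (card B) (card J) 0 (card B)"
    unfolding f_def cK uc(2)[symmetric] by (rule LXp) (use m uc(4,5) in auto)
  also have "\<dots> \<approx> - split_lower w x n a y' y (unshuffle3 N B J) 0 (card B) 1 (card J)"
    by (rule split_lower_parallel[OF a tp(2)]) (use cN N_def in simp)
  finally show "f ?K \<approx> - split_lower w x n a y' y (unshuffle3 N B J) 0 (card B) 1 (card J)" .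
  \<comment> \<open>Adding the inner edge to the block places it at position 0, so the block itself
    occupies the positions from 1 on. By \<open>blk_cong\<close> this unshuffle, which leaves
    \<open>J\<close> in front, may replace the original one.\<close>
  have img: "unshuffle m ?K ` {0..<0 + card B} = unshuffle m (insert 0 ?K) ` {1..<1 + card B}"
  proof -
    have "unshuffle m ?K ` {0..<0 + card B} = ?K" using unshuffle_image[OF Km] by (simp add: cK atLeast0LessThan)
    moreover have "unshuffle m (insert 0 ?K) ` {..<card B + 1} = insert 0 ?K"
      using unshuffle_image[of "insert 0 ?K" m] Km m(2) by (simp only: cK' insert_subset lessThan_iff simp_thms)
    moreover have "{..<card B + 1} = insert 0 {1..<1 + card B}" by auto
    moreover have "0 \<notin> unshuffle m (insert 0 ?K) ` {1..<1 + card B}"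
    proof
      assume "0 \<in> unshuffle m (insert 0 ?K) ` {1..<1 + card B}"
      then obtain p where "p \<in> {1..<1 + card B}" "unshuffle m (insert 0 ?K) p = unshuffle m (insert 0 ?K) 0" using uc(3) by auto
      then show False using permutes_inj[OF unshuffle_permutes] by (auto simp: inj_def)
    qed
    ultimately show ?thesis
      by (metis K0 uc(3) image_insert Diff_insert_absorb)
  qed
  have "csum v x 0 u n (lower_blk v x u y y' (unshuffle m ?K) 0 (card B)) (act C \<sigma> a)
      \<approx> csum v x 0 u n (lower_blk v x u y y' (unshuffle m (insert 0 ?K)) 1 (card B)) (act C \<sigma> a)"
  proof (rule csum_cong[OF v0(1) a'(1)])
    fix d b e c assume b: "b \<in> part C v x d" and c: "c \<in> part C u (v ! 0) e"
    show "lower_blk v x u y y' (unshuffle m ?K) 0 (card B) d b e c \<approx> lower_blk v x u y y' (unshuffle m (insert 0 ?K)) 1 (card B) d b e c"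
      unfolding lower_blk_def
      by (intro cong_scale cong_comp_left blk_cong[OF b] cor_spanned) (use img unshuffle_permutes lv uc(5) c v0 in auto)
  qed
  moreover have "\<sigma> permutes {..<length (permw \<sigma> w)}" using \<sigma> by simp
  moreover have hom: "csum v x 0 u n (lower_blk v x u y y' (unshuffle m K) i (card B)) (act C \<sigma> a) \<in> homog Sg (permw \<sigma> w) x (n + 3)"
    if "i \<le> 1" for K i
  proof (rule csum_homog[OF v0(1) a'(1)])
    fix d b e c assume "b \<in> part C v x d" "c \<in> part C u (v ! 0) e" "d + e = n"
    moreover have "i + card B \<le> m" using that uc(5) by simp
    ultimately show "lower_blk v x u y y' (unshuffle m K) i (card B) d b e c \<in> homog Sg (permw \<sigma> w) x (n + 3)"
      using lower_blk_homog[OF v0(1), of "unshuffle m K" i "card B" b x d c u e n y'] unshuffle_permutes[of m K] unfolding lv a'(2) v0(2) by blast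
  qed
  ultimately have "f ?K \<approx> rel \<sigma> (csum v x 0 u n (lower_blk v x u y y' (unshuffle m (insert 0 ?K)) 1 (card B)) (act C \<sigma> a))"
    unfolding f_def cK by (intro cong_rel[OF _ _ hom hom]) simp_all
  also have "\<dots> \<approx> split_lower w x n a y y' (unshuffle3 N J B) 0 (card J) 1 (card B)"
    unfolding uc(1)[symmetric] by (rule LXp) (use m uc(3,5) in auto)
  finally show "f ?K \<approx> split_lower w x n a y y' (unshuffle3 N J B) 0 (card J) 1 (card B)" .
qed

text \<open>Subsets of the positions at the upper vertex are translated into subsets of
  \<open>M\<close>; after that both unshuffles merge into one of three blocks.\<close>

lemma right_terms:
  fixes y y' :: color
  assumes a: "a \<in> part C w x n" and M: "M \<subseteq> {..<length w}"
  defines "N \<equiv> length w"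
  defines "\<sigma> \<equiv> unshuffle N M"
  defines "v \<equiv> splice y 0 (card M) (permw \<sigma> w)" and "u \<equiv> seg 0 (card M) (permw \<sigma> w)"
  defines "f \<equiv> \<lambda>K. rel \<sigma> (csum v x 0 u n (upper_blk v x u y y' (unshuffle (card M) K) (card K)) (act C \<sigma> a))"
  shows "(\<Sum>K\<in>Pow {..<card M}. f K) \<approx> (\<Sum>A\<in>Pow M. split_upper w x n a y' y (unshuffle3 N A (M - A)) (card M) (card A))"
proof -
  have \<sigma>: "\<sigma> permutes {..<length w}" unfolding \<sigma>_def N_def by (rule unshuffle_permutes)
  have cM: "card M \<le> length w" using card_mono[OF _ M] by simp
  note uc = unshuffle_comp_upper[OF M, folded N_def, folded \<sigma>_def]
  let ?g = "idx (filter (\<lambda>j. j \<in> M) [0..<N])"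
  have "(\<Sum>K\<in>Pow {..<card M}. f K) = (\<Sum>A\<in>Pow M. f (?g ` A))" by (rule sum_Pow_image[OF uc(3)[OF subset_refl]])
  also have "\<dots> \<approx> (\<Sum>A\<in>Pow M. split_upper w x n a y' y (unshuffle3 N A (M - A)) (card M) (card A))"
  proof (rule cong_sum)
    fix A assume "A \<in> Pow M"
    then have A: "A \<subseteq> M" by simp
    have "card A \<le> card M" using card_mono[OF finite_subset[OF M] A] by simp
    from split_upper_perm[OF a \<sigma> cM unshuffle_permutes[of "card M" "?g ` A"] this, where y = y and y' = y', folded v_def u_def, folded upper_blk_def]
    show "f (?g ` A) \<approx> split_upper w x n a y' y (unshuffle3 N A (M - A)) (card M) (card A)"
      unfolding uc(1)[OF A] f_def uc(2)[OF A] .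
  qed
  finally show ?thesis .
qed

lemma cobar_diff_diff_cor:
  assumes two: "(2::'k) \<noteq> 0" and a: "a \<in> part C w x n"
  shows "cobar_diff (cobar_diff (cor w x n a)) \<approx> 0"
proof -
  let ?N = "length w"
  let ?P = "Pow {..<?N}"
  define \<sigma> v u where "\<sigma> = unshuffle ?N" and "v = (\<lambda>y J. splice y 0 (card J) (permw (\<sigma> J) w))"
    and "u = (\<lambda>J. seg 0 (card J) (permw (\<sigma> J) w))"
  define l where "l = (\<lambda>y J y' K. rel (\<sigma> J) (csum (v y J) x 0 (u J) n
    (lower_blk (v y J) x (u J) y y' (unshuffle (?N - card J + 1) K) 0 (card K)) (act C (\<sigma> J) a)))"
  define r where "r = (\<lambda>y J y' K. rel (\<sigma> J) (csum (v y J) x 0 (u J) n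
    (upper_blk (v y J) x (u J) y y' (unshuffle (card J) K) (card K)) (act C (\<sigma> J) a)))"
  define R where "R = (\<lambda>y y' A B. split_upper w x n a y y' (unshuffle3 ?N A B) (card (A \<union> B)) (card A))"
  \<comment> \<open>The tree with two upper vertices, written with the block \<open>A\<close> split
    off first; the start 1 of the second block skips the inner edge of the first.\<close>
  define Q where "Q = (\<lambda>y y' A B. split_lower w x n a y y' (unshuffle3 ?N A B) 0 (card A) 1 (card B))"
  define S where "S = (\<Sum>y\<in>cols. \<Sum>y'\<in>cols. \<Sum>J\<in>?P. \<Sum>B\<in>Pow ({..<?N} - J). l y J y' (lower ?N J B))"
  define RR where "RR = (\<Sum>y\<in>cols. \<Sum>y'\<in>cols. \<Sum>J\<in>?P. \<Sum>B\<in>Pow ({..<?N} - J). R y y' J B)"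
  have swap: "(\<Sum>y\<in>cols. \<Sum>J\<in>?P. \<Sum>y'\<in>cols. F y J y') = (\<Sum>y\<in>cols. \<Sum>y'\<in>cols. \<Sum>J\<in>?P. F y J y')"
    for F :: "color \<Rightarrow> nat set \<Rightarrow> color \<Rightarrow> 'a cobar_gen tree \<Rightarrow>\<^sub>0 'k"
    by (intro sum.cong refl sum.swap)
  have D1: "cobar_diff (blk w x n a y (\<sigma> J) 0 (card J))
      \<approx> - (\<Sum>y'\<in>cols. \<Sum>K\<in>Pow {..<?N - card J + 1}. l y J y' K) + (\<Sum>y'\<in>cols. \<Sum>K\<in>Pow {..<card J}. r y J y' K)"
    if J: "J \<in> ?P" for y J
  proof -
    note cJ = card_le[OF J]
    have \<sigma>: "\<sigma> J permutes {..<?N}" unfolding \<sigma>_def by (rule unshuffle_permutes)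
    have lv: "length (v y J) = ?N - card J + 1" "v y J ! 0 = y" "0 < length (v y J)" "length (u J) = card J"
      using cJ by (simp_all add: v_def u_def)
    have ins: "ins (v y J) 0 (u J) = permw (\<sigma> J) w"
      using permw_split[of 0 "card J" "permw (\<sigma> J) w" y] cJ by (simp add: v_def u_def)
    have a': "act C (\<sigma> J) a \<in> part C (ins (v y J) 0 (u J)) x n" using act_closed[OF \<sigma> a] ins by simp
    have "cobar_diff (blk w x n a y (\<sigma> J) 0 (card J)) = rel (\<sigma> J) (cobar_diff (kappa (v y J) x 0 (u J) n (act C (\<sigma> J) a)))"
      by (simp add: blk_def v_def u_def cobar_diff_rel)
    also note cobar_diff_kappa[OF lv(3) a', unfolded ins lv]
    note kap = this
    have h: "cobar_diff (kappa (v y J) x 0 (u J) n (act C (\<sigma> J) a)) \<in> homog Sg (permw (\<sigma> J) w) x (n + 3)"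
      using cobar_diff_homog[OF kappa_homog[OF lv(3) a']] unfolding ins by (simp add: add.assoc)
    have "rel (\<sigma> J) (cobar_diff (kappa (v y J) x 0 (u J) n (act C (\<sigma> J) a)))
      \<approx> - (\<Sum>y'\<in>cols. \<Sum>K\<in>Pow {..<?N - card J + 1}. l y J y' K) + (\<Sum>y'\<in>cols. \<Sum>K\<in>Pow {..<card J}. r y J y' K)"
      unfolding l_def r_def
      by (rule cong_eq_trans(1)[OF cong_rel[OF kap(1) _ h kap(2)]]) (use \<sigma> in \<open>simp_all add: rel_linear module_hom.sum[OF linear_rel]\<close>)
    then show ?thesis by (simp add: blk_def v_def u_def cobar_diff_rel)
  qed
  have left: "(\<Sum>K\<in>Pow {..<?N - card J + 1}. l y J y' K)
      \<approx> (\<Sum>B\<in>Pow ({..<?N} - J). R y y' J B) + (\<Sum>B\<in>Pow ({..<?N} - J). l y J y' (lower ?N J B))" if "J \<in> ?P" for y J y'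
  proof -
    have J: "J \<subseteq> {..<?N}" using that by simp
    show ?thesis
      unfolding sum_Pow_lower[OF J] sum.distrib[symmetric]
      by (intro cong_sum cong_add cong_refl) (use left_terms(1)[OF a J] in \<open>simp add: l_def R_def \<sigma>_def v_def u_def\<close>)
  qed
  have right: "(\<Sum>K\<in>Pow {..<card M}. r y M y' K) \<approx> (\<Sum>A\<in>Pow M. R y' y A (M - A))" if "M \<in> ?P" for y M y'
  proof -
    have M: "M \<subseteq> {..<?N}" using that by simp
    have "A \<union> (M - A) = M" if "A \<in> Pow M" for A using that by auto
    then have "(\<Sum>A\<in>Pow M. R y' y A (M - A)) = (\<Sum>A\<in>Pow M. split_upper w x n a y' y (unshuffle3 ?N A (M - A)) (card M) (card A))"
      by (intro sum.cong refl) (simp only: R_def)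
    then show ?thesis
      using right_terms[OF a M, of y y'] by (simp only: r_def \<sigma>_def v_def u_def)
  qed
  \<comment> \<open>A pair consisting of a set \<open>M\<close> and a subset \<open>A\<close> is the
    same as the pair of disjoint sets \<open>A\<close> and \<open>M - A\<close>. This matches the
    upper terms with the path terms coming from the lower vertex.\<close>
  have RR: "(\<Sum>y\<in>cols. \<Sum>y'\<in>cols. \<Sum>M\<in>?P. \<Sum>A\<in>Pow M. R y' y A (M - A)) = RR"
  proof -
    have "(\<Sum>y\<in>cols. \<Sum>y'\<in>cols. \<Sum>M\<in>?P. \<Sum>A\<in>Pow M. R y' y A (M - A))
        = (\<Sum>y\<in>cols. \<Sum>y'\<in>cols. \<Sum>A\<in>?P. \<Sum>B\<in>Pow ({..<?N} - A). R y' y A ((A \<union> B) - A))"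
      by (intro sum.cong refl sum_Pow_Pow) simp
    also have "\<dots> = (\<Sum>y\<in>cols. \<Sum>y'\<in>cols. \<Sum>A\<in>?P. \<Sum>B\<in>Pow ({..<?N} - A). R y' y A B)"
      by (intro sum.cong refl arg_cong[where f = "R _ _ _"]) auto
    also have "\<dots> = RR" unfolding RR_def by (rule sum.swap)
    finally show ?thesis .
  qed
  have "cobar_diff (cobar_diff (cor w x n a)) \<approx> cobar_diff (corolla_diff w x n a)"
    unfolding corolla_diff_def by (rule cong_cobar_diff[OF cobar_diff_cor[OF a]])
  also have "\<dots> = - (\<Sum>y\<in>cols. \<Sum>J\<in>?P. cobar_diff (blk w x n a y (\<sigma> J) 0 (card J)))"
    unfolding corolla_diff_def \<sigma>_def by (simp only: module_hom.neg[OF linear_cobar_diff] module_hom.sum[OF linear_cobar_diff])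
  also have "\<dots> \<approx> - (\<Sum>y\<in>cols. \<Sum>J\<in>?P. - (\<Sum>y'\<in>cols. (\<Sum>B\<in>Pow ({..<?N} - J). R y y' J B) + (\<Sum>B\<in>Pow ({..<?N} - J). l y J y' (lower ?N J B)))
      + (\<Sum>y'\<in>cols. \<Sum>A\<in>Pow J. R y' y A (J - A)))"
    by (intro cong_uminus cong_sum cong_trans[OF D1] cong_add left right)
  \<comment> \<open>The path terms occur as \<open>RR\<close> with both signs and cancel, leaving
    the terms with two upper vertices.\<close>
  also have "\<dots> = S"
    unfolding sum.distrib sum_negf swap RR RR_def[symmetric] S_def[symmetric] by simp
  finally have DS: "cobar_diff (cobar_diff (cor w x n a)) \<approx> S" .
  have "S \<approx> (\<Sum>y\<in>cols. \<Sum>y'\<in>cols. \<Sum>J\<in>?P. \<Sum>B\<in>Pow ({..<?N} - J). Q y y' J B)"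
    unfolding S_def
    by (intro cong_sum) (use left_terms(2)[OF a] in \<open>simp add: l_def Q_def \<sigma>_def v_def u_def\<close>)
  moreover have "S \<approx> - (\<Sum>y\<in>cols. \<Sum>y'\<in>cols. \<Sum>J\<in>?P. \<Sum>B\<in>Pow ({..<?N} - J). Q y y' J B)"
  proof -
    have "S \<approx> (\<Sum>y\<in>cols. \<Sum>y'\<in>cols. \<Sum>J\<in>?P. \<Sum>B\<in>Pow ({..<?N} - J). - Q y' y B J)"
      unfolding S_def
      by (intro cong_sum) (use left_terms(3)[OF a] in \<open>simp add: l_def Q_def \<sigma>_def v_def u_def\<close>)
    also have "\<dots> = - (\<Sum>y\<in>cols. \<Sum>y'\<in>cols. \<Sum>J\<in>?P. \<Sum>B\<in>Pow ({..<?N} - J). Q y' y J B)"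
      unfolding sum_negf
      by (intro arg_cong[where f = uminus] sum.cong refl sum_Pow_disjoint_swap[symmetric]) simp
    also have "(\<Sum>y\<in>cols. \<Sum>y'\<in>cols. \<Sum>J\<in>?P. \<Sum>B\<in>Pow ({..<?N} - J). Q y' y J B)
        = (\<Sum>y\<in>cols. \<Sum>y'\<in>cols. \<Sum>J\<in>?P. \<Sum>B\<in>Pow ({..<?N} - J). Q y y' J B)" by (rule sum.swap)
    finally show ?thesis .
  qed
  \<comment> \<open>The two expressions for \<open>S\<close> differ by a sign after the blocks and
    their colors have been exchanged.\<close>
  ultimately have "S + S \<approx> 0" using cong_add by fastforce
  then have "scale (inverse 2) (S + S) \<approx> 0" using cong_scale by fastforce
  moreover have "scale (inverse 2) (S + S) = S"
  proof -
    have "S + S = scale 2 S" using pm.scale_left_distrib[of 1 1 S] by (simp add: pm.scale_one)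
    then show ?thesis using two by (simp add: pm.scale_one)
  qed
  ultimately have "S \<approx> 0" by simp
  with DS show ?thesis by (rule cong_trans)
qed

text \<open>\<open>D^2\<close> is a derivation without signs and commutes with relabeling, so by
  \<open>operad_induct\<close> it suffices to know that it vanishes on corollas.\<close>

lemma cobar_diff_diff:
  assumes two: "(2::'k) \<noteq> 0" and a: "a \<in> homog Sg w x d"
  shows "cobar_diff (cobar_diff a) \<in> total_ideal Sg (cobar_relations C)"
proof -
  have tree: "cobar_diff (cobar_diff (mon T)) \<approx> 0" if "T \<in> trees Sg w x d" for T w x d
    using that
  proof (induction rule: operad_induct)
    case (leaf x)
    then show ?case by (simp add: cobar_diff_mon)
  next
    case (corolla g)
    obtain w x d a where g: "g = (w, x, d, a)" by (cases g)
    then have a: "a \<in> part C w x d" "w = [x] \<Longrightarrow> counit C x a = 0" using corolla by auto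
    have "reduce C w x a = a" using reduce_id[OF a(1)] a(2) by blast
    then show ?case using cobar_diff_diff_cor[OF two a(1)] unfolding g cor_def by simp
  next
    case (graft T S w x d i u e)
    note h = homog_mon[OF graft(1), of 1] homog_mon[OF graft(3), of 1]
    let ?T = "mon T" and ?S = "mon S"
    \<comment> \<open>The two mixed terms carry \<open>ksign d\<close> and
      \<open>ksign (d + 1)\<close> and cancel.\<close>
    have "cobar_diff (cobar_diff (free_comp Sg i ?T ?S))
        = free_comp Sg i (cobar_diff (cobar_diff ?T)) ?S + free_comp Sg i ?T (cobar_diff (cobar_diff ?S))"
      unfolding cobar_diff_comp[OF h(1) graft(2) h(2)] cobar_diff_linear
        cobar_diff_comp[OF cobar_diff_homog[OF h(1)] graft(2) h(2)] cobar_diff_comp[OF h(1) graft(2) cobar_diff_homog[OF h(2)]]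
      by (auto simp: ksign_def pm.scale_right_distrib pm.scale_minus_left pm.scale_one)
    also have "\<dots> \<approx> free_comp Sg i 0 ?S + free_comp Sg i ?T 0"
      by (intro cong_add cong_comp_left cong_comp_right graft.IH homog_spanned[OF h(1)] homog_spanned[OF h(2)])
    also have "\<dots> = 0" using free_comp_scale_left[of Sg i 0 0] free_comp_scale_right[of Sg i _ 0 0] by simp
    finally have "scale (graft_sign Sg i T S) (cobar_diff (cobar_diff (mon (graft i T S)))) \<approx> 0"
      unfolding free_comp_mon_scale[OF graft(1-3)] cobar_diff_linear .
    from cong_scale[OF this, of "graft_sign Sg i T S"] show ?case by (simp add: graft_sign_def ksign_def pm.scale_one split: if_splits)
  next
    case (relabel T \<sigma> w x d)
    note h = homog_mon[OF relabel(1), of 1]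
    have "cobar_diff (cobar_diff (mon (relabel \<sigma> T))) = rel \<sigma> (cobar_diff (cobar_diff (mon T)))"
      by (simp flip: cobar_diff_rel)
    also have "\<dots> \<approx> rel \<sigma> 0"
      by (rule cong_rel[OF relabel.IH _ cobar_diff_homog[OF cobar_diff_homog[OF h]]]) (use relabel(2) in auto)
    finally show ?case by simp
  qed
  show ?thesis
    using a by (induction rule: homog_induct) (auto simp: cobar_diff_linear intro: total_ideal_add total_ideal_scale tree[unfolded cong_zero_iff])
qed

lemma dg_operad_cobar:
  assumes "(2::'k) \<noteq> 0"
  shows "dg_operad (cobar C)"
  unfolding cobar_def cobar_diff_def[symmetric]
  by (rule dg_operad_presented[OF linear_cobar_diff cobar_diff_ideal cobar_diff_homog cobar_diff_diff[OF assms] cobar_diff_rel cobar_diff_comp])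

end

section \<open>Functoriality of presented operads\<close>

definition tree_map :: "('g \<Rightarrow> 'h) \<Rightarrow> ('g tree \<Rightarrow>\<^sub>0 'k::field) \<Rightarrow> 'h tree \<Rightarrow>\<^sub>0 'k" where
  "tree_map h = lin_ext (\<lambda>T. mon (map_tree h T))"

lemma linear_tree_map: "module_hom scale scale (tree_map h)"
  unfolding tree_map_def by (rule linear_lin_ext)

lemma tree_map_mon [simp]: "tree_map h (Poly_Mapping.single T c) = Poly_Mapping.single (map_tree h T) c"
  by (simp add: tree_map_def)

lemma tree_map_id [simp]: "tree_map id a = a"
  by (simp add: tree_map_def tree.map_id)

lemma leaves_map_tree [simp]: "leaves (map_tree h T) = leaves T"
  by (induction T) (simp_all add: comp_def cong: map_cong)

lemma relabel_map_tree: "relabel \<pi> (map_tree h T) = map_tree h (relabel \<pi> T)"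
  by (induction T) auto

lemma graft_map_tree: "graft i (map_tree h T) (map_tree h S) = map_tree h (graft i T S)"
proof -
  have "plug i (map_tree h S) m (map_tree h T) = map_tree h (plug i S m T)" for S m by (induction T) auto
  then show ?thesis by (simp add: graft_def relabel_map_tree)
qed

lemma map_tree_corolla: "fst (h g) = fst g \<Longrightarrow> map_tree h (corolla g) = corolla (h g)"
  by (simp add: corolla_def)

lemma tree_map_free_act: "tree_map h (free_act \<sigma> a) = free_act \<sigma> (tree_map h a)"
  unfolding tree_map_def free_act_def lin_ext_lin_ext
  by (rule lin_ext_cong) (simp add: relabel_map_tree pm.scale_one)

lemma set_tree_gens: "wf_tree \<Sigma> T \<Longrightarrow> set_tree T \<subseteq> gens \<Sigma>"
  by (induction T) (auto simp: list_all_iff)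

text \<open>Replacing decorations by others of the same type commutes with grafting, its signs and
  relabeling. Whether the ideals are respected can thus be decided on the defining
  relations.\<close>

locale signature_map =
  fixes \<Sigma> :: "'g signature" and \<Sigma>' :: "'h signature" and h :: "'g \<Rightarrow> 'h"
  assumes gens: "g \<in> gens \<Sigma> \<Longrightarrow> h g \<in> gens \<Sigma>'"
    and cols [simp]: "in_cols \<Sigma>' (h g) = in_cols \<Sigma> g" "out_col \<Sigma>' (h g) = out_col \<Sigma> g"
    and gdeg [simp]: "gdeg \<Sigma>' (h g) = gdeg \<Sigma> g"
begin

lemma root_col_map [simp]: "root_col \<Sigma>' (map_tree h T) = root_col \<Sigma> T"
  by (cases T) auto

lemma tdeg_map [simp]: "tdeg \<Sigma>' (map_tree h T) = tdeg \<Sigma> T"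
  by (induction T) (simp_all add: comp_def cong: map_cong)

lemma wf_tree_map: "wf_tree \<Sigma> T \<Longrightarrow> wf_tree \<Sigma>' (map_tree h T)"
  by (induction T) (auto simp: list_all_iff gens comp_def)

lemma deg_after_map [simp]: "deg_after \<Sigma>' i (map_tree h T) = deg_after \<Sigma> i T"
proof -
  have "preorder (map_tree h T) = map (map_sum h id) (preorder T)" for T :: "'g tree"
  proof (induction T)
    case (Node g ts)
    have "map (preorder \<circ> map_tree h) ts = map (map (map_sum h id) \<circ> preorder) ts"
      by (rule map_cong[OF refl]) (simp only: comp_apply Node)
    then show ?case by (simp only: tree.map preorder.simps list.map map_map map_concat map_sum.simps)
  qed simp
  moreover have "(\<lambda>s. s \<noteq> Inr i) \<circ> map_sum h id = (\<lambda>s. s \<noteq> Inr (i :: nat))"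
    by (auto simp: fun_eq_iff map_sum_def split: sum.splits)
  moreover have "case_sum (gdeg \<Sigma>') (\<lambda>_. 0) \<circ> map_sum h id = case_sum (gdeg \<Sigma>) (\<lambda>_ :: nat. 0)"
    by (auto simp: fun_eq_iff split: sum.split)
  ultimately show ?thesis by (simp only: deg_after_def dropWhile_map map_map)
qed

lemma trees_map: "T \<in> trees \<Sigma> w x d \<Longrightarrow> map_tree h T \<in> trees \<Sigma>' w x d"
  by (simp add: trees_def wf_tree_map)

lemma homog_map: "a \<in> homog \<Sigma> w x d \<Longrightarrow> tree_map h a \<in> homog \<Sigma>' w x d"
  unfolding tree_map_def by (rule homog_lin_ext) (auto simp: homog_def intro: trees_map)

lemma free_comp_map: "tree_map h (free_comp \<Sigma> i a b) = free_comp \<Sigma>' i (tree_map h a) (tree_map h b)"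
  unfolding tree_map_def free_comp_def lin_ext_lin_ext lin_ext_single pm.scale_one
  by (intro lin_ext_cong) (simp add: graft_sign_def graft_map_tree)

lemma total_ideal_map:
  assumes R: "\<And>r w x d. r \<in> R \<Longrightarrow> r \<in> homog \<Sigma> w x d \<Longrightarrow> tree_map h r \<in> R'"
    and r: "r \<in> total_ideal \<Sigma> R"
  shows "tree_map h r \<in> total_ideal \<Sigma>' R'"
proof (rule total_ideal_linear[OF linear_tree_map r])
  fix w x d r assume "rel_ideal \<Sigma> R w x d r"
  then show "tree_map h r \<in> total_ideal \<Sigma>' R'"
  proof (induction rule: rel_ideal.induct)
    case (gen r w x d)
    then have "r \<in> homog \<Sigma> w x d" by (simp add: homog_def)
    from rel_ideal.gen[OF R[OF gen(1) this], of \<Sigma>' w x d] homog_map[OF this] show ?case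
      by (auto simp: homog_def intro: rel_ideal_total)
  next
    case (act w x d r \<sigma>)
    then show ?case unfolding tree_map_free_act by (intro total_ideal_act)
  next
    case (comp_left w x d r i S u e)
    then show ?case
      unfolding free_comp_map
      by (intro total_ideal_comp_left homog_spanned[OF homog_map]) (auto simp: homog_def)
  next
    case (comp_right T w x d i u e r)
    then show ?case
      unfolding free_comp_map
      by (intro total_ideal_comp_right homog_spanned[OF homog_map]) (auto simp: homog_def)
  qed (simp_all add: module_hom.zero[OF linear_tree_map] module_hom.add[OF linear_tree_map]
         module_hom.scale[OF linear_tree_map] total_ideal_add total_ideal_scale)
qed

end

section \<open>Retracts of cooperads\<close>

text \<open>Generators and relations of a cobar construction only involve the linear structure, the
  action and the counit. These are the compatibilities asked of \<open>p\<close>.\<close>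

locale cooperad_retract = D: cooperad D + C: cooperad C
  for D :: "('k::field, 'a, 'y) cooperad_scheme" and C :: "('k, 'a, 'z) cooperad_scheme" +
  fixes p :: "'a \<Rightarrow> 'a"
  assumes sub: "subcooperad D C"
    and p_closed: "a \<in> part C w x d \<Longrightarrow> p a \<in> part D w x d"
    and p_id: "a \<in> part D w x d \<Longrightarrow> p a = a"
    and p_add: "a \<in> part C w x d \<Longrightarrow> b \<in> part C w x d \<Longrightarrow> p (a \<oplus>\<^bsub>C\<^esub> b) = p a \<oplus>\<^bsub>D\<^esub> p b"
    and p_smult: "a \<in> part C w x d \<Longrightarrow> p (c \<odot>\<^bsub>C\<^esub> a) = c \<odot>\<^bsub>D\<^esub> p a"
    and p_act: "a \<in> part C w x d \<Longrightarrow> \<sigma> permutes {..<length w} \<Longrightarrow> p (act C \<sigma> a) = act D \<sigma> (p a)"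
    and p_counit: "a \<in> part C [x] x d \<Longrightarrow> counit D x (p a) = counit C x a"
begin

abbreviation "R\<^sub>D \<equiv> cobar_relations D :: ('a cobar_gen tree \<Rightarrow>\<^sub>0 'k) set"
abbreviation "R\<^sub>C \<equiv> cobar_relations C :: ('a cobar_gen tree \<Rightarrow>\<^sub>0 'k) set"

lemma sub_simps:
  "coaug D x = coaug C x" "a \<in> part D [x] x d \<Longrightarrow> counit D x a = counit C x a"
  "a \<in> part D w x d \<Longrightarrow> a \<in> part C w x d"
  "a \<in> part D w x d \<Longrightarrow> b \<in> part D w x d \<Longrightarrow> a \<oplus>\<^bsub>D\<^esub> b = a \<oplus>\<^bsub>C\<^esub> b"
  "a \<in> part D w x d \<Longrightarrow> c \<odot>\<^bsub>D\<^esub> a = c \<odot>\<^bsub>C\<^esub> a"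
  "a \<in> part D w x d \<Longrightarrow> \<sigma> permutes {..<length w} \<Longrightarrow> act D \<sigma> a = act C \<sigma> a"
  using sub unfolding subcooperad_def by blast+

lemma sub_cocomp:
  "i < length w \<Longrightarrow> a \<in> part D (ins w i u) x n \<Longrightarrow> tensor_eq C [(w, x), (u, w ! i)]
     (ten2 (cocomp D w x i u n a)) (ten2 (cocomp C w x i u n a))"
  using sub unfolding subcooperad_def by blast

sublocale inclusion: signature_map D.Sg C.Sg id
  by unfold_locales (auto simp: cobar_signature_def sub_simps)

sublocale retraction: signature_map C.Sg D.Sg "\<lambda>(w, x, d, a). (w, x, d, p a)"
  by unfold_locales (auto simp: cobar_signature_def p_closed p_counit)

lemma homog_sub: "a \<in> homog D.Sg w x d \<Longrightarrow> a \<in> homog C.Sg w x d"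
  using inclusion.homog_map[of a w x d] by simp

lemma free_comp_sub: "free_comp D.Sg i a b = free_comp C.Sg i a b"
  using inclusion.free_comp_map[of i a b] by simp

lemma relations_sub:
  assumes "r \<in> R\<^sub>D"
  shows "r \<in> R\<^sub>C"
  using assms
proof (cases rule: cobar_relations_cases)
  case (add w x d a b)
  have "a \<oplus>\<^bsub>D\<^esub> b = a \<oplus>\<^bsub>C\<^esub> b" using add(2,3) sub_simps(4)[of a w x d b] by simp
  then show ?thesis using cobar_relationsI(1)[OF add(2,3)[THEN inclusion.gens, unfolded id_apply]] add(1) by simp
next
  case (smult w x d c a)
  have "c \<odot>\<^bsub>D\<^esub> a = c \<odot>\<^bsub>C\<^esub> a" using smult(2) sub_simps(5)[of a w x d c] by simp
  then show ?thesis using cobar_relationsI(2)[OF smult(2)[THEN inclusion.gens, unfolded id_apply]] smult(1) by simp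
next
  case (act w x d \<sigma> a)
  have "act D \<sigma> a = act C \<sigma> a" using act(2,3) sub_simps(6)[of a w x d \<sigma>] by simp
  then show ?thesis using cobar_relationsI(3)[OF act(2)[THEN inclusion.gens, unfolded id_apply] act(3)] act(1) by simp
qed

lemma ideal_sub: "r \<in> total_ideal D.Sg R\<^sub>D \<Longrightarrow> r \<in> total_ideal C.Sg R\<^sub>C"
  using inclusion.total_ideal_map[of R\<^sub>D R\<^sub>C r] relations_sub by simp

lemma cong_sub: "cong_mod D.Sg R\<^sub>D a b \<Longrightarrow> cong_mod C.Sg R\<^sub>C a b"
  unfolding cong_mod_def by (rule ideal_sub)

lemma relations_retract:
  assumes "r \<in> R\<^sub>C"
  shows "tree_map (\<lambda>(w, x, d, a). (w, x, d, p a)) r \<in> R\<^sub>D"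
proof -
  let ?h = "\<lambda>(w, x, d, a). (w, x, d, p a)"
  have cor: "map_tree ?h (corolla (w, x, d, a)) = corolla (w, x, d, p a)" for w x d a
    using map_tree_corolla[of ?h "(w, x, d, a)"] by simp
  note lin = module_hom.diff[OF linear_tree_map] module_hom.scale[OF linear_tree_map] tree_map_free_act tree_map_mon cor
  show ?thesis
    using assms
  proof (cases rule: cobar_relations_cases)
    case (add w x d a b)
    have "p (a \<oplus>\<^bsub>C\<^esub> b) = p a \<oplus>\<^bsub>D\<^esub> p b" using add(2,3) p_add[of a w x d b] by simp
    then show ?thesis
      using cobar_relationsI(1)[OF add(2,3)[THEN retraction.gens, unfolded prod.case]] unfolding add(1) lin by simp
  next
    case (smult w x d c a)
    have "p (c \<odot>\<^bsub>C\<^esub> a) = c \<odot>\<^bsub>D\<^esub> p a" using smult(2) p_smult[of a w x d c] by simp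
    then show ?thesis
      using cobar_relationsI(2)[OF smult(2)[THEN retraction.gens, unfolded prod.case], of c] unfolding smult(1) lin by simp
  next
    case (act w x d \<sigma> a)
    have "p (act C \<sigma> a) = act D \<sigma> (p a)" using act(2,3) p_act[of a w x d \<sigma>] by simp
    then show ?thesis
      using cobar_relationsI(3)[OF act(2)[THEN retraction.gens, unfolded prod.case] act(3)] unfolding act(1) lin by simp
  qed
qed

text \<open>Decorating by \<open>p\<close> sends the ideal of \<open>C\<close> to that of
  \<open>D\<close>, and it fixes \<open>a\<close> because all decorations in the trees of
  \<open>a\<close> already belong to \<open>D\<close>. This gives injectivity.\<close>

lemma ideal_retract:
  assumes a: "a \<in> homog D.Sg w x d" and "a \<in> total_ideal C.Sg R\<^sub>C"
  shows "a \<in> total_ideal D.Sg R\<^sub>D"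
proof -
  let ?h = "\<lambda>(w, x, d, a). (w, x, d, p a)"
  have "map_tree ?h T = T" if "T \<in> Poly_Mapping.keys a" for T
  proof -
    have "wf_tree D.Sg T" using a that by (auto simp: homog_def trees_def)
    then have "?h g = g" if "g \<in> set_tree T" for g
      using subsetD[OF set_tree_gens that, of D.Sg] by (auto simp del: split_paired_All intro: p_id)
    then show ?thesis by (simp add: tree.map_ident_strong)
  qed
  then have "tree_map ?h a = lin_ext mon a" unfolding tree_map_def by (intro lin_ext_cong) simp
  moreover have "tree_map ?h a \<in> total_ideal D.Sg R\<^sub>D"
    by (rule retraction.total_ideal_map[OF relations_retract assms(2)])
  ultimately show ?thesis by simp
qed

lemma cor_sub:
  assumes "a \<in> part D w x d"
  shows "D.cor w x d a = C.cor w x d a"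
proof -
  note aC = sub_simps(3)[OF assms]
  have "a \<oplus>\<^bsub>D\<^esub> (- counit D x a) \<odot>\<^bsub>D\<^esub> coaug D x = a \<oplus>\<^bsub>C\<^esub> (- counit C x a) \<odot>\<^bsub>C\<^esub> coaug C x" if w: "w = [x]"
  proof (cases "d = 0")
    case True
    have c: "coaug D x \<in> part D w x d" using D.coaug_closed w True by simp
    show ?thesis
      using sub_simps(4)[OF assms D.part_smult[OF c]] sub_simps(5)[OF c] sub_simps(2)[of a x d] assms w sub_simps(1)
      by simp
  next
    \<comment> \<open>The coaugmentation element is known to lie in degree 0 only, so the sums in
      \<open>D\<close> and \<open>C\<close> cannot be compared directly. But here both counits
      vanish, and both sums are \<open>a\<close>.\<close>
    case False
    have z: "counit D x a = 0" "counit C x a = 0" using D.counit_degree[of a x d] C.counit_degree[of a x d] assms aC w False by auto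
    have "a \<oplus>\<^bsub>D\<^esub> 0 \<odot>\<^bsub>D\<^esub> coaug D x = a"
      using D.smult_zero[OF D.coaug_carrier] D.part_carrier[OF assms] by (simp add: D.r_zero)
    moreover have "a \<oplus>\<^bsub>C\<^esub> 0 \<odot>\<^bsub>C\<^esub> coaug C x = a"
      using C.smult_zero[OF C.coaug_carrier] C.part_carrier[OF aC] by (simp add: C.r_zero)
    ultimately show ?thesis by (simp add: z)
  qed
  then have "reduce D w x a = reduce C w x a"
    unfolding D.reduce_altdef[OF D.part_carrier[OF assms]] C.reduce_altdef[OF C.part_carrier[OF aC]] by simp
  then show ?thesis by (simp add: D.cor_def C.cor_def)
qed

text \<open>The summands agree exactly, but the two cocompositions may be different lists for the
  same tensor over \<open>C\<close>; hence a congruence.\<close>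

lemma kappa_sub:
  assumes i: "i < length v" and a: "a \<in> part D (ins v i u) x n"
  shows "cong_mod C.Sg R\<^sub>C (D.kappa v x i u n a) (C.kappa v x i u n a)"
proof -
  have "D.kappa v x i u n a = D.csum v x i u n (C.kterm v x i u (v ! i)) a"
    unfolding D.kappa_def
    by (rule D.csum_eq[OF i a]) (simp add: D.kterm_def C.kterm_def cor_sub free_comp_sub)
  then show ?thesis
    using C.tensor2_cong[OF sub_cocomp[OF i a] C.bilin_kterm] by (simp add: D.csum_def C.csum_def C.kappa_def)
qed

lemma blk_sub:
  assumes a: "a \<in> part D w x n" and \<sigma>: "\<sigma> permutes {..<length w}" and k: "k \<le> length w"
  shows "cong_mod C.Sg R\<^sub>C (D.blk w x n a y \<sigma> 0 k) (C.blk w x n a y \<sigma> 0 k)"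
proof -
  have k': "0 + k \<le> length w" using k by simp
  note aC = sub_simps(3)[OF a]
  have "act D \<sigma> a = act C \<sigma> a" by (rule sub_simps(6)[OF a \<sigma>])
  then show ?thesis
    unfolding D.blk_def C.blk_def
    using kappa_sub[OF D.blk_part(2,1)[OF a \<sigma> k']] homog_sub[OF D.blk_kappa_homog[OF a \<sigma> k']] C.blk_kappa_homog[OF aC \<sigma> k'] \<sigma>
    by (intro cong_rel[where w = "permw \<sigma> w" and x = x and d = "n + 2"]) auto
qed

text \<open>Both differentials are derivations and compatible with relabeling, so the comparison
  reduces to corollas and there to the terms \<open>blk\<close>. The congruence is taken over
  \<open>C\<close>, where the target of the map lives.\<close>

lemma diff_sub:
  assumes "a \<in> homog D.Sg w x d"
  shows "cong_mod C.Sg R\<^sub>C (D.cobar_diff a) (C.cobar_diff a)"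
proof -
  have tree: "cong_mod C.Sg R\<^sub>C (D.cobar_diff (mon T)) (C.cobar_diff (mon T))" if "T \<in> trees D.Sg w x d" for T w x d
    using that
  proof (induction rule: D.operad_induct)
    case (leaf x)
    then show ?case by (simp add: D.cobar_diff_mon C.cobar_diff_mon)
  next
    case (corolla g)
    obtain w x n a where g: "g = (w, x, n, a)" by (cases g)
    then have a: "a \<in> part D w x n" "w = [x] \<Longrightarrow> counit D x a = 0" using corolla by auto
    have "reduce D w x a = a" using D.reduce_id[OF a(1)] a(2) by blast
    then have D: "mon (corolla g) = D.cor w x n a" by (simp add: g D.cor_def)
    then have C: "mon (corolla g) = C.cor w x n a" using cor_sub[OF a(1)] by simp
    have "cong_mod C.Sg R\<^sub>C (D.cobar_diff (D.cor w x n a))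
        (- (\<Sum>y\<in>{Closed, Open}. \<Sum>J\<in>Pow {..<length w}. D.blk w x n a y (unshuffle (length w) J) 0 (card J)))"
      by (rule cong_sub[OF D.cobar_diff_cor[OF a(1)]])
    also have "cong_mod C.Sg R\<^sub>C \<dots>
        (- (\<Sum>y\<in>{Closed, Open}. \<Sum>J\<in>Pow {..<length w}. C.blk w x n a y (unshuffle (length w) J) 0 (card J)))"
      by (intro cong_uminus cong_sum blk_sub a unshuffle_permutes D.card_le)
    also have "cong_mod C.Sg R\<^sub>C \<dots> (C.cobar_diff (C.cor w x n a))"
      by (rule cong_sym[OF C.cobar_diff_cor[OF sub_simps(3)[OF a(1)]]])
    finally show ?case unfolding D[symmetric] C[symmetric] .
  next
    case (graft T S w x d i u e)
    note h = homog_mon[OF graft(1), of 1] homog_mon[OF graft(3), of 1]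
    let ?T = "mon T" and ?S = "mon S"
    note hC = homog_sub[OF h(1)] homog_sub[OF h(2)]
    have "cong_mod C.Sg R\<^sub>C (D.cobar_diff (free_comp D.Sg i ?T ?S)) (C.cobar_diff (free_comp C.Sg i ?T ?S))"
      unfolding D.cobar_diff_comp[OF h(1) graft(2) h(2)] C.cobar_diff_comp[OF hC(1) graft(2) hC(2)]
      unfolding free_comp_sub
      by (intro cong_add cong_scale cong_comp_left cong_comp_right graft.IH homog_spanned[OF hC(1)] homog_spanned[OF hC(2)])
    from cong_scale[OF this[folded free_comp_sub], of "graft_sign D.Sg i T S"]
    show ?case
      unfolding free_comp_mon_scale[OF graft(1-3)] D.cobar_diff_linear C.cobar_diff_linear
      by (simp add: graft_sign_def ksign_def pm.scale_one split: if_splits)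
  next
    case (relabel T \<sigma> w x d)
    note h = homog_mon[OF relabel(1), of 1]
    have "cong_mod C.Sg R\<^sub>C (rel \<sigma> (D.cobar_diff (mon T))) (rel \<sigma> (C.cobar_diff (mon T)))"
      by (rule cong_rel[OF relabel.IH _ homog_sub[OF D.cobar_diff_homog[OF h]] C.cobar_diff_homog[OF homog_sub[OF h]]])
         (use relabel(2) in simp)
    then show ?case by (simp flip: D.cobar_diff_rel C.cobar_diff_rel)
  qed
  show ?thesis
    using assms
    by (induction rule: homog_induct) (auto simp: D.cobar_diff_linear C.cobar_diff_linear intro: tree cong_add cong_scale)
qed

text \<open>The map enlarges a coset to the coset of the bigger ideal; all representatives agree
  because the ideal of \<open>D\<close> is contained in that of \<open>C\<close>.\<close>

lemma cobar_map_coset: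
  "cobar_map id C (coset D.Sg R\<^sub>D a) = coset C.Sg R\<^sub>C a"
proof -
  have "(\<lambda>(w, x, d, b). (w, x, d, id b)) = (id :: 'a cobar_gen \<Rightarrow> _)" by auto
  then have "cobar_map id C A = (\<Union>a\<in>A. coset C.Sg R\<^sub>C a)" for A
    unfolding cobar_map_def by (simp add: tree.map_id)
  moreover have "coset C.Sg R\<^sub>C a' = coset C.Sg R\<^sub>C a" if "cong_mod D.Sg R\<^sub>D a' a" for a'
    unfolding coset_eq_iff by (rule cong_sub[OF that])
  ultimately show ?thesis using UN_coset[of D.Sg R\<^sub>D a "coset C.Sg R\<^sub>C"] by (simp only:)
qed

theorem sub_dg_operad_cobar:
  assumes two: "(2::'k) \<noteq> 0"
  shows "sub_dg_operad_via (cobar_map id C) (cobar D) (cobar C)"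
proof -
  note D = cobar_def[of D, folded D.cobar_diff_def] and C = cobar_def[of C, folded C.cobar_diff_def]
  have dD: "diff (presented_dg_operad D.Sg R\<^sub>D D.cobar_diff) (coset D.Sg R\<^sub>D a) = coset D.Sg R\<^sub>D (D.cobar_diff a)" for a
    by (rule presented_diff[OF D.linear_cobar_diff]) (rule D.cobar_diff_ideal)
  have dC: "diff (presented_dg_operad C.Sg R\<^sub>C C.cobar_diff) (coset C.Sg R\<^sub>C a) = coset C.Sg R\<^sub>C (C.cobar_diff a)" for a
    by (rule presented_diff[OF C.linear_cobar_diff]) (rule C.cobar_diff_ideal)
  have "dg_operad_hom (cobar_map id C) (cobar D) (cobar C)"
    unfolding dg_operad_hom_def D C presented_simps ball_simps cobar_map_coset presented_add presented_smult presented_act dD dC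

  proof (intro conjI allI impI ballI imageI)
    fix w x d and a :: "'a cobar_gen tree \<Rightarrow>\<^sub>0 'k" assume a: "a \<in> homog D.Sg w x d"
    show "a \<in> homog C.Sg w x d" by (rule homog_sub[OF a])
    show "coset C.Sg R\<^sub>C (D.cobar_diff a) = coset C.Sg R\<^sub>C (C.cobar_diff a)"
      unfolding coset_eq_iff by (rule diff_sub[OF a])
    fix i u e and b :: "'a cobar_gen tree \<Rightarrow>\<^sub>0 'k" assume "i < length w" and b: "b \<in> homog D.Sg u (w ! i) e"
    show "cobar_map id C (pcomp (presented_dg_operad D.Sg R\<^sub>D D.cobar_diff) i (coset D.Sg R\<^sub>D a) (coset D.Sg R\<^sub>D b))
        = pcomp (presented_dg_operad C.Sg R\<^sub>C C.cobar_diff) i (coset C.Sg R\<^sub>C a) (coset C.Sg R\<^sub>C b)"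
      unfolding presented_pcomp[OF homog_spanned[OF a] homog_spanned[OF b]]
        presented_pcomp[OF homog_spanned[OF homog_sub[OF a]] homog_spanned[OF homog_sub[OF b]]]
        cobar_map_coset free_comp_sub ..
  qed (rule refl)+
  moreover have "inj_on (cobar_map id C) (part (cobar D) w x d)" for w x d
    unfolding D presented_simps
  proof (rule inj_onI, elim imageE, hypsubst)
    fix a b assume ab: "a \<in> homog D.Sg w x d" "b \<in> homog D.Sg w x d"
      and "cobar_map id C (coset D.Sg R\<^sub>D a) = cobar_map id C (coset D.Sg R\<^sub>D b)"
    then have "a - b \<in> total_ideal C.Sg R\<^sub>C" by (simp add: cobar_map_coset coset_eq_iff cong_mod_def)
    from ideal_retract[OF homog_diff[OF ab] this] show "coset D.Sg R\<^sub>D a = coset D.Sg R\<^sub>D b"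
      by (simp add: coset_eq_iff cong_mod_def)
  qed
  ultimately show ?thesis
    unfolding sub_dg_operad_via_def using D.dg_operad_cobar[OF two] C.dg_operad_cobar[OF two] by blast
qed

end

text \<open>Restriction to trees without \<open>delta_c\<close> is pointwise, hence linear. It is
  equivariant since relabeling keeps the decorations, and it respects the counit because the trivial
  tree has no decoration.\<close>

lemma cooperad_retract_OC:
  "cooperad_retract (OC_cooperad :: ('k::field, cooperation tree \<Rightarrow> 'k) cooperad) S_cooperad oc_restrict"
proof (intro cooperad_retract.intro cooperad_retract_axioms.intro)
  note simps = OC_cooperad_def S_cooperad_def governing_cooperad_def
  show "cooperad (OC_cooperad :: ('k, cooperation tree \<Rightarrow> 'k) cooperad)" by (rule cooperad_OC)
  show "cooperad (S_cooperad :: ('k, cooperation tree \<Rightarrow> 'k) cooperad)" by (rule cooperad_S)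
  show "subcooperad (OC_cooperad :: ('k, cooperation tree \<Rightarrow> 'k) cooperad) S_cooperad" by (rule subcooperad_OC_S)
  fix w x d c \<sigma> and a b :: "cooperation tree \<Rightarrow> 'k"
  show "oc_restrict a \<in> part OC_cooperad w x d" if "a \<in> part S_cooperad w x d"
    using oc_restrict_dual that by (simp add: simps)
  show "oc_restrict a = a" if "a \<in> part OC_cooperad w x d"
    using oc_restrict_OC that by (simp add: simps)
  show "oc_restrict (a \<oplus>\<^bsub>S_cooperad\<^esub> b) = oc_restrict a \<oplus>\<^bsub>OC_cooperad\<^esub> oc_restrict b"
    by (simp add: simps oc_restrict_def fun_eq_iff)
  show "oc_restrict (c \<odot>\<^bsub>S_cooperad\<^esub> a) = c \<odot>\<^bsub>OC_cooperad\<^esub> oc_restrict a"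
    by (simp add: simps oc_restrict_def fun_eq_iff)
  show "oc_restrict (act S_cooperad \<sigma> a) = act OC_cooperad \<sigma> (oc_restrict a)"
    by (simp add: simps oc_restrict_def fun_eq_iff set_tree_relabel)
  show "counit OC_cooperad x (oc_restrict a) = counit S_cooperad x a"
    by (simp add: simps oc_restrict_def)
qed

theorem mainTheorem9:
  shows "subcooperad (OC_cooperad :: ('k::field_char_0, cooperation tree \<Rightarrow> 'k) cooperad) S_cooperad
    \<and> sub_dg_operad_via (cobar_map id (S_cooperad :: ('k, cooperation tree \<Rightarrow> 'k) cooperad))
        OC_infinity Ger_plus_infinity"
  unfolding OC_infinity_def Ger_plus_infinity_def
  by (intro conjI subcooperad_OC_S cooperad_retract.sub_dg_operad_cobar[OF cooperad_retract_OC]) simp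

end
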